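(* Let $m\geq2$ and let $\Omega\subseteq\mathbb{R}^m$ be a non-empty open set. Consider the operator $$\mathrm{div}:C_0(\Omega;\mathbb{R}^m)\to BV_{\mathrm{cst}}(\Omega)[\mathcal{M}_{1,TV}]^*,\qquad\langle[u],\mathrm{div}\,v\rangle=-\sum_{i=1}^m\int_\Omega v_i\,d(D_iu).$$ If this operator is surjective, then $\Omega$ satisfies the $(1,1)$-Poincaré inequality. If $\Omega$ is a bounded, connected $BV$-extension set, then this operator is surjective.
   Context: $\mathcal{L}^m$ is Lebesgue measure. $BV(\Omega)$ is the space of $u\in L_1(\Omega)$ whose distributional partial derivatives are finite signed Borel measures $D_1u,\dots,D_mu$; $\|Du\|(\Omega)=\sup\{\int_\Omega u\,\mathrm{div}\,v\,d\mathcal{L}^m:v\in C_c^\infty(\Omega;\mathbb{R}^m),\ \sup_x|v(x)|_2\leq1\}$; $\|u\|_{BV(\Omega)}=\|u\|_{L_1(\Omega)}+\|Du\|(\Omega)$. $BV_{\mathrm{cst}}(\Omega)$ is the quotient of $BV(\Omega)$ by its subspace of a.e. constant functions, with elements $[u]$. $(u)_\Omega=\mathcal{L}^m(\Omega)^{-1}\int_\Omega u\,d\mathcal{L}^m$ if $\mathcal{L}^m(\Omega)<\infty$ and $(u)_\Omega=0$ if $\mathcal{L}^m(\Omega)=\infty$. $C_0(\Omega;\mathbb{R}^m)$: continuous vector fields on $\Omega$ vanishing at infinity. $\mathcal{M}_{1,TV}$ is the localized locally convex topology on $BV_{\mathrm{cst}}(\Omega)$ associated with the quotient norm of $\|\cdot\|_{L_1}$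 and the sets $\{[u]:\|Du\|(\Omega)\leq k\}$, $k\in\mathbb{N}$. Its dual $BV_{\mathrm{cst}}(\Omega)[\mathcal{M}_{1,TV}]^*$ is exactly the space of linear forms $F$ on $BV_{\mathrm{cst}}(\Omega)$ such that for every $\varepsilon>0$ there exists $\theta>0$ with $|\langle[u],F\rangle|\leq\theta\|u-(u)_\Omega\mathbf{1}_\Omega\|_{L_1(\Omega)}+\varepsilon\|Du\|(\Omega)$ for all $[u]$; this can be taken as the definition. $\Omega$ satisfies the $(1,1)$-Poincaré inequality if there is $c>0$ such that for every $u\in C^\infty(\Omega)\cap L_1(\Omega)$ there is $y\in\mathbb{R}$ with $\|u-y\mathbf{1}_\Omega\|_{L_1(\Omega)}\leq c\|\nabla u\|_{L_1(\Omega)}$. $\Omega$ is a $BV$-extension set if there is $c>0$ such that every $u\in BV(\Omega)$ has an extension $\hat u\in BV(\mathbb{R}^m)$, $\hat u|_\Omega=u$, with $\|D\hat u\|(\mathbb{R}^m)\leq c\|u\|_{BV(\Omega)}$. *)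

theory Defs
  imports "HOL-Analysis.Analysis"
begin

section \<open>Finite signed measures\<close>

text \<open>A finite signed measure on the measurable space \<open>M\<close> is a real-valued, countably additive
  set function on \<open>sets M\<close>; the measure carried by \<open>M\<close> and the values of \<open>\<nu>\<close> outside \<open>sets M\<close>
  are irrelevant.  Taking all \<open>A n\<close> empty in the definition forces \<open>\<nu> {} = 0\<close>.\<close>

definition signed_measure :: "'a measure \<Rightarrow> ('a set \<Rightarrow> real) \<Rightarrow> bool" where
  "signed_measure M \<nu> \<longleftrightarrow>
     (\<forall>A :: nat \<Rightarrow> 'a set. range A \<subseteq> sets M \<and> disjoint_family A \<longrightarrow>
        (\<lambda>n. \<nu> (A n)) sums \<nu> (\<Union>n. A n))"

text \<open>Upper variation (the positive part of the Jordan decomposition).  As \<open>ennreal\<close> truncates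
  negative reals to \<open>0 = \<nu> {}\<close>, the supremum is that of the numbers \<open>\<nu> B\<close>.  The lower variation of
  \<open>\<nu>\<close> is the upper variation of \<open>-\<nu>\<close>.\<close>

definition upper_variation :: "'a measure \<Rightarrow> ('a set \<Rightarrow> real) \<Rightarrow> 'a measure" where
  "upper_variation M \<nu> =
     measure_of (space M) (sets M) (\<lambda>A. SUP B\<in>{B \<in> sets M. B \<subseteq> A}. ennreal (\<nu> B))"

definition signed_integral :: "'a measure \<Rightarrow> ('a set \<Rightarrow> real) \<Rightarrow> ('a \<Rightarrow> real) \<Rightarrow> real" where
  "signed_integral M \<nu> f =
     (LINT x|upper_variation M \<nu>. f x) - (LINT x|upper_variation M (\<lambda>A. - \<nu> A). f x)"


section \<open>Smooth functions and test functions\<close>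

definition partial :: "'m \<Rightarrow> (real ^ 'm \<Rightarrow> real) \<Rightarrow> real ^ 'm \<Rightarrow> real" where
  "partial i f x = frechet_derivative f (at x) (axis i 1)"

text \<open>The following two notions are meant for open \<open>S\<close>.\<close>

primrec Ck_on :: "nat \<Rightarrow> (real ^ 'm) set \<Rightarrow> (real ^ 'm \<Rightarrow> real) \<Rightarrow> bool" where
  "Ck_on 0 S f \<longleftrightarrow> continuous_on S f"
| "Ck_on (Suc k) S f \<longleftrightarrow> f differentiable_on S \<and> (\<forall>i. Ck_on k S (partial i f))"

definition smooth_on :: "(real ^ 'm) set \<Rightarrow> (real ^ 'm \<Rightarrow> real) \<Rightarrow> bool" where
  "smooth_on S f \<longleftrightarrow> (\<forall>k. Ck_on k S f)"

text \<open>Elements of \<open>C\<^sub>c\<^sup>\<infinity>(\<Omega>)\<close> are identified with their extensions by zero.\<close>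

definition test_function :: "(real ^ 'm) set \<Rightarrow> (real ^ 'm \<Rightarrow> real) \<Rightarrow> bool" where
  "test_function \<Omega> \<phi> \<longleftrightarrow> smooth_on UNIV \<phi> \<and>
     compact (closure {x. \<phi> x \<noteq> 0}) \<and> closure {x. \<phi> x \<noteq> 0} \<subseteq> \<Omega>"

definition test_field :: "(real ^ 'm) set \<Rightarrow> (real ^ 'm \<Rightarrow> real ^ 'm) \<Rightarrow> bool" where
  "test_field \<Omega> v \<longleftrightarrow> (\<forall>i. test_function \<Omega> (\<lambda>x. v x $ i))"

definition grad :: "(real ^ 'm \<Rightarrow> real) \<Rightarrow> real ^ 'm \<Rightarrow> real ^ 'm" where
  "grad u x = (\<chi> i. partial i u x)"

definition divergence :: "(real ^ 'm \<Rightarrow> real ^ 'm) \<Rightarrow> real ^ 'm \<Rightarrow> real" where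
  "divergence v x = (\<Sum>i\<in>UNIV. partial i (\<lambda>y. v y $ i) x)"


section \<open>Functions of bounded variation\<close>

text \<open>Members of \<open>L\<^sub>1(\<Omega>)\<close> and \<open>BV(\<Omega>)\<close> are represented by functions on the whole space whose
  values outside \<open>\<Omega>\<close> play no role.\<close>

definition L1 :: "(real ^ 'm) set \<Rightarrow> (real ^ 'm \<Rightarrow> real) set" where
  "L1 \<Omega> = {u. integrable (lebesgue_on \<Omega>) u}"

definition L1_norm :: "(real ^ 'm) set \<Rightarrow> (real ^ 'm \<Rightarrow> real) \<Rightarrow> real" where
  "L1_norm \<Omega> u = (LINT x|lebesgue_on \<Omega>. \<bar>u x\<bar>)"

definition is_weak_partial ::
    "(real ^ 'm) set \<Rightarrow> 'm \<Rightarrow> (real ^ 'm \<Rightarrow> real) \<Rightarrow> ((real ^ 'm) set \<Rightarrow> real) \<Rightarrow> bool" where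
  "is_weak_partial \<Omega> i u \<nu> \<longleftrightarrow>
     signed_measure (restrict_space borel \<Omega>) \<nu> \<and>
     (\<forall>\<phi>. test_function \<Omega> \<phi> \<longrightarrow>
        (LINT x|lebesgue_on \<Omega>. u x * partial i \<phi> x) =
          - signed_integral (restrict_space borel \<Omega>) \<nu> \<phi>)"

definition BV :: "(real ^ 'm) set \<Rightarrow> (real ^ 'm \<Rightarrow> real) set" where
  "BV \<Omega> = {u \<in> L1 \<Omega>. \<forall>i. \<exists>\<nu>. is_weak_partial \<Omega> i u \<nu>}"

text \<open>The choice below is unique on the Borel subsets of \<open>\<Omega>\<close>, for \<open>u\<close> in \<open>BV \<Omega>\<close>.\<close>

definition weak_partial ::
    "(real ^ 'm) set \<Rightarrow> 'm \<Rightarrow> (real ^ 'm \<Rightarrow> real) \<Rightarrow> (real ^ 'm) set \<Rightarrow> real" where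
  "weak_partial \<Omega> i u = (SOME \<nu>. is_weak_partial \<Omega> i u \<nu>)"

text \<open>Used only for \<open>u\<close> in \<open>BV \<Omega>\<close>, where the set of which the supremum is taken is bounded.\<close>

definition total_variation :: "(real ^ 'm) set \<Rightarrow> (real ^ 'm \<Rightarrow> real) \<Rightarrow> real" where
  "total_variation \<Omega> u =
     (SUP v\<in>{v. test_field \<Omega> v \<and> (\<forall>x. norm (v x) \<le> 1)}.
        LINT x|lebesgue_on \<Omega>. u x * divergence v x)"

definition BV_norm :: "(real ^ 'm) set \<Rightarrow> (real ^ 'm \<Rightarrow> real) \<Rightarrow> real" where
  "BV_norm \<Omega> u = L1_norm \<Omega> u + total_variation \<Omega> u"

definition mean :: "(real ^ 'm) set \<Rightarrow> (real ^ 'm \<Rightarrow> real) \<Rightarrow> real" where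
  "mean \<Omega> u =
     (if emeasure lebesgue \<Omega> < \<infinity> then (LINT x|lebesgue_on \<Omega>. u x) / measure lebesgue \<Omega> else 0)"


section \<open>The quotient by constants and its dual\<close>

text \<open>The class \<open>[u]\<close>.  Since \<open>c = 0\<close> is allowed, it also absorbs the identification of functions
  that agree almost everywhere.\<close>

definition cst_class :: "(real ^ 'm) set \<Rightarrow> (real ^ 'm \<Rightarrow> real) \<Rightarrow> (real ^ 'm \<Rightarrow> real) set" where
  "cst_class \<Omega> u = {w \<in> BV \<Omega>. \<exists>c. AE x in lebesgue_on \<Omega>. w x - u x = c}"

definition BV_cst :: "(real ^ 'm) set \<Rightarrow> (real ^ 'm \<Rightarrow> real) set set" where
  "BV_cst \<Omega> = cst_class \<Omega> ` BV \<Omega>"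

text \<open>Forms on \<open>BV_cst \<Omega>\<close> are extensional functions, so that equality of forms is equality on
  \<open>BV_cst \<Omega>\<close>.\<close>

definition linear_form :: "(real ^ 'm) set \<Rightarrow> ((real ^ 'm \<Rightarrow> real) set \<Rightarrow> real) \<Rightarrow> bool" where
  "linear_form \<Omega> F \<longleftrightarrow> F \<in> extensional (BV_cst \<Omega>) \<and>
     (\<forall>u\<in>BV \<Omega>. \<forall>w\<in>BV \<Omega>.
        F (cst_class \<Omega> (\<lambda>x. u x + w x)) = F (cst_class \<Omega> u) + F (cst_class \<Omega> w)) \<and>
     (\<forall>u\<in>BV \<Omega>. \<forall>a. F (cst_class \<Omega> (\<lambda>x. a * u x)) = a * F (cst_class \<Omega> u))"

definition BV_cst_dual :: "(real ^ 'm) set \<Rightarrow> ((real ^ 'm \<Rightarrow> real) set \<Rightarrow> real) set" where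
  "BV_cst_dual \<Omega> = {F. linear_form \<Omega> F \<and>
     (\<forall>\<epsilon>>0. \<exists>\<theta>>0. \<forall>u\<in>BV \<Omega>.
        \<bar>F (cst_class \<Omega> u)\<bar> \<le>
          \<theta> * L1_norm \<Omega> (\<lambda>x. u x - mean \<Omega> u) + \<epsilon> * total_variation \<Omega> u)}"


section \<open>The divergence operator\<close>

definition C0 :: "(real ^ 'm) set \<Rightarrow> (real ^ 'm \<Rightarrow> real ^ 'm) set" where
  "C0 \<Omega> = {v. continuous_on \<Omega> v \<and>
     (\<forall>\<epsilon>>0. \<exists>K. compact K \<and> K \<subseteq> \<Omega> \<and> (\<forall>x\<in>\<Omega> - K. norm (v x) < \<epsilon>))}"

text \<open>The value at a class is the common value over all its representatives.\<close>

definition div_op ::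
    "(real ^ 'm) set \<Rightarrow> (real ^ 'm \<Rightarrow> real ^ 'm) \<Rightarrow> (real ^ 'm \<Rightarrow> real) set \<Rightarrow> real" where
  "div_op \<Omega> v = (\<lambda>X\<in>BV_cst \<Omega>. THE r. \<forall>u\<in>X. r =
     - (\<Sum>i\<in>UNIV. signed_integral (restrict_space borel \<Omega>) (weak_partial \<Omega> i u) (\<lambda>x. v x $ i)))"


section \<open>Conditions on the domain\<close>

text \<open>Norms are extended nonnegative integrals here, since \<open>u - y\<close> need not be integrable if \<open>\<Omega>\<close> has
  infinite measure, and the gradient of \<open>u\<close> need not be integrable either.\<close>

definition poincare_1_1 :: "(real ^ 'm) set \<Rightarrow> bool" where
  "poincare_1_1 \<Omega> \<longleftrightarrow> (\<exists>c>0. \<forall>u. smooth_on \<Omega> u \<and> u \<in> L1 \<Omega> \<longrightarrow>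
     (\<exists>y. (\<integral>\<^sup>+ x. ennreal \<bar>u x - y\<bar> \<partial>lebesgue_on \<Omega>) \<le>
            ennreal c * (\<integral>\<^sup>+ x. ennreal (norm (grad u x)) \<partial>lebesgue_on \<Omega>)))"

definition BV_extension_set :: "(real ^ 'm) set \<Rightarrow> bool" where
  "BV_extension_set \<Omega> \<longleftrightarrow> (\<exists>c>0. \<forall>u\<in>BV \<Omega>. \<exists>w\<in>BV UNIV.
     (AE x in lebesgue_on \<Omega>. w x = u x) \<and> total_variation UNIV w \<le> c * BV_norm \<Omega> u)"

end

theory Submission
  imports Defs "HOL-Library.Diagonal_Subsequence"
begin

text \<open>If the operator is onto, every bounded \<open>g\<close> defines a form \<open>[u] \<mapsto> \<integral> (u - (u)\<^sub>\<Omega>) g\<close> in its range, so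
  that \<open>\<bar>\<integral> (u - (u)\<^sub>\<Omega>) g\<bar>\<close> is at most a constant, depending on \<open>g\<close>, times \<open>\<parallel>Du\<parallel>(\<Omega>)\<close>.  The uniform
  boundedness principle, in the form of a gliding hump, makes the constant uniform in \<open>\<bar>g\<bar> \<le> 1\<close>; this
  is the Poincare inequality.

  On a bounded connected extension domain, the translation estimate gives compactness of \<open>BV\<close> in \<open>L\<^sub>1\<close>
  and hence the Poincare inequality for \<open>BV\<close>, so every form \<open>F\<close> in the dual is bounded by
  \<open>M \<parallel>Du\<parallel>(\<Omega>)\<close>, and is continuous in \<open>L\<^sub>1\<close> on the unit ball of \<open>BV\<close> modulo constants.  For each \<open>u\<close> there
  is a test field \<open>v\<close> with \<open>\<bar>v\<bar> \<le> M\<close> and \<open>F [u] \<le> \<integral> u div v + \<delta>\<close>; by compactness finitely many fields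
  suffice for the whole ball, and by the minimax principle some convex combination of them does for all
  \<open>u\<close> at once.  Iterating on the remainder with \<open>\<delta> = M / 2\<close>, \<open>M / 4\<close>, \<dots> yields a uniformly convergent
  series of test fields, whose sum is in \<open>C\<^sub>0(\<Omega>)\<close> and represents \<open>F\<close> up to sign.\<close>


section \<open>Smooth functions and test functions\<close>

text \<open>Membership in \<open>BV\<close> asks for derivative measures, whereas the estimates
  concern the supremum \<open>total_variation\<close>. Identities for integrals against
  \<open>Du\<close> are therefore proved for test fields first, where they become integrals of
  \<open>u * divergence v\<close>, and reach \<open>C0\<close> by uniform density; this copes with
  the arbitrary choice in \<open>weak_partial\<close>. A form can be estimated only at members of
  \<open>BV\<close>, so an L1 limit of functions of bounded variation must regain its measures,
  which a Riesz theorem provides. Compactness rests on averages over small cubes: translations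
  control the deviation from them, and they are finitely many numbers. Near-attainment of the total
  variation gives some field for each \<open>u\<close>, whereas a representation needs one field for
  all \<open>u\<close>; minimax exchanges the quantifiers at the price of an error, which the
  iteration removes. The arbitrarily small \<open>\<epsilon>\<close> in the definition of the dual
  makes a form L1-continuous on sets of bounded variation, so that limits of bad functions can be
  used.\<close>

lemma partial_eq: "(f has_derivative D) (at x) \<Longrightarrow> partial i f x = D (axis i 1)"
  by (simp add: partial_def flip: frechet_derivative_at)

lemma has_derivative_partial:
  fixes f :: "real ^ 'm \<Rightarrow> real"
  shows "f differentiable (at x) \<Longrightarrow> (f has_derivative (\<lambda>h. \<Sum>i\<in>UNIV. h $ i * partial i f x)) (at x)"
proof -
  assume f: "f differentiable (at x)"
  let ?D = "frechet_derivative f (at x)"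
  have D: "(f has_derivative ?D) (at x)" using f frechet_derivative_works by blast
  then interpret bounded_linear ?D by (rule has_derivative_bounded_linear)
  have "?D h = (\<Sum>i\<in>UNIV. h $ i * partial i f x)" for h :: "real ^ 'm"
  proof -
    have "h = (\<Sum>i\<in>UNIV. h $ i *\<^sub>R axis i 1)"
      by (simp add: vec_eq_iff axis_def if_distrib[where f="\<lambda>x. _ * x"] cong: if_cong)
    then have "?D h = ?D (\<Sum>i\<in>UNIV. h $ i *\<^sub>R axis i 1)" by simp
    then show ?thesis by (simp add: sum scaleR partial_def)
  qed
  then have "?D = (\<lambda>h. \<Sum>i\<in>UNIV. h $ i * partial i f x)" by (rule ext)
  with D show ?thesis by metis
qed

lemma partial_add:
  assumes "f differentiable (at x)" "g differentiable (at x)"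
  shows "partial i (\<lambda>x. f x + g x) x = partial i f x + partial i g x"
  using partial_eq[OF has_derivative_add[OF assms[unfolded frechet_derivative_works]]]
  by (simp add: partial_def)

lemma partial_mult:
  fixes f :: "real ^ 'm \<Rightarrow> real"
  assumes "f differentiable (at x)" "g differentiable (at x)"
  shows "partial i (\<lambda>x. f x * g x) x = f x * partial i g x + partial i f x * g x"
  using partial_eq[OF has_derivative_mult[OF assms[unfolded frechet_derivative_works]]]
  by (simp add: partial_def)

lemma partial_const [simp]: "partial i (\<lambda>x. c) x = 0"
  by (simp add: partial_def)

lemma partial_cmult:
  "f differentiable (at x) \<Longrightarrow> partial i (\<lambda>x. c * f x) x = c * partial i f x"
  by (subst partial_mult) auto

lemma partial_compose_translate:
  fixes f :: "real ^ 'm \<Rightarrow> real"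
  assumes "f differentiable (at (x + h))"
  shows "partial i (\<lambda>x. f (x + h)) x = partial i f (x + h)"
proof -
  have "((\<lambda>x. x + h) has_derivative (\<lambda>x. x)) (at x)" by (auto intro!: derivative_eq_intros)
  moreover have "(f has_derivative frechet_derivative f (at (x + h))) (at (x + h))"
    using assms frechet_derivative_works by blast
  ultimately have "((\<lambda>x. f (x + h)) has_derivative frechet_derivative f (at (x + h))) (at x)"
    using has_derivative_compose by fastforce
  then show ?thesis by (simp add: partial_eq) (simp add: partial_def)
qed

lemma partial_eq_zero_on_open:
  assumes "open S" "x \<in> S" "\<And>y. y \<in> S \<Longrightarrow> f y = 0"
  shows "partial i f x = 0"
proof -
  have "(f has_derivative (\<lambda>_. 0)) (at x)"
    by (rule has_derivative_transform_within_open[of "\<lambda>_. 0" _ _ _ S]) (use assms in auto)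
  then show ?thesis by (simp add: partial_eq)
qed

lemma Ck_on_SucD: "Ck_on (Suc k) S f \<Longrightarrow> Ck_on k S f"
proof (induction k arbitrary: f)
  case 0
  then show ?case by (auto intro: differentiable_imp_continuous_on)
next
  case (Suc k)
  then show ?case by (metis Ck_on.simps(2))
qed

lemma Ck_UNIV_const: "Ck_on k UNIV (\<lambda>x. c)"
  by (induction k arbitrary: c) (auto simp: partial_def[abs_def] differentiable_on_def)

lemma Ck_UNIV_linear: "bounded_linear f \<Longrightarrow> Ck_on k UNIV (f :: real ^ 'm \<Rightarrow> real)"
proof (cases k)
  case 0
  assume "bounded_linear f" then show ?thesis using 0
    by (simp add: linear_continuous_on)
next
  case (Suc j)
  assume f: "bounded_linear f"
  then have D: "(f has_derivative f) (at x)" for x by (rule bounded_linear_imp_has_derivative)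
  have "partial i f = (\<lambda>x. f (axis i 1))" for i by (rule ext) (use D partial_eq in blast)
  then show ?thesis using D Suc by (auto simp: differentiable_on_def differentiable_def Ck_UNIV_const)
qed

lemma Ck_UNIV_add:
  "Ck_on k UNIV f \<Longrightarrow> Ck_on k UNIV g \<Longrightarrow> Ck_on k UNIV (\<lambda>x. f x + g x)"
proof (induction k arbitrary: f g)
  case 0
  then show ?case by (auto intro: continuous_intros)
next
  case (Suc k)
  have "partial i (\<lambda>x. f x + g x) = (\<lambda>x. partial i f x + partial i g x)" for i
    using Suc.prems by (intro ext partial_add) (auto simp: differentiable_on_def)
  then show ?case using Suc by (auto simp: differentiable_on_def)
qed

lemma Ck_UNIV_mult:
  "Ck_on k UNIV f \<Longrightarrow> Ck_on k UNIV g \<Longrightarrow> Ck_on k UNIV (\<lambda>x. f x * g x)"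
proof (induction k arbitrary: f g)
  case 0
  then show ?case by (auto intro: continuous_intros)
next
  case (Suc k)
  have "partial i (\<lambda>x. f x * g x) = (\<lambda>x. f x * partial i g x + partial i f x * g x)" for i
    using Suc.prems by (intro ext partial_mult) (auto simp: differentiable_on_def)
  then show ?case using Suc Ck_on_SucD[OF Suc.prems(1)] Ck_on_SucD[OF Suc.prems(2)]
    by (auto simp: differentiable_on_def intro!: Ck_UNIV_add)
qed

lemma Ck_UNIV_translate:
  "Ck_on k UNIV f \<Longrightarrow> Ck_on k UNIV (\<lambda>x. f (x + h))"
proof (induction k arbitrary: f)
  case 0
  then show ?case by (auto intro!: continuous_on_compose2[of UNIV f] continuous_intros)
next
  case (Suc k)
  have "partial i (\<lambda>x. f (x + h)) = (\<lambda>x. partial i f (x + h))" for i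
    using Suc.prems by (intro ext partial_compose_translate) (auto simp: differentiable_on_def)
  moreover have "(\<lambda>x. f (x + h)) differentiable (at x)" for x
    using Suc.prems differentiable_chain_at[of "\<lambda>x. x + h" x f]
    by (auto simp: differentiable_on_def o_def)
  ultimately show ?case using Suc by (auto simp: differentiable_on_def)
qed

text \<open>Polynomials enter twice: as the squared distance inside \<open>smooth_bump\<close> and
  as the Stone-Weierstrass factor in \<open>test_function_dense\<close>.\<close>

lemma Ck_UNIV_real_polynomial:
  "real_polynomial_function (f :: real ^ 'm \<Rightarrow> real) \<Longrightarrow> Ck_on k UNIV f"
  by (induction rule: real_polynomial_function.induct)
     (auto intro: Ck_UNIV_linear Ck_UNIV_const Ck_UNIV_add Ck_UNIV_mult)

text \<open>Up to a polynomial factor in \<open>1 / t\<close>, these are the derivatives of the classical flat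
  function \<open>exp (- 1 / t)\<close>; the family is closed under differentiation.\<close>

definition flat :: "nat \<Rightarrow> real \<Rightarrow> real" where
  "flat n t = (if t \<le> 0 then 0 else inverse t ^ n * exp (- inverse t))"

text \<open>With \<open>s = 1 / t\<close> the right-hand limit is that of
  \<open>s ^ n / exp s\<close> at infinity; to the left of the origin \<open>flat n\<close> is
  zero.\<close>

lemma flat_tendsto_0: "(flat n \<longlongrightarrow> 0) (at 0)"
proof -
  have "((\<lambda>t::real. inverse t ^ n / exp (inverse t)) \<longlongrightarrow> 0) (at_right 0)"
    using filterlim_compose[OF tendsto_power_div_exp_0 filterlim_inverse_at_top_right] .
  moreover have "\<forall>\<^sub>F t in at_right 0. inverse t ^ n / exp (inverse t) = flat n t"
    by (auto simp: flat_def eventually_at_right_field exp_minus divide_inverse intro: exI[of _ 1])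
  ultimately have 1: "(flat n \<longlongrightarrow> 0) (at_right 0)"
    by (rule tendsto_cong[THEN iffD1, rotated])
  have "\<forall>\<^sub>F t in at_left 0. 0 = flat n t"
    by (auto simp: flat_def eventually_at_left_field intro!: exI[of _ "-1"])
  then have 2: "(flat n \<longlongrightarrow> 0) (at_left 0)"
    using tendsto_cong[of "\<lambda>_. 0" "flat n"] by auto
  from 1 2 show ?thesis by (simp add: filterlim_split_at_real)
qed

text \<open>At the origin the difference quotient of \<open>flat n\<close> is
  \<open>flat (Suc n)\<close>, so \<open>flat_tendsto_0\<close> one index higher gives the
  derivative there; at positive \<open>t\<close> it is the product rule.\<close>

lemma flat_has_derivative:
  "(flat n has_real_derivative (flat (n + 2) t - n * flat (n + 1) t)) (at t)"
proof -
  consider "t < 0" | "t = 0" | "t > 0" by linarith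
  then show ?thesis
  proof cases
    case 1
    have "((\<lambda>_. 0) has_real_derivative 0) (at t)" by simp
    then have "(flat n has_real_derivative 0) (at t)"
      by (rule has_field_derivative_transform_within_open[where S = "{..<0}"])
         (use 1 in \<open>simp_all add: flat_def\<close>)
    then show ?thesis using 1 by (simp add: flat_def)
  next
    case 2
    have "(\<lambda>y. (flat n y - flat n 0) / (y - 0)) = flat (Suc n)"
      by (auto simp: flat_def fun_eq_iff divide_inverse)
    then have "(flat n has_real_derivative 0) (at 0)"
      using flat_tendsto_0[of "Suc n"] by (simp add: has_field_derivative_iff)
    then show ?thesis using 2 by (simp add: flat_def)
  next
    case 3
    have pw: "((\<lambda>t. inverse t ^ n) has_real_derivative
        real n * (- (inverse t ^ Suc (Suc 0)) * inverse t ^ (n - Suc 0))) (at t)"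
      using 3 by (intro DERIV_power DERIV_inverse) auto
    have ex: "((\<lambda>t. exp (- inverse t)) has_real_derivative exp (- inverse t) * (inverse t)\<^sup>2) (at t)"
      using 3 by (auto intro!: derivative_eq_intros simp: power2_eq_square)
    have "((\<lambda>t. inverse t ^ n * exp (- inverse t)) has_real_derivative
        (flat (n + 2) t - n * flat (n + 1) t)) (at t)"
    proof (rule DERIV_cong[OF DERIV_mult[OF pw ex]])
      \<comment> \<open>Splitting on \<open>n\<close> deals with the truncated exponent
        \<open>n - Suc 0\<close>; for \<open>n = 0\<close> the factor \<open>real n\<close> removes
        that term.\<close>
      have "real n * (- (s ^ Suc (Suc 0)) * s ^ (n - Suc 0)) * E + E * s\<^sup>2 * s ^ n =
          s ^ (n + 2) * E - real n * (s ^ (n + 1) * E)" for s E :: real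
        by (cases n) (simp_all add: algebra_simps power2_eq_square)
      then show "real n * (- (inverse t ^ Suc (Suc 0)) * inverse t ^ (n - Suc 0)) * exp (- inverse t) +
          exp (- inverse t) * (inverse t)\<^sup>2 * inverse t ^ n = flat (n + 2) t - n * flat (n + 1) t"
        using 3 unfolding flat_def by (simp only: not_le[symmetric] if_False)
    qed
    then show ?thesis
      by (rule has_field_derivative_transform_within_open[where S = "{0<..}"])
         (use 3 in \<open>simp_all add: flat_def\<close>)
  qed
qed

text \<open>The index \<open>n\<close> is generalised in the induction, since one differentiation
  replaces \<open>flat n\<close> by \<open>flat (n + 2)\<close> and \<open>flat (n + 1)\<close>,
  times a partial derivative of \<open>q\<close>.\<close>

lemma Ck_UNIV_flat:
  fixes q :: "real ^ 'm \<Rightarrow> real"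
  assumes q: "\<And>k. Ck_on k UNIV q"
  shows "Ck_on k UNIV (\<lambda>x. flat n (q x))"
proof (induction k arbitrary: n)
  case 0
  have "continuous_on UNIV (flat n)"
    by (intro continuous_at_imp_continuous_on ballI DERIV_isCont[OF flat_has_derivative])
  then show ?case using q[of 0] by (auto intro: continuous_on_compose2)
next
  case (Suc k)
  have D: "((\<lambda>x. flat n (q x)) has_derivative
      (\<lambda>h. (flat (n + 2) (q x) - n * flat (n + 1) (q x)) * frechet_derivative q (at x) h)) (at x)" for x
  proof -
    have "(q has_derivative frechet_derivative q (at x)) (at x)"
      using q[of 1] by (auto simp: differentiable_on_def frechet_derivative_works)
    from has_derivative_compose[OF this flat_has_derivative[unfolded has_field_derivative_def]]
    show ?thesis .
  qed
  have eq: "partial i (\<lambda>x. flat n (q x)) =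
      (\<lambda>x. (flat (n + 2) (q x) + (- real n) * flat (n + 1) (q x)) * partial i q x)" for i
    by (rule ext, subst partial_eq[OF D]) (simp add: partial_def)
  have "Ck_on k UNIV (\<lambda>x. (flat (n + 2) (q x) + (- real n) * flat (n + 1) (q x)) * partial i q x)"
    for i using q[of "Suc k"] by (intro Ck_UNIV_mult Ck_UNIV_add Ck_UNIV_const Suc.IH) auto
  then have "\<forall>i. Ck_on k UNIV (partial i (\<lambda>x. flat n (q x)))" by (simp only: eq simp_thms)
  then show ?case using D by (auto simp: differentiable_on_def differentiable_def)
qed

section \<open>Test functions and their closure properties\<close>

lemma test_functionI:
  assumes "\<And>k. Ck_on k UNIV \<phi>" "compact K" "K \<subseteq> \<Omega>" "\<And>x. x \<notin> K \<Longrightarrow> \<phi> x = 0"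
  shows "test_function \<Omega> \<phi>"
proof -
  have *: "closure {x. \<phi> x \<noteq> 0} \<subseteq> K"
    using assms by (intro closure_minimal) (auto intro: compact_imp_closed)
  then have "compact (closure {x. \<phi> x \<noteq> 0})"
    using bounded_subset[OF compact_imp_bounded[OF assms(2)]] by (simp add: compact_eq_bounded_closed)
  with * assms show ?thesis by (auto simp: test_function_def smooth_on_def)
qed

lemma test_functionE:
  assumes "test_function \<Omega> \<phi>"
  obtains K where "compact K" "K \<subseteq> \<Omega>" "\<And>x. x \<notin> K \<Longrightarrow> \<phi> x = 0"
    "\<And>i x. x \<notin> K \<Longrightarrow> partial i \<phi> x = 0"
proof
  let ?K = "closure {x. \<phi> x \<noteq> 0}"
  show "compact ?K" "?K \<subseteq> \<Omega>" using assms by (auto simp: test_function_def)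
  show z: "\<phi> x = 0" if "x \<notin> ?K" for x using that closure_subset[of "{x. \<phi> x \<noteq> 0}"] by blast
  show "partial i \<phi> x = 0" if "x \<notin> ?K" for i x
    by (rule partial_eq_zero_on_open[OF _ _ z, of "- ?K"]) (use that in \<open>simp_all add: open_Compl\<close>)
qed

lemma test_function_Ck: "test_function \<Omega> \<phi> \<Longrightarrow> Ck_on k UNIV \<phi>"
  by (auto simp: test_function_def smooth_on_def)

lemma test_function_differentiable: "test_function \<Omega> \<phi> \<Longrightarrow> \<phi> differentiable (at x)"
  using test_function_Ck[of \<Omega> \<phi> "Suc 0"] by (auto simp: differentiable_on_def)

lemma test_function_continuous: "test_function \<Omega> \<phi> \<Longrightarrow> continuous_on UNIV \<phi>"
  using test_function_Ck[of \<Omega> \<phi> 0] by auto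

lemma test_function_partial_continuous: "test_function \<Omega> \<phi> \<Longrightarrow> continuous_on UNIV (partial i \<phi>)"
  using test_function_Ck[of \<Omega> \<phi> "Suc 0"] by auto

lemma test_function_add:
  assumes "test_function \<Omega> \<phi>" "test_function \<Omega> \<psi>"
  shows "test_function \<Omega> (\<lambda>x. \<phi> x + \<psi> x)"
proof -
  from assms(1) obtain K where K: "compact K" "K \<subseteq> \<Omega>" "\<And>x. x \<notin> K \<Longrightarrow> \<phi> x = 0"
    by (rule test_functionE) blast
  from assms(2) obtain L where L: "compact L" "L \<subseteq> \<Omega>" "\<And>x. x \<notin> L \<Longrightarrow> \<psi> x = 0"
    by (rule test_functionE) blast
  show ?thesis
    by (rule test_functionI[of _ "K \<union> L"])
       (use K L assms in \<open>auto intro!: Ck_UNIV_add compact_Un intro: test_function_Ck[of \<Omega>]\<close>)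
qed

lemma test_function_mult:
  assumes "test_function \<Omega> \<phi>" "\<And>k. Ck_on k UNIV f"
  shows "test_function \<Omega> (\<lambda>x. \<phi> x * f x)"
proof -
  from assms(1) obtain K where K: "compact K" "K \<subseteq> \<Omega>" "\<And>x. x \<notin> K \<Longrightarrow> \<phi> x = 0"
    by (rule test_functionE) blast
  show ?thesis
    by (rule test_functionI[of _ K]) (use K assms in \<open>auto intro!: Ck_UNIV_mult intro:
      test_function_Ck[of \<Omega>]\<close>)
qed

lemma test_function_cmult: "test_function \<Omega> \<phi> \<Longrightarrow> test_function \<Omega> (\<lambda>x. c * \<phi> x)"
  using test_function_mult[of \<Omega> \<phi> "\<lambda>_. c"] by (simp add: Ck_UNIV_const mult.commute)

lemma test_function_zero: "test_function \<Omega> (\<lambda>x. 0)"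
  by (rule test_functionI[of _ "{}"]) (auto intro: Ck_UNIV_const)

lemma test_function_sum:
  "(\<And>j. j \<in> J \<Longrightarrow> test_function \<Omega> (\<phi> j)) \<Longrightarrow> test_function \<Omega> (\<lambda>x. \<Sum>j\<in>J. \<phi> j x)"
  by (induction J rule: infinite_finite_induct) (auto intro: test_function_zero test_function_add)

lemma test_function_translate:
  assumes "test_function A \<phi>" "\<And>x. x \<in> A \<Longrightarrow> x - h \<in> B"
  shows "test_function B (\<lambda>x. \<phi> (x + h))"
proof -
  from assms(1) obtain K where K: "compact K" "K \<subseteq> A" "\<And>x. x \<notin> K \<Longrightarrow> \<phi> x = 0"
    by (rule test_functionE) blast
  show ?thesis
  proof (rule test_functionI[of _ "(\<lambda>x. x - h) ` K"])
    show "Ck_on k UNIV (\<lambda>x. \<phi> (x + h))" for k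
      using assms(1) by (intro Ck_UNIV_translate test_function_Ck)
    show "compact ((\<lambda>x. x - h) ` K)" using K(1) by (rule compact_translation_subtract)
    show "(\<lambda>x. x - h) ` K \<subseteq> B" using K(2) assms(2) by blast
    fix x assume "x \<notin> (\<lambda>x. x - h) ` K"
    moreover have "x = (x + h) - h" by simp
    ultimately have "x + h \<notin> K" by blast
    then show "\<phi> (x + h) = 0" by (rule K(3))
  qed
qed

section \<open>Bump functions and uniform density of test functions\<close>

lemma smooth_bump:
  fixes a :: "real ^ 'm"
  assumes "r > 0" "cball a r \<subseteq> \<Omega>"
  obtains \<sigma> where "test_function \<Omega> \<sigma>" "\<And>x. \<sigma> x \<ge> 0" "\<And>x. x \<in> ball a r \<Longrightarrow> \<sigma> x > 0"
proof
  \<comment> \<open>The squared distance is written out with sums and products so that it is visibly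
    a \<open>real_polynomial_function\<close>; \<open>flat 0\<close> of
    \<open>r\<^sup>2 - (dist a x)\<^sup>2\<close> is positive exactly inside the ball.\<close>
  let ?q = "\<lambda>x. r\<^sup>2 + (- 1) * (\<Sum>i\<in>UNIV. (x $ i + - (a $ i)) * (x $ i + - (a $ i)))"
  let ?\<sigma> = "\<lambda>x. flat 0 (?q x)"
  have q: "?q x = r\<^sup>2 - (dist a x)\<^sup>2" for x
    by (subst dist_commute) (simp add: dist_norm power2_norm_eq_inner inner_vec_def)
  have "real_polynomial_function ?q"
    by (intro real_polynomial_function.intros(2-) real_polynomial_function_sum finite
        real_polynomial_function.intros(1) bounded_linear_vec_nth)
  then have "Ck_on k UNIV ?\<sigma>" for k by (intro Ck_UNIV_flat Ck_UNIV_real_polynomial)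
  moreover have "?\<sigma> x = 0" if "x \<notin> cball a r" for x
  proof -
    have "r\<^sup>2 \<le> (dist a x)\<^sup>2" using that assms(1) by (intro power_mono) auto
    then show ?thesis unfolding q by (simp add: flat_def)
  qed
  ultimately show "test_function \<Omega> ?\<sigma>"
    by (intro test_functionI[of _ "cball a r"]) (use assms in auto)
  show "?\<sigma> x \<ge> 0" for x by (simp add: flat_def)
  show "?\<sigma> x > 0" if "x \<in> ball a r" for x
  proof -
    have "(dist a x)\<^sup>2 < r\<^sup>2" using that assms(1) by (intro power_strict_mono) auto
    then show ?thesis unfolding q by (simp add: flat_def)
  qed
qed

text \<open>Finitely many balls carrying a \<open>smooth_bump\<close> cover \<open>K\<close>, and
  the bumps of the finite cover are added.\<close>

lemma test_function_positive_on_compact: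
  fixes K :: "(real ^ 'm) set"
  assumes "compact K" "K \<subseteq> \<Omega>" "open \<Omega>"
  obtains \<sigma> where "test_function \<Omega> \<sigma>" "\<And>x. \<sigma> x \<ge> 0" "\<And>x. x \<in> K \<Longrightarrow> \<sigma> x > 0"
proof -
  have "\<exists>r>0. cball x r \<subseteq> \<Omega>" if "x \<in> K" for x
    using assms that open_contains_cball by blast
  then obtain r where r: "\<And>x. x \<in> K \<Longrightarrow> r x > 0 \<and> cball x (r x) \<subseteq> \<Omega>" by metis
  then have "\<exists>\<sigma>. test_function \<Omega> \<sigma> \<and> (\<forall>y. \<sigma> y \<ge> 0) \<and> (\<forall>y\<in>ball x (r x). \<sigma> y > 0)" if "x \<in> K" for x
    using smooth_bump[of "r x" x \<Omega>] that by metis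
  then obtain s where s: "\<And>x. x \<in> K \<Longrightarrow> test_function \<Omega> (s x)" "\<And>x y. x \<in> K \<Longrightarrow> s x y \<ge> 0"
    "\<And>x y. x \<in> K \<Longrightarrow> y \<in> ball x (r x) \<Longrightarrow> s x y > 0" by metis
  have "K \<subseteq> (\<Union>x\<in>K. ball x (r x))" using r by force
  then obtain F where F: "F \<subseteq> K" "finite F" "K \<subseteq> (\<Union>x\<in>F. ball x (r x))"
    using compactE_image[OF assms(1), of K "\<lambda>x. ball x (r x)"] by auto
  show ?thesis
  proof
    show "test_function \<Omega> (\<lambda>y. \<Sum>x\<in>F. s x y)" using F s by (intro test_function_sum) auto
    show "(\<Sum>x\<in>F. s x y) \<ge> 0" for y using F s by (intro sum_nonneg) auto
    show "(\<Sum>x\<in>F. s x y) > 0" if y: "y \<in> K" for y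
    proof -
      obtain x where "x \<in> F" "y \<in> ball x (r x)" using F y by blast
      then show ?thesis using F s by (intro sum_pos2[of _ x]) auto
    qed
  qed
qed

text \<open>Stone-Weierstrass takes the place of mollification. With \<open>\<sigma>\<close>
  positive on \<open>K\<close>, the quotient \<open>g / \<sigma>\<close> is continuous and is
  approximated by a polynomial on the compact set \<open>S\<close> that carries
  \<open>\<sigma>\<close>; multiplying back by \<open>\<sigma>\<close> gives a smooth function with
  compact support in \<open>\<Omega>\<close>.\<close>

lemma test_function_dense:
  fixes g :: "real ^ 'm \<Rightarrow> real"
  assumes "continuous_on UNIV g" "compact K" "K \<subseteq> \<Omega>" "open \<Omega>" "\<And>x. x \<notin> K \<Longrightarrow> g x = 0" "e > 0"
  obtains \<phi> where "test_function \<Omega> \<phi>" "\<And>x. \<bar>\<phi> x - g x\<bar> < e"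
proof -
  obtain \<sigma> where \<sigma>: "test_function \<Omega> \<sigma>" "\<And>x. \<sigma> x \<ge> 0" "\<And>x. x \<in> K \<Longrightarrow> \<sigma> x > 0"
    using test_function_positive_on_compact[OF assms(2-4)] by blast
  obtain S where S: "compact S" "\<And>x. x \<notin> S \<Longrightarrow> \<sigma> x = 0" using \<sigma>(1) by (rule test_functionE) blast
  note c\<sigma> = test_function_continuous[OF \<sigma>(1)]
  have "bounded (\<sigma> ` S)"
    using S(1) c\<sigma> by (intro compact_imp_bounded compact_continuous_image) (auto intro: continuous_on_subset)
  then obtain B where B: "B > 0" "\<And>x. x \<in> S \<Longrightarrow> \<sigma> x \<le> B"
    unfolding bounded_pos by (metis abs_le_D1 imageI real_norm_def)
  let ?h = "\<lambda>x. g x / \<sigma> x"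
  have op: "open {x. \<sigma> x > 0}" using c\<sigma> by (simp add: open_Collect_less)
  \<comment> \<open>Where \<open>\<sigma>\<close> vanishes the quotient has the default value 0,
    which agrees with \<open>g = 0\<close> off \<open>K\<close>; continuity is glued from the open
    sets \<open>\<sigma> > 0\<close> and \<open>- K\<close>.\<close>
  have "continuous_on {x. \<sigma> x > 0} ?h"
    using assms(1) c\<sigma> by (intro continuous_intros) (auto intro: continuous_on_subset)
  moreover have "continuous_on (- K) ?h"
    using assms(5) by (subst continuous_on_cong[of _ "- K" _ "\<lambda>_. 0"]) auto
  ultimately have "continuous_on ({x. \<sigma> x > 0} \<union> - K) ?h"
    using op compact_imp_closed[OF assms(2)] by (intro continuous_on_open_Un) auto
  moreover have "{x. \<sigma> x > 0} \<union> - K = UNIV" using \<sigma> by auto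
  ultimately have "continuous_on S ?h" by (metis continuous_on_subset subset_UNIV)
  then obtain p where p: "real_polynomial_function p" "\<And>x. x \<in> S \<Longrightarrow> \<bar>?h x - p x\<bar> < e / B"
    using Stone_Weierstrass_real_polynomial_function[OF S(1), of ?h "e / B"] assms(6) B(1) by auto
  show ?thesis
  proof
    show "test_function \<Omega> (\<lambda>x. \<sigma> x * p x)"
      by (rule test_function_mult[OF \<sigma>(1)]) (rule Ck_UNIV_real_polynomial[OF p(1)])
    fix x
    have g: "g x = \<sigma> x * ?h x" using assms(5)[of x] \<sigma>(3)[of x] by (cases "x \<in> K") auto
    show "\<bar>\<sigma> x * p x - g x\<bar> < e"
    proof (cases "x \<in> S")
      case True
      have "\<bar>\<sigma> x * p x - g x\<bar> = \<sigma> x * \<bar>?h x - p x\<bar>"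
        by (subst g) (use \<sigma>(2)[of x] in \<open>simp only: right_diff_distrib[symmetric] abs_mult
          abs_minus_commute abs_of_nonneg\<close>)
      also have "\<dots> \<le> B * \<bar>?h x - p x\<bar>" using B True by (intro mult_right_mono) auto
      also have "\<dots> < e" using p(2)[OF True] B by (simp add: field_simps)
      finally show ?thesis .
    next
      case False
      then show ?thesis using S(2) \<sigma>(3)[of x] assms(5,6) by fastforce
    qed
  qed
qed

lemma test_function_dense_vanishing:
  fixes f :: "real ^ 'm \<Rightarrow> real"
  assumes "open \<Omega>" "continuous_on \<Omega> f" "e > 0"
    and van: "\<And>\<epsilon>. \<epsilon> > 0 \<Longrightarrow> \<exists>K. compact K \<and> K \<subseteq> \<Omega> \<and> (\<forall>x\<in>\<Omega> - K. \<bar>f x\<bar> < \<epsilon>)"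
  obtains \<phi> where "test_function \<Omega> \<phi>" "\<And>x. x \<in> \<Omega> \<Longrightarrow> \<bar>\<phi> x - f x\<bar> < e"
proof -
  obtain K where K: "compact K" "K \<subseteq> \<Omega>" "\<And>x. x \<in> \<Omega> - K \<Longrightarrow> \<bar>f x\<bar> < e / 2"
    using van[of "e / 2"] assms(3) by auto
  \<comment> \<open>Soft thresholding: subtracting from \<open>f\<close> its truncation at level
    \<open>e / 2\<close> changes it by at most \<open>e / 2\<close> and leaves a function that
    vanishes off the compact set \<open>K\<close>, so that \<open>test_function_dense\<close>
    applies.\<close>
  define g where "g x = (if x \<in> \<Omega> then f x - max (- (e / 2)) (min (e / 2) (f x)) else 0)" for x
  have g0: "g x = 0" if "x \<notin> K" for x using K(3)[of x] that by (auto simp: g_def)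
  have "continuous_on \<Omega> g"
    using assms(2) unfolding g_def by (auto intro!: continuous_intros)
  moreover have "continuous_on (- K) g" using g0 by (subst continuous_on_cong[of _ "- K" _ "\<lambda>_. 0"]) auto
  ultimately have "continuous_on (\<Omega> \<union> - K) g"
    using assms(1) compact_imp_closed[OF K(1)] by (intro continuous_on_open_Un) auto
  moreover have "\<Omega> \<union> - K = UNIV" using K by auto
  ultimately have cg: "continuous_on UNIV g" by simp
  obtain \<phi> where \<phi>: "test_function \<Omega> \<phi>" "\<And>x. \<bar>\<phi> x - g x\<bar> < e / 2"
    using test_function_dense[OF cg K(1,2) assms(1) g0, of "e / 2"] assms(3) by auto
  show ?thesis
  proof
    show "test_function \<Omega> \<phi>" by fact
    show "\<bar>\<phi> x - f x\<bar> < e" if "x \<in> \<Omega>" for x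
    proof -
      have "\<bar>f x - g x\<bar> \<le> e / 2" using that assms(3) by (auto simp: g_def min_def max_def)
      then show ?thesis using \<phi>(2)[of x] by arith
    qed
  qed
qed

lemma test_field_dense_C0:
  assumes "open \<Omega>" "v \<in> C0 \<Omega>" "e > 0"
  obtains \<phi> where "test_field \<Omega> \<phi>" "\<And>x. x \<in> \<Omega> \<Longrightarrow> norm (\<phi> x - v x) < e"
proof -
  let ?n = "real CARD('a)"
  have "\<exists>\<psi>. test_function \<Omega> \<psi> \<and> (\<forall>x\<in>\<Omega>. \<bar>\<psi> x - v x $ i\<bar> < e / ?n)" for i
  proof -
    have "continuous_on \<Omega> (\<lambda>x. v x $ i)"
      using assms(2) by (auto simp: C0_def intro!: continuous_intros)
    moreover have "\<exists>K. compact K \<and> K \<subseteq> \<Omega> \<and> (\<forall>x\<in>\<Omega> - K. \<bar>v x $ i\<bar> < \<epsilon>)" if "\<epsilon> > 0" for \<epsilon>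
      using assms(2) that component_le_norm_cart[of "v _" i] unfolding C0_def
      by (smt (verit, ccfv_threshold) mem_Collect_eq)
    moreover have "e / ?n > 0" using assms(3) by simp
    ultimately show ?thesis
      by (metis test_function_dense_vanishing[OF assms(1), of "\<lambda>x. v x $ i" "e / ?n"])
  qed
  then obtain \<psi> where \<psi>: "\<And>i. test_function \<Omega> (\<psi> i)" "\<And>i x. x \<in> \<Omega> \<Longrightarrow> \<bar>\<psi> i x - v x $ i\<bar> < e / ?n"
    by metis
  show ?thesis
  proof
    show "test_field \<Omega> (\<lambda>x. \<chi> i. \<psi> i x)" using \<psi> by (simp add: test_field_def)
    show "norm ((\<chi> i. \<psi> i x) - v x) < e" if "x \<in> \<Omega>" for x
    proof -
      have "norm ((\<chi> i. \<psi> i x) - v x) \<le> (\<Sum>i\<in>UNIV. \<bar>((\<chi> i. \<psi> i x) - v x) $ i\<bar>)"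
        by (rule norm_le_l1_cart)
      also have "\<dots> < (\<Sum>i\<in>(UNIV::'a set). e / ?n)"
        using \<psi>(2)[OF that] by (intro sum_strict_mono) auto
      finally show ?thesis by simp
    qed
  qed
qed

section \<open>Finite signed measures\<close>

lemma signed_measureD:
  "signed_measure M \<nu> \<Longrightarrow> range A \<subseteq> sets M \<Longrightarrow> disjoint_family A \<Longrightarrow> (\<lambda>n. \<nu> (A n)) sums \<nu> (\<Union>n. A n)"
  by (auto simp: signed_measure_def)

lemma signed_measure_empty:
  assumes "signed_measure M \<nu>" shows "\<nu> {} = 0"
proof -
  have "(\<lambda>n::nat. \<nu> {}) sums \<nu> {}"
    using signed_measureD[OF assms, of "\<lambda>_. {}"] by (simp add: disjoint_family_on_def)
  then have "(\<lambda>n::nat. \<nu> {}) \<longlonglongrightarrow> 0" by (intro summable_LIMSEQ_zero sums_summable)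
  then show ?thesis by (simp add: LIMSEQ_const_iff)
qed

lemma signed_measure_Un:
  assumes "signed_measure M \<nu>" "A \<in> sets M" "B \<in> sets M" "A \<inter> B = {}"
  shows "\<nu> (A \<union> B) = \<nu> A + \<nu> B"
proof -
  have "(\<lambda>n. \<nu> (binaryset A B n)) sums \<nu> (\<Union>n. binaryset A B n)"
    using assms by (intro signed_measureD) (auto simp: range_binaryset_eq disjoint_family_on_def
      binaryset_def)
  then show ?thesis
    using binaryset_sums[of \<nu> A B, OF signed_measure_empty[OF assms(1)]]
    by (simp add: UN_binaryset_eq sums_unique2)
qed

lemma signed_measure_Diff:
  assumes "signed_measure M \<nu>" "A \<in> sets M" "B \<in> sets M" "B \<subseteq> A"
  shows "\<nu> (A - B) = \<nu> A - \<nu> B"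
proof -
  have "B \<union> (A - B) = A" using assms(4) by auto
  then show ?thesis using signed_measure_Un[OF assms(1) assms(3), of "A - B"] assms by auto
qed

lemma signed_measure_uminus: "signed_measure M \<nu> \<Longrightarrow> signed_measure M (\<lambda>A. - \<nu> A)"
  by (auto simp: signed_measure_def intro: sums_minus)

lemma signed_measure_add:
  "signed_measure M \<nu> \<Longrightarrow> signed_measure M \<mu> \<Longrightarrow> signed_measure M (\<lambda>A. \<nu> A + \<mu> A)"
  by (auto simp: signed_measure_def intro: sums_add)

lemma signed_measure_cmult: "signed_measure M \<nu> \<Longrightarrow> signed_measure M (\<lambda>A. c * \<nu> A)"
  by (auto simp: signed_measure_def intro: sums_mult)

text \<open>Otherwise a set on whose subsets \<open>\<nu>\<close> is unbounded could be shrunk again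
  and again, each time discarding a piece whose value has modulus at least 1; the discarded pieces
  are disjoint, so their values would have to tend to 0.\<close>

lemma signed_measure_bounded:
  assumes \<nu>: "signed_measure M \<nu>"
  obtains C where "\<And>A. A \<in> sets M \<Longrightarrow> \<bar>\<nu> A\<bar> \<le> C"
proof (rule ccontr)
  assume no: "\<not> thesis"
  define U where "U A \<longleftrightarrow> A \<in> sets M \<and> (\<forall>C. \<exists>B\<in>sets M. B \<subseteq> A \<and> \<bar>\<nu> B\<bar> > C)" for A
  have U0: "U (space M)" using no that sets.sets_into_space unfolding U_def
    by (metis linorder_not_le sets.top)
  have step: "\<exists>A'. U A' \<and> A' \<subseteq> A \<and> \<bar>\<nu> (A - A')\<bar> \<ge> 1" if A: "U A" for A
  proof -
    \<comment> \<open>A value exceeding \<open>\<bar>\<nu> A\<bar> + 1\<close> gives both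
      \<open>B\<close> and \<open>A - B\<close> a value of modulus at least 1, so whichever of the
      two is still unbounded may be kept and the other discarded.\<close>
    obtain B where B: "B \<in> sets M" "B \<subseteq> A" "\<bar>\<nu> B\<bar> > \<bar>\<nu> A\<bar> + 1" using A unfolding U_def by blast
    have As: "A \<in> sets M" using A by (simp add: U_def)
    have d: "\<nu> (A - B) = \<nu> A - \<nu> B" using signed_measure_Diff[OF \<nu> As B(1,2)] .
    show ?thesis
    proof (cases "U B")
      case True
      then show ?thesis using B d by (intro exI[of _ B]) auto
    next
      case nB: False
      show ?thesis
      proof (cases "U (A - B)")
        case True
        moreover have "A - (A - B) = B" using B(2) by auto
        ultimately show ?thesis using B by (intro exI[of _ "A - B"]) auto
      next
        case False
        from nB obtain C1 where C1: "\<And>D. D \<in> sets M \<Longrightarrow> D \<subseteq> B \<Longrightarrow> \<bar>\<nu> D\<bar> \<le> C1"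
          using B(1) unfolding U_def by (metis linorder_not_le)
        from False obtain C2 where C2: "\<And>D. D \<in> sets M \<Longrightarrow> D \<subseteq> A - B \<Longrightarrow> \<bar>\<nu> D\<bar> \<le> C2"
          using B(1) As unfolding U_def by (metis linorder_not_le sets.Diff)
        have "\<bar>\<nu> D\<bar> \<le> C1 + C2" if D: "D \<in> sets M" "D \<subseteq> A" for D
        proof -
          have "\<nu> ((D \<inter> B) \<union> (D - B)) = \<nu> (D \<inter> B) + \<nu> (D - B)"
            using D B by (intro signed_measure_Un[OF \<nu>]) auto
          moreover have "(D \<inter> B) \<union> (D - B) = D" by auto
          moreover have "\<bar>\<nu> (D \<inter> B)\<bar> \<le> C1" "\<bar>\<nu> (D - B)\<bar> \<le> C2" using D B by (auto intro!: C1 C2)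
          ultimately show ?thesis by simp
        qed
        then have "\<not> U A" unfolding U_def by (meson linorder_not_le)
        with A show ?thesis by simp
      qed
    qed
  qed
  have "\<exists>A. \<forall>n. U (A n) \<and> A (Suc n) \<subseteq> A n \<and> \<bar>\<nu> (A n - A (Suc n))\<bar> \<ge> 1"
    using dependent_nat_choice[of "\<lambda>_. U" "\<lambda>_ X Y. Y \<subseteq> X \<and> \<bar>\<nu> (X - Y)\<bar> \<ge> 1"] U0 step by metis
  then obtain A where A: "\<And>n. U (A n)" "\<And>n. A (Suc n) \<subseteq> A n" "\<And>n. \<bar>\<nu> (A n - A (Suc n))\<bar> \<ge> 1"
    by metis
  have anti: "A n \<subseteq> A m" if "m \<le> n" for m n using that A(2) by (rule lift_Suc_antimono_le[rotated])
  have dj: "(A i - A (Suc i)) \<inter> (A j - A (Suc j)) = {}" if "i < j" for i j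
    using anti[of "Suc i" j] that by auto
  have "disjoint_family (\<lambda>n. A n - A (Suc n))"
    unfolding disjoint_family_on_def using dj by (metis Int_commute linorder_neqE_nat)
  moreover have "range (\<lambda>n. A n - A (Suc n)) \<subseteq> sets M" using A(1) by (auto simp: U_def)
  ultimately have "(\<lambda>n. \<nu> (A n - A (Suc n))) \<longlonglongrightarrow> 0"
    using signed_measureD[OF \<nu>] by (meson sums_summable summable_LIMSEQ_zero)
  from LIMSEQ_D[OF this, of 1] A(3) show False by (auto simp: not_less[symmetric])
qed

section \<open>Upper variation and the Jordan decomposition\<close>

lemma ennreal_add_le: "ennreal (a + b) \<le> ennreal a + ennreal b"
proof -
  consider "a \<ge> 0" "b \<ge> 0" | "a < 0" | "b < 0" by linarith
  then show ?thesis by cases (auto simp: ennreal_plus ennreal_neg intro!: ennreal_leI add_increasing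
    add_increasing2)
qed

lemma ennreal_sum_le: "ennreal (\<Sum>i\<in>I. f i) \<le> (\<Sum>i\<in>I. ennreal (f i))"
proof (induction I rule: infinite_finite_induct)
  case (insert x F)
  then show ?case using order_trans[OF ennreal_add_le add_left_mono] by (metis sum.insert)
qed auto

text \<open>What has to be shown is that the supremum is countably additive. It is superadditive on
  disjoint sets, by uniting subsets of each; conversely a subset of a union is cut into its traces,
  whose values sum up by countable additivity of \<open>\<nu>\<close>.\<close>

lemma emeasure_upper_variation:
  assumes \<nu>: "signed_measure M \<nu>" and A: "A \<in> sets M"
  shows "emeasure (upper_variation M \<nu>) A = (SUP B\<in>{B \<in> sets M. B \<subseteq> A}. ennreal (\<nu> B))"
proof -
  define p where "p A = (SUP B\<in>{B \<in> sets M. B \<subseteq> A}. ennreal (\<nu> B))" for A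
  have upper: "ennreal (\<nu> B) \<le> p A" if "B \<in> sets M" "B \<subseteq> A" for A B
    unfolding p_def using that by (intro SUP_upper) auto
  have least: "p A \<le> c" if "\<And>B. B \<in> sets M \<Longrightarrow> B \<subseteq> A \<Longrightarrow> ennreal (\<nu> B) \<le> c" for A c
    unfolding p_def using that by (intro SUP_least) auto
  have super: "p A + p B \<le> p (A \<union> B)" if "A \<in> sets M" "B \<in> sets M" "A \<inter> B = {}" for A B
  proof -
    have ne: "{C \<in> sets M. C \<subseteq> X} \<noteq> {}" for X by blast
    have 1: "ennreal (\<nu> C) + ennreal (\<nu> D) \<le> p (A \<union> B)"
      if C: "C \<in> sets M" "C \<subseteq> A" and D: "D \<in> sets M" "D \<subseteq> B" for C D
    proof -
      \<comment> \<open>A negative value counts as 0 under \<open>ennreal\<close>; then the other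
        set alone competes in the supremum for \<open>A \<union> B\<close>.\<close>
      consider "\<nu> C \<ge> 0" "\<nu> D \<ge> 0" | "\<nu> C < 0" | "\<nu> D < 0" by linarith
      then show ?thesis
      proof cases
        case 1
        have "C \<inter> D = {}" using C D \<open>A \<inter> B = {}\<close> by auto
        then have "\<nu> (C \<union> D) = \<nu> C + \<nu> D" using C D by (intro signed_measure_Un[OF \<nu>]) auto
        then have "ennreal (\<nu> C) + ennreal (\<nu> D) = ennreal (\<nu> (C \<union> D))" using 1 by (simp add: ennreal_plus)
        also have "\<dots> \<le> p (A \<union> B)" using C D by (intro upper) auto
        finally show ?thesis .
      next
        case 2
        then show ?thesis using upper[of D "A \<union> B"] C D by (auto simp: ennreal_neg)
      next
        case 3
        then show ?thesis using upper[of C "A \<union> B"] C D by (auto simp: ennreal_neg)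
      qed
    qed
    have 2: "ennreal (\<nu> C) + p B \<le> p (A \<union> B)" if C: "C \<in> sets M" "C \<subseteq> A" for C
    proof -
      have "ennreal (\<nu> C) + p B = (SUP D\<in>{D \<in> sets M. D \<subseteq> B}. ennreal (\<nu> C) + ennreal (\<nu> D))"
        unfolding p_def by (rule ennreal_SUP_add_right[OF ne])
      also have "\<dots> \<le> p (A \<union> B)" using 1[OF C] by (intro SUP_least) auto
      finally show ?thesis .
    qed
    have "p A + p B = (SUP C\<in>{C \<in> sets M. C \<subseteq> A}. ennreal (\<nu> C) + p B)"
      unfolding p_def[of A] by (rule ennreal_SUP_add_left[OF ne, symmetric])
    also have "\<dots> \<le> p (A \<union> B)" using 2 by (intro SUP_least) auto
    finally show ?thesis .
  qed
  have "p {} = 0"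
  proof -
    have "p {} \<le> 0" by (rule least) (use signed_measure_empty[OF \<nu>] in auto)
    then show ?thesis by simp
  qed
  then have "positive (sets M) p" by (simp add: positive_def)
  moreover have "countably_additive (sets M) p"
  proof (unfold countably_additive_def, safe)
    fix A :: "nat \<Rightarrow> 'a set"
    assume A: "range A \<subseteq> sets M" "disjoint_family A" "\<Union> (range A) \<in> sets M"
    show "(\<Sum>i. p (A i)) = p (\<Union> (range A))"
    proof (rule antisym)
      have fin: "(\<Sum>i<N. p (A i)) \<le> p (\<Union>i<N. A i)" for N
      proof (induction N)
        case (Suc N)
        have "A i \<inter> A N = {}" if "i < N" for i
          using A(2) that by (metis UNIV_I disjoint_family_onD less_irrefl)
        then have "(\<Union>i<N. A i) \<inter> A N = {}" by blast
        then have "p (\<Union>i<N. A i) + p (A N) \<le> p ((\<Union>i<N. A i) \<union> A N)" using A(1) by (intro super) auto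
        moreover have "(\<Union>i<N. A i) \<union> A N = (\<Union>i<Suc N. A i)" by (auto simp: lessThan_Suc)
        ultimately show ?case using Suc by (metis (no_types, lifting) add_right_mono order_trans
          sum.lessThan_Suc)
      qed simp
      have "(\<Sum>i<N. p (A i)) \<le> p (\<Union> (range A))" for N
        by (rule order_trans[OF fin]) (auto intro!: least upper)
      then show "(\<Sum>i. p (A i)) \<le> p (\<Union> (range A))" by (intro suminf_le_const) auto
      show "p (\<Union> (range A)) \<le> (\<Sum>i. p (A i))"
      proof (rule least)
        fix B assume B: "B \<in> sets M" "B \<subseteq> \<Union> (range A)"
        have "(\<lambda>n. \<nu> (B \<inter> A n)) sums \<nu> (\<Union>n. B \<inter> A n)"
          using A B by (intro signed_measureD[OF \<nu>]) (auto simp: disjoint_family_on_def)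
        moreover have "(\<Union>n. B \<inter> A n) = B" using B by auto
        ultimately have lim: "(\<lambda>N. ennreal (\<Sum>n<N. \<nu> (B \<inter> A n))) \<longlonglongrightarrow> ennreal (\<nu> B)"
          by (simp add: sums_def)
        have "ennreal (\<Sum>n<N. \<nu> (B \<inter> A n)) \<le> (\<Sum>i. p (A i))" for N
        proof -
          have "ennreal (\<Sum>n<N. \<nu> (B \<inter> A n)) \<le> (\<Sum>n<N. ennreal (\<nu> (B \<inter> A n)))" by (rule ennreal_sum_le)
          also have "\<dots> \<le> (\<Sum>n<N. p (A n))" using A B by (intro sum_mono upper) auto
          also have "\<dots> \<le> (\<Sum>i. p (A i))" by (intro sum_le_suminf) auto
          finally show ?thesis .
        qed
        then show "ennreal (\<nu> B) \<le> (\<Sum>i. p (A i))" by (intro LIMSEQ_le_const2[OF lim]) auto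
      qed
    qed
  qed
  ultimately show ?thesis
    unfolding upper_variation_def p_def[abs_def]
    by (rule emeasure_measure_of_sigma[OF sets.sigma_algebra_axioms _ _ A])
qed

lemma sets_upper_variation [simp, measurable_cong]: "sets (upper_variation M \<nu>) = sets M"
  by (simp add: upper_variation_def)

lemma space_upper_variation [simp]: "space (upper_variation M \<nu>) = space M"
  by (simp add: upper_variation_def)

lemma finite_measure_upper_variation:
  assumes "signed_measure M \<nu>" shows "finite_measure (upper_variation M \<nu>)"
proof
  obtain C where C: "\<And>A. A \<in> sets M \<Longrightarrow> \<bar>\<nu> A\<bar> \<le> C" using signed_measure_bounded[OF assms] by blast
  have "emeasure (upper_variation M \<nu>) (space M) \<le> ennreal C"
    unfolding emeasure_upper_variation[OF assms sets.top]
    using C by (intro SUP_least ennreal_leI) (auto intro: order_trans[OF abs_ge_self])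
  then show "emeasure (upper_variation M \<nu>) (space (upper_variation M \<nu>)) \<noteq> \<infinity>"
    by (metis ennreal_less_top infinity_ennreal_def leD space_upper_variation)
qed

text \<open>For \<open>B \<subseteq> A\<close> one has
  \<open>\<nu> B = \<nu> A - \<nu> (A - B)\<close>, and the last term is controlled by the lower
  variation of \<open>A\<close>. Together with the same bound for the negative of
  \<open>\<nu>\<close> this yields the Jordan decomposition.\<close>

lemma measure_upper_variation_le:
  assumes \<nu>: "signed_measure M \<nu>" and A: "A \<in> sets M"
  shows "measure (upper_variation M \<nu>) A \<le> \<nu> A + measure (upper_variation M (\<lambda>A. - \<nu> A)) A"
proof -
  note \<nu>' = signed_measure_uminus[OF \<nu>]
  interpret u: finite_measure "upper_variation M \<nu>" by (rule finite_measure_upper_variation[OF \<nu>])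
  interpret l: finite_measure "upper_variation M (\<lambda>A. - \<nu> A)" by (rule finite_measure_upper_variation[OF \<nu>'])
  let ?l = "measure (upper_variation M (\<lambda>A. - \<nu> A)) A"
  have *: "\<nu> B \<le> \<nu> A + ?l" if B: "B \<in> sets M" "B \<subseteq> A" for B
  proof -
    have "ennreal (- \<nu> (A - B)) \<le> emeasure (upper_variation M (\<lambda>A. - \<nu> A)) A"
      unfolding emeasure_upper_variation[OF \<nu>' A] using A B by (intro SUP_upper2[of "A - B"]) auto
    then have "- \<nu> (A - B) \<le> ?l"
      by (metis ennreal_le_iff l.emeasure_eq_measure measure_nonneg)
    then show ?thesis using signed_measure_Diff[OF \<nu> A B] by simp
  qed
  have nn: "\<nu> A + ?l \<ge> 0" using *[of "{}"] signed_measure_empty[OF \<nu>] by simp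
  have "emeasure (upper_variation M \<nu>) A \<le> ennreal (\<nu> A + ?l)"
    unfolding emeasure_upper_variation[OF \<nu> A] using * by (intro SUP_least ennreal_leI) auto
  then show ?thesis using nn by (simp add: u.emeasure_eq_measure)
qed

lemma jordan_decomposition:
  assumes \<nu>: "signed_measure M \<nu>" and A: "A \<in> sets M"
  shows "\<nu> A = measure (upper_variation M \<nu>) A - measure (upper_variation M (\<lambda>A. - \<nu> A)) A"
  using measure_upper_variation_le[OF \<nu> A] measure_upper_variation_le[OF signed_measure_uminus[OF \<nu>] A]
  by simp

lemma integrable_bounded_finite_measure:
  fixes f :: "'a \<Rightarrow> real"
  assumes "finite_measure \<mu>" "sets \<mu> = sets M" "f \<in> borel_measurable M" "\<And>x. x \<in> space M \<Longrightarrow> \<bar>f x\<bar> \<le> B"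
  shows "integrable \<mu> f"
proof -
  interpret finite_measure \<mu> by fact
  have "space \<mu> = space M" using assms(2) by (rule sets_eq_imp_space_eq)
  moreover have "f \<in> borel_measurable \<mu>" using assms(3) measurable_cong_sets[OF assms(2) refl] by blast
  ultimately show ?thesis using assms(4) by (intro integrable_const_bound[of _ B]) auto
qed

text \<open>The proof rounds \<open>f\<close> to multiples of \<open>1 / n\<close>.\<close>

lemma integral_measure_combination:
  fixes f :: "'a \<Rightarrow> real" and \<mu> :: "'j \<Rightarrow> 'a measure"
  assumes fin: "finite J" "\<And>j. j \<in> J \<Longrightarrow> finite_measure (\<mu> j)" "\<And>j. j \<in> J \<Longrightarrow> sets (\<mu> j) = sets M"
    and zero: "\<And>A. A \<in> sets M \<Longrightarrow> (\<Sum>j\<in>J. c j * measure (\<mu> j) A) = 0"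
    and f: "f \<in> borel_measurable M" "\<And>x. x \<in> space M \<Longrightarrow> \<bar>f x\<bar> \<le> B"
  shows "(\<Sum>j\<in>J. c j * (LINT x|\<mu> j. f x)) = 0"
proof -
  define D where "D = (\<Sum>j\<in>J. \<bar>c j\<bar> * measure (\<mu> j) (space M))"
  \<comment> \<open>The rounded function is a finite combination of indicators, so its contribution
    vanishes by \<open>zero\<close>; the rounding error costs \<open>1 / n\<close> times the
    weighted total mass \<open>D\<close>.\<close>
  have est: "\<bar>\<Sum>j\<in>J. c j * (LINT x|\<mu> j. f x)\<bar> \<le> D / n" if n: "n > 0" for n :: nat
  proof -
    define K where "K = \<lceil>real n * B\<rceil> + 1"
    define E where "E k = {x \<in> space M. \<lfloor>real n * f x\<rfloor> = k}" for k
    define g where "g x = (\<Sum>k\<in>{-K..K}. (of_int k / n) * indicator (E k) x)" for x :: 'a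
    have Es: "E k \<in> sets M" for k unfolding E_def using f(1) by measurable
    have g: "g x = of_int \<lfloor>real n * f x\<rfloor> / n" if x: "x \<in> space M" for x
    proof -
      have "real n * \<bar>f x\<bar> \<le> real n * B" using f(2)[OF x] by (intro mult_left_mono) auto
      then have "\<bar>real n * f x\<bar> \<le> of_int \<lceil>real n * B\<rceil>" by (simp add: abs_mult) linarith
      then have "\<lfloor>real n * f x\<rfloor> \<in> {-K..K}" unfolding K_def by simp linarith
      then show ?thesis using x unfolding g_def E_def
        by (subst sum.cong[OF refl, where h = "\<lambda>k. if k = \<lfloor>real n * f x\<rfloor> then of_int k / n else 0"])
           (auto simp: indicator_def)
    qed
    have fg: "\<bar>f x - g x\<bar> \<le> 1 / n" if "x \<in> space M" for x
    proof -
      have "\<bar>real n * f x - of_int \<lfloor>real n * f x\<rfloor>\<bar> \<le> 1" by linarith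
      then have "\<bar>real n * f x - of_int \<lfloor>real n * f x\<rfloor>\<bar> / n \<le> 1 / n" by (rule divide_right_mono) simp
      moreover have "f x - g x = (real n * f x - of_int \<lfloor>real n * f x\<rfloor>) / n"
        using n g[OF that] by (simp add: diff_divide_distrib)
      ultimately show ?thesis by (simp add: abs_divide)
    qed
    have gm: "g \<in> borel_measurable M" unfolding g_def using Es by measurable
    have int: "integrable (\<mu> j) f" "integrable (\<mu> j) g" "(LINT x|\<mu> j. g x) = (\<Sum>k\<in>{-K..K}. (of_int k / n)
      * measure (\<mu> j) (E k))"
      and err: "\<bar>(LINT x|\<mu> j. f x) - (LINT x|\<mu> j. g x)\<bar> \<le> measure (\<mu> j) (space M) / n" if j: "j \<in> J" for j
    proof -
      interpret finite_measure "\<mu> j" using fin j by blast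
      have sp: "space (\<mu> j) = space M" using fin(3)[OF j] by (rule sets_eq_imp_space_eq)
      show i1: "integrable (\<mu> j) f" using integrable_bounded_finite_measure[OF fin(2)[OF j] fin(3)[OF j] f] .
      have E': "E k \<in> sets (\<mu> j)" for k using Es fin(3)[OF j] by simp
      show i2: "integrable (\<mu> j) g" unfolding g_def using E'
        by (intro Bochner_Integration.integrable_sum integrable_mult_right) (auto simp: less_top[symmetric])
      have "(LINT x|\<mu> j. g x) = (\<Sum>k\<in>{-K..K}. LINT x|\<mu> j. (of_int k / n) * indicator (E k) x)"
        unfolding g_def using E' by (intro Bochner_Integration.integral_sum integrable_mult_right) (auto
          simp: less_top[symmetric])
      also have "\<dots> = (\<Sum>k\<in>{-K..K}. (of_int k / n) * measure (\<mu> j) (E k))"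
        using E' sets.sets_into_space[OF E'] by (intro sum.cong refl) (auto simp: Int_absorb2)
      finally show "(LINT x|\<mu> j. g x) = (\<Sum>k\<in>{-K..K}. (of_int k / n) * measure (\<mu> j) (E k))" .
      have "\<bar>LINT x|\<mu> j. f x - g x\<bar> \<le> (LINT x|\<mu> j. \<bar>f x - g x\<bar>)" by (rule integral_abs_bound)
      also have "\<dots> \<le> (LINT x|\<mu> j. 1 / n)" using fg sp i1 i2 by (intro integral_mono) auto
      finally show "\<bar>(LINT x|\<mu> j. f x) - (LINT x|\<mu> j. g x)\<bar> \<le> measure (\<mu> j) (space M) / n"
        using i1 i2 sp by simp
    qed
    have "(\<Sum>j\<in>J. c j * (LINT x|\<mu> j. g x)) = (\<Sum>j\<in>J. \<Sum>k\<in>{-K..K}. (of_int k / n) * (c j * measure (\<mu> j) (E k)))"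
      using int(3) by (intro sum.cong refl) (simp add: sum_distrib_left algebra_simps)
    also have "\<dots> = (\<Sum>k\<in>{-K..K}. (of_int k / n) * (\<Sum>j\<in>J. c j * measure (\<mu> j) (E k)))"
      by (subst sum.swap) (simp add: sum_distrib_left)
    also have "\<dots> = 0" using zero[OF Es] by simp
    finally have "(\<Sum>j\<in>J. c j * (LINT x|\<mu> j. f x)) = (\<Sum>j\<in>J. c j * ((LINT x|\<mu> j. f x) - (LINT x|\<mu> j. g x)))"
      by (simp add: right_diff_distrib sum_subtractf)
    also have "\<bar>\<dots>\<bar> \<le> (\<Sum>j\<in>J. \<bar>c j\<bar> * (measure (\<mu> j) (space M) / n))"
      using err
      by (intro order_trans[OF sum_abs] sum_mono) (simp only: abs_mult, intro mult_left_mono, auto)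
    also have "\<dots> = D / n" by (simp add: D_def sum_divide_distrib)
    finally show ?thesis .
  qed
  have lim: "(\<lambda>n. D / real (Suc n)) \<longlonglongrightarrow> 0"
    using LIMSEQ_Suc[OF tendsto_divide_0[OF tendsto_const filterlim_at_top_imp_at_infinity[OF
      filterlim_real_sequentially]]] .
  then have "\<bar>\<Sum>j\<in>J. c j * (LINT x|\<mu> j. f x)\<bar> \<le> 0"
    by (intro LIMSEQ_le_const[OF lim] exI[of _ 0] allI impI est) simp
  then show ?thesis by simp
qed

text \<open>An explicit list of coefficients and measures may repeat a measure. A linear identity
  between signed integrals thereby reduces to a numerical identity between the measures of each
  set.\<close>

lemma integral_measure_combination_list:
  fixes f :: "'a \<Rightarrow> real"
  assumes "\<forall>p\<in>set ps. finite_measure (snd p) \<and> sets (snd p) = sets M"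
    and "\<And>A. A \<in> sets M \<Longrightarrow> (\<Sum>p\<leftarrow>ps. fst p * measure (snd p) A) = 0"
    and "f \<in> borel_measurable M" "\<And>x. x \<in> space M \<Longrightarrow> \<bar>f x\<bar> \<le> B"
  shows "(\<Sum>p\<leftarrow>ps. fst p * (LINT x|snd p. f x)) = 0"
  unfolding sum_list_sum_nth length_map
proof (subst sum.cong[OF refl nth_map])
  show "(\<Sum>j = 0..<length ps. fst (ps ! j) * (LINT x|snd (ps ! j). f x)) = 0"
  proof (rule integral_measure_combination[OF _ _ _ _ assms(3,4)])
    show "(\<Sum>j = 0..<length ps. fst (ps ! j) * measure (snd (ps ! j)) A) = 0" if "A \<in> sets M" for A
      using assms(2)[OF that] by (simp add: sum_list_sum_nth)
  qed (use assms(1) in auto)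
qed auto

lemma signed_measure_diff:
  assumes "finite_measure \<mu>\<^sub>1" "finite_measure \<mu>\<^sub>2" "sets \<mu>\<^sub>1 = sets M" "sets \<mu>\<^sub>2 = sets M"
    and "\<And>A. A \<in> sets M \<Longrightarrow> \<nu> A = measure \<mu>\<^sub>1 A - measure \<mu>\<^sub>2 A"
  shows "signed_measure M \<nu>"
  unfolding signed_measure_def
proof (intro allI impI, elim conjE)
  fix A :: "nat \<Rightarrow> 'a set" assume A: "range A \<subseteq> sets M" "disjoint_family A"
  have "(\<lambda>n. measure \<mu>\<^sub>1 (A n) - measure \<mu>\<^sub>2 (A n)) sums (measure \<mu>\<^sub>1 (\<Union>n. A n) - measure \<mu>\<^sub>2 (\<Union>n. A n))"
    using A assms by (intro sums_diff finite_measure.finite_measure_UNION) auto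
  moreover have "\<nu> (\<Union>n. A n) = measure \<mu>\<^sub>1 (\<Union>n. A n) - measure \<mu>\<^sub>2 (\<Union>n. A n)"
    using A(1) by (intro assms(5)) auto
  moreover have "\<nu> (A n) = measure \<mu>\<^sub>1 (A n) - measure \<mu>\<^sub>2 (A n)" for n
    using A(1) by (intro assms(5)) auto
  ultimately show "(\<lambda>n. \<nu> (A n)) sums \<nu> (\<Union>n. A n)" by simp
qed

text \<open>Frees the signed integral from its Jordan parts, which are rarely the measures at hand:
  both representations give the same values on sets, and
  \<open>integral_measure_combination_list\<close> carries this over to integrals.\<close>

lemma signed_integral_diff_measure:
  fixes f :: "'a \<Rightarrow> real"
  assumes fm: "finite_measure \<mu>\<^sub>1" "finite_measure \<mu>\<^sub>2" "sets \<mu>\<^sub>1 = sets M" "sets \<mu>\<^sub>2 = sets M"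
    and eq: "\<And>A. A \<in> sets M \<Longrightarrow> \<nu> A = measure \<mu>\<^sub>1 A - measure \<mu>\<^sub>2 A"
    and f: "f \<in> borel_measurable M" "\<And>x. x \<in> space M \<Longrightarrow> \<bar>f x\<bar> \<le> B"
  shows "signed_integral M \<nu> f = (LINT x|\<mu>\<^sub>1. f x) - (LINT x|\<mu>\<^sub>2. f x)"
proof -
  note \<nu> = signed_measure_diff[OF fm eq]
  note fin = finite_measure_upper_variation[OF \<nu>]
    finite_measure_upper_variation[OF signed_measure_uminus[OF \<nu>]]
  have "(\<Sum>p\<leftarrow>[(1, upper_variation M \<nu>), (- 1, upper_variation M (\<lambda>A. - \<nu> A)), (- 1, \<mu>\<^sub>1), (1, \<mu>\<^sub>2)].
      fst p * (LINT x|snd p. f x)) = 0"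
  proof (rule integral_measure_combination_list[OF _ _ f])
    show "(\<Sum>p\<leftarrow>[(1, upper_variation M \<nu>), (- 1, upper_variation M (\<lambda>A. - \<nu> A)), (- 1, \<mu>\<^sub>1), (1, \<mu>\<^sub>2)].
        fst p * measure (snd p) A) = 0" if "A \<in> sets M" for A
      using jordan_decomposition[OF \<nu> that] eq[OF that] by simp
  qed (use fm fin in simp_all)
  then show ?thesis by (simp add: signed_integral_def)
qed

text \<open>Because of cancellation the Jordan parts of a sum are in general not the sums of the
  Jordan parts. The differences agree on every set, and this passes to integrals of bounded
  functions.\<close>

lemma signed_integral_add_measure:
  fixes f :: "'a \<Rightarrow> real"
  assumes \<nu>: "signed_measure M \<nu>" and \<mu>: "signed_measure M \<mu>"
    and f: "f \<in> borel_measurable M" "\<And>x. x \<in> space M \<Longrightarrow> \<bar>f x\<bar> \<le> B"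
  shows "signed_integral M (\<lambda>A. \<nu> A + \<mu> A) f = signed_integral M \<nu> f + signed_integral M \<mu> f"
proof -
  let ?\<kappa> = "\<lambda>A. \<nu> A + \<mu> A"
  note \<kappa> = signed_measure_add[OF \<nu> \<mu>]
  note fin = finite_measure_upper_variation[OF \<nu>] finite_measure_upper_variation[OF \<mu>]
    finite_measure_upper_variation[OF \<kappa>] finite_measure_upper_variation[OF signed_measure_uminus[OF \<nu>]]
    finite_measure_upper_variation[OF signed_measure_uminus[OF \<mu>]]
    finite_measure_upper_variation[OF signed_measure_uminus[OF \<kappa>]]
  have jd: "measure (upper_variation M ?\<kappa>) A - measure (upper_variation M (\<lambda>A. - ?\<kappa> A)) A =
      measure (upper_variation M \<nu>) A - measure (upper_variation M (\<lambda>A. - \<nu> A)) A +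
      (measure (upper_variation M \<mu>) A - measure (upper_variation M (\<lambda>A. - \<mu> A)) A)" if "A \<in> sets M" for A
    unfolding jordan_decomposition[OF \<nu> that, symmetric] jordan_decomposition[OF \<mu> that, symmetric]
      jordan_decomposition[OF \<kappa> that, symmetric] ..
  have "(\<Sum>p\<leftarrow>[(1, upper_variation M ?\<kappa>), (- 1, upper_variation M (\<lambda>A. - ?\<kappa> A)),
      (- 1, upper_variation M \<nu>), (1, upper_variation M (\<lambda>A. - \<nu> A)),
      (- 1, upper_variation M \<mu>), (1, upper_variation M (\<lambda>A. - \<mu> A))]. fst p * (LINT x|snd p. f x)) = 0"
  proof (rule integral_measure_combination_list[OF _ _ f])
    show "(\<Sum>p\<leftarrow>[(1, upper_variation M ?\<kappa>), (- 1, upper_variation M (\<lambda>A. - ?\<kappa> A)),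
      (- 1, upper_variation M \<nu>), (1, upper_variation M (\<lambda>A. - \<nu> A)),
      (- 1, upper_variation M \<mu>), (1, upper_variation M (\<lambda>A. - \<mu> A))]. fst p * measure (snd p) A) = 0"
      if "A \<in> sets M" for A
      using jd[OF that] by (simp del: minus_add_distrib)
  qed (use fin in \<open>simp_all del: minus_add_distrib\<close>)
  then show ?thesis by (simp add: signed_integral_def del: minus_add_distrib)
qed

lemma signed_integral_cmult_measure:
  fixes f :: "'a \<Rightarrow> real"
  assumes \<nu>: "signed_measure M \<nu>"
    and f: "f \<in> borel_measurable M" "\<And>x. x \<in> space M \<Longrightarrow> \<bar>f x\<bar> \<le> B"
  shows "signed_integral M (\<lambda>A. a * \<nu> A) f = a * signed_integral M \<nu> f"
proof -
  let ?\<kappa> = "\<lambda>A. a * \<nu> A"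
  note \<kappa> = signed_measure_cmult[OF \<nu>, of a]
  note fin = finite_measure_upper_variation[OF \<nu>] finite_measure_upper_variation[OF \<kappa>]
    finite_measure_upper_variation[OF signed_measure_uminus[OF \<nu>]]
    finite_measure_upper_variation[OF signed_measure_uminus[OF \<kappa>]]
  have jd: "measure (upper_variation M ?\<kappa>) A - measure (upper_variation M (\<lambda>A. - ?\<kappa> A)) A =
      a * (measure (upper_variation M \<nu>) A - measure (upper_variation M (\<lambda>A. - \<nu> A)) A)" if "A \<in> sets M" for A
    unfolding jordan_decomposition[OF \<nu> that, symmetric] jordan_decomposition[OF \<kappa> that, symmetric] ..
  have "(\<Sum>p\<leftarrow>[(1, upper_variation M ?\<kappa>), (- 1, upper_variation M (\<lambda>A. - ?\<kappa> A)),
      (- a, upper_variation M \<nu>), (a, upper_variation M (\<lambda>A. - \<nu> A))]. fst p * (LINT x|snd p. f x)) = 0"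
  proof (rule integral_measure_combination_list[OF _ _ f])
    show "(\<Sum>p\<leftarrow>[(1, upper_variation M ?\<kappa>), (- 1, upper_variation M (\<lambda>A. - ?\<kappa> A)),
      (- a, upper_variation M \<nu>), (a, upper_variation M (\<lambda>A. - \<nu> A))]. fst p * measure (snd p) A) = 0"
      if "A \<in> sets M" for A
      using jd[OF that] by (simp add: right_diff_distrib)
  qed (use fin in simp_all)
  then show ?thesis by (simp add: signed_integral_def right_diff_distrib)
qed

text \<open>The total variation norm of a signed measure.\<close>

definition variation_mass :: "'a measure \<Rightarrow> ('a set \<Rightarrow> real) \<Rightarrow> real" where
  "variation_mass M \<nu> = measure (upper_variation M \<nu>) (space M) +
     measure (upper_variation M (\<lambda>A. - \<nu> A)) (space M)"

lemma variation_mass_nonneg: "variation_mass M \<nu> \<ge> 0"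
  by (simp add: variation_mass_def)

lemma abs_signed_integral_le:
  fixes f :: "'a \<Rightarrow> real"
  assumes \<nu>: "signed_measure M \<nu>"
    and f: "f \<in> borel_measurable M" "\<And>x. x \<in> space M \<Longrightarrow> \<bar>f x\<bar> \<le> B"
  shows "\<bar>signed_integral M \<nu> f\<bar> \<le> B * variation_mass M \<nu>"
proof -
  have *: "\<bar>LINT x|\<mu>. f x\<bar> \<le> B * measure \<mu> (space M)" if \<mu>: "finite_measure \<mu>" "sets \<mu> = sets M" for \<mu>
  proof -
    interpret finite_measure \<mu> by fact
    have sp: "space \<mu> = space M" using \<mu>(2) by (rule sets_eq_imp_space_eq)
    have "\<bar>LINT x|\<mu>. f x\<bar> \<le> (LINT x|\<mu>. \<bar>f x\<bar>)" by (rule integral_abs_bound)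
    also have "\<dots> \<le> (LINT x|\<mu>. B)"
      using integrable_bounded_finite_measure[OF \<mu> f] f(2) sp by (intro integral_mono) auto
    finally show ?thesis using sp by (simp add: mult.commute)
  qed
  show ?thesis
    using *[OF finite_measure_upper_variation[OF \<nu>]]
      *[OF finite_measure_upper_variation[OF signed_measure_uminus[OF \<nu>]]]
    by (simp add: signed_integral_def variation_mass_def distrib_left)
qed

lemma signed_integral_add:
  fixes f g :: "'a \<Rightarrow> real"
  assumes \<nu>: "signed_measure M \<nu>"
    and f: "f \<in> borel_measurable M" "\<And>x. x \<in> space M \<Longrightarrow> \<bar>f x\<bar> \<le> B"
    and g: "g \<in> borel_measurable M" "\<And>x. x \<in> space M \<Longrightarrow> \<bar>g x\<bar> \<le> C"
  shows "signed_integral M \<nu> (\<lambda>x. f x + g x) = signed_integral M \<nu> f + signed_integral M \<nu> g"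
proof -
  note fin = finite_measure_upper_variation[OF \<nu>] finite_measure_upper_variation[OF
    signed_measure_uminus[OF \<nu>]]
  show ?thesis unfolding signed_integral_def
    using integrable_bounded_finite_measure[OF fin(1) _ f] integrable_bounded_finite_measure[OF fin(2) _ f]
      integrable_bounded_finite_measure[OF fin(1) _ g] integrable_bounded_finite_measure[OF fin(2) _ g]
    by simp
qed

lemma signed_integral_cmult: "signed_integral M \<nu> (\<lambda>x. a * f x) = a * signed_integral M \<nu> f"
  by (simp add: signed_integral_def right_diff_distrib)

lemma signed_integral_diff:
  fixes f g :: "'a \<Rightarrow> real"
  assumes "signed_measure M \<nu>"
    and "f \<in> borel_measurable M" "\<And>x. x \<in> space M \<Longrightarrow> \<bar>f x\<bar> \<le> B"
    and "g \<in> borel_measurable M" "\<And>x. x \<in> space M \<Longrightarrow> \<bar>g x\<bar> \<le> C"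
  shows "signed_integral M \<nu> (\<lambda>x. f x - g x) = signed_integral M \<nu> f - signed_integral M \<nu> g"
  using signed_integral_add[OF assms(1-3), of "\<lambda>x. - 1 * g x" C] assms
  by (simp add: signed_integral_cmult[of M \<nu> "- 1" g, simplified])

text \<open>Meant for \<open>N = lebesgue_on \<Omega>\<close> and \<open>M\<close> the Borel sets of
  \<open>\<Omega>\<close>: the density is integrable for the larger sigma-algebra, while derivative
  measures live on the smaller one.\<close>

lemma signed_integral_density:
  fixes h :: "'a \<Rightarrow> real"
  assumes sub: "space N = space M" "sets M \<subseteq> sets N" and h: "integrable N h"
  defines "\<nu> \<equiv> \<lambda>A. LINT x|N. indicator A x * h x"
  shows "signed_measure M \<nu>"
    and "\<And>f B. f \<in> borel_measurable M \<Longrightarrow> (\<And>x. x \<in> space M \<Longrightarrow> \<bar>f x\<bar> \<le> B) \<Longrightarrow>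
      signed_integral M \<nu> f = (LINT x|N. h x * f x)"
proof -
  \<comment> \<open>The identity map, read from \<open>N\<close> to \<open>M\<close>, forgets the
    additional measurable sets; the positive parts of \<open>h\<close> and of its negative supply
    the two finite measures.\<close>
  define \<mu> where "\<mu> k = distr (density N (\<lambda>x. ennreal (max 0 (k x)))) M (\<lambda>x. x)" for k :: "'a \<Rightarrow> real"
  have up: "f \<in> measurable M K \<Longrightarrow> f \<in> measurable N K" for f :: "'a \<Rightarrow> 'c" and K
    using sub by (auto simp: measurable_def)
  have id: "(\<lambda>x. x) \<in> measurable N M" using up[OF measurable_ident] by (simp add: id_def)
  have fin: "finite_measure (\<mu> k)" and s: "sets (\<mu> k) = sets M"
    and int: "f \<in> borel_measurable M \<Longrightarrow> (LINT x|\<mu> k. f x) = (LINT x|N. max 0 (k x) * f x)"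
    if k: "integrable N k" for k and f :: "'a \<Rightarrow> real"
  proof -
    have [measurable]: "k \<in> borel_measurable N" using k by auto
    show "sets (\<mu> k) = sets M" by (simp add: \<mu>_def)
    have "(\<integral>\<^sup>+ x. ennreal (max 0 (k x)) \<partial>N) < \<infinity>"
    proof -
      have "integrable N (\<lambda>x. max 0 (k x))" using k by auto
      then show ?thesis by (simp add: integrable_iff_bounded)
    qed
    then have "finite_measure (density N (\<lambda>x. ennreal (max 0 (k x))))"
      by (intro finite_measureI) (auto simp: emeasure_density cong: nn_integral_cong)
    then show "finite_measure (\<mu> k)" unfolding \<mu>_def
      using id by (intro finite_measure.finite_measure_distr) (auto simp: measurable_def)
    show "(LINT x|\<mu> k. f x) = (LINT x|N. max 0 (k x) * f x)" if f: "f \<in> borel_measurable M"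
    proof -
      have fN: "f \<in> borel_measurable N" using up[OF f] .
      have "(LINT x|\<mu> k. f x) = (LINT x|density N (\<lambda>x. ennreal (max 0 (k x))). f x)"
        unfolding \<mu>_def using id f by (intro integral_distr) (auto simp: measurable_def)
      also have "\<dots> = (LINT x|N. max 0 (k x) * f x)"
        using fN by (subst integral_density) auto
      finally show ?thesis .
    qed
  qed
  have h': "integrable N (\<lambda>x. - h x)" using h by simp
  have split: "max 0 (h x) * y - max 0 (- h x) * y = h x * y" for x y
    by (auto simp: max_def)
  have eqf: "(LINT x|\<mu> h. f x) - (LINT x|\<mu> (\<lambda>x. - h x). f x) = (LINT x|N. h x * f x)"
    if f: "f \<in> borel_measurable M" "\<And>x. x \<in> space M \<Longrightarrow> \<bar>f x\<bar> \<le> B" for f B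
  proof -
    have fN: "f \<in> borel_measurable N" using up[OF f(1)] .
    note sp = sub(1)
    have "integrable N (\<lambda>x. max 0 (k x) * f x)" if k: "integrable N k" for k
    proof (rule Bochner_Integration.integrable_bound[of _ "\<lambda>x. B * \<bar>k x\<bar>"])
      show "integrable N (\<lambda>x. B * \<bar>k x\<bar>)" using k by auto
      show "(\<lambda>x. max 0 (k x) * f x) \<in> borel_measurable N" using k fN by measurable
      show "AE x in N. norm (max 0 (k x) * f x) \<le> norm (B * \<bar>k x\<bar>)"
      proof (intro AE_I2)
        fix x assume "x \<in> space N"
        then have "\<bar>max 0 (k x)\<bar> * \<bar>f x\<bar> \<le> \<bar>k x\<bar> * B" using f(2) sp by (intro mult_mono) auto
        then show "norm (max 0 (k x) * f x) \<le> norm (B * \<bar>k x\<bar>)"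
          by (metis abs_ge_self abs_mult mult.commute order_trans real_norm_def)
      qed
    qed
    from this[OF h] this[OF h'] show ?thesis
      unfolding int[OF h f(1)] int[OF h' f(1)]
      by (subst Bochner_Integration.integral_diff[symmetric]) (auto simp: split)
  qed
  have eq: "\<nu> A = measure (\<mu> h) A - measure (\<mu> (\<lambda>x. - h x)) A" if A: "A \<in> sets M" for A
  proof -
    have A': "A \<inter> space (\<mu> k) = A" for k
      using sets.sets_into_space[OF A] sets_eq_imp_space_eq[of "\<mu> k" M] by (auto simp: \<mu>_def)
    have "(LINT x|\<mu> h. indicator A x) - (LINT x|\<mu> (\<lambda>x. - h x). indicator A x) = (LINT x|N. h x *
      indicator A x)"
      using A by (intro eqf[of _ 1]) (auto simp: indicator_def)
    then show ?thesis by (simp add: A' \<nu>_def mult.commute)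
  qed
  show "signed_measure M \<nu>"
    by (rule signed_measure_diff[OF fin[OF h] fin[OF h'] s[OF h] s[OF h'] eq])
  show "signed_integral M \<nu> f = (LINT x|N. h x * f x)"
    if "f \<in> borel_measurable M" "\<And>x. x \<in> space M \<Longrightarrow> \<bar>f x\<bar> \<le> B" for f B
    using signed_integral_diff_measure[OF fin[OF h] fin[OF h'] s[OF h] s[OF h'] eq that] eqf[OF that] by simp
qed

section \<open>Integration by parts\<close>

lemma distr_lebesgue_translate:
  fixes t :: "'a::euclidean_space"
  shows "distr lebesgue lebesgue (\<lambda>x. x + t) = lebesgue" and "(\<lambda>x. x + t) \<in> lebesgue \<rightarrow>\<^sub>M lebesgue"
proof -
  have T: "(\<lambda>x. t + (\<Sum>j\<in>Basis. (1 * (x \<bullet> j)) *\<^sub>R j)) = (\<lambda>x. x + t)"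
    by (simp add: euclidean_representation add.commute)
  have "lebesgue = density (distr lebesgue lebesgue (\<lambda>x. x + t)) (\<lambda>_. 1)"
    using lebesgue_affine_euclidean[of "\<lambda>_. 1" t] unfolding T by simp
  then show "distr lebesgue lebesgue (\<lambda>x. x + t) = lebesgue" by (simp add: density_1)
  show "(\<lambda>x. x + t) \<in> lebesgue \<rightarrow>\<^sub>M lebesgue"
    using lebesgue_affine_measurable[of "\<lambda>_. 1" t] unfolding T by simp
qed

lemma integral_translate:
  fixes f :: "'a::euclidean_space \<Rightarrow> real"
  assumes f: "integrable lebesgue f"
  shows "integrable lebesgue (\<lambda>x. f (x + t))" "(LINT x|lebesgue. f (x + t)) = (LINT x|lebesgue. f x)"
proof -
  note d = distr_lebesgue_translate[of t]
  show "integrable lebesgue (\<lambda>x. f (x + t))"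
    by (rule integrable_distr[OF d(2)]) (simp add: d(1) f)
  show "(LINT x|lebesgue. f (x + t)) = (LINT x|lebesgue. f x)"
    using integral_distr[OF d(2), of f] f by (simp add: d(1))
qed

lemma integrable_continuous_compact_support:
  fixes f :: "'a::euclidean_space \<Rightarrow> real"
  assumes "compact K" "continuous_on K f" "\<And>x. x \<notin> K \<Longrightarrow> f x = 0"
  shows "integrable lebesgue f"
proof -
  have "(\<lambda>x. indicator K x *\<^sub>R f x) = f" using assms(3) by (auto simp: indicator_def fun_eq_iff)
  then have "integrable lborel f" using borel_integrable_compact[OF assms(1,2)] by simp
  then show ?thesis by (subst integrable_completion) auto
qed

lemma integral_lebesgue_on:
  fixes f :: "'a::euclidean_space \<Rightarrow> real"
  assumes "open \<Omega>"
  shows "(LINT x|lebesgue_on \<Omega>. f x) = (LINT x|lebesgue. indicator \<Omega> x * f x)"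
    and "integrable (lebesgue_on \<Omega>) f \<longleftrightarrow> integrable lebesgue (\<lambda>x. indicator \<Omega> x * f x)"
  using assms by (simp_all add: integral_restrict_space integrable_restrict_space)

lemma has_real_derivative_along:
  assumes "\<phi> differentiable (at (x + s *\<^sub>R h))"
  shows "((\<lambda>s. \<phi> (x + s *\<^sub>R h)) has_real_derivative (\<Sum>i\<in>UNIV. h $ i * partial i \<phi> (x + s *\<^sub>R h))) (at s)"
proof -
  have "((\<lambda>s. x + s *\<^sub>R h) has_derivative (\<lambda>t. t *\<^sub>R h)) (at s)" by (auto intro!: derivative_eq_intros)
  from has_derivative_compose[OF this has_derivative_partial[OF assms]]
  have "((\<lambda>s. \<phi> (x + s *\<^sub>R h)) has_derivative (\<lambda>t. \<Sum>i\<in>UNIV. (t *\<^sub>R h) $ i * partial i \<phi> (x + s *\<^sub>R h)))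
    (at s)" .
  moreover have "(\<lambda>t. \<Sum>i\<in>UNIV. (t *\<^sub>R h) $ i * partial i \<phi> (x + s *\<^sub>R h)) =
      (*) (\<Sum>i\<in>UNIV. h $ i * partial i \<phi> (x + s *\<^sub>R h))"
    by (auto simp: fun_eq_iff sum_distrib_left sum_distrib_right mult_ac)
  ultimately show ?thesis unfolding has_field_derivative_def by simp
qed

lemma sum_axis_mult: "(\<Sum>j\<in>UNIV. axis i 1 $ j * g j) = (g i :: real)"
  by (simp add: axis_def if_distrib[where f="\<lambda>x. x * _"] cong: if_cong)

text \<open>The difference quotients of \<open>\<psi>\<close> have vanishing integral by translation invariance, and they
  converge to the partial derivative boundedly.\<close>

lemma integral_partial_eq_zero:
  fixes \<psi> :: "real ^ 'm \<Rightarrow> real"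
  assumes d: "\<And>x. \<psi> differentiable (at x)" and c: "continuous_on UNIV (partial i \<psi>)"
    and K: "compact K" "\<And>x. x \<notin> K \<Longrightarrow> \<psi> x = 0"
  shows "(LINT x|lebesgue. partial i \<psi> x) = 0"
proof -
  let ?e = "axis i 1 :: real ^ 'm"
  have p0: "partial i \<psi> x = 0" if "x \<notin> K" for x
    using K that by (intro partial_eq_zero_on_open[of "- K"]) (auto simp: open_Compl compact_imp_closed)
  have "bounded (partial i \<psi> ` K)"
    using K(1) c by (intro compact_imp_bounded compact_continuous_image) (auto intro: continuous_on_subset)
  then obtain B where B: "B > 0" "\<And>x. x \<in> K \<Longrightarrow> \<bar>partial i \<psi> x\<bar> \<le> B"
    unfolding bounded_pos by (metis imageI real_norm_def)
  have B': "\<bar>partial i \<psi> x\<bar> \<le> B" for x using B p0[of x] by (cases "x \<in> K") auto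
  obtain R where R: "R > 0" "\<And>x. x \<in> K \<Longrightarrow> norm x \<le> R"
    using compact_imp_bounded[OF K(1)] by (meson bounded_pos)
  define t where "t n = inverse (real (Suc n))" for n
  have t: "0 < t n" "t n \<le> 1" for n by (auto simp: t_def field_simps)
  define D where "D n x = (\<psi> (x + t n *\<^sub>R ?e) - \<psi> x) / t n" for n x
  have der: "((\<lambda>s. \<psi> (x + s *\<^sub>R ?e)) has_real_derivative partial i \<psi> (x + s *\<^sub>R ?e)) (at s)" for x s
    using has_real_derivative_along[OF d, where x = x and s = s and h = ?e] by (simp add: sum_axis_mult)
  have lim: "(\<lambda>n. D n x) \<longlonglongrightarrow> partial i \<psi> x" for x
  proof -
    have "((\<lambda>h. (\<psi> (x + h *\<^sub>R ?e) - \<psi> x) / h) \<longlongrightarrow> partial i \<psi> x) (at 0)"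
      using der[of x 0] by (simp add: DERIV_def)
    moreover have "filterlim t (at 0) sequentially"
      unfolding filterlim_at using LIMSEQ_inverse_real_of_nat t(1)
      by (auto simp: t_def[abs_def])
    ultimately show ?thesis unfolding D_def by (rule filterlim_compose)
  qed
  \<comment> \<open>By the mean value theorem \<open>D n x\<close> is a value of the partial
    derivative, hence bounded by \<open>B\<close>; steps of length at most 1 keep the support within
    the ball of radius \<open>R + 1\<close>.\<close>
  have bd: "\<bar>D n x\<bar> \<le> B * indicator (cball 0 (R + 1)) x" for n x
  proof (cases "x \<in> cball 0 (R + 1)")
    case True
    have "\<exists>z>0. z < t n \<and> \<psi> (x + t n *\<^sub>R ?e) - \<psi> (x + 0 *\<^sub>R ?e) = (t n - 0) * partial i \<psi> (x + z *\<^sub>R ?e)"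
      by (rule MVT2[OF t(1)]) (rule der)
    then obtain z where "\<psi> (x + t n *\<^sub>R ?e) - \<psi> x = t n * partial i \<psi> (x + z *\<^sub>R ?e)" by auto
    then have "D n x = partial i \<psi> (x + z *\<^sub>R ?e)" using t(1)[of n] by (simp add: D_def)
    then show ?thesis using True B'[of "x + z *\<^sub>R ?e"] by simp
  next
    case False
    then have "x \<notin> K" using R(2)[of x] by auto
    moreover have "x + t n *\<^sub>R ?e \<notin> K"
    proof
      assume "x + t n *\<^sub>R ?e \<in> K"
      then have "norm (x + t n *\<^sub>R ?e) \<le> R" by (rule R(2))
      moreover have "norm x \<le> norm (x + t n *\<^sub>R ?e) + norm (t n *\<^sub>R ?e)"
        using norm_triangle_ineq4[of "x + t n *\<^sub>R ?e" "t n *\<^sub>R ?e"] by simp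
      moreover have "norm (t n *\<^sub>R ?e) \<le> 1" using t[of n] by simp
      ultimately show False using False by auto
    qed
    ultimately show ?thesis using False K(2) by (simp add: D_def)
  qed
  have c\<psi>: "continuous_on UNIV \<psi>"
    using d by (auto intro!: continuous_at_imp_continuous_on differentiable_imp_continuous_within)
  have i\<psi>: "integrable lebesgue \<psi>"
    using K c\<psi> by (intro integrable_continuous_compact_support[of K]) (auto intro: continuous_on_subset)
  have iD: "(LINT x|lebesgue. D n x) = 0" for n
    unfolding D_def using integral_translate[OF i\<psi>, of "t n *\<^sub>R ?e"] i\<psi> by simp
  have "integrable lebesgue (\<lambda>x :: real ^ 'm. B * indicator (cball 0 (R + 1)) x :: real)"
    using lmeasurable_cball[of "0 :: real ^ 'm" "R + 1"]
      by (intro integrable_mult_right) (simp add: lmeasurable_iff_integrable)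
  then have "(\<lambda>n. LINT x|lebesgue. D n x) \<longlonglongrightarrow> (LINT x|lebesgue. partial i \<psi> x)"
  proof (rule integral_dominated_convergence[rotated 2])
    show "partial i \<psi> \<in> borel_measurable lebesgue"
      using continuous_imp_measurable_on_sets_lebesgue[OF c] by simp
    show "D n \<in> borel_measurable lebesgue" for n
      unfolding D_def using integral_translate[OF i\<psi>, of "t n *\<^sub>R ?e"] i\<psi> by simp
  qed (use lim bd in auto)
  then show ?thesis unfolding iD by (simp add: LIMSEQ_const_iff)
qed

lemma test_function_bounded:
  assumes "test_function \<Omega> \<phi>"
  obtains B where "B > 0" "\<And>x. \<bar>\<phi> x\<bar> \<le> B" "\<And>i x. \<bar>partial i \<phi> x\<bar> \<le> B"
proof -
  from assms obtain K where K: "compact K" "\<And>x. x \<notin> K \<Longrightarrow> \<phi> x = 0" "\<And>i x. x \<notin> K \<Longrightarrow> partial i \<phi> x = 0"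
    by (rule test_functionE) blast
  have 1: "\<exists>B>0. \<forall>x. \<bar>g x\<bar> \<le> B" if g: "continuous_on UNIV g" "\<And>x. x \<notin> K \<Longrightarrow> g x = 0" for g :: "_ \<Rightarrow> real"
  proof -
    have "bounded (g ` K)"
      using K(1) g(1) by (intro compact_imp_bounded compact_continuous_image) (auto intro:
        continuous_on_subset)
    then obtain B where "B > 0" "\<And>x. x \<in> K \<Longrightarrow> \<bar>g x\<bar> \<le> B"
      unfolding bounded_pos by (metis imageI real_norm_def)
    then have "\<bar>g x\<bar> \<le> B" for x using g(2)[of x] by (cases "x \<in> K") auto
    then show ?thesis using \<open>B > 0\<close> by blast
  qed
  obtain C where C: "C > 0" "\<And>x. \<bar>\<phi> x\<bar> \<le> C" using 1[OF test_function_continuous[OF assms] K(2)] by blast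
  have "\<forall>i. \<exists>B>0. \<forall>x. \<bar>partial i \<phi> x\<bar> \<le> B"
    by (intro allI 1 test_function_partial_continuous[OF assms] K(3))
  then obtain b where b: "\<And>i. b i > 0" "\<And>i x. \<bar>partial i \<phi> x\<bar> \<le> b i" by metis
  have b0: "b i \<ge> 0" for i using b(1)[of i] by simp
  have ble: "b i \<le> (\<Sum>i\<in>UNIV. b i)" for i using b0 by (intro member_le_sum) auto
  have s0: "(\<Sum>i\<in>UNIV. b i) \<ge> 0" using b0 by (intro sum_nonneg)
  show ?thesis
  proof
    show "C + (\<Sum>i\<in>UNIV. b i) > 0" using C(1) s0 by linarith
    show "\<bar>\<phi> x\<bar> \<le> C + (\<Sum>i\<in>UNIV. b i)" for x using C(2)[of x] s0 by linarith
    show "\<bar>partial i \<phi> x\<bar> \<le> C + (\<Sum>i\<in>UNIV. b i)" for i x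
      using b(2)[of i x] ble[of i] C(1) by linarith
  qed
qed

lemma integral_test_partial_eq_zero:
  assumes "test_function \<Omega> \<phi>" "open \<Omega>"
  shows "(LINT x|lebesgue_on \<Omega>. partial i \<phi> x) = 0"
proof -
  from assms(1) obtain K where K: "compact K" "K \<subseteq> \<Omega>" "\<And>x. x \<notin> K \<Longrightarrow> \<phi> x = 0"
    "\<And>x. x \<notin> K \<Longrightarrow> partial i \<phi> x = 0" by (rule test_functionE) blast
  have "(\<lambda>x. indicator \<Omega> x * partial i \<phi> x) = partial i \<phi>"
    using K by (auto simp: indicator_def fun_eq_iff)
  then show ?thesis
    unfolding integral_lebesgue_on[OF assms(2)]
    using integral_partial_eq_zero[OF test_function_differentiable[OF assms(1)]
        test_function_partial_continuous[OF assms(1)] K(1,3)] by simp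
qed

lemma integrable_mult_bounded:
  fixes f g :: "'a \<Rightarrow> real"
  assumes "integrable M f" "g \<in> borel_measurable M" "\<And>x. x \<in> space M \<Longrightarrow> \<bar>g x\<bar> \<le> B"
  shows "integrable M (\<lambda>x. f x * g x)"
    and "\<bar>LINT x|M. f x * g x\<bar> \<le> B * (LINT x|M. \<bar>f x\<bar>)"
proof -
  have b: "\<bar>f x * g x\<bar> \<le> B * \<bar>f x\<bar>" if "x \<in> space M" for x
    using mult_left_mono[OF assms(3)[OF that] abs_ge_zero[of "f x"]] by (simp add: abs_mult mult.commute)
  show i: "integrable M (\<lambda>x. f x * g x)"
  proof (rule Bochner_Integration.integrable_bound[of _ "\<lambda>x. B * \<bar>f x\<bar>"])
    show "AE x in M. norm (f x * g x) \<le> norm (B * \<bar>f x\<bar>)"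
      using b by (intro AE_I2) (metis abs_ge_self order_trans real_norm_def)
  qed (use assms in auto)
  have "\<bar>LINT x|M. f x * g x\<bar> \<le> (LINT x|M. \<bar>f x * g x\<bar>)" by (rule integral_abs_bound)
  also have "\<dots> \<le> (LINT x|M. B * \<bar>f x\<bar>)" using i assms(1) b by (intro integral_mono) auto
  finally show "\<bar>LINT x|M. f x * g x\<bar> \<le> B * (LINT x|M. \<bar>f x\<bar>)" by simp
qed

lemma measurable_continuous_lebesgue_on:
  fixes f :: "'a::euclidean_space \<Rightarrow> real"
  assumes "open \<Omega>" "continuous_on UNIV f"
  shows "f \<in> borel_measurable (lebesgue_on \<Omega>)"
  by (rule continuous_imp_measurable_on_sets_lebesgue[OF continuous_on_subset[OF assms(2) subset_UNIV]])
     (rule sets_completionI_sets, simp add: assms(1))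

lemma integrable_times_test:
  fixes u :: "real ^ 'm \<Rightarrow> real"
  assumes "open \<Omega>" "test_function \<Omega>' \<phi>" "integrable (lebesgue_on \<Omega>) u"
  shows "integrable (lebesgue_on \<Omega>) (\<lambda>x. u x * \<phi> x)" "integrable (lebesgue_on \<Omega>) (\<lambda>x. u x * partial i \<phi> x)"
proof -
  obtain B where "B > 0" "\<And>x. \<bar>\<phi> x\<bar> \<le> B" "\<And>i x. \<bar>partial i \<phi> x\<bar> \<le> B"
    by (rule test_function_bounded[OF assms(2)]) (rule that)
  note B = this
  show "integrable (lebesgue_on \<Omega>) (\<lambda>x. u x * \<phi> x)"
    by (rule integrable_mult_bounded(1)[OF assms(3) measurable_continuous_lebesgue_on[OF assms(1)
          test_function_continuous[OF assms(2)]] B(2)])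
  show "integrable (lebesgue_on \<Omega>) (\<lambda>x. u x * partial i \<phi> x)"
    by (rule integrable_mult_bounded(1)[OF assms(3) measurable_continuous_lebesgue_on[OF assms(1)
          test_function_partial_continuous[OF assms(2)]] B(3)])
qed

text \<open>Outside \<open>\<Omega>\<close> nothing is known about \<open>u\<close>, but its product
  with \<open>\<phi>\<close> is zero off the compact set \<open>K\<close> and thus continuously
  differentiable on the whole space; the integral of its partial derivative vanishes by
  \<open>integral_partial_eq_zero\<close>.\<close>

lemma integration_by_parts_test:
  fixes u :: "real ^ 'm \<Rightarrow> real"
  assumes \<Omega>: "open \<Omega>" and u: "u differentiable_on \<Omega>" "continuous_on \<Omega> (partial i u)"
    and \<phi>: "test_function \<Omega> \<phi>"
  shows "(LINT x|lebesgue_on \<Omega>. u x * partial i \<phi> x) = - (LINT x|lebesgue_on \<Omega>. partial i u x * \<phi> x)"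
proof -
  from \<phi> obtain K where K: "compact K" "K \<subseteq> \<Omega>" "\<And>x. x \<notin> K \<Longrightarrow> \<phi> x = 0"
    "\<And>x. x \<notin> K \<Longrightarrow> partial i \<phi> x = 0" by (rule test_functionE) blast
  have cl: "open (- K)" using K(1) by (simp add: compact_imp_closed open_Compl)
  have un: "\<Omega> \<union> - K = UNIV" using K(2) by auto
  have du: "u differentiable (at x)" if "x \<in> \<Omega>" for x
    using u(1) \<Omega> that by (simp add: differentiable_on_eq_differentiable_at)
  have d\<phi>: "\<phi> differentiable (at x)" for x by (rule test_function_differentiable[OF \<phi>])
  let ?\<psi> = "\<lambda>x. u x * \<phi> x"
  let ?g = "\<lambda>x. u x * partial i \<phi> x + partial i u x * \<phi> x"
  have d0: "(?\<psi> has_derivative (\<lambda>_. 0)) (at x)" if "x \<notin> K" for x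
    by (rule has_derivative_transform_within_open[of "\<lambda>_. 0" _ _ _ "- K"]) (use cl that K in auto)
  have d: "?\<psi> differentiable (at x)" for x
    using du[of x] d\<phi>[of x] d0[of x] K(2) by (cases "x \<in> K") (auto intro: differentiable_mult differentiableI)
  have p: "partial i ?\<psi> x = ?g x" for x
  proof (cases "x \<in> K")
    case True then show ?thesis using du d\<phi> K(2) by (subst partial_mult) auto
  next
    case False then show ?thesis using K partial_eq[OF d0[OF False], of i] by simp
  qed
  have cu: "continuous_on \<Omega> u" using u(1) by (rule differentiable_imp_continuous_on)
  have "continuous_on \<Omega> (partial i ?\<psi>)"
    unfolding p[abs_def]
    by (intro continuous_on_add continuous_on_mult cu u(2) continuous_on_subset[OF
      test_function_continuous[OF \<phi>]]
        continuous_on_subset[OF test_function_partial_continuous[OF \<phi>]] subset_UNIV)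
  moreover have "continuous_on (- K) (partial i ?\<psi>)"
    using p K by (subst continuous_on_cong[of _ "- K" _ "\<lambda>_. 0"]) auto
  ultimately have "continuous_on (\<Omega> \<union> - K) (partial i ?\<psi>)" using \<Omega> cl by (intro continuous_on_open_Un) auto
  then have c: "continuous_on UNIV (partial i ?\<psi>)" unfolding un .
  have "(LINT x|lebesgue. partial i ?\<psi> x) = 0"
    by (rule integral_partial_eq_zero[OF d c K(1)]) (use K in auto)
  moreover have "(\<lambda>x. indicator \<Omega> x * ?g x) = partial i ?\<psi>"
  proof
    show "indicator \<Omega> x * ?g x = partial i ?\<psi> x" for x
      unfolding p using K(2) K(3)[of x] K(4)[of x] by (cases "x \<in> K") (auto simp: indicator_def)
  qed
  ultimately have "(LINT x|lebesgue_on \<Omega>. ?g x) = 0"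
    unfolding integral_lebesgue_on[OF \<Omega>] by simp
  moreover have int: "integrable (lebesgue_on \<Omega>) (\<lambda>x. f x * g x)"
    if "continuous_on \<Omega> f" "continuous_on UNIV g" "\<And>x. x \<notin> K \<Longrightarrow> g x = 0" for f g :: "real ^ 'm \<Rightarrow> real"
  proof -
    have "integrable lebesgue (\<lambda>x. f x * g x)"
      by (intro integrable_continuous_compact_support[OF K(1)] continuous_on_mult
          continuous_on_subset[OF that(1) K(2)] continuous_on_subset[OF that(2) subset_UNIV]) (simp add:
            that(3))
    moreover have "(\<lambda>x. indicator \<Omega> x * (f x * g x)) = (\<lambda>x. f x * g x)"
      using that(3) K(2) by (auto simp: indicator_def fun_eq_iff)
    ultimately show ?thesis unfolding integral_lebesgue_on[OF \<Omega>] by simp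
  qed
  ultimately show ?thesis
    using int[OF cu test_function_partial_continuous[OF \<phi>] K(4)] int[OF u(2) test_function_continuous[OF
      \<phi>] K(3)]
    by simp
qed

section \<open>Functions of bounded variation\<close>

lemma measurable_restrict_borel:
  fixes f :: "'a::topological_space \<Rightarrow> real"
  shows "continuous_on \<Omega> f \<Longrightarrow> f \<in> borel_measurable (restrict_space borel \<Omega>)"
  by (rule borel_measurable_continuous_on_restrict)

lemma measurable_test_function:
  "test_function \<Omega>' \<phi> \<Longrightarrow> \<phi> \<in> borel_measurable (restrict_space borel \<Omega>)"
  by (rule measurable_restrict_borel[OF continuous_on_subset[OF test_function_continuous subset_UNIV]])

lemma weak_partial_spec: "u \<in> BV \<Omega> \<Longrightarrow> is_weak_partial \<Omega> i u (weak_partial \<Omega> i u)"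
  unfolding weak_partial_def by (rule someI_ex[of "is_weak_partial \<Omega> i u"]) (simp add: BV_def)

lemma BV_integrable: "u \<in> BV \<Omega> \<Longrightarrow> integrable (lebesgue_on \<Omega>) u"
  by (simp add: BV_def L1_def)

lemma BV_I:
  "integrable (lebesgue_on \<Omega>) u \<Longrightarrow> (\<And>i. is_weak_partial \<Omega> i u (\<nu> i)) \<Longrightarrow> u \<in> BV \<Omega>"
  by (auto simp: BV_def L1_def)

lemma is_weak_partial_add:
  fixes u w :: "real ^ 'm \<Rightarrow> real"
  assumes \<Omega>: "open \<Omega>" and u: "integrable (lebesgue_on \<Omega>) u" "is_weak_partial \<Omega> i u \<nu>"
    and w: "integrable (lebesgue_on \<Omega>) w" "is_weak_partial \<Omega> i w \<mu>"
  shows "is_weak_partial \<Omega> i (\<lambda>x. u x + w x) (\<lambda>A. \<nu> A + \<mu> A)"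
  unfolding is_weak_partial_def
proof (intro conjI allI impI)
  have s: "signed_measure (restrict_space borel \<Omega>) \<nu>" "signed_measure (restrict_space borel \<Omega>) \<mu>"
    using u(2) w(2) by (auto simp: is_weak_partial_def)
  then show "signed_measure (restrict_space borel \<Omega>) (\<lambda>A. \<nu> A + \<mu> A)" by (rule signed_measure_add)
  fix \<phi> assume \<phi>: "test_function \<Omega> \<phi>"
  obtain B where "B > 0" and B: "\<And>x. \<bar>\<phi> x\<bar> \<le> B" "\<And>i x. \<bar>partial i \<phi> x\<bar> \<le> B"
    by (rule test_function_bounded[OF \<phi>]) (rule that)
  have "signed_integral (restrict_space borel \<Omega>) (\<lambda>A. \<nu> A + \<mu> A) \<phi> =
      signed_integral (restrict_space borel \<Omega>) \<nu> \<phi> + signed_integral (restrict_space borel \<Omega>) \<mu> \<phi>"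
    by (rule signed_integral_add_measure[OF s measurable_test_function[OF \<phi>] B(1)])
  moreover have "(LINT x|lebesgue_on \<Omega>. (u x + w x) * partial i \<phi> x) =
      (LINT x|lebesgue_on \<Omega>. u x * partial i \<phi> x) + (LINT x|lebesgue_on \<Omega>. w x * partial i \<phi> x)"
    unfolding distrib_right
    by (rule Bochner_Integration.integral_add[OF integrable_times_test(2)[OF \<Omega> \<phi> u(1)]
      integrable_times_test(2)[OF \<Omega> \<phi> w(1)]])
  moreover have "(LINT x|lebesgue_on \<Omega>. u x * partial i \<phi> x) = - signed_integral (restrict_space borel \<Omega>) \<nu> \<phi>"
    "(LINT x|lebesgue_on \<Omega>. w x * partial i \<phi> x) = - signed_integral (restrict_space borel \<Omega>) \<mu> \<phi>"
    using u(2) w(2) \<phi> by (auto simp: is_weak_partial_def)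
  ultimately show "(LINT x|lebesgue_on \<Omega>. (u x + w x) * partial i \<phi> x) =
      - signed_integral (restrict_space borel \<Omega>) (\<lambda>A. \<nu> A + \<mu> A) \<phi>" by simp
qed

lemma is_weak_partial_cmult:
  fixes u :: "real ^ 'm \<Rightarrow> real"
  assumes u: "is_weak_partial \<Omega> i u \<nu>"
  shows "is_weak_partial \<Omega> i (\<lambda>x. a * u x) (\<lambda>A. a * \<nu> A)"
  unfolding is_weak_partial_def
proof (intro conjI allI impI)
  have s: "signed_measure (restrict_space borel \<Omega>) \<nu>" using u by (auto simp: is_weak_partial_def)
  then show "signed_measure (restrict_space borel \<Omega>) (\<lambda>A. a * \<nu> A)" by (rule signed_measure_cmult)
  fix \<phi> assume \<phi>: "test_function \<Omega> \<phi>"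
  obtain B where "B > 0" and B: "\<And>x. \<bar>\<phi> x\<bar> \<le> B" "\<And>i x. \<bar>partial i \<phi> x\<bar> \<le> B"
    by (rule test_function_bounded[OF \<phi>]) (rule that)
  have "signed_integral (restrict_space borel \<Omega>) (\<lambda>A. a * \<nu> A) \<phi> = a * signed_integral (restrict_space
    borel \<Omega>) \<nu> \<phi>"
    by (rule signed_integral_cmult_measure[OF s measurable_test_function[OF \<phi>] B(1)])
  moreover have "(LINT x|lebesgue_on \<Omega>. u x * partial i \<phi> x) = - signed_integral (restrict_space borel \<Omega>) \<nu> \<phi>"
    using u \<phi> by (auto simp: is_weak_partial_def)
  ultimately show "(LINT x|lebesgue_on \<Omega>. a * u x * partial i \<phi> x) =
      - signed_integral (restrict_space borel \<Omega>) (\<lambda>A. a * \<nu> A) \<phi>" by (simp add: mult.assoc)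
qed

lemma BV_add:
  assumes "open \<Omega>" "u \<in> BV \<Omega>" "w \<in> BV \<Omega>" shows "(\<lambda>x. u x + w x) \<in> BV \<Omega>"
  by (rule BV_I[OF Bochner_Integration.integrable_add is_weak_partial_add[OF assms(1)]])
     (rule BV_integrable weak_partial_spec assms)+

lemma BV_cmult:
  assumes "u \<in> BV \<Omega>" shows "(\<lambda>x. a * u x) \<in> BV \<Omega>"
  by (rule BV_I[OF _ is_weak_partial_cmult[OF weak_partial_spec[OF assms]]])
     (simp add: BV_integrable[OF assms])

lemma BV_diff:
  assumes "open \<Omega>" "u \<in> BV \<Omega>" "w \<in> BV \<Omega>" shows "(\<lambda>x. u x - w x) \<in> BV \<Omega>"
  using BV_add[OF assms(1,2) BV_cmult[OF assms(3), of "- 1"]] by simp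

section \<open>Test fields and their divergence\<close>

lemma test_fieldD: "test_field \<Omega> v \<Longrightarrow> test_function \<Omega> (\<lambda>x. v x $ i)"
  by (simp add: test_field_def)

lemma test_field_add: "test_field \<Omega> v \<Longrightarrow> test_field \<Omega> w \<Longrightarrow> test_field \<Omega> (\<lambda>x. v x + w x)"
  by (simp add: test_field_def test_function_add)

lemma test_field_scaleR: "test_field \<Omega> v \<Longrightarrow> test_field \<Omega> (\<lambda>x. a *\<^sub>R v x)"
  by (simp add: test_field_def test_function_cmult)

lemma test_field_zero: "test_field \<Omega> (\<lambda>x. 0)"
  by (simp add: test_field_def test_function_zero)

lemma test_field_sum: "(\<And>j. j \<in> J \<Longrightarrow> test_field \<Omega> (v j)) \<Longrightarrow> test_field \<Omega> (\<lambda>x. \<Sum>j\<in>J. v j x)"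
  by (induction J rule: infinite_finite_induct) (auto intro: test_field_zero test_field_add)

lemma test_field_continuous: "test_field \<Omega> v \<Longrightarrow> continuous_on UNIV v"
  by (subst continuous_on_componentwise)
     (auto simp: Basis_vec_def inner_axis intro: test_function_continuous[OF test_fieldD])

lemma test_field_outside:
  assumes "test_field \<Omega> v" "x \<notin> \<Omega>" shows "v x = 0"
proof -
  have "v x $ i = 0" for i
    by (rule test_functionE[OF test_fieldD[OF assms(1), of i]]) (use assms(2) in blast)
  then show ?thesis by (simp add: vec_eq_iff)
qed

lemma divergence_add:
  assumes "test_field \<Omega> v" "test_field \<Omega> w"
  shows "divergence (\<lambda>x. v x + w x) x = divergence v x + divergence w x"
  unfolding divergence_def sum.distrib[symmetric] vector_add_component
  by (intro sum.cong refl partial_add test_function_differentiable[OF test_fieldD[OF assms(1)]]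
      test_function_differentiable[OF test_fieldD[OF assms(2)]])

lemma divergence_scaleR:
  assumes "test_field \<Omega> v"
  shows "divergence (\<lambda>x. a *\<^sub>R v x) x = a * divergence v x"
  unfolding divergence_def sum_distrib_left vector_scaleR_component real_scaleR_def
  by (intro sum.cong refl partial_cmult test_function_differentiable[OF test_fieldD[OF assms(1)]])

lemma divergence_zero [simp]: "divergence (\<lambda>x. 0) x = 0"
  by (simp add: divergence_def)

lemma divergence_sum:
  assumes "\<And>j. j \<in> J \<Longrightarrow> test_field \<Omega> (v j)"
  shows "divergence (\<lambda>x. \<Sum>j\<in>J. v j x) x = (\<Sum>j\<in>J. divergence (v j) x)"
  using assms
proof (induction J rule: infinite_finite_induct)
  case (insert j F)
  then have "divergence (\<lambda>x. v j x + (\<Sum>j\<in>F. v j x)) x = divergence (v j) x + divergence (\<lambda>x. \<Sum>j\<in>F. v j x) x"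
    by (intro divergence_add[of \<Omega>] test_field_sum) auto
  with insert show ?case by simp
qed auto

lemma divergence_continuous: "test_field \<Omega> v \<Longrightarrow> continuous_on UNIV (divergence v)"
  unfolding divergence_def[abs_def]
  by (intro continuous_on_sum test_function_partial_continuous[OF test_fieldD])

lemma divergence_bounded:
  assumes "test_field \<Omega> v"
  obtains B where "B > 0" "\<And>x. \<bar>divergence v x\<bar> \<le> B"
proof -
  have "\<exists>b. b > 0 \<and> (\<forall>x. \<bar>partial i (\<lambda>y. v y $ i) x\<bar> \<le> b)" for i
    by (rule test_function_bounded[OF test_fieldD[OF assms, of i]]) metis
  then obtain b where b: "\<And>i. b i > 0" "\<And>i x. \<bar>partial i (\<lambda>y. v y $ i) x\<bar> \<le> b i" by metis
  show ?thesis
  proof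
    show "(\<Sum>i\<in>UNIV. b i) > 0" using b(1) by (intro sum_pos) auto
    show "\<bar>divergence v x\<bar> \<le> (\<Sum>i\<in>UNIV. b i)" for x
      unfolding divergence_def by (rule order_trans[OF sum_abs sum_mono]) (rule b(2))
  qed
qed

lemma integral_times_divergence:
  fixes u :: "real ^ 'm \<Rightarrow> real"
  assumes "open \<Omega>" "integrable (lebesgue_on \<Omega>) u" "test_field \<Omega>' v"
  shows "integrable (lebesgue_on \<Omega>) (\<lambda>x. u x * divergence v x)"
    and "(LINT x|lebesgue_on \<Omega>. u x * divergence v x) =
      (\<Sum>i\<in>UNIV. LINT x|lebesgue_on \<Omega>. u x * partial i (\<lambda>y. v y $ i) x)"
proof -
  note i = integrable_times_test(2)[OF assms(1) test_fieldD[OF assms(3)] assms(2)]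
  show "integrable (lebesgue_on \<Omega>) (\<lambda>x. u x * divergence v x)"
    unfolding divergence_def sum_distrib_left by (intro Bochner_Integration.integrable_sum i)
  show "(LINT x|lebesgue_on \<Omega>. u x * divergence v x) =
      (\<Sum>i\<in>UNIV. LINT x|lebesgue_on \<Omega>. u x * partial i (\<lambda>y. v y $ i) x)"
    unfolding divergence_def sum_distrib_left by (intro Bochner_Integration.integral_sum i)
qed

lemma integral_divergence_eq_zero:
  assumes "open \<Omega>" "test_field \<Omega> v"
  shows "integrable (lebesgue_on \<Omega>) (divergence v)" "(LINT x|lebesgue_on \<Omega>. divergence v x) = 0"
proof -
  have i: "integrable (lebesgue_on \<Omega>) (partial i \<phi>)" if "test_function \<Omega> \<phi>" for i \<phi>
  proof -
    from that obtain K where K: "compact K" "K \<subseteq> \<Omega>" "\<And>x. x \<notin> K \<Longrightarrow> partial i \<phi> x = 0"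
      by (rule test_functionE) blast
    have "integrable lebesgue (\<lambda>x. indicator \<Omega> x * partial i \<phi> x)"
    proof (rule integrable_continuous_compact_support[OF K(1)])
      show "continuous_on K (\<lambda>x. indicator \<Omega> x * partial i \<phi> x)"
        using continuous_on_subset[OF test_function_partial_continuous[OF that, of i], of K] K(2)
        by (subst continuous_on_cong[OF refl, where g = "partial i \<phi>"]) (auto simp: indicator_def)
    qed (simp add: K(3))
    then show ?thesis unfolding integral_lebesgue_on[OF assms(1)] .
  qed
  show "integrable (lebesgue_on \<Omega>) (divergence v)"
    unfolding divergence_def[abs_def] by (intro Bochner_Integration.integrable_sum i test_fieldD assms)
  have "(LINT x|lebesgue_on \<Omega>. divergence v x) = (\<Sum>i\<in>UNIV. LINT x|lebesgue_on \<Omega>. partial i (\<lambda>y. v y $ i) x)"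
    unfolding divergence_def by (intro Bochner_Integration.integral_sum i test_fieldD assms)
  then show "(LINT x|lebesgue_on \<Omega>. divergence v x) = 0"
    by (simp add: integral_test_partial_eq_zero[OF test_fieldD[OF assms(2)] assms(1)])
qed

text \<open>The integral of \<open>v\<close> against the vector measure \<open>Du\<close>;
  \<open>div_op\<close> is its negative, read on classes.\<close>

definition pairing :: "(real ^ 'm) set \<Rightarrow> (real ^ 'm \<Rightarrow> real ^ 'm) \<Rightarrow> (real ^ 'm \<Rightarrow> real) \<Rightarrow> real" where
  "pairing \<Omega> v u =
    (\<Sum>i\<in>UNIV. signed_integral (restrict_space borel \<Omega>) (weak_partial \<Omega> i u) (\<lambda>x. v x $ i))"

text \<open>A crude substitute for the mass of \<open>Du\<close>, summed over components. It serves
  for continuity and for boundedness of suprema; the sharp constant \<open>total_variation\<close>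
  is recovered in \<open>abs_pairing_le\<close>.\<close>

definition gradient_mass :: "(real ^ 'm) set \<Rightarrow> (real ^ 'm \<Rightarrow> real) \<Rightarrow> real" where
  "gradient_mass \<Omega> u = (\<Sum>i\<in>UNIV. variation_mass (restrict_space borel \<Omega>) (weak_partial \<Omega> i u))"

lemma pairing_test:
  assumes "open \<Omega>" "u \<in> BV \<Omega>" "test_field \<Omega> v"
  shows "pairing \<Omega> v u = - (LINT x|lebesgue_on \<Omega>. u x * divergence v x)"
proof -
  have "signed_integral (restrict_space borel \<Omega>) (weak_partial \<Omega> i u) (\<lambda>x. v x $ i) =
      - (LINT x|lebesgue_on \<Omega>. u x * partial i (\<lambda>y. v y $ i) x)" for i
    using weak_partial_spec[OF assms(2), of i] test_fieldD[OF assms(3), of i]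
    unfolding is_weak_partial_def by (metis minus_minus)
  then show ?thesis unfolding pairing_def integral_times_divergence(2)[OF assms(1) BV_integrable[OF
    assms(2)] assms(3)]
    by (simp add: sum_negf)
qed

lemma signed_measure_weak_partial:
  "u \<in> BV \<Omega> \<Longrightarrow> signed_measure (restrict_space borel \<Omega>) (weak_partial \<Omega> i u)"
  using weak_partial_spec by (auto simp: is_weak_partial_def)

lemma pairing_diff_le:
  assumes u: "u \<in> BV \<Omega>" and v: "continuous_on \<Omega> v" "\<And>x. x \<in> \<Omega> \<Longrightarrow> norm (v x) \<le> B"
    and w: "continuous_on \<Omega> w" "\<And>x. x \<in> \<Omega> \<Longrightarrow> norm (w x) \<le> C"
    and e: "\<And>x. x \<in> \<Omega> \<Longrightarrow> norm (v x - w x) \<le> e"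
  shows "\<bar>pairing \<Omega> v u - pairing \<Omega> w u\<bar> \<le> e * gradient_mass \<Omega> u"
proof -
  let ?M = "restrict_space borel \<Omega>"
  have c: "(\<lambda>x. z x $ i) \<in> borel_measurable ?M" if "continuous_on \<Omega> z" for z :: "real ^ 'a \<Rightarrow> real ^ 'a" and i
    by (intro measurable_restrict_borel continuous_on_component that)
  have b: "x \<in> space ?M \<Longrightarrow> \<bar>v x $ i\<bar> \<le> B" "x \<in> space ?M \<Longrightarrow> \<bar>w x $ i\<bar> \<le> C"
    "x \<in> space ?M \<Longrightarrow> \<bar>v x $ i - w x $ i\<bar> \<le> e" for x i
    using component_le_norm_cart[of "v x" i] component_le_norm_cart[of "w x" i]
      component_le_norm_cart[of "v x - w x" i] v(2)[of x] w(2)[of x] e[of x]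
        by (auto simp: space_restrict_space)
  have 1: "\<bar>signed_integral ?M (weak_partial \<Omega> i u) (\<lambda>x. v x $ i) - signed_integral ?M (weak_partial \<Omega> i
    u) (\<lambda>x. w x $ i)\<bar>
      \<le> e * variation_mass ?M (weak_partial \<Omega> i u)" for i
  proof -
    note s = signed_measure_weak_partial[OF u, of i]
    have "signed_integral ?M (weak_partial \<Omega> i u) (\<lambda>x. v x $ i) - signed_integral ?M (weak_partial \<Omega> i
      u) (\<lambda>x. w x $ i) =
        signed_integral ?M (weak_partial \<Omega> i u) (\<lambda>x. v x $ i - w x $ i)"
      by (rule signed_integral_diff[OF s c[OF v(1)] b(1) c[OF w(1)] b(2), symmetric])
    also have "\<bar>\<dots>\<bar> \<le> e * variation_mass ?M (weak_partial \<Omega> i u)"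
      by (rule abs_signed_integral_le[OF s borel_measurable_diff[OF c[OF v(1)] c[OF w(1)]] b(3)])
    finally show ?thesis .
  qed
  show ?thesis unfolding pairing_def gradient_mass_def sum_subtractf[symmetric] sum_distrib_left
    by (rule order_trans[OF sum_abs sum_mono]) (rule 1)
qed

lemma C0_bounded:
  assumes "v \<in> C0 \<Omega>"
  obtains B where "B > 0" "\<And>x. x \<in> \<Omega> \<Longrightarrow> norm (v x) \<le> B"
proof -
  have "\<exists>K. compact K \<and> K \<subseteq> \<Omega> \<and> (\<forall>x\<in>\<Omega> - K. norm (v x) < 1)"
    using assms unfolding C0_def by simp
  then obtain K where K: "compact K" "K \<subseteq> \<Omega>" "\<And>x. x \<in> \<Omega> - K \<Longrightarrow> norm (v x) < 1" by auto
  have "bounded (v ` K)"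
    using assms by (intro compact_imp_bounded compact_continuous_image continuous_on_subset[OF _ K(2)]
      K(1)) (simp add: C0_def)
  then obtain B where B: "B > 0" "\<And>x. x \<in> K \<Longrightarrow> norm (v x) \<le> B" unfolding bounded_pos by blast
  show ?thesis
  proof
    show "B + 1 > 0" using B by simp
    show "norm (v x) \<le> B + 1" if "x \<in> \<Omega>" for x
      using B(1) B(2)[of x] K(3)[of x] that by (cases "x \<in> K") auto
  qed
qed

lemma test_field_C0:
  assumes "test_field \<Omega> v" shows "v \<in> C0 \<Omega>"
  unfolding C0_def
proof (intro CollectI conjI allI impI)
  show "continuous_on \<Omega> v" by (rule continuous_on_subset[OF test_field_continuous[OF assms] subset_UNIV])
  fix e :: real assume "e > 0"
  have "\<exists>K. compact K \<and> K \<subseteq> \<Omega> \<and> (\<forall>x. x \<notin> K \<longrightarrow> v x $ i = 0)" for i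
    by (rule test_functionE[OF test_fieldD[OF assms, of i]]) blast
  then obtain K where K: "\<And>i. compact (K i)" "\<And>i. K i \<subseteq> \<Omega>" "\<And>i x. x \<notin> K i \<Longrightarrow> v x $ i = 0" by metis
  have "norm (v x) < e" if "x \<notin> (\<Union>i. K i)" for x
  proof -
    have "v x = 0" using K(3) that by (auto simp: vec_eq_iff)
    then show ?thesis using \<open>e > 0\<close> by simp
  qed
  then show "\<exists>K. compact K \<and> K \<subseteq> \<Omega> \<and> (\<forall>x\<in>\<Omega> - K. norm (v x) < e)"
    using K(1,2) by (intro exI[of _ "\<Union>i. K i"]) (auto intro: compact_UN)
qed

lemma C0_continuous: "v \<in> C0 \<Omega> \<Longrightarrow> continuous_on \<Omega> v"
  by (simp add: C0_def)

lemma pairing_tendsto: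
  assumes u: "u \<in> BV \<Omega>" and v: "continuous_on \<Omega> v" "\<And>x. x \<in> \<Omega> \<Longrightarrow> norm (v x) \<le> B"
    and w: "\<And>n. continuous_on \<Omega> (w n)" "\<And>n x. x \<in> \<Omega> \<Longrightarrow> norm (w n x - v x) \<le> e n" and e: "e \<longlonglongrightarrow> 0"
  shows "(\<lambda>n. pairing \<Omega> (w n) u) \<longlonglongrightarrow> pairing \<Omega> v u"
proof (rule LIM_zero_cancel, rule Lim_null_comparison)
  have "\<bar>pairing \<Omega> (w n) u - pairing \<Omega> v u\<bar> \<le> e n * gradient_mass \<Omega> u" for n
  proof (rule pairing_diff_le[OF u w(1) _ v w(2)])
    show "norm (w n x) \<le> B + e n" if "x \<in> \<Omega>" for x
      using norm_triangle_sub[of "w n x" "v x"] v(2)[OF that] w(2)[OF that, of n] by simp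
  qed
  then show "\<forall>\<^sub>F n in sequentially. norm (pairing \<Omega> (w n) u - pairing \<Omega> v u) \<le> e n * gradient_mass \<Omega> u"
    by simp
  show "(\<lambda>n. e n * gradient_mass \<Omega> u) \<longlonglongrightarrow> 0" using tendsto_mult_left_zero[OF e] .
qed

text \<open>The vehicle for linearity and bounds of \<open>pairing\<close>: on test fields it is an
  integral against \<open>divergence\<close>, where these properties are elementary, and they
  survive the limit.\<close>

lemma C0_approximation:
  assumes "open \<Omega>" "v \<in> C0 \<Omega>"
  obtains \<phi> where "\<And>n. test_field \<Omega> (\<phi> n)" "\<And>n x. x \<in> \<Omega> \<Longrightarrow> norm (\<phi> n x - v x) \<le> inverse (real (Suc n))"
    "\<And>u. u \<in> BV \<Omega> \<Longrightarrow> (\<lambda>n. pairing \<Omega> (\<phi> n) u) \<longlonglongrightarrow> pairing \<Omega> v u"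
proof -
  have "\<exists>\<phi>. test_field \<Omega> \<phi> \<and> (\<forall>x\<in>\<Omega>. norm (\<phi> x - v x) \<le> inverse (real (Suc n)))" for n
    by (rule test_field_dense_C0[OF assms, of "inverse (real (Suc n))"]) (auto intro: less_imp_le)
  then obtain \<phi> where \<phi>: "\<And>n. test_field \<Omega> (\<phi> n)"
    "\<And>n x. x \<in> \<Omega> \<Longrightarrow> norm (\<phi> n x - v x) \<le> inverse (real (Suc n))" by metis
  obtain B where "B > 0" and B: "\<And>x. x \<in> \<Omega> \<Longrightarrow> norm (v x) \<le> B" by (rule C0_bounded[OF assms(2)]) (rule that)
  show ?thesis
  proof (rule that[OF \<phi>])
    show "(\<lambda>n. pairing \<Omega> (\<phi> n) u) \<longlonglongrightarrow> pairing \<Omega> v u" if "u \<in> BV \<Omega>" for u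
      by (rule pairing_tendsto[OF that C0_continuous[OF assms(2)] B C0_continuous[OF test_field_C0[OF
        \<phi>(1)]] \<phi>(2)
            LIMSEQ_inverse_real_of_nat])
  qed
qed

text \<open>\<open>weak_partial\<close> of a sum is a fresh choice, not defined as the sum of the
  two choices; additivity is read off from integrals over test fields and extended by
  \<open>C0_approximation\<close>.\<close>

lemma pairing_add:
  assumes \<Omega>: "open \<Omega>" and v: "v \<in> C0 \<Omega>" and u: "u \<in> BV \<Omega>" and w: "w \<in> BV \<Omega>"
  shows "pairing \<Omega> v (\<lambda>x. u x + w x) = pairing \<Omega> v u + pairing \<Omega> v w"
proof -
  obtain \<phi> where \<phi>: "\<And>n. test_field \<Omega> (\<phi> n)" "\<And>n x. x \<in> \<Omega> \<Longrightarrow> norm (\<phi> n x - v x) \<le> inverse (real (Suc n))"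
    "\<And>u. u \<in> BV \<Omega> \<Longrightarrow> (\<lambda>n. pairing \<Omega> (\<phi> n) u) \<longlonglongrightarrow> pairing \<Omega> v u" by (rule C0_approximation[OF \<Omega> v]) (rule that)
  have "pairing \<Omega> (\<phi> n) (\<lambda>x. u x + w x) = pairing \<Omega> (\<phi> n) u + pairing \<Omega> (\<phi> n) w" for n
    unfolding pairing_test[OF \<Omega> u \<phi>(1)] pairing_test[OF \<Omega> w \<phi>(1)] pairing_test[OF \<Omega> BV_add[OF \<Omega> u w]
      \<phi>(1)] distrib_right
    by (subst Bochner_Integration.integral_add)
       (auto intro: integral_times_divergence(1)[OF \<Omega> BV_integrable \<phi>(1)] u w)
  then show ?thesis
    using LIMSEQ_unique[OF \<phi>(3)[OF BV_add[OF \<Omega> u w]]] tendsto_add[OF \<phi>(3)[OF u] \<phi>(3)[OF w]] by simp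
qed

lemma pairing_cmult:
  assumes \<Omega>: "open \<Omega>" and v: "v \<in> C0 \<Omega>" and u: "u \<in> BV \<Omega>"
  shows "pairing \<Omega> v (\<lambda>x. a * u x) = a * pairing \<Omega> v u"
proof -
  obtain \<phi> where \<phi>: "\<And>n. test_field \<Omega> (\<phi> n)" "\<And>n x. x \<in> \<Omega> \<Longrightarrow> norm (\<phi> n x - v x) \<le> inverse (real (Suc n))"
    "\<And>u. u \<in> BV \<Omega> \<Longrightarrow> (\<lambda>n. pairing \<Omega> (\<phi> n) u) \<longlonglongrightarrow> pairing \<Omega> v u" by (rule C0_approximation[OF \<Omega> v]) (rule that)
  have "pairing \<Omega> (\<phi> n) (\<lambda>x. a * u x) = a * pairing \<Omega> (\<phi> n) u" for n
    unfolding pairing_test[OF \<Omega> u \<phi>(1)] pairing_test[OF \<Omega> BV_cmult[OF u] \<phi>(1)] by (simp add: mult.assoc)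
  then show ?thesis
    using LIMSEQ_unique[OF \<phi>(3)[OF BV_cmult[OF u]]] tendsto_mult_left[OF \<phi>(3)[OF u]] by simp
qed

section \<open>Total variation as a seminorm\<close>

lemma total_variation_least:
  assumes "\<And>v. test_field \<Omega> v \<Longrightarrow> (\<And>x. norm (v x) \<le> 1) \<Longrightarrow> (LINT x|lebesgue_on \<Omega>. u x * divergence v x) \<le> c"
  shows "total_variation \<Omega> u \<le> c"
  unfolding total_variation_def
proof (rule cSUP_least)
  show "{v. test_field \<Omega> v \<and> (\<forall>x. norm (v x) \<le> 1)} \<noteq> {}" using test_field_zero by force
qed (use assms in auto)

lemma total_variation_upper:
  assumes \<Omega>: "open \<Omega>" and u: "u \<in> BV \<Omega>" and v: "test_field \<Omega> v" "\<And>x. norm (v x) \<le> 1"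
  shows "(LINT x|lebesgue_on \<Omega>. u x * divergence v x) \<le> total_variation \<Omega> u"
  unfolding total_variation_def
proof (rule cSUP_upper)
  show "v \<in> {v. test_field \<Omega> v \<and> (\<forall>x. norm (v x) \<le> 1)}" using v by simp
  \<comment> \<open>A supremum of reals needs an upper bound, found here by comparing
    \<open>w\<close> with the zero field in \<open>pairing_diff_le\<close>.\<close>
  have "(LINT x|lebesgue_on \<Omega>. u x * divergence w x) \<le> gradient_mass \<Omega> u"
    if w: "test_field \<Omega> w" "\<And>x. norm (w x) \<le> 1" for w
  proof -
    have "\<bar>pairing \<Omega> w u - pairing \<Omega> (\<lambda>x. 0) u\<bar> \<le> 1 * gradient_mass \<Omega> u"
      by (rule pairing_diff_le[OF u C0_continuous[OF test_field_C0[OF w(1)]] w(2), where C = 0])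
         (use w(2) in \<open>auto intro: continuous_intros\<close>)
    then show ?thesis using pairing_test[OF \<Omega> u w(1)] pairing_test[OF \<Omega> u test_field_zero] by simp
  qed
  then show "bdd_above ((\<lambda>v. LINT x|lebesgue_on \<Omega>. u x * divergence v x) ` {v. test_field \<Omega> v \<and> (\<forall>x.
    norm (v x) \<le> 1)})"
    by (intro bdd_aboveI2) auto
qed

lemma total_variation_nonneg: "open \<Omega> \<Longrightarrow> u \<in> BV \<Omega> \<Longrightarrow> total_variation \<Omega> u \<ge> 0"
  using total_variation_upper[OF _ _ test_field_zero, of \<Omega> u] by simp

lemma integral_divergence_le:
  assumes \<Omega>: "open \<Omega>" and u: "u \<in> BV \<Omega>" and v: "test_field \<Omega> v" "\<And>x. norm (v x) \<le> B"
  shows "\<bar>LINT x|lebesgue_on \<Omega>. u x * divergence v x\<bar> \<le> B * total_variation \<Omega> u"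
proof -
  have B: "B \<ge> 0" using v(2)[of 0] norm_ge_zero order_trans by blast
  show ?thesis
  proof (cases "B = 0")
    case True
    then have "v = (\<lambda>x. 0)" using v(2) by (auto simp: fun_eq_iff)
    then show ?thesis using True by simp
  next
    case False
    have *: "a / B * (LINT x|lebesgue_on \<Omega>. u x * divergence v x) \<le> total_variation \<Omega> u" if "\<bar>a\<bar> = 1" for a
    proof -
      have "(LINT x|lebesgue_on \<Omega>. u x * divergence (\<lambda>x. (a / B) *\<^sub>R v x) x) \<le> total_variation \<Omega> u"
        using v B False that by (intro total_variation_upper[OF \<Omega> u] test_field_scaleR) (auto simp:
          abs_divide field_simps)
      then show ?thesis unfolding divergence_scaleR[OF v(1)] by (simp add: mult.left_commute)
    qed
    show ?thesis using *[of 1] *[of "- 1"] B False by (simp add: field_simps abs_le_iff)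
  qed
qed

text \<open>The approximating test fields exceed \<open>B\<close> by at most
  \<open>1 / (n + 1)\<close>, also off \<open>\<Omega>\<close>, where they vanish. After scaling
  they compete in the supremum defining \<open>total_variation\<close>, and the excess disappears in
  the limit.\<close>

lemma abs_pairing_le:
  assumes \<Omega>: "open \<Omega>" and u: "u \<in> BV \<Omega>" and v: "v \<in> C0 \<Omega>" "\<And>x. x \<in> \<Omega> \<Longrightarrow> norm (v x) \<le> B" and B: "B \<ge> 0"
  shows "\<bar>pairing \<Omega> v u\<bar> \<le> B * total_variation \<Omega> u"
proof -
  obtain \<phi> where \<phi>: "\<And>n. test_field \<Omega> (\<phi> n)" "\<And>n x. x \<in> \<Omega> \<Longrightarrow> norm (\<phi> n x - v x) \<le> inverse (real (Suc n))"
    "\<And>u. u \<in> BV \<Omega> \<Longrightarrow> (\<lambda>n. pairing \<Omega> (\<phi> n) u) \<longlonglongrightarrow> pairing \<Omega> v u" by (rule C0_approximation[OF \<Omega> v(1)]) (rule that)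
  have "\<bar>pairing \<Omega> (\<phi> n) u\<bar> \<le> (B + inverse (real (Suc n))) * total_variation \<Omega> u" for n
  proof -
    have "norm (\<phi> n x) \<le> B + inverse (real (Suc n))" for x
    proof (cases "x \<in> \<Omega>")
      case True
      then show ?thesis using norm_triangle_sub[of "\<phi> n x" "v x"] v(2)[OF True] \<phi>(2)[OF True, of n]
        by linarith
    next
      case False
      then show ?thesis using test_field_outside[OF \<phi>(1)[of n] False] B by simp
    qed
    then show ?thesis using integral_divergence_le[OF \<Omega> u \<phi>(1)] pairing_test[OF \<Omega> u \<phi>(1)] by simp
  qed
  moreover have "(\<lambda>n. (B + inverse (real (Suc n))) * total_variation \<Omega> u) \<longlonglongrightarrow> (B + 0) * total_variation \<Omega> u"
    by (intro tendsto_intros LIMSEQ_inverse_real_of_nat)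
  ultimately show ?thesis using LIMSEQ_le[OF tendsto_rabs[OF \<phi>(3)[OF u]]] by simp
qed

lemma total_variation_add:
  assumes \<Omega>: "open \<Omega>" and u: "u \<in> BV \<Omega>" and w: "w \<in> BV \<Omega>"
  shows "total_variation \<Omega> (\<lambda>x. u x + w x) \<le> total_variation \<Omega> u + total_variation \<Omega> w"
proof (rule total_variation_least)
  fix v assume v: "test_field \<Omega> v" "\<And>x. norm (v x) \<le> 1"
  have "(LINT x|lebesgue_on \<Omega>. (u x + w x) * divergence v x) =
      (LINT x|lebesgue_on \<Omega>. u x * divergence v x) + (LINT x|lebesgue_on \<Omega>. w x * divergence v x)"
    unfolding distrib_right by (rule Bochner_Integration.integral_add[OF integral_times_divergence(1)[OF
      \<Omega> BV_integrable[OF u] v(1)]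
        integral_times_divergence(1)[OF \<Omega> BV_integrable[OF w] v(1)]])
  then show "(LINT x|lebesgue_on \<Omega>. (u x + w x) * divergence v x) \<le> total_variation \<Omega> u + total_variation \<Omega> w"
    using total_variation_upper[OF \<Omega> u v] total_variation_upper[OF \<Omega> w v] by linarith
qed

lemma total_variation_cmult:
  assumes \<Omega>: "open \<Omega>" and u: "u \<in> BV \<Omega>"
  shows "total_variation \<Omega> (\<lambda>x. a * u x) \<le> \<bar>a\<bar> * total_variation \<Omega> u"
proof (rule total_variation_least)
  fix v assume v: "test_field \<Omega> v" "\<And>x. norm (v x) \<le> 1"
  have "(LINT x|lebesgue_on \<Omega>. a * u x * divergence v x) = a * (LINT x|lebesgue_on \<Omega>. u x * divergence v x)"
    by (simp add: mult.assoc)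
  also have "\<dots> \<le> \<bar>a\<bar> * \<bar>LINT x|lebesgue_on \<Omega>. u x * divergence v x\<bar>" by (metis abs_ge_self abs_mult)
  also have "\<dots> \<le> \<bar>a\<bar> * total_variation \<Omega> u"
    using integral_divergence_le[OF \<Omega> u v] by (intro mult_left_mono) auto
  finally show "(LINT x|lebesgue_on \<Omega>. a * u x * divergence v x) \<le> \<bar>a\<bar> * total_variation \<Omega> u" .
qed

lemma total_variation_diff:
  assumes \<Omega>: "open \<Omega>" and u: "u \<in> BV \<Omega>" and w: "w \<in> BV \<Omega>"
  shows "total_variation \<Omega> (\<lambda>x. u x - w x) \<le> total_variation \<Omega> u + total_variation \<Omega> w"
  using total_variation_add[OF \<Omega> u BV_cmult[OF w, of "- 1"]] total_variation_cmult[OF \<Omega> w, of "- 1"] by simp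

section \<open>Classes modulo constants\<close>

text \<open>Only \<open>c * g\<close> is integrated, never \<open>c\<close> itself; the measure may
  therefore be infinite.\<close>

lemma integral_shift_constant:
  fixes u w g :: "'a \<Rightarrow> real"
  assumes u: "integrable M (\<lambda>x. u x * g x)" and w: "integrable M (\<lambda>x. w x * g x)"
    and g: "integrable M g" "(LINT x|M. g x) = 0" and eq: "AE x in M. w x - u x = c"
  shows "(LINT x|M. w x * g x) = (LINT x|M. u x * g x)"
proof -
  have "(LINT x|M. w x * g x) = (LINT x|M. u x * g x + c * g x)"
  proof (rule integral_cong_AE)
    show "AE x in M. w x * g x = u x * g x + c * g x" using eq by eventually_elim (auto simp: algebra_simps)
  qed (use u w g in auto)
  then show ?thesis using u g by simp
qed

lemma integral_divergence_shift:
  assumes \<Omega>: "open \<Omega>" and u: "integrable (lebesgue_on \<Omega>) u" and w: "integrable (lebesgue_on \<Omega>) w"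
    and eq: "AE x in lebesgue_on \<Omega>. w x - u x = c" and v: "test_field \<Omega> v"
  shows "(LINT x|lebesgue_on \<Omega>. w x * divergence v x) = (LINT x|lebesgue_on \<Omega>. u x * divergence v x)"
  by (rule integral_shift_constant[OF integral_times_divergence(1)[OF \<Omega> u v]
    integral_times_divergence(1)[OF \<Omega> w v]
        integral_divergence_eq_zero[OF \<Omega> v] eq])

lemma total_variation_shift:
  assumes "open \<Omega>" "integrable (lebesgue_on \<Omega>) u" "integrable (lebesgue_on \<Omega>) w"
    and "AE x in lebesgue_on \<Omega>. w x - u x = c"
  shows "total_variation \<Omega> w = total_variation \<Omega> u"
  unfolding total_variation_def by (intro SUP_cong refl integral_divergence_shift[OF assms]) simp

lemma test_field_axis:
  assumes "test_function \<Omega> \<phi>" shows "test_field \<Omega> (\<lambda>x. \<phi> x *\<^sub>R axis i 1)"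
  unfolding test_field_def
proof
  show "test_function \<Omega> (\<lambda>x. (\<phi> x *\<^sub>R axis i 1) $ j)" for j
    using assms by (cases "j = i") (simp_all add: axis_def test_function_zero)
qed

lemma divergence_axis: "divergence (\<lambda>x. \<phi> x *\<^sub>R axis i 1) x = partial i \<phi> x"
proof -
  have "divergence (\<lambda>x. \<phi> x *\<^sub>R axis i 1) x = (\<Sum>j\<in>UNIV. if j = i then partial i \<phi> x else 0)"
    unfolding divergence_def by (intro sum.cong refl) (auto simp: axis_def)
  then show ?thesis by simp
qed

text \<open>Divergences of test fields have integral 0, so constants are invisible to the defining
  condition. As the two predicates coincide, \<open>weak_partial\<close> makes literally the same
  choice for both functions, which gives \<open>pairing_shift\<close> and makes
  \<open>div_op\<close> well defined on classes.\<close>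

lemma is_weak_partial_shift:
  assumes "open \<Omega>" "integrable (lebesgue_on \<Omega>) u" "integrable (lebesgue_on \<Omega>) w"
    and "AE x in lebesgue_on \<Omega>. w x - u x = c"
  shows "is_weak_partial \<Omega> i w = is_weak_partial \<Omega> i u"
  using integral_divergence_shift[OF assms test_field_axis, of _ i]
  by (intro ext) (simp add: is_weak_partial_def divergence_axis)

lemma pairing_shift:
  assumes "open \<Omega>" "integrable (lebesgue_on \<Omega>) u" "integrable (lebesgue_on \<Omega>) w"
    and "AE x in lebesgue_on \<Omega>. w x - u x = c"
  shows "pairing \<Omega> v w = pairing \<Omega> v u"
  unfolding pairing_def weak_partial_def is_weak_partial_shift[OF assms] ..

lemma cst_class_self: "u \<in> BV \<Omega> \<Longrightarrow> u \<in> cst_class \<Omega> u"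
  by (auto simp: cst_class_def intro!: exI[of _ 0])

lemma cst_class_eqI:
  assumes eq: "AE x in lebesgue_on \<Omega>. w x - u x = c"
  shows "cst_class \<Omega> w = cst_class \<Omega> u"
proof -
  have "(\<exists>d. AE x in lebesgue_on \<Omega>. z x - w x = d) \<longleftrightarrow> (\<exists>d. AE x in lebesgue_on \<Omega>. z x - u x = d)" for z
  proof
    assume "\<exists>d. AE x in lebesgue_on \<Omega>. z x - w x = d"
    then obtain d where "AE x in lebesgue_on \<Omega>. z x - w x = d" ..
    with eq have "AE x in lebesgue_on \<Omega>. z x - u x = d + c" by eventually_elim simp
    then show "\<exists>d. AE x in lebesgue_on \<Omega>. z x - u x = d" ..
  next
    assume "\<exists>d. AE x in lebesgue_on \<Omega>. z x - u x = d"
    then obtain d where "AE x in lebesgue_on \<Omega>. z x - u x = d" ..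
    with eq have "AE x in lebesgue_on \<Omega>. z x - w x = d - c" by eventually_elim simp
    then show "\<exists>d. AE x in lebesgue_on \<Omega>. z x - w x = d" ..
  qed
  then show ?thesis by (simp add: cst_class_def)
qed

lemma div_op_cst_class:
  assumes \<Omega>: "open \<Omega>" and u: "u \<in> BV \<Omega>"
  shows "div_op \<Omega> v (cst_class \<Omega> u) = - pairing \<Omega> v u"
proof -
  have c: "pairing \<Omega> v w = pairing \<Omega> v u" if "w \<in> cst_class \<Omega> u" for w
    using that pairing_shift[OF \<Omega> BV_integrable[OF u] BV_integrable] by (auto simp: cst_class_def)
  have "(THE r. \<forall>w\<in>cst_class \<Omega> u. r = - pairing \<Omega> v w) = - pairing \<Omega> v u"
  proof (rule the_equality)
    show "\<forall>w\<in>cst_class \<Omega> u. - pairing \<Omega> v u = - pairing \<Omega> v w"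
    proof
      fix w assume "w \<in> cst_class \<Omega> u"
      from c[OF this] show "- pairing \<Omega> v u = - pairing \<Omega> v w" by (rule arg_cong[where f = uminus, OF sym])
    qed
    show "r = - pairing \<Omega> v u" if "\<forall>w\<in>cst_class \<Omega> u. r = - pairing \<Omega> v w" for r
      using that cst_class_self[OF u] by (rule bspec)
  qed
  moreover have "cst_class \<Omega> u \<in> BV_cst \<Omega>" using u by (simp add: BV_cst_def)
  ultimately show ?thesis by (simp add: div_op_def pairing_def)
qed

section \<open>Smooth functions of bounded variation\<close>

text \<open>By integration by parts the derivative measures have the classical partial derivatives
  as densities; Cauchy-Schwarz under the integral bounds the total variation.\<close>

lemma smooth_BV:
  fixes u :: "real ^ 'm \<Rightarrow> real"
  assumes \<Omega>: "open \<Omega>" and u: "smooth_on \<Omega> u" "u \<in> L1 \<Omega>"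
    and g: "integrable (lebesgue_on \<Omega>) (\<lambda>x. norm (grad u x))"
  shows "u \<in> BV \<Omega>" "total_variation \<Omega> u \<le> (LINT x|lebesgue_on \<Omega>. norm (grad u x))"
proof -
  have du: "u differentiable_on \<Omega>" "continuous_on \<Omega> (partial i u)" for i
    using u(1) unfolding smooth_on_def by (auto dest: spec[of _ "Suc 0"])
  have iu: "integrable (lebesgue_on \<Omega>) u" using u(2) by (simp add: L1_def)
  have pm: "partial i u \<in> borel_measurable (lebesgue_on \<Omega>)" for i
    using du(2) \<Omega> by (intro continuous_imp_measurable_on_sets_lebesgue) simp_all
  have ip: "integrable (lebesgue_on \<Omega>) (partial i u)" for i
  proof (rule Bochner_Integration.integrable_bound[OF g pm])
    show "AE x in lebesgue_on \<Omega>. norm (partial i u x) \<le> norm (norm (grad u x))"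
      using component_le_norm_cart[of "grad u _" i] by (intro AE_I2) (simp add: grad_def)
  qed
  have sp: "space (lebesgue_on \<Omega>) = space (restrict_space borel \<Omega>)"
    "sets (restrict_space borel \<Omega>) \<subseteq> sets (lebesgue_on \<Omega>)"
    by (auto simp: space_restrict_space sets_restrict_space)
  have "is_weak_partial \<Omega> i u (\<lambda>A. LINT x|lebesgue_on \<Omega>. indicator A x * partial i u x)" for i
    unfolding is_weak_partial_def
  proof (intro conjI allI impI)
    show "signed_measure (restrict_space borel \<Omega>) (\<lambda>A. LINT x|lebesgue_on \<Omega>. indicator A x * partial i u x)"
      by (rule signed_integral_density(1)[OF sp ip])
    fix \<phi> assume \<phi>: "test_function \<Omega> \<phi>"
    obtain B where "B > 0" and B: "\<And>x. \<bar>\<phi> x\<bar> \<le> B" "\<And>i x. \<bar>partial i \<phi> x\<bar> \<le> B"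
      by (rule test_function_bounded[OF \<phi>]) (rule that)
    show "(LINT x|lebesgue_on \<Omega>. u x * partial i \<phi> x) =
        - signed_integral (restrict_space borel \<Omega>) (\<lambda>A. LINT x|lebesgue_on \<Omega>. indicator A x * partial i
          u x) \<phi>"
      unfolding signed_integral_density(2)[OF sp ip measurable_test_function[OF \<phi>] B(1)]
      by (rule integration_by_parts_test[OF \<Omega> du \<phi>])
  qed
  then show BV: "u \<in> BV \<Omega>" using iu by (intro BV_I)
  show "total_variation \<Omega> u \<le> (LINT x|lebesgue_on \<Omega>. norm (grad u x))"
  proof (rule total_variation_least)
    fix v assume v: "test_field \<Omega> v" "\<And>x. norm (v x) \<le> 1"
    have i: "integrable (lebesgue_on \<Omega>) (\<lambda>x. partial i u x * v x $ i)" for i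
      by (rule integrable_times_test(1)[OF \<Omega> test_fieldD[OF v(1)] ip])
    have "(LINT x|lebesgue_on \<Omega>. u x * divergence v x) = (\<Sum>i\<in>UNIV. LINT x|lebesgue_on \<Omega>. (- (partial i u
      x * v x $ i)))"
      unfolding integral_times_divergence(2)[OF \<Omega> iu v(1)]
      using integration_by_parts_test[OF \<Omega> du test_fieldD[OF v(1)]] by simp
    also have "\<dots> = (LINT x|lebesgue_on \<Omega>. (\<Sum>i\<in>UNIV. - (partial i u x * v x $ i)))"
      using i by (intro Bochner_Integration.integral_sum[symmetric]) auto
    also have "\<dots> \<le> (LINT x|lebesgue_on \<Omega>. norm (grad u x))"
    proof (rule integral_mono[OF _ g])
      show "integrable (lebesgue_on \<Omega>) (\<lambda>x. \<Sum>i\<in>UNIV. - (partial i u x * v x $ i))"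
        using i by (intro Bochner_Integration.integrable_sum) auto
      fix x
      have "(\<Sum>i\<in>UNIV. - (partial i u x * v x $ i)) = - inner (grad u x) (v x)"
        by (simp add: grad_def inner_vec_def sum_negf)
      also have "\<dots> \<le> norm (grad u x) * norm (v x)" using Cauchy_Schwarz_ineq2[of "grad u x" "v x"] by linarith
      also have "\<dots> \<le> norm (grad u x)" using v(2) by (intro mult_left_le) auto
      finally show "(\<Sum>i\<in>UNIV. - (partial i u x * v x $ i)) \<le> norm (grad u x)" .
    qed
    finally show "(LINT x|lebesgue_on \<Omega>. u x * divergence v x) \<le> (LINT x|lebesgue_on \<Omega>. norm (grad u x))" .
  qed
qed

section \<open>Surjectivity implies the Poincare inequality\<close>

lemma integrable_minus_mean:
  fixes u :: "real ^ 'm \<Rightarrow> real"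
  assumes "open \<Omega>" "integrable (lebesgue_on \<Omega>) u"
  shows "integrable (lebesgue_on \<Omega>) (\<lambda>x. u x - mean \<Omega> u)"
proof (cases "emeasure lebesgue \<Omega> < \<infinity>")
  case True
  then have "integrable (lebesgue_on \<Omega>) (\<lambda>x. mean \<Omega> u)"
    using assms(1) finite_measure.integrable_const[of "lebesgue_on \<Omega>"]
    by (simp add: emeasure_restrict_space space_restrict_space finite_measureI)
  then show ?thesis using assms(2) by (intro Bochner_Integration.integrable_diff)
qed (use assms in \<open>simp add: mean_def\<close>)

lemma mean_add:
  assumes "integrable (lebesgue_on \<Omega>) u" "integrable (lebesgue_on \<Omega>) w"
  shows "mean \<Omega> (\<lambda>x. u x + w x) = mean \<Omega> u + mean \<Omega> w"
  using assms by (simp add: mean_def add_divide_distrib)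

lemma mean_cmult: "mean \<Omega> (\<lambda>x. a * u x) = a * mean \<Omega> u"
  by (simp add: mean_def)

lemma measure_open_pos:
  fixes \<Omega> :: "(real ^ 'm) set"
  assumes "open \<Omega>" "\<Omega> \<noteq> {}" "emeasure lebesgue \<Omega> < \<infinity>"
  shows "measure lebesgue \<Omega> > 0"
proof -
  have "emeasure lebesgue \<Omega> \<noteq> 0"
    using open_not_negligible[OF assms(1,2)] assms(1) by (auto simp: negligible_iff_null_sets null_sets_def)
  then show ?thesis using assms(3) by (simp add: measure_def enn2real_positive_iff less_top
    zero_less_iff_neq_zero)
qed

text \<open>In finite measure the mean moves along with the constant. In infinite measure a constant
  difference of two integrable functions can only be 0, so the convention \<open>mean = 0\<close> is
  consistent.\<close>

lemma minus_mean_shift: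
  fixes u w :: "real ^ 'm \<Rightarrow> real"
  assumes \<Omega>: "open \<Omega>" "\<Omega> \<noteq> {}"
    and u: "integrable (lebesgue_on \<Omega>) u" and w: "integrable (lebesgue_on \<Omega>) w"
    and eq: "AE x in lebesgue_on \<Omega>. w x - u x = c"
  shows "AE x in lebesgue_on \<Omega>. w x - mean \<Omega> w = u x - mean \<Omega> u"
proof -
  have ic: "integrable (lebesgue_on \<Omega>) (\<lambda>x. c)"
    by (rule integrable_cong_AE_imp[OF Bochner_Integration.integrable_diff[OF w u]]) (use eq in auto)
  have em: "emeasure (lebesgue_on \<Omega>) (space (lebesgue_on \<Omega>)) = emeasure lebesgue \<Omega>"
    using \<Omega> by (simp add: emeasure_restrict_space space_restrict_space)
  have "mean \<Omega> w = mean \<Omega> u + c"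
  proof (cases "emeasure lebesgue \<Omega> < \<infinity>")
    case True
    have m: "measure (lebesgue_on \<Omega>) (space (lebesgue_on \<Omega>)) = measure lebesgue \<Omega>"
      using em by (simp add: measure_def)
    have "(LINT x|lebesgue_on \<Omega>. w x) = (LINT x|lebesgue_on \<Omega>. u x + c)"
      by (rule integral_cong_AE) (use u w eq in auto)
    also have "\<dots> = (LINT x|lebesgue_on \<Omega>. u x) + c * measure lebesgue \<Omega>"
      using u ic m by simp
    finally show ?thesis using measure_open_pos[OF \<Omega> True] True by (simp add: mean_def add_divide_distrib)
  next
    case False
    then have "c = 0"
    proof -
      have "(\<integral>\<^sup>+ x. ennreal \<bar>c\<bar> \<partial>lebesgue_on \<Omega>) < \<infinity>" using ic by (simp add: integrable_iff_bounded)
      then have "ennreal \<bar>c\<bar> * emeasure lebesgue \<Omega> < \<infinity>" using em by simp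
      then show ?thesis using False by (cases "c = 0") (auto simp: top_unique ennreal_mult_top
        less_top[symmetric])
    qed
    then show ?thesis using False by (simp add: mean_def)
  qed
  with eq show ?thesis by (auto elim: eventually_mono)
qed

lemma L1_norm_nonneg: "L1_norm \<Omega> u \<ge> 0"
  by (simp add: L1_norm_def)

text \<open>The form is defined through an arbitrary representative of the class; subtracting the
  mean makes the value independent of it, by \<open>minus_mean_shift\<close>. Boundedness of
  \<open>g\<close> yields the estimate from the L1 term.\<close>

lemma bounded_form_in_dual:
  fixes g :: "real ^ 'm \<Rightarrow> real"
  assumes \<Omega>: "open \<Omega>" "\<Omega> \<noteq> {}" and g: "g \<in> borel_measurable (lebesgue_on \<Omega>)" "\<And>x. x \<in> \<Omega> \<Longrightarrow> \<bar>g x\<bar> \<le> G"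
  obtains F where "F \<in> BV_cst_dual \<Omega>"
    "\<And>u. u \<in> BV \<Omega> \<Longrightarrow> F (cst_class \<Omega> u) = (LINT x|lebesgue_on \<Omega>. (u x - mean \<Omega> u) * g x)"
proof -
  define J where "J u = (LINT x|lebesgue_on \<Omega>. (u x - mean \<Omega> u) * g x)" for u
  define F where "F = (\<lambda>X\<in>BV_cst \<Omega>. J (SOME u. u \<in> BV \<Omega> \<and> cst_class \<Omega> u = X))"
  have ii: "integrable (lebesgue_on \<Omega>) (\<lambda>x. u x - mean \<Omega> u)" if "u \<in> BV \<Omega>" for u
    by (rule integrable_minus_mean[OF \<Omega>(1) BV_integrable[OF that]])
  have gb: "\<bar>g x\<bar> \<le> G" if "x \<in> space (lebesgue_on \<Omega>)" for x using g(2) that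
    by (simp add: space_restrict_space)
  have ig: "integrable (lebesgue_on \<Omega>) (\<lambda>x. (u x - mean \<Omega> u) * g x)" if "u \<in> BV \<Omega>" for u
    by (rule integrable_mult_bounded(1)[OF ii[OF that] g(1) gb])
  have J_eq: "J w = J u" if u: "u \<in> BV \<Omega>" and w: "w \<in> BV \<Omega>" and eq: "cst_class \<Omega> w = cst_class \<Omega> u" for u w
  proof -
    have "w \<in> cst_class \<Omega> u" using cst_class_self[OF w] eq by simp
    then obtain c where "AE x in lebesgue_on \<Omega>. w x - u x = c" by (auto simp: cst_class_def)
    from minus_mean_shift[OF \<Omega> BV_integrable[OF u] BV_integrable[OF w] this]
    show ?thesis unfolding J_def
      by (intro integral_cong_AE borel_measurable_integrable ig u w) (auto elim: eventually_mono)
  qed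
  have F: "F (cst_class \<Omega> u) = J u" if u: "u \<in> BV \<Omega>" for u
  proof -
    have "(SOME w. w \<in> BV \<Omega> \<and> cst_class \<Omega> w = cst_class \<Omega> u) \<in> BV \<Omega> \<and>
        cst_class \<Omega> (SOME w. w \<in> BV \<Omega> \<and> cst_class \<Omega> w = cst_class \<Omega> u) = cst_class \<Omega> u"
      by (rule someI[of _ u]) (use u in simp)
    then have "J (SOME w. w \<in> BV \<Omega> \<and> cst_class \<Omega> w = cst_class \<Omega> u) = J u" using J_eq[OF u] by blast
    moreover have "cst_class \<Omega> u \<in> BV_cst \<Omega>" using u by (simp add: BV_cst_def)
    ultimately show ?thesis by (simp add: F_def)
  qed
  have "F \<in> BV_cst_dual \<Omega>"
    unfolding BV_cst_dual_def linear_form_def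
  proof (intro CollectI conjI ballI allI impI)
    show "F \<in> extensional (BV_cst \<Omega>)" by (simp add: F_def)
    show "F (cst_class \<Omega> (\<lambda>x. u x + w x)) = F (cst_class \<Omega> u) + F (cst_class \<Omega> w)"
      if u: "u \<in> BV \<Omega>" and w: "w \<in> BV \<Omega>" for u w
    proof -
      have "J (\<lambda>x. u x + w x) = (LINT x|lebesgue_on \<Omega>. (u x - mean \<Omega> u) * g x + (w x - mean \<Omega> w) * g x)"
        unfolding J_def mean_add[OF BV_integrable[OF u] BV_integrable[OF w]]
        by (intro Bochner_Integration.integral_cong refl) (simp add: algebra_simps)
      also have "\<dots> = J u + J w" unfolding J_def
        by (rule Bochner_Integration.integral_add[OF ig[OF u] ig[OF w]])
      finally show ?thesis unfolding F[OF u] F[OF w] F[OF BV_add[OF \<Omega>(1) u w]] .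
    qed
    show "F (cst_class \<Omega> (\<lambda>x. a * u x)) = a * F (cst_class \<Omega> u)" if u: "u \<in> BV \<Omega>" for u a
    proof -
      have "J (\<lambda>x. a * u x) = (LINT x|lebesgue_on \<Omega>. a * ((u x - mean \<Omega> u) * g x))"
        unfolding J_def mean_cmult by (intro Bochner_Integration.integral_cong refl) (simp add: algebra_simps)
      also have "\<dots> = a * J u" by (simp add: J_def)
      finally show ?thesis unfolding F[OF u] F[OF BV_cmult[OF u]] .
    qed
    fix \<epsilon> :: real assume "\<epsilon> > 0"
    \<comment> \<open>The constant \<open>\<bar>G\<bar> + 1\<close> is positive whatever the sign of
      \<open>G\<close>.\<close>
    have "\<bar>F (cst_class \<Omega> u)\<bar> \<le> (\<bar>G\<bar> + 1) * L1_norm \<Omega> (\<lambda>x. u x - mean \<Omega> u) + \<epsilon> * total_variation \<Omega> u"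
      if u: "u \<in> BV \<Omega>" for u
    proof -
      have "\<bar>J u\<bar> \<le> G * L1_norm \<Omega> (\<lambda>x. u x - mean \<Omega> u)"
        unfolding J_def L1_norm_def by (rule integrable_mult_bounded(2)[OF ii[OF u] g(1) gb])
      also have "\<dots> \<le> (\<bar>G\<bar> + 1) * L1_norm \<Omega> (\<lambda>x. u x - mean \<Omega> u)"
        by (intro mult_right_mono L1_norm_nonneg) simp
      also have "\<dots> \<le> (\<bar>G\<bar> + 1) * L1_norm \<Omega> (\<lambda>x. u x - mean \<Omega> u) + \<epsilon> * total_variation \<Omega> u"
        using \<open>\<epsilon> > 0\<close> total_variation_nonneg[OF \<Omega>(1) u] by simp
      finally show ?thesis unfolding F[OF u] .
    qed
    then show "\<exists>\<theta>>0. \<forall>u\<in>BV \<Omega>. \<bar>F (cst_class \<Omega> u)\<bar> \<le>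
        \<theta> * L1_norm \<Omega> (\<lambda>x. u x - mean \<Omega> u) + \<epsilon> * total_variation \<Omega> u"
      by (intro exI[of _ "\<bar>G\<bar> + 1"]) auto
  qed
  then show ?thesis using F unfolding J_def by (rule that)
qed

text \<open>The gliding hump argument of Sokal: \<open>g\<close> is a series of signs \<open>\<plusminus> 3\<^sup>-\<^sup>n sgn (f n)\<close>, the sign of
  the \<open>n\<close>-th term being chosen so that it does not cancel the integral of \<open>f n\<close> against the
  previous terms; the tail is too small to undo this.\<close>

lemma gliding_hump:
  fixes f :: "nat \<Rightarrow> 'a \<Rightarrow> real"
  assumes f: "\<And>n. integrable M (f n)"
  obtains g where "g \<in> borel_measurable M" "\<And>x. \<bar>g x\<bar> \<le> 3 / 2"
    "\<And>n. (LINT x|M. \<bar>f n x\<bar>) * (1 / 3) ^ n / 2 \<le> \<bar>LINT x|M. f n x * g x\<bar>"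
proof -
  define s where "s n x = (1 / 3) ^ n * sgn (f n x)" for n x
  define N where "N n = (LINT x|M. \<bar>f n x\<bar>)" for n
  \<comment> \<open>\<open>P n\<close> is the sum of the first \<open>n\<close> signed terms; the
    plus sign is chosen when adding \<open>s n\<close> already makes the integral against
    \<open>f n\<close> large.\<close>
  define P where "P = rec_nat (\<lambda>x. 0) (\<lambda>n h. \<lambda>x. h x +
    (if \<bar>LINT x|M. f n x * (h x + s n x)\<bar> \<ge> N n * (1 / 3) ^ n then 1 else - 1) * s n x)"
  define e where "e n = (if \<bar>LINT x|M. f n x * (P n x + s n x)\<bar> \<ge> N n * (1 / 3) ^ n then 1 else - 1 ::
    real)" for n
  have P0: "P 0 x = 0" and PS: "P (Suc n) x = P n x + e n * s n x" for n x by (simp_all add: P_def e_def)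
  have Psum: "P n x = (\<Sum>k<n. e k * s k x)" for n x by (induction n) (simp_all add: P0 PS)
  have es: "\<bar>e n * s n x\<bar> \<le> (1 / 3) ^ n" for n x
    by (auto simp: e_def s_def abs_mult sgn_if)
  have geo: "summable (\<lambda>n. (1 / 3 :: real) ^ n)" by (intro summable_geometric) simp
  have sm: "summable (\<lambda>n. e n * s n x)" for x
    by (rule summable_comparison_test'[OF geo, of 0]) (use es in simp)
  define g where "g x = (\<Sum>n. e n * s n x)" for x
  have [measurable]: "f n \<in> borel_measurable M" for n using f by auto
  have sM: "s n \<in> borel_measurable M" for n unfolding s_def[abs_def] by measurable
  have PM: "P n \<in> borel_measurable M" for n unfolding Psum[abs_def] using sM by measurable
  have gM: "g \<in> borel_measurable M" unfolding g_def[abs_def] using sM by measurable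
  have tail: "\<bar>g x - P n x\<bar> \<le> (1 / 3) ^ n * (3 / 2)" for n x
  proof -
    have "g x - P n x = (\<Sum>k. e (k + n) * s (k + n) x)"
      unfolding g_def Psum using suminf_split_initial_segment[OF sm, of x n] by simp
    also have "\<bar>\<dots>\<bar> \<le> (\<Sum>k. (1 / 3) ^ k * (1 / 3) ^ n)"
      unfolding real_norm_def[symmetric]
      by (rule norm_suminf_le[OF _ summable_mult2[OF geo]]) (use es[of "_ + n"] in \<open>simp add: power_add\<close>)
    also have "\<dots> = (1 / 3) ^ n * (3 / 2)"
      by (subst suminf_mult2[OF geo, symmetric]) (simp add: suminf_geometric)
    finally show ?thesis .
  qed
  show ?thesis
  proof
    show "g \<in> borel_measurable M" by fact
    show gb: "\<bar>g x\<bar> \<le> 3 / 2" for x using tail[of x 0] by (simp add: P0)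
    fix n
    have Pb: "\<bar>P n x\<bar> \<le> 3 / 2 + 3 / 2" for n x
    proof -
      have "(1 / 3) ^ n * (3 / 2) \<le> (3 / 2 :: real)" by (simp add: power_le_one)
      then show ?thesis using tail[of x n] gb[of x] by linarith
    qed
    have sb: "\<bar>s n x\<bar> \<le> 1" for x by (auto simp: s_def abs_mult sgn_if power_le_one)
    note iP = integrable_mult_bounded(1)[OF f PM Pb] and i_s = integrable_mult_bounded(1)[OF f sM sb]
      and ig = integrable_mult_bounded(1)[OF f gM gb]
    have fs: "(LINT x|M. f n x * s n x) = N n * (1 / 3) ^ n"
      unfolding N_def s_def by (subst integral_mult_left_zero[symmetric])
        (intro Bochner_Integration.integral_cong refl, simp add: sgn_if)
    \<comment> \<open>The integrals obtained with plus and with minus differ by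
      \<open>2 * N n * (1 / 3) ^ n\<close>, so at least one of them has modulus at least half of
      this.\<close>
    have big: "N n * (1 / 3) ^ n \<le> \<bar>LINT x|M. f n x * P (Suc n) x\<bar>"
    proof -
      have eq: "(LINT x|M. f n x * (P n x + c * s n x)) = (LINT x|M. f n x * P n x) + c * (N n * (1 / 3)
        ^ n)" for c
      proof -
        have "(LINT x|M. f n x * (P n x + c * s n x)) = (LINT x|M. f n x * P n x + c * (f n x * s n x))"
          by (simp add: algebra_simps)
        also have "\<dots> = (LINT x|M. f n x * P n x) + (LINT x|M. c * (f n x * s n x))"
          by (rule Bochner_Integration.integral_add[OF iP integrable_mult_right]) (rule i_s)
        finally show ?thesis using fs by simp
      qed
      have "N n * (1 / 3) ^ n \<ge> 0" by (simp add: N_def)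
      then show ?thesis
        unfolding PS using eq[of 1] eq[of "e n"] by (auto simp: e_def)
    qed
    \<comment> \<open>The terms after the \<open>n\<close>-th sum to at most
      \<open>(1 / 3) ^ Suc n * (3 / 2)\<close>, which is half of \<open>(1 / 3) ^ n\<close>; half of
      the lower bound survives.\<close>
    have "\<bar>LINT x|M. f n x * (g x - P (Suc n) x)\<bar> \<le> (1 / 3) ^ Suc n * (3 / 2) * N n"
      unfolding N_def by (rule integrable_mult_bounded(2)[OF f borel_measurable_diff[OF gM PM] tail])
    moreover have "(LINT x|M. f n x * (g x - P (Suc n) x)) = (LINT x|M. f n x * g x) - (LINT x|M. f n x
      * P (Suc n) x)"
      unfolding right_diff_distrib by (rule Bochner_Integration.integral_diff[OF ig iP])
    ultimately have "\<bar>(LINT x|M. f n x * g x) - (LINT x|M. f n x * P (Suc n) x)\<bar> \<le> N n * (1 / 3) ^ n / 2"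
      by (simp add: mult.commute)
    with big show "(LINT x|M. \<bar>f n x\<bar>) * (1 / 3) ^ n / 2 \<le> \<bar>LINT x|M. f n x * g x\<bar>"
      unfolding N_def[symmetric] by linarith
  qed
qed

lemma BV_poincare_of_surjective:
  fixes \<Omega> :: "(real ^ 'm) set"
  assumes \<Omega>: "open \<Omega>" "\<Omega> \<noteq> {}" and sur: "BV_cst_dual \<Omega> \<subseteq> div_op \<Omega> ` C0 \<Omega>"
  obtains c where "c > 0" "\<And>u. u \<in> BV \<Omega> \<Longrightarrow> L1_norm \<Omega> (\<lambda>x. u x - mean \<Omega> u) \<le> c * total_variation \<Omega> u"
proof (rule ccontr)
  assume no: "\<not> thesis"
  note obt = that
  have "\<exists>u. u \<in> BV \<Omega> \<and> L1_norm \<Omega> (\<lambda>x. u x - mean \<Omega> u) > c * total_variation \<Omega> u" if "c > 0" for c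
    using no obt[of c] that by (meson linorder_not_le)
  \<comment> \<open>The factor \<open>2 * 3 ^ n\<close> compensates the loss
    \<open>(1 / 3) ^ n / 2\<close> in \<open>gliding_hump\<close>; the factor \<open>Suc n\<close>
    will outgrow the sup norm of the field that represents the resulting form.\<close>
  then have "\<exists>u. u \<in> BV \<Omega> \<and> L1_norm \<Omega> (\<lambda>x. u x - mean \<Omega> u) > (2 * real (Suc n) * 3 ^ n) *
    total_variation \<Omega> u" for n
    by simp
  then obtain u where u: "\<And>n. u n \<in> BV \<Omega>"
    "\<And>n. L1_norm \<Omega> (\<lambda>x. u n x - mean \<Omega> (u n)) > (2 * real (Suc n) * 3 ^ n) * total_variation \<Omega> (u n)"
    by metis
  obtain g where g: "g \<in> borel_measurable (lebesgue_on \<Omega>)" "\<And>x. \<bar>g x\<bar> \<le> 3 / 2"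
    "\<And>n. (LINT x|lebesgue_on \<Omega>. \<bar>u n x - mean \<Omega> (u n)\<bar>) * (1 / 3) ^ n / 2 \<le>
      \<bar>LINT x|lebesgue_on \<Omega>. (u n x - mean \<Omega> (u n)) * g x\<bar>"
    by (rule gliding_hump[of "lebesgue_on \<Omega>" "\<lambda>n x. u n x - mean \<Omega> (u n)"])
       (rule integrable_minus_mean[OF \<Omega>(1) BV_integrable[OF u(1)]], rule that)
  obtain F where F: "F \<in> BV_cst_dual \<Omega>"
    "\<And>u. u \<in> BV \<Omega> \<Longrightarrow> F (cst_class \<Omega> u) = (LINT x|lebesgue_on \<Omega>. (u x - mean \<Omega> u) * g x)"
    by (rule bounded_form_in_dual[OF \<Omega> g(1) g(2)]) (rule that)
  obtain v where v: "v \<in> C0 \<Omega>" "F = div_op \<Omega> v" using sur F(1) by auto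
  obtain B where B: "B > 0" "\<And>x. x \<in> \<Omega> \<Longrightarrow> norm (v x) \<le> B" by (rule C0_bounded[OF v(1)]) (rule that)
  obtain n :: nat where n: "real n \<ge> B" using real_arch_simple by blast
  let ?T = "total_variation \<Omega> (u n)"
  have T: "?T \<ge> 0" by (rule total_variation_nonneg[OF \<Omega>(1) u(1)])
  have "real (Suc n) * ?T < L1_norm \<Omega> (\<lambda>x. u n x - mean \<Omega> (u n)) * (1 / 3) ^ n / 2"
    using u(2)[of n] by (simp add: field_simps)
  also have "\<dots> \<le> \<bar>F (cst_class \<Omega> (u n))\<bar>" using g(3)[of n] F(2)[OF u(1)] by (simp add: L1_norm_def)
  also have "\<dots> = \<bar>pairing \<Omega> v (u n)\<bar>" unfolding v(2) div_op_cst_class[OF \<Omega>(1) u(1)] by simp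
  also have "\<dots> \<le> B * ?T" by (rule abs_pairing_le[OF \<Omega>(1) u(1) v(1) B(2)]) (use B in auto)
  also have "\<dots> \<le> real (Suc n) * ?T" using n T by (intro mult_right_mono) auto
  finally show False by simp
qed

text \<open>The constant subtracted is \<open>mean \<Omega> u\<close>. An infinite gradient integral
  leaves nothing to prove; a finite one puts \<open>u\<close> into \<open>BV\<close> by
  \<open>smooth_BV\<close>.\<close>

lemma poincare_of_surjective:
  fixes \<Omega> :: "(real ^ 'm) set"
  assumes \<Omega>: "open \<Omega>" "\<Omega> \<noteq> {}" and sur: "BV_cst_dual \<Omega> \<subseteq> div_op \<Omega> ` C0 \<Omega>"
  shows "poincare_1_1 \<Omega>"
proof -
  obtain c where c: "c > 0" "\<And>u. u \<in> BV \<Omega> \<Longrightarrow> L1_norm \<Omega> (\<lambda>x. u x - mean \<Omega> u) \<le> c * total_variation \<Omega> u"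
    by (rule BV_poincare_of_surjective[OF assms]) (rule that)
  have "\<exists>y. (\<integral>\<^sup>+ x. ennreal \<bar>u x - y\<bar> \<partial>lebesgue_on \<Omega>) \<le> ennreal c * (\<integral>\<^sup>+ x. ennreal (norm (grad u x))
    \<partial>lebesgue_on \<Omega>)"
    if u: "smooth_on \<Omega> u" "u \<in> L1 \<Omega>" for u
  proof (cases "(\<integral>\<^sup>+ x. ennreal (norm (grad u x)) \<partial>lebesgue_on \<Omega>) = \<infinity>")
    case True
    then show ?thesis using c(1) by (simp add: ennreal_mult_top)
  next
    case False
    have "continuous_on \<Omega> (partial i u)" for i
      using u(1) unfolding smooth_on_def by (auto dest: spec[of _ "Suc 0"])
    then have "continuous_on \<Omega> (\<lambda>x. norm (grad u x))"
      unfolding grad_def by (intro continuous_on_norm continuous_on_vec_lambda)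
    then have m: "(\<lambda>x. norm (grad u x)) \<in> borel_measurable (lebesgue_on \<Omega>)"
      using \<Omega>(1) by (intro continuous_imp_measurable_on_sets_lebesgue) simp_all
    have g: "integrable (lebesgue_on \<Omega>) (\<lambda>x. norm (grad u x))"
      using False m by (intro integrableI_bounded) (auto simp: less_top)
    note BV = smooth_BV[OF \<Omega>(1) u g]
    note ii = integrable_minus_mean[OF \<Omega>(1) BV_integrable[OF BV(1)]]
    have "(\<integral>\<^sup>+ x. ennreal \<bar>u x - mean \<Omega> u\<bar> \<partial>lebesgue_on \<Omega>) = ennreal (L1_norm \<Omega> (\<lambda>x. u x - mean \<Omega> u))"
      unfolding L1_norm_def using ii by (intro nn_integral_eq_integral) auto
    also have "\<dots> \<le> ennreal (c * (LINT x|lebesgue_on \<Omega>. norm (grad u x)))"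
      using c(2)[OF BV(1)] BV(2) c(1) by (intro ennreal_leI) (meson less_imp_le mult_left_mono order_trans)
    also have "\<dots> = ennreal c * ennreal (LINT x|lebesgue_on \<Omega>. norm (grad u x))"
      using c(1) by (intro ennreal_mult) auto
    also have "ennreal (LINT x|lebesgue_on \<Omega>. norm (grad u x)) = (\<integral>\<^sup>+ x. ennreal (norm (grad u x))
      \<partial>lebesgue_on \<Omega>)"
      using g by (intro nn_integral_eq_integral[symmetric]) auto
    finally show ?thesis by blast
  qed
  then show ?thesis unfolding poincare_1_1_def using c(1) by blast
qed

section \<open>The translation estimate\<close>

text \<open>The increment \<open>g 1 - g 0\<close> telescopes over the nodes, the mean value theorem
  turns each piece into a value of \<open>g'\<close> in its subinterval, and uniform continuity of
  \<open>g'\<close> moves that value to the left node.\<close>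

lemma riemann_sum_derivative_tendsto:
  fixes g g' :: "real \<Rightarrow> real"
  assumes d: "\<And>s. (g has_real_derivative g' s) (at s)" and c: "continuous_on UNIV g'"
  shows "(\<lambda>N. (\<Sum>j<Suc N. g' (real j / real (Suc N))) / real (Suc N)) \<longlonglongrightarrow> g 1 - g 0"
proof (rule LIMSEQ_I)
  fix r :: real assume r: "r > 0"
  have "uniformly_continuous_on {0..1} g'"
    by (intro compact_uniformly_continuous continuous_on_subset[OF c]) auto
  then obtain \<delta> where \<delta>: "\<delta> > 0" "\<And>s t. s \<in> {0..1} \<Longrightarrow> t \<in> {0..1} \<Longrightarrow> dist s t < \<delta> \<Longrightarrow> dist (g' s) (g' t) < r / 2"
    unfolding uniformly_continuous_on_def using r by (metis half_gt_zero)
  obtain N0 :: nat where N0: "inverse (real (Suc N0)) < \<delta>" using reals_Archimedean[OF \<delta>(1)] by blast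
  show "\<exists>no. \<forall>N\<ge>no. norm ((\<Sum>j<Suc N. g' (real j / real (Suc N))) / real (Suc N) - (g 1 - g 0)) < r"
  proof (intro exI[of _ N0] allI impI)
    fix N assume N: "N \<ge> N0"
    define n where "n = real (Suc N)"
    have n: "n > 0" by (simp add: n_def)
    have small: "1 / n < \<delta>"
      using N0 N by (smt (verit, ccfv_threshold) inverse_eq_divide le_imp_inverse_le n_def
        of_nat_0_less_iff of_nat_le_iff Suc_le_mono zero_less_Suc)
    have tele: "g 1 - g 0 = (\<Sum>j<Suc N. g (real (Suc j) / n) - g (real j / n))"
      using sum_lessThan_telescope[of "\<lambda>j. g (real j / n)" "Suc N"] n
        by (simp add: n_def del: sum.lessThan_Suc of_nat_Suc)
    have each: "\<bar>g' (real j / n) / n - (g (real (Suc j) / n) - g (real j / n))\<bar> \<le> r / 2 / n"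
      if j: "j < Suc N" for j
    proof -
      have lt: "real j / n < real (Suc j) / n" using n by (simp add: divide_strict_right_mono)
      obtain z where z: "real j / n < z" "z < real (Suc j) / n"
        "g (real (Suc j) / n) - g (real j / n) = (real (Suc j) / n - real j / n) * g' z"
        using MVT2[OF lt, of g g'] d by blast
      have le1: "real (Suc j) / n \<le> 1" using j n by (simp add: n_def)
      have w: "real (Suc j) / n - real j / n = 1 / n" by (simp add: diff_divide_distrib[symmetric])
      have j0: "real j / n \<ge> 0" using n by simp
      have "dist (g' (real j / n)) (g' z) < r / 2"
        by (rule \<delta>(2)) (use z le1 w small j0 in \<open>auto simp: dist_real_def\<close>)
      then have "\<bar>g' (real j / n) - g' z\<bar> / n \<le> r / 2 / n" using n
        by (intro divide_right_mono) (auto simp: dist_real_def)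
      moreover have "g' (real j / n) / n - (g (real (Suc j) / n) - g (real j / n)) = (g' (real j / n) -
        g' z) / n"
        unfolding z(3) w by (simp add: diff_divide_distrib)
      ultimately show ?thesis using n by (simp add: abs_divide)
    qed
    have "\<bar>(\<Sum>j<Suc N. g' (real j / n)) / n - (g 1 - g 0)\<bar> =
        \<bar>\<Sum>j<Suc N. g' (real j / n) / n - (g (real (Suc j) / n) - g (real j / n))\<bar>"
      unfolding tele sum_subtractf sum_divide_distrib ..
    also have "\<dots> \<le> (\<Sum>j<Suc N. r / 2 / n)" by (rule order_trans[OF sum_abs sum_mono]) (use each in simp)
    also have "\<dots> = n * (r / 2 / n)" unfolding n_def by (simp only: sum_constant card_lessThan)
    also have "\<dots> = r / 2" using n by simp
    finally show "norm ((\<Sum>j<Suc N. g' (real j / real (Suc N))) / real (Suc N) - (g 1 - g 0)) < r"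
      using r unfolding n_def real_norm_def by linarith
  qed
qed

text \<open>Inner regularity from an F-sigma kernel: growing finite unions of its closed pieces are
  intersected with growing balls. The eventual membership is the form that suits dominated
  convergence.\<close>

lemma lebesgue_compact_exhaustion:
  fixes P :: "(real ^ 'm) set"
  assumes "P \<in> sets lebesgue"
  obtains K T where "\<And>n::nat. compact (K n)" "\<And>n. K n \<subseteq> P" "T \<in> null_sets lebesgue"
    "\<And>x. x \<in> P - T \<Longrightarrow> \<forall>\<^sub>F n in sequentially. x \<in> K n"
proof -
  obtain C T where CT: "fsigma C" "T \<in> null_sets lebesgue" "C \<union> T = P" "disjnt C T"
    by (rule lebesgue_set_almost_fsigma[OF assms])
  from CT(1) obtain F where F: "\<And>n::nat. closed (F n)" "C = (\<Union>n. F n)" by (cases rule: fsigma.cases) auto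
  define K where "K n = cball 0 (real n) \<inter> (\<Union>i\<le>n. F i)" for n
  show ?thesis
  proof (rule that[of K T])
    show "compact (K n)" for n unfolding K_def using F by (intro compact_Int_closed closed_UN) auto
    show "K n \<subseteq> P" for n using CT F by (auto simp: K_def)
    show "T \<in> null_sets lebesgue" by fact
    fix x assume "x \<in> P - T"
    then obtain i where i: "x \<in> F i" using CT F by auto
    obtain k :: nat where k: "norm x \<le> real k" using real_arch_simple by blast
    have "x \<in> K n" if "n \<ge> max i k" for n using that i k by (auto simp: K_def)
    then show "\<forall>\<^sub>F n in sequentially. x \<in> K n" unfolding eventually_sequentially by blast
  qed
qed

text \<open>Both Urysohn functions are made to vanish on the zero set of \<open>\<sigma>\<close>, so
  their difference is carried by a compact subset of \<open>U\<close>; test functions approximate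
  that difference uniformly.\<close>

lemma test_function_separating:
  fixes K L U :: "(real ^ 'm) set"
  assumes U: "open U" and K: "compact K" "K \<subseteq> U" and L: "compact L" "L \<subseteq> U" and "K \<inter> L = {}" and e: "e > 0"
  obtains \<phi> where "test_function U \<phi>" "\<And>x. \<bar>\<phi> x\<bar> \<le> 1 + e" "\<And>x. x \<in> K \<Longrightarrow> \<bar>\<phi> x - 1\<bar> \<le> e" "\<And>x. x \<in> L \<Longrightarrow> \<bar>\<phi> x
    + 1\<bar> \<le> e"
proof -
  obtain \<sigma> where \<sigma>: "test_function U \<sigma>" "\<And>x. \<sigma> x \<ge> 0" "\<And>x. x \<in> K \<union> L \<Longrightarrow> \<sigma> x > 0"
    by (rule test_function_positive_on_compact[of "K \<union> L" U]) (use assms in \<open>auto intro: compact_Un\<close>)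
  define Z where "Z = {x. \<sigma> x = 0}"
  have cZ: "closed Z" unfolding Z_def
    by (intro closed_Collect_eq test_function_continuous[OF \<sigma>(1)] continuous_on_const)
  have "\<sigma> x \<noteq> 0" if "x \<in> K \<union> L" for x using \<sigma>(3)[OF that] by simp
  then have KZ: "K \<inter> (Z \<union> L) = {}" "L \<inter> (Z \<union> K) = {}" using assms(6) by (auto simp: Z_def)
  obtain p :: "real ^ 'm \<Rightarrow> real" where p: "continuous_on UNIV p" "\<And>x. p x \<in> closed_segment 1 0"
    "\<And>x. x \<in> K \<Longrightarrow> p x = 1" "\<And>x. x \<in> Z \<union> L \<Longrightarrow> p x = 0"
    by (rule Urysohn[OF compact_imp_closed[OF K(1)] closed_Un[OF cZ compact_imp_closed[OF L(1)]] KZ(1),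
      of 1 0]) (rule that)
  obtain q :: "real ^ 'm \<Rightarrow> real" where q: "continuous_on UNIV q" "\<And>x. q x \<in> closed_segment 1 0"
    "\<And>x. x \<in> L \<Longrightarrow> q x = 1" "\<And>x. x \<in> Z \<union> K \<Longrightarrow> q x = 0"
    by (rule Urysohn[OF compact_imp_closed[OF L(1)] closed_Un[OF cZ compact_imp_closed[OF K(1)]] KZ(2),
      of 1 0]) (rule that)
  have pq: "0 \<le> p x" "p x \<le> 1" "0 \<le> q x" "q x \<le> 1" for x
    using p(2)[of x] q(2)[of x] by (auto simp: closed_segment_eq_real_ivl)
  from \<sigma>(1) obtain S where S: "compact S" "S \<subseteq> U" "\<And>x. x \<notin> S \<Longrightarrow> \<sigma> x = 0"
    by (rule test_functionE) blast
  have g0: "p x - q x = 0" if "x \<notin> S" for x using S(3)[OF that] p(4)[of x] q(4)[of x] by (simp add: Z_def)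
  obtain \<phi> where \<phi>: "test_function U \<phi>" "\<And>x. \<bar>\<phi> x - (p x - q x)\<bar> < e"
    by (rule test_function_dense[OF continuous_on_diff[OF p(1) q(1)] S(1,2) U _ e], rule g0, assumption,
      rule that)
  show ?thesis
  proof (rule that[OF \<phi>(1)])
    show "\<bar>\<phi> x\<bar> \<le> 1 + e" for x using \<phi>(2)[of x] pq[of x] by linarith
    show "\<bar>\<phi> x - 1\<bar> \<le> e" if "x \<in> K" for x using \<phi>(2)[of x] p(3)[OF that] q(4)[of x] that by simp
    show "\<bar>\<phi> x + 1\<bar> \<le> e" if "x \<in> L" for x using \<phi>(2)[of x] q(3)[OF that] p(4)[of x] that by simp
  qed
qed

text \<open>Compact exhaustions of the sets in \<open>U\<close> where \<open>f\<close> is positive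
  and where it is negative yield test functions \<open>\<psi> n\<close> for which
  \<open>f x * \<psi> n x\<close> tends almost everywhere to \<open>\<bar>f x\<bar>\<close> on
  \<open>U\<close>; dominated convergence carries the bound over.\<close>

lemma L1_bound_by_duality:
  fixes f :: "real ^ 'm \<Rightarrow> real"
  assumes f: "integrable lebesgue f" and U: "open U"
    and le: "\<And>\<phi>. test_function U \<phi> \<Longrightarrow> (\<And>x. \<bar>\<phi> x\<bar> \<le> 1) \<Longrightarrow> (LINT x|lebesgue. f x * \<phi> x) \<le> C"
  shows "(LINT x|lebesgue. indicator U x * \<bar>f x\<bar>) \<le> C"
proof -
  have fm: "f \<in> borel_measurable lebesgue" using f by auto
  have Us: "U \<in> sets lebesgue" using U by simp
  have "{x \<in> space lebesgue. f x > 0} \<in> sets lebesgue" "{x \<in> space lebesgue. f x < 0} \<in> sets lebesgue"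
    by (rule borel_measurable_less[OF borel_measurable_const fm], rule borel_measurable_less[OF fm
      borel_measurable_const])
  then have PQ: "U \<inter> {x. f x > 0} \<in> sets lebesgue" "U \<inter> {x. f x < 0} \<in> sets lebesgue"
    using Us by (auto intro: sets.Int)
  obtain K S where K: "\<And>n::nat. compact (K n)" "\<And>n. K n \<subseteq> U \<inter> {x. f x > 0}" "S \<in> null_sets lebesgue"
    "\<And>x. x \<in> U \<inter> {x. f x > 0} - S \<Longrightarrow> \<forall>\<^sub>F n in sequentially. x \<in> K n"
    by (rule lebesgue_compact_exhaustion[OF PQ(1)]) (rule that)
  obtain L T where L: "\<And>n::nat. compact (L n)" "\<And>n. L n \<subseteq> U \<inter> {x. f x < 0}" "T \<in> null_sets lebesgue"
    "\<And>x. x \<in> U \<inter> {x. f x < 0} - T \<Longrightarrow> \<forall>\<^sub>F n in sequentially. x \<in> L n"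
    by (rule lebesgue_compact_exhaustion[OF PQ(2)]) (rule that)
  define e where "e n = inverse (real (Suc n))" for n
  have e: "e n > 0" for n by (simp add: e_def)
  have e0: "e \<longlonglongrightarrow> 0" unfolding e_def using LIMSEQ_inverse_real_of_nat .
  have "\<exists>\<phi>. test_function U \<phi> \<and> (\<forall>x. \<bar>\<phi> x\<bar> \<le> 1 + e n) \<and> (\<forall>x\<in>K n. \<bar>\<phi> x - 1\<bar> \<le> e n) \<and> (\<forall>x\<in>L n. \<bar>\<phi> x + 1\<bar> \<le>
    e n)" for n
  proof -
    have "K n \<subseteq> U" "L n \<subseteq> U" using K(2) L(2) by auto
    moreover have "K n \<inter> L n = {}"
    proof -
      have False if "x \<in> K n" "x \<in> L n" for x using K(2)[of n] L(2)[of n] that by force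
      then show ?thesis by blast
    qed
    ultimately show ?thesis by (rule test_function_separating[OF U K(1) _ L(1) _ _ e]) blast
  qed
  then obtain \<phi> where \<phi>: "\<And>n. test_function U (\<phi> n)" "\<And>n x. \<bar>\<phi> n x\<bar> \<le> 1 + e n"
    "\<And>n x. x \<in> K n \<Longrightarrow> \<bar>\<phi> n x - 1\<bar> \<le> e n" "\<And>n x. x \<in> L n \<Longrightarrow> \<bar>\<phi> n x + 1\<bar> \<le> e n" by metis
  \<comment> \<open>Division by \<open>1 + e n\<close> restores the bound 1 that \<open>le\<close>
    requires of its test functions.\<close>
  define \<psi> where "\<psi> n x = inverse (1 + e n) * \<phi> n x" for n x
  have \<psi>: "test_function U (\<psi> n)" for n unfolding \<psi>_def by (rule test_function_cmult[OF \<phi>(1)])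
  have \<psi>1: "\<bar>\<psi> n x\<bar> \<le> 1" for n x
    using \<phi>(2)[of n x] e[of n] by (simp add: \<psi>_def abs_mult field_simps)
  have \<psi>0: "\<psi> n x = 0" if "x \<notin> U" for n x
    by (rule test_functionE[OF \<psi>[of n]]) (use that in blast)
  have einv: "(\<lambda>n. inverse (1 + e n)) \<longlonglongrightarrow> 1"
    using tendsto_inverse[OF tendsto_add[OF tendsto_const e0], of 1] by simp
  have lim: "(\<lambda>n. f x * \<psi> n x) \<longlonglongrightarrow> indicator U x * \<bar>f x\<bar>" if x: "x \<notin> S" "x \<notin> T" for x
  proof -
    consider "x \<notin> U" | "f x = 0" | "x \<in> U" "f x > 0" | "x \<in> U" "f x < 0" by linarith
    then show ?thesis
    proof cases
      case 1 then show ?thesis using \<psi>0[OF 1] by simp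
    next
      case 2 then show ?thesis by simp
    next
      case 3
      have ev: "\<forall>\<^sub>F n in sequentially. norm (\<phi> n x - 1) \<le> e n"
        using K(4)[of x] 3 x(1) \<phi>(3) by (auto elim!: eventually_mono)
      have "(\<lambda>n. \<phi> n x) \<longlonglongrightarrow> 1" by (rule LIM_zero_cancel, rule Lim_null_comparison[OF ev e0])
      from tendsto_mult[OF tendsto_const tendsto_mult[OF einv this]] show ?thesis using 3 by (simp add: \<psi>_def)
    next
      case 4
      have ev: "\<forall>\<^sub>F n in sequentially. norm (\<phi> n x - (- 1)) \<le> e n"
        using L(4)[of x] 4 x(2) \<phi>(4) by (auto elim!: eventually_mono)
      have "(\<lambda>n. \<phi> n x) \<longlonglongrightarrow> - 1" by (rule LIM_zero_cancel, rule Lim_null_comparison[OF ev e0])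
      from tendsto_mult[OF tendsto_const tendsto_mult[OF einv this]] show ?thesis using 4 by (simp add: \<psi>_def)
    qed
  qed
  have \<psi>m: "\<psi> n \<in> borel_measurable lebesgue" for n
    using continuous_imp_measurable_on_sets_lebesgue[OF test_function_continuous[OF \<psi>]] by simp
  have "(\<lambda>n. LINT x|lebesgue. f x * \<psi> n x) \<longlonglongrightarrow> (LINT x|lebesgue. indicator U x * \<bar>f x\<bar>)"
  proof (rule integral_dominated_convergence)
    show "integrable lebesgue (\<lambda>x. \<bar>f x\<bar>)" using f by simp
    show "(\<lambda>x. indicator U x * \<bar>f x\<bar>) \<in> borel_measurable lebesgue"
      using fm Us by (intro borel_measurable_times borel_measurable_indicator borel_measurable_abs) auto
    show "(\<lambda>x. f x * \<psi> n x) \<in> borel_measurable lebesgue" for n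
      by (intro borel_measurable_times fm \<psi>m)
    have "AE x in lebesgue. x \<notin> S" "AE x in lebesgue. x \<notin> T" using K(3) L(3) by (auto intro: AE_not_in)
    then show "AE x in lebesgue. (\<lambda>n. f x * \<psi> n x) \<longlonglongrightarrow> indicator U x * \<bar>f x\<bar>"
      by eventually_elim (rule lim)
    show "AE x in lebesgue. norm (f x * \<psi> n x) \<le> \<bar>f x\<bar>" for n
      using \<psi>1 by (intro AE_I2) (simp add: abs_mult mult_left_le)
  qed
  then show ?thesis by (rule LIMSEQ_le_const2) (use le[OF \<psi> \<psi>1] in blast)
qed

lemma test_field_translate_direction:
  fixes \<phi> :: "real ^ 'm \<Rightarrow> real"
  assumes "test_function A \<phi>" "\<And>y. y \<in> A \<Longrightarrow> y + s *\<^sub>R h \<in> \<Omega>"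
  shows "test_field \<Omega> (\<lambda>x. \<phi> (x - s *\<^sub>R h) *\<^sub>R h)"
    and "divergence (\<lambda>x. \<phi> (x - s *\<^sub>R h) *\<^sub>R h) x = (\<Sum>i\<in>UNIV. h $ i * partial i \<phi> (x - s *\<^sub>R h))"
proof -
  have t: "test_function \<Omega> (\<lambda>x. \<phi> (x - s *\<^sub>R h))"
    using test_function_translate[OF assms(1), of "- (s *\<^sub>R h)" \<Omega>] assms(2) by simp
  then show "test_field \<Omega> (\<lambda>x. \<phi> (x - s *\<^sub>R h) *\<^sub>R h)"
    unfolding test_field_def using test_function_cmult[OF t] by (simp add: mult.commute)
  show "divergence (\<lambda>x. \<phi> (x - s *\<^sub>R h) *\<^sub>R h) x = (\<Sum>i\<in>UNIV. h $ i * partial i \<phi> (x - s *\<^sub>R h))"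
    unfolding divergence_def
  proof (rule sum.cong[OF refl])
    fix i
    have "partial i (\<lambda>y. h $ i * \<phi> (y - s *\<^sub>R h)) x = h $ i * partial i (\<lambda>y. \<phi> (y - s *\<^sub>R h)) x"
      by (rule partial_cmult[OF test_function_differentiable[OF t]])
    also have "partial i (\<lambda>y. \<phi> (y - s *\<^sub>R h)) x = partial i \<phi> (x - s *\<^sub>R h)"
      using partial_compose_translate[of \<phi> x "- (s *\<^sub>R h)" i] test_function_differentiable[OF assms(1)]
        by simp
    finally show "partial i (\<lambda>y. (\<phi> (y - s *\<^sub>R h) *\<^sub>R h) $ i) x = h $ i * partial i \<phi> (x - s *\<^sub>R h)"
      by (simp add: mult.commute)
  qed
qed

text \<open>The difference \<open>\<phi> (x - h) - \<phi> x\<close> is a limit of divergences of the fields \<open>v N\<close>, the Riemann sums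
  of \<open>- h \<integral>\<^sub>0\<^sup>1 \<phi> (x - s h) ds\<close>; working with the sums avoids differentiation under the integral.\<close>

lemma translation_estimate:
  fixes u :: "real ^ 'm \<Rightarrow> real"
  assumes u: "integrable lebesgue u" and t: "t \<ge> 0"
    and le: "\<And>v. test_field \<Omega> v \<Longrightarrow> (\<And>x. norm (v x) \<le> 1) \<Longrightarrow> (LINT x|lebesgue. u x * divergence v x) \<le> t"
    and A: "open A" "\<And>y s. y \<in> A \<Longrightarrow> 0 \<le> s \<Longrightarrow> s \<le> 1 \<Longrightarrow> y + s *\<^sub>R h \<in> \<Omega>"
  shows "(LINT x|lebesgue. indicator A x * \<bar>u (x + h) - u x\<bar>) \<le> norm h * t"
proof (rule L1_bound_by_duality[OF _ A(1)])
  note ut = integral_translate[OF u, of h]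
  show "integrable lebesgue (\<lambda>x. u (x + h) - u x)" using ut u by simp
  fix \<phi> assume \<phi>: "test_function A \<phi>" "\<And>x. \<bar>\<phi> x\<bar> \<le> 1"
  obtain B where B: "B > 0" "\<And>x. \<bar>\<phi> x\<bar> \<le> B" "\<And>i x. \<bar>partial i \<phi> x\<bar> \<le> B"
    by (rule test_function_bounded[OF \<phi>(1)]) (rule that)
  define s where "s N j = real j / real (Suc N)" for N j :: nat
  have s01: "0 \<le> s N j" "s N j \<le> 1" if "j < Suc N" for N j using that by (auto simp: s_def)
  define w where "w N = (\<lambda>x. \<Sum>j<Suc N. \<phi> (x - s N j *\<^sub>R h) *\<^sub>R h)" for N
  define v where "v N = (\<lambda>x. (- inverse (real (Suc N))) *\<^sub>R w N x)" for N
  \<comment> \<open>Each summand is supported in the translate of \<open>A\<close> by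
    \<open>s N j *\<^sub>R h\<close>, which lies in \<open>\<Omega>\<close> by the assumption on
    segments.\<close>
  have wj: "test_field \<Omega> (\<lambda>x. \<phi> (x - s N j *\<^sub>R h) *\<^sub>R h)" if "j \<in> {..<Suc N}" for N j
    using that s01 by (intro test_field_translate_direction(1)[OF \<phi>(1)] A(2)) auto
  have w: "test_field \<Omega> (w N)" for N unfolding w_def by (rule test_field_sum[OF wj])
  have v: "test_field \<Omega> (v N)" for N unfolding v_def by (rule test_field_scaleR[OF w])
  have vn: "norm (v N x) \<le> norm h" for N x
  proof -
    have "norm (w N x) \<le> (\<Sum>j<Suc N. norm h)"
      unfolding w_def using \<phi>(2) by (intro sum_norm_le) (simp add: mult_right_le_one_le mult_left_le_one_le)
    then have "norm (w N x) \<le> real (Suc N) * norm h" by (simp del: sum.lessThan_Suc)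
    then show ?thesis unfolding v_def by (simp add: field_simps)
  qed
  define g' where "g' x \<sigma> = - (\<Sum>i\<in>UNIV. h $ i * partial i \<phi> (x - \<sigma> *\<^sub>R h))" for x \<sigma>
  have div: "divergence (v N) x = (\<Sum>j<Suc N. g' x (s N j)) / real (Suc N)" for N x
  proof -
    have "divergence (w N) x = (\<Sum>j<Suc N. divergence (\<lambda>x. \<phi> (x - s N j *\<^sub>R h) *\<^sub>R h) x)"
      unfolding w_def by (rule divergence_sum[OF wj])
    also have "\<dots> = (\<Sum>j<Suc N. - g' x (s N j))"
      using s01 by (intro sum.cong refl) (subst test_field_translate_direction(2)[OF \<phi>(1), of _ _ \<Omega>],
        auto simp: g'_def intro: A(2))
    finally show ?thesis
      unfolding v_def divergence_scaleR[OF w]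
        by (simp add: sum_negf divide_inverse mult.commute del: sum.lessThan_Suc)
  qed
  have lim: "(\<lambda>N. divergence (v N) x) \<longlonglongrightarrow> \<phi> (x - h) - \<phi> x" for x
  proof -
    have d: "((\<lambda>\<sigma>. \<phi> (x - \<sigma> *\<^sub>R h)) has_real_derivative g' x \<sigma>) (at \<sigma>)" for \<sigma>
      using has_real_derivative_along[OF test_function_differentiable[OF \<phi>(1)],
        where x = x and s = \<sigma> and h = "- h"]
      by (simp add: g'_def sum_negf)
    have "continuous_on UNIV (g' x)"
      unfolding g'_def
      by (intro continuous_intros continuous_on_compose2[OF test_function_partial_continuous[OF \<phi>(1)]]) auto
    from riemann_sum_derivative_tendsto[OF d this] show ?thesis unfolding div s_def by simp
  qed
  define D where "D = (\<Sum>i\<in>UNIV. \<bar>h $ i\<bar> * B)"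
  have g'b: "\<bar>g' x \<sigma>\<bar> \<le> D" for x \<sigma>
    unfolding g'_def D_def abs_minus_cancel
    by (rule order_trans[OF sum_abs sum_mono]) (simp add: abs_mult B(3) mult_left_mono)
  have divb: "\<bar>divergence (v N) x\<bar> \<le> D" for N x
  proof -
    have "\<bar>\<Sum>j<Suc N. g' x (s N j)\<bar> \<le> (\<Sum>j<Suc N. D)" by (rule order_trans[OF sum_abs sum_mono]) (rule g'b)
    then have "\<bar>\<Sum>j<Suc N. g' x (s N j)\<bar> \<le> real (Suc N) * D" by (simp del: sum.lessThan_Suc)
    then show ?thesis unfolding div by (simp add: abs_divide field_simps del: sum.lessThan_Suc)
  qed
  have um: "u \<in> borel_measurable lebesgue" using u by auto
  have c\<phi>: "continuous_on UNIV \<phi>" by (rule test_function_continuous[OF \<phi>(1)])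
  have cm: "k \<in> borel_measurable lebesgue" if "continuous_on UNIV k" for k :: "real ^ 'm \<Rightarrow> real"
    using continuous_imp_measurable_on_sets_lebesgue[OF that] by simp
  have \<phi>h: "continuous_on UNIV (\<lambda>x. \<phi> (x - h))"
    by (rule continuous_on_compose2[OF c\<phi>]) (auto intro: continuous_intros)
  have i1: "integrable lebesgue (\<lambda>x. u x * \<phi> x)" "integrable lebesgue (\<lambda>x. u (x + h) * \<phi> x)"
    by (rule integrable_mult_bounded(1)[OF u cm[OF c\<phi>] \<phi>(2)], rule integrable_mult_bounded(1)[OF ut(1)
      cm[OF c\<phi>] \<phi>(2)])
  have i2: "integrable lebesgue (\<lambda>x. u x * \<phi> (x - h))"
    by (rule integrable_mult_bounded(1)[OF u cm[OF \<phi>h] \<phi>(2)])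
  have "(\<lambda>N. LINT x|lebesgue. u x * divergence (v N) x) \<longlonglongrightarrow> (LINT x|lebesgue. u x * (\<phi> (x - h) - \<phi> x))"
  proof (rule integral_dominated_convergence)
    show "integrable lebesgue (\<lambda>x. D * \<bar>u x\<bar>)" using u by simp
    show "(\<lambda>x. u x * (\<phi> (x - h) - \<phi> x)) \<in> borel_measurable lebesgue"
      by (intro borel_measurable_times borel_measurable_diff um cm[OF c\<phi>] cm[OF \<phi>h])
    show "(\<lambda>x. u x * divergence (v N) x) \<in> borel_measurable lebesgue" for N
      by (intro borel_measurable_times um cm[OF divergence_continuous[OF v]])
    show "AE x in lebesgue. (\<lambda>N. u x * divergence (v N) x) \<longlonglongrightarrow> u x * (\<phi> (x - h) - \<phi> x)"
      by (intro AE_I2 tendsto_mult tendsto_const lim)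
    show "AE x in lebesgue. norm (u x * divergence (v N) x) \<le> D * \<bar>u x\<bar>" for N
    proof (intro AE_I2)
      show "norm (u x * divergence (v N) x) \<le> D * \<bar>u x\<bar>" for x
        using mult_left_mono[OF divb[of N x] abs_ge_zero[of "u x"]] by (simp add: abs_mult mult.commute)
    qed
  qed
  \<comment> \<open>The field \<open>v N\<close> has norm up to \<open>norm h\<close> and is divided
    by it before the hypothesis applies; for \<open>h = 0\<close> the field is zero.\<close>
  moreover have "(LINT x|lebesgue. u x * divergence (v N) x) \<le> norm h * t" for N
  proof (cases "h = 0")
    case True
    then have "v N = (\<lambda>x. 0)" using vn[of N] by (auto simp: fun_eq_iff)
    then show ?thesis using True by simp
  next
    case False
    have "(LINT x|lebesgue. u x * divergence (\<lambda>x. inverse (norm h) *\<^sub>R v N x) x) \<le> t"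
      using vn[of N] False by (intro le test_field_scaleR v) (simp add: field_simps)
    then have "inverse (norm h) * (LINT x|lebesgue. u x * divergence (v N) x) \<le> t"
      unfolding divergence_scaleR[OF v] mult.left_commute[of "u _"] by simp
    then show ?thesis using False by (simp add: field_simps)
  qed
  ultimately have "(LINT x|lebesgue. u x * (\<phi> (x - h) - \<phi> x)) \<le> norm h * t"
    by (intro LIMSEQ_le_const2) auto
  moreover have "(LINT x|lebesgue. u x * (\<phi> (x - h) - \<phi> x)) = (LINT x|lebesgue. (u (x + h) - u x) * \<phi> x)"
  proof -
    have "(LINT x|lebesgue. u x * \<phi> (x - h)) = (LINT x|lebesgue. u (x + h) * \<phi> x)"
      using integral_translate(2)[OF i2, of h] by simp
    then show ?thesis using i1 i2 by (simp add: right_diff_distrib left_diff_distrib)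
  qed
  ultimately show "(LINT x|lebesgue. (u (x + h) - u x) * \<phi> x) \<le> norm h * t" by simp
qed

section \<open>Averages over cells\<close>

lemma AE_lebesgue_translate:
  fixes h :: "'a::euclidean_space"
  assumes "AE x in lebesgue. P x" shows "AE x in lebesgue. P (x + h)"
  by (rule AE_distrD[OF distr_lebesgue_translate(2)]) (subst distr_lebesgue_translate(1), rule assms)

text \<open>\<open>cell_estimate\<close> applies Tonelli over \<open>lborel\<close> and works with a
  Borel function. Translates of \<open>u\<close> and of its Borel version still agree almost
  everywhere, since null sets are translation invariant.\<close>

lemma borel_version:
  fixes u :: "real ^ 'm \<Rightarrow> real"
  assumes u: "integrable lebesgue u"
  obtains G where "integrable lborel G" "AE x in lebesgue. u x = G x"
    "\<And>A h. A \<in> sets borel \<Longrightarrow> (\<integral>\<^sup>+ x. indicator A x * ennreal \<bar>G (x + h) - G x\<bar> \<partial>lborel) =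
      ennreal (LINT x|lebesgue. indicator A x * \<bar>u (x + h) - u x\<bar>)"
proof -
  obtain G where G: "G \<in> borel_measurable lborel" "AE x in lborel. u x = G x"
    using completion_ex_borel_measurable_real[OF borel_measurable_integrable[OF u]] by blast
  then have ae: "AE x in lebesgue. u x = G x" by (auto intro: AE_completion)
  have Gb: "G \<in> borel_measurable borel" using G(1) by simp
  have iL: "integrable lebesgue G"
    by (rule integrable_cong_AE_imp[OF u measurable_completion[OF G(1)]]) (use ae in \<open>auto elim:
      eventually_mono\<close>)
  then have i: "integrable lborel G" using integrable_completion[OF G(1)] by simp
  show ?thesis
  proof (rule that[OF i ae])
    fix A :: "(real ^ 'm) set" and h :: "real ^ 'm" assume A: "A \<in> sets borel"
    have Al: "A \<in> sets lebesgue" using A by simp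
    have iu: "integrable lebesgue (\<lambda>x. indicator A x * \<bar>u (x + h) - u x\<bar>)"
    proof -
      have "integrable lebesgue (\<lambda>x. indicator A x *\<^sub>R \<bar>u (x + h) - u x\<bar>)"
        using integral_translate(1)[OF u, of h] u Al
        by (intro integrable_mult_indicator integrable_abs Bochner_Integration.integrable_diff) auto
      then show ?thesis by simp
    qed
    have "(\<integral>\<^sup>+ x. indicator A x * ennreal \<bar>G (x + h) - G x\<bar> \<partial>lborel) =
        (\<integral>\<^sup>+ x. indicator A x * ennreal \<bar>G (x + h) - G x\<bar> \<partial>lebesgue)"
      by (simp add: nn_integral_completion)
    also have "\<dots> = (\<integral>\<^sup>+ x. ennreal (indicator A x * \<bar>u (x + h) - u x\<bar>) \<partial>lebesgue)"
    proof (rule nn_integral_cong_AE)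
      show "AE x in lebesgue. indicator A x * ennreal \<bar>G (x + h) - G x\<bar> = ennreal (indicator A x * \<bar>u (x
        + h) - u x\<bar>)"
        using ae AE_lebesgue_translate[OF ae, of h] by eventually_elim (auto simp: indicator_def)
    qed
    also have "\<dots> = ennreal (LINT x|lebesgue. indicator A x * \<bar>u (x + h) - u x\<bar>)"
      using iu by (intro nn_integral_eq_integral) auto
    finally show "(\<integral>\<^sup>+ x. indicator A x * ennreal \<bar>G (x + h) - G x\<bar> \<partial>lborel) =
      ennreal (LINT x|lebesgue. indicator A x * \<bar>u (x + h) - u x\<bar>)" .
  qed
qed

text \<open>Averaging \<open>G x - G y\<close> over \<open>y\<close> in \<open>Q\<close> gives the
  deviation of \<open>G x\<close> from the mean. The lower bound \<open>q\<close> replaces the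
  actual measure of \<open>Q\<close>, so that one constant serves all cells.\<close>

lemma average_deviation_le:
  fixes G :: "real ^ 'm \<Rightarrow> real"
  assumes G: "integrable lborel G" and Q: "Q \<in> sets borel" "emeasure lborel Q < \<infinity>" "ennreal q \<le> emeasure
    lborel Q" and q: "q > 0"
  shows "ennreal \<bar>G x - (LINT y|lborel. indicator Q y * G y) / measure lborel Q\<bar> \<le>
    ennreal (1 / q) * (\<integral>\<^sup>+ y. indicator Q y * ennreal \<bar>G y - G x\<bar> \<partial>lborel)"
proof -
  define m where "m = measure lborel Q"
  define c where "c = (LINT y|lborel. indicator Q y * G y) / m"
  have em: "emeasure lborel Q = ennreal m" using Q(2) unfolding m_def
    by (intro emeasure_eq_ennreal_measure) auto
  have m: "q \<le> m" using Q(3) unfolding em by (simp add: ennreal_le_iff m_def)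
  have i1: "integrable lborel (\<lambda>y. indicator Q y * G y)"
    using integrable_mult_indicator[OF _ G, of Q] Q(1) by simp
  have i2: "integrable lborel (\<lambda>y. indicator Q y * G x)"
    using Q by (intro integrable_mult_left integrable_real_indicator) auto
  have i3: "integrable lborel (\<lambda>y. indicator Q y * (G x - G y))"
    using Bochner_Integration.integrable_diff[OF i2 i1] by (simp add: right_diff_distrib)
  have "(LINT y|lborel. indicator Q y * (G x - G y)) = m * (G x - c)"
    unfolding right_diff_distrib using i1 i2 m q by (simp add: c_def m_def right_diff_distrib)
  then have "\<bar>m * (G x - c)\<bar> \<le> (LINT y|lborel. \<bar>indicator Q y * (G x - G y)\<bar>)"
    using integral_abs_bound[of lborel "\<lambda>y. indicator Q y * (G x - G y)"] by simp
  then have "ennreal (m * \<bar>G x - c\<bar>) \<le> ennreal (LINT y|lborel. \<bar>indicator Q y * (G x - G y)\<bar>)"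
    using m q by (intro ennreal_leI) (simp add: abs_mult)
  also have "\<dots> = (\<integral>\<^sup>+ y. ennreal \<bar>indicator Q y * (G x - G y)\<bar> \<partial>lborel)"
    using i3 by (intro nn_integral_eq_integral[symmetric]) auto
  also have "\<dots> = (\<integral>\<^sup>+ y. indicator Q y * ennreal \<bar>G y - G x\<bar> \<partial>lborel)"
    by (intro nn_integral_cong) (auto simp: indicator_def abs_minus_commute)
  finally have I: "ennreal (m * \<bar>G x - c\<bar>) \<le> (\<integral>\<^sup>+ y. indicator Q y * ennreal \<bar>G y - G x\<bar> \<partial>lborel)" .
  have "\<bar>G x - c\<bar> \<le> (1 / q) * (m * \<bar>G x - c\<bar>)"
    using m q mult_right_mono[OF m abs_ge_zero[of "G x - c"]] by (simp add: field_simps)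
  then have "ennreal \<bar>G x - c\<bar> \<le> ennreal (1 / q) * ennreal (m * \<bar>G x - c\<bar>)"
    using q m by (simp add: ennreal_mult[symmetric] ennreal_leI)
  also have "\<dots> \<le> ennreal (1 / q) * (\<integral>\<^sup>+ y. indicator Q y * ennreal \<bar>G y - G x\<bar> \<partial>lborel)"
    by (intro mult_left_mono I) simp
  finally show ?thesis unfolding c_def m_def .
qed

text \<open>The deviation at \<open>x\<close> is controlled by the integral of
  \<open>\<bar>G y - G x\<bar>\<close> over \<open>Q x\<close>. Substituting
  \<open>y = x + h\<close> and exchanging the integrals leaves, for each fixed \<open>h\<close>, a
  translation difference bounded by \<open>d\<close>, and only \<open>h\<close> in \<open>B\<close>
  occur.\<close>

lemma cell_estimate:
  fixes G :: "real ^ 'm \<Rightarrow> real" and Q :: "real ^ 'm \<Rightarrow> (real ^ 'm) set"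
  assumes G: "integrable lborel G"
    and S: "{p. fst p \<in> E \<and> snd p \<in> Q (fst p)} \<in> sets borel"
    and Q: "\<And>x. x \<in> E \<Longrightarrow> Q x \<in> sets borel" "\<And>x. x \<in> E \<Longrightarrow> emeasure lborel (Q x) < \<infinity>"
      "\<And>x. x \<in> E \<Longrightarrow> ennreal q \<le> emeasure lborel (Q x)" and q: "q > 0"
    and B: "B \<in> sets borel" "\<And>x y. x \<in> E \<Longrightarrow> y \<in> Q x \<Longrightarrow> y - x \<in> B"
    and d: "\<And>h. h \<in> B \<Longrightarrow>
      (\<integral>\<^sup>+ x. indicator {x. x \<in> E \<and> x + h \<in> Q x} x * ennreal \<bar>G (x + h) - G x\<bar> \<partial>lborel) \<le> d"
  shows "(\<integral>\<^sup>+ x. indicator E x * ennreal \<bar>G x - (LINT y|lborel. indicator (Q x) y * G y) / measure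
    lborel (Q x)\<bar> \<partial>lborel)
    \<le> ennreal (1 / q) * (d * emeasure lborel B)"
proof -
  define S where "S = {p. fst p \<in> E \<and> snd p \<in> Q (fst p)}"
  define K where "K x y = indicator S (x, y) * ennreal \<bar>G y - G x\<bar>" for x y
  have Sm: "S \<in> sets (borel \<Otimes>\<^sub>M borel)" using S unfolding S_def borel_prod .
  have Gm[measurable]: "G \<in> borel_measurable borel" using borel_measurable_integrable[OF G] by simp
  have Km[measurable]: "(\<lambda>(x, y). K x y) \<in> borel_measurable (borel \<Otimes>\<^sub>M borel)"
  proof -
    have "(\<lambda>p. indicator S p * ennreal \<bar>G (snd p) - G (fst p)\<bar>) \<in> borel_measurable (borel \<Otimes>\<^sub>M borel)"
      using Sm by measurable
    then show ?thesis by (simp add: K_def case_prod_beta')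
  qed
  have shift: "(\<integral>\<^sup>+ y. K x y \<partial>lborel) = (\<integral>\<^sup>+ h. K x (x + h) \<partial>lborel)" for x
  proof -
    have kx: "K x \<in> borel_measurable borel" using measurable_Pair2[OF Km, of x] by simp
    have "(\<integral>\<^sup>+ y. K x y \<partial>lborel) = (\<integral>\<^sup>+ y. K x y \<partial>distr lborel borel ((+) x))"
      by (simp only: lborel_distr_plus)
    also have "\<dots> = (\<integral>\<^sup>+ h. K x (x + h) \<partial>lborel)" using kx by (intro nn_integral_distr) auto
    finally show ?thesis .
  qed
  have sh: "(\<lambda>(x, h). (x, x + h)) \<in> (borel \<Otimes>\<^sub>M borel) \<rightarrow>\<^sub>M (borel \<Otimes>\<^sub>M (borel :: (real ^ 'm) measure))"
    by measurable
  have Km': "(\<lambda>(x, h). K x (x + h)) \<in> borel_measurable (lborel \<Otimes>\<^sub>M lborel)"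
  proof -
    have "(\<lambda>(x, h). K x (x + h)) \<in> borel_measurable (borel \<Otimes>\<^sub>M borel)"
      using measurable_compose[OF sh Km] by (simp add: case_prod_beta')
    moreover have "sets (lborel \<Otimes>\<^sub>M lborel) = sets (borel \<Otimes>\<^sub>M (borel :: (real ^ 'm) measure))"
      by (intro sets_pair_measure_cong) auto
    ultimately show ?thesis by (simp cong: measurable_cong_sets)
  qed
  have "(\<integral>\<^sup>+ x. indicator E x * ennreal \<bar>G x - (LINT y|lborel. indicator (Q x) y * G y) / measure lborel
    (Q x)\<bar> \<partial>lborel)
    \<le> (\<integral>\<^sup>+ x. ennreal (1 / q) * (\<integral>\<^sup>+ y. K x y \<partial>lborel) \<partial>lborel)"
  proof (rule nn_integral_mono)
    fix x
    show "indicator E x * ennreal \<bar>G x - (LINT y|lborel. indicator (Q x) y * G y) / measure lborel (Q x)\<bar> \<le>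
      ennreal (1 / q) * (\<integral>\<^sup>+ y. K x y \<partial>lborel)"
    proof (cases "x \<in> E")
      case True
      then have "(\<integral>\<^sup>+ y. K x y \<partial>lborel) = (\<integral>\<^sup>+ y. indicator (Q x) y * ennreal \<bar>G y - G x\<bar> \<partial>lborel)"
        by (intro nn_integral_cong) (auto simp: K_def S_def indicator_def)
      then show ?thesis using average_deviation_le[OF G Q(1)[OF True] Q(2)[OF True] Q(3)[OF True] q, of
        x] True by simp
    qed simp
  qed
  also have "\<dots> = (\<integral>\<^sup>+ x. ennreal (1 / q) * (\<integral>\<^sup>+ h. K x (x + h) \<partial>lborel) \<partial>lborel)" unfolding shift ..
  also have "\<dots> = ennreal (1 / q) * (\<integral>\<^sup>+ x. (\<integral>\<^sup>+ h. K x (x + h) \<partial>lborel) \<partial>lborel)"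
    by (rule nn_integral_cmult[OF lborel.borel_measurable_nn_integral[OF Km']])
  also have "(\<integral>\<^sup>+ x. (\<integral>\<^sup>+ h. K x (x + h) \<partial>lborel) \<partial>lborel) = (\<integral>\<^sup>+ h. (\<integral>\<^sup>+ x. K x (x + h) \<partial>lborel) \<partial>lborel)"
    by (rule lborel_pair.Fubini'[OF Km', symmetric])
  also have "\<dots> \<le> (\<integral>\<^sup>+ h. d * indicator B h \<partial>lborel)"
  proof (rule nn_integral_mono)
    fix h
    show "(\<integral>\<^sup>+ x. K x (x + h) \<partial>lborel) \<le> d * indicator B h"
    proof (cases "h \<in> B")
      case True
      have "(\<integral>\<^sup>+ x. K x (x + h) \<partial>lborel) =
          (\<integral>\<^sup>+ x. indicator {x. x \<in> E \<and> x + h \<in> Q x} x * ennreal \<bar>G (x + h) - G x\<bar> \<partial>lborel)"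
        by (intro nn_integral_cong) (auto simp: K_def S_def indicator_def)
      then show ?thesis using d[OF True] True by simp
    next
      case False
      then have "K x (x + h) = 0" for x using B(2)[of x "x + h"] by (auto simp: K_def S_def indicator_def)
      then show ?thesis by simp
    qed
  qed
  also have "\<dots> = d * emeasure lborel B" using B(1) by (intro nn_integral_cmult_indicator) simp
  finally show ?thesis by (simp add: mult_left_mono)
qed

section \<open>Vanishing gradient\<close>

text \<open>The deviation from the mean over the ball is estimated by translation differences within
  the ball, all of which vanish by \<open>translation_estimate\<close> with \<open>t = 0\<close>;
  convexity of the ball keeps the segments inside.\<close>

lemma constant_on_ball:
  fixes u :: "real ^ 'm \<Rightarrow> real"
  assumes u: "integrable lebesgue u"
    and le: "\<And>v. test_field \<Omega> v \<Longrightarrow> (LINT x|lebesgue. u x * divergence v x) \<le> 0"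
    and ball: "r > 0" "ball a r \<subseteq> \<Omega>"
  obtains c where "AE x in lebesgue. x \<in> ball a r \<longrightarrow> u x = c"
proof -
  obtain G where G: "integrable lborel G" "AE x in lebesgue. u x = G x"
    "\<And>A h. A \<in> sets borel \<Longrightarrow> (\<integral>\<^sup>+ x. indicator A x * ennreal \<bar>G (x + h) - G x\<bar> \<partial>lborel) =
      ennreal (LINT x|lebesgue. indicator A x * \<bar>u (x + h) - u x\<bar>)"
    by (rule borel_version[OF u]) (rule that)
  let ?Q = "ball a r"
  define c where "c = (LINT y|lborel. indicator ?Q y * G y) / measure lborel ?Q"
  define q where "q = measure lborel ?Q"
  have fin: "emeasure lborel ?Q < \<infinity>" by (rule emeasure_lborel_ball_finite)
  have "\<not> negligible ?Q" using ball(1) by (intro open_not_negligible) auto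
  then have "emeasure lborel ?Q \<noteq> 0" by (auto simp: negligible_iff_null_sets null_sets_def)
  then have q: "q > 0" using fin by (simp add: q_def measure_def enn2real_positive_iff less_top
    zero_less_iff_neq_zero)
  have eq: "emeasure lborel ?Q = ennreal q" unfolding q_def using fin
    by (intro emeasure_eq_ennreal_measure) auto
  have "(\<integral>\<^sup>+ x. indicator ?Q x * ennreal \<bar>G x - (LINT y|lborel. indicator ?Q y * G y) / measure lborel
    ?Q\<bar> \<partial>lborel)
      \<le> ennreal (1 / q) * (0 * emeasure lborel (UNIV :: (real ^ 'm) set))"
  \<comment> \<open>With \<open>d = 0\<close> the infinite measure of \<open>B = UNIV\<close> is
    harmless, because 0 times infinity is 0 in \<open>ennreal\<close>.\<close>
  proof (rule cell_estimate[OF G(1), where E = ?Q and Q = "\<lambda>_. ?Q" and B = UNIV and d = 0])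
    have "{p. fst p \<in> ?Q \<and> snd p \<in> ?Q} = ?Q \<times> ?Q" by auto
    then show "{p. fst p \<in> ?Q \<and> snd p \<in> ?Q} \<in> sets borel" by (simp add: open_Times)
    show "(\<integral>\<^sup>+ x. indicator {x. x \<in> ?Q \<and> x + h \<in> ?Q} x * ennreal \<bar>G (x + h) - G x\<bar> \<partial>lborel) \<le> 0" for h
    proof -
      let ?A = "{x. x \<in> ?Q \<and> x + h \<in> ?Q}"
      have "?A = ?Q \<inter> (\<lambda>x. x + h) -` ?Q" by auto
      moreover have "open ((\<lambda>x. x + h) -` ?Q)" by (rule open_vimage) (auto intro: continuous_intros)
      ultimately have oA: "open ?A" by auto
      have "(LINT x|lebesgue. indicator ?A x * \<bar>u (x + h) - u x\<bar>) \<le> norm h * 0"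
      proof (rule translation_estimate[OF u _ _ oA])
        fix y s assume y: "y \<in> ?A" and s: "0 \<le> s" "s \<le> (1::real)"
        have "(1 - s) *\<^sub>R y + s *\<^sub>R (y + h) \<in> ?Q"
          using y s convexD[OF convex_ball, of y a r "y + h" "1 - s" s] by auto
        then show "y + s *\<^sub>R h \<in> \<Omega>" using ball(2) by (auto simp: algebra_simps)
      qed (use le in auto)
      then show ?thesis using G(3)[OF borel_open[OF oA], of h] by (simp add: ennreal_neg)
    qed
  qed (use q fin eq in auto)
  then have "(\<integral>\<^sup>+ x. indicator ?Q x * ennreal \<bar>G x - c\<bar> \<partial>lborel) = 0" by (simp add: c_def)
  moreover have [measurable]: "G \<in> borel_measurable borel" using borel_measurable_integrable[OF G(1)] by simp
  have [measurable]: "?Q \<in> sets borel" by simp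
  have "(\<lambda>x. indicator ?Q x * ennreal \<bar>G x - c\<bar>) \<in> borel_measurable lborel" by measurable
  ultimately have "AE x in lborel. indicator ?Q x * ennreal \<bar>G x - c\<bar> = 0" by (simp add: nn_integral_0_iff_AE)
  then have "AE x in lebesgue. indicator ?Q x * ennreal \<bar>G x - c\<bar> = 0" by (rule AE_completion)
  with G(2) have "AE x in lebesgue. x \<in> ?Q \<longrightarrow> u x = c" by eventually_elim (auto simp: indicator_def)
  then show ?thesis by (rule that)
qed

text \<open>The constant of a ball agrees with the one at each of its points, because the two balls
  meet in an open set that is not negligible; connectedness makes all constants equal, and Lindelof
  reduces the exceptional null sets to countably many.\<close>

lemma constant_of_zero_gradient:
  fixes u :: "real ^ 'm \<Rightarrow> real"
  assumes \<Omega>: "open \<Omega>" "connected \<Omega>" and u: "integrable lebesgue u"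
    and le: "\<And>v. test_field \<Omega> v \<Longrightarrow> (LINT x|lebesgue. u x * divergence v x) \<le> 0"
  obtains c where "AE x in lebesgue. x \<in> \<Omega> \<longrightarrow> u x = c"
proof -
  define P where "P x r c \<longleftrightarrow> (AE y in lebesgue. y \<in> ball x r \<longrightarrow> u y = c)" for x r c
  have "\<exists>r c. r > 0 \<and> ball x r \<subseteq> \<Omega> \<and> P x r c" if "x \<in> \<Omega>" for x
  proof -
    obtain r where r: "r > 0" "ball x r \<subseteq> \<Omega>" using \<Omega>(1) \<open>x \<in> \<Omega>\<close> by (meson openE)
    obtain c where "AE y in lebesgue. y \<in> ball x r \<longrightarrow> u y = c"
      by (rule constant_on_ball[OF u le r]) (assumption, rule that)
    then show ?thesis using r unfolding P_def by blast
  qed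
  then obtain r c where rc': "\<And>x. x \<in> \<Omega> \<Longrightarrow> r x > 0 \<and> ball x (r x) \<subseteq> \<Omega> \<and> P x (r x) (c x)" by metis
  note rc = rc'[unfolded P_def]
  have agree: "c x = c z" if x: "x \<in> \<Omega>" and z: "z \<in> ball x (r x)" for x z
  proof -
    have zO: "z \<in> \<Omega>" using rc[OF x] z by blast
    let ?W = "ball x (r x) \<inter> ball z (r z)"
    have "z \<in> ?W" using z rc[OF zO] by simp
    then have "\<not> negligible ?W" by (intro open_not_negligible) auto
    have "AE y in lebesgue. y \<in> ?W \<longrightarrow> c x = c z"
    proof -
      have "AE y in lebesgue. y \<in> ball x (r x) \<longrightarrow> u y = c x" "AE y in lebesgue. y \<in> ball z (r z) \<longrightarrow> u y = c z"
        using rc[OF x] rc[OF zO] by auto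
      then show ?thesis by eventually_elim auto
    qed
    show ?thesis
    proof (rule ccontr)
      assume "c x \<noteq> c z"
      then have "AE y in lebesgue. y \<notin> ?W" using \<open>AE y in lebesgue. y \<in> ?W \<longrightarrow> c x = c z\<close> by simp
      then have "?W \<in> null_sets lebesgue" by (subst (asm) AE_iff_null_sets[symmetric]) auto
      then show False using \<open>\<not> negligible ?W\<close> by (simp add: negligible_iff_null_sets)
    qed
  qed
  have "c constant_on \<Omega>"
  proof (rule locally_constant_imp_constant[OF \<Omega>(2)])
    fix a assume a: "a \<in> \<Omega>"
    have "openin (top_of_set \<Omega>) (ball a (r a))" using rc[OF a] \<Omega>(1) by (simp add: openin_open_eq)
    moreover have "a \<in> ball a (r a)" using rc'[OF a] by simp
    moreover have "\<forall>x\<in>ball a (r a). c x = c a"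
    proof
      show "c x = c a" if "x \<in> ball a (r a)" for x by (rule agree[OF a that, symmetric])
    qed
    ultimately show "\<exists>T. openin (top_of_set \<Omega>) T \<and> a \<in> T \<and> (\<forall>x\<in>T. c x = c a)"
      by (intro exI[of _ "ball a (r a)"] conjI)
  qed
  then obtain k where k: "\<And>x. x \<in> \<Omega> \<Longrightarrow> c x = k" by (auto simp: constant_on_def)
  obtain F' where F': "F' \<subseteq> (\<lambda>x. ball x (r x)) ` \<Omega>" "countable F'" "\<Union>F' = \<Union>((\<lambda>x. ball x (r x)) ` \<Omega>)"
    by (rule Lindelof[of "(\<lambda>x. ball x (r x)) ` \<Omega>"]) auto
  have "AE y in lebesgue. \<forall>W\<in>F'. y \<in> W \<longrightarrow> u y = k"
  proof (subst AE_ball_countable[OF F'(2)], intro ballI)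
    fix W assume "W \<in> F'"
    then obtain x where "x \<in> \<Omega>" "W = ball x (r x)" using F'(1) by auto
    then show "AE y in lebesgue. y \<in> W \<longrightarrow> u y = k" using rc k by auto
  qed
  moreover have "\<Omega> \<subseteq> \<Union>F'" unfolding F'(3) using rc by force
  ultimately have "AE y in lebesgue. y \<in> \<Omega> \<longrightarrow> u y = k" by (auto elim!: eventually_mono)
  then show ?thesis by (rule that)
qed

section \<open>Compactness on extension domains\<close>

lemma floor_divide_eq_iff:
  fixes y \<delta> :: real
  assumes "\<delta> > 0"
  shows "\<lfloor>y / \<delta>\<rfloor> = k \<longleftrightarrow> \<delta> * of_int k \<le> y \<and> y < \<delta> * of_int k + \<delta>"
  using assms by (simp add: floor_eq_iff field_simps)

lemma measure_cube:
  fixes l :: "real ^ 'm"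
  assumes "\<delta> \<ge> 0"
  shows "emeasure lborel (box l (l + (\<chi> i. \<delta>))) = ennreal (\<delta> ^ CARD('m))"
    and "emeasure lborel (cbox l (l + (\<chi> i. \<delta>))) = ennreal (\<delta> ^ CARD('m))"
proof -
  have b: "(\<chi> i. \<delta>) \<bullet> b = \<delta>" if "b \<in> Basis" for b :: "real ^ 'm"
    using that by (auto simp: Basis_vec_def inner_axis)
  have le: "l \<bullet> b \<le> (l + (\<chi> i. \<delta>)) \<bullet> b" if "b \<in> Basis" for b :: "real ^ 'm"
    using b[OF that] assms by (simp add: inner_add_left)
  have "(\<Prod>b\<in>(Basis :: (real ^ 'm) set). ((l + (\<chi> i. \<delta>)) - l) \<bullet> b) = (\<Prod>b\<in>(Basis :: (real ^ 'm) set). \<delta>)"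
    by (intro prod.cong refl) (simp add: b)
  then have p: "(\<Prod>b\<in>(Basis :: (real ^ 'm) set). ((l + (\<chi> i. \<delta>)) - l) \<bullet> b) = \<delta> ^ CARD('m)" by simp
  show "emeasure lborel (box l (l + (\<chi> i. \<delta>))) = ennreal (\<delta> ^ CARD('m))"
    using emeasure_lborel_box[OF le] p by simp
  show "emeasure lborel (cbox l (l + (\<chi> i. \<delta>))) = ennreal (\<delta> ^ CARD('m))"
    using emeasure_lborel_cbox[OF le] p by simp
qed

text \<open>The pieces depend on \<open>\<epsilon>\<close> and \<open>\<Omega>\<close> only, which
  is what compactness needs. On small cubes \<open>G\<close> is L1-close to its averages, and these
  are governed by finitely many integrals.\<close>

lemma partition_estimate:
  fixes \<Omega> :: "(real ^ 'm) set"
  assumes \<Omega>: "open \<Omega>" "bounded \<Omega>" and \<epsilon>: "\<epsilon> > 0"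
  shows "\<exists>(N :: nat) P. (\<forall>j. P j \<in> sets borel \<and> P j \<subseteq> \<Omega>) \<and>
    (\<forall>G t. integrable lebesgue G \<longrightarrow> t \<ge> 0 \<longrightarrow> (\<forall>h. (LINT x|lebesgue. \<bar>G (x + h) - G x\<bar>) \<le> norm h * t) \<longrightarrow>
      (LINT x|lebesgue. indicator \<Omega> x * \<bar>G x\<bar>) \<le> \<epsilon> * t + (\<Sum>j<N. \<bar>LINT x|lebesgue. indicator (P j) x * G x\<bar>))"
proof -
  define n where "n = CARD('m)"
  have n: "n > 0" by (simp add: n_def)
  \<comment> \<open>Chosen so that the constant \<open>2 ^ n * real n * \<delta>\<close> arising
    from \<open>cell_estimate\<close> equals \<open>\<epsilon> / 2\<close>; the other half of
    \<open>\<epsilon>\<close> is spent because the deviation enters twice in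
    \<open>piece\<close>.\<close>
  define \<delta> where "\<delta> = \<epsilon> / (2 * 2 ^ n * real n)"
  have \<delta>: "\<delta> > 0" using \<epsilon> n by (simp add: \<delta>_def)
  \<comment> \<open>Half-open cubes of side \<open>\<delta>\<close>, indexed by integer vectors.
    Averages are taken over the whole cube rather than over its part in \<open>\<Omega>\<close>,
    which may have arbitrarily small measure.\<close>
  define R where "R \<kappa> = {y :: real ^ 'm. \<forall>i. \<lfloor>y $ i / \<delta>\<rfloor> = \<kappa> i}" for \<kappa>
  define k where "k x = (\<lambda>i. \<lfloor>x $ i / \<delta>\<rfloor>)" for x :: "real ^ 'm"
  have R_iff: "x \<in> R \<kappa> \<longleftrightarrow> k x = \<kappa>" for x \<kappa> by (auto simp: R_def k_def fun_eq_iff)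
  define l where "l \<kappa> = (\<chi> i. \<delta> * of_int (\<kappa> i)) " for \<kappa> :: "'m \<Rightarrow> int"
  have R_sub: "box (l \<kappa>) (l \<kappa> + (\<chi> i. \<delta>)) \<subseteq> R \<kappa>" "R \<kappa> \<subseteq> cbox (l \<kappa>) (l \<kappa> + (\<chi> i. \<delta>))" for \<kappa>
    by (auto simp: R_def l_def mem_box_cart floor_divide_eq_iff[OF \<delta>] less_imp_le)
  have Rb: "R \<kappa> \<in> sets borel" for \<kappa>
  proof -
    have "{y \<in> space borel. real_of_int \<lfloor>y $ i / \<delta>\<rfloor> = real_of_int (\<kappa> i)} \<in> sets (borel :: (real ^ 'm)
      measure)" for i
    proof -
      have [measurable]: "(\<lambda>y :: real ^ 'm. y $ i / \<delta>) \<in> borel_measurable borel"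
        using \<delta> by (intro borel_measurable_continuous_onI continuous_intros) auto
      show ?thesis by (intro borel_measurable_eq borel_measurable_const) measurable
    qed
    then have "(\<Inter>i. {y :: real ^ 'm. real_of_int \<lfloor>y $ i / \<delta>\<rfloor> = real_of_int (\<kappa> i)}) \<in> sets borel"
      by (intro sets.finite_INT) auto
    moreover have "R \<kappa> = (\<Inter>i. {y :: real ^ 'm. real_of_int \<lfloor>y $ i / \<delta>\<rfloor> = real_of_int (\<kappa> i)})"
      by (auto simp: R_def)
    ultimately show ?thesis by simp
  qed
  have Rm: "ennreal (\<delta> ^ n) \<le> emeasure lborel (R \<kappa>)" "emeasure lborel (R \<kappa>) < \<infinity>" for \<kappa>
  proof -
    show "ennreal (\<delta> ^ n) \<le> emeasure lborel (R \<kappa>)"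
      using emeasure_mono[OF R_sub(1)[of \<kappa>], of lborel] Rb measure_cube(1)[of \<delta> "l \<kappa>"] \<delta> by (simp add: n_def)
    show "emeasure lborel (R \<kappa>) < \<infinity>"
      using emeasure_mono[OF R_sub(2)[of \<kappa>], of lborel] measure_cube(2)[of \<delta> "l \<kappa>"] \<delta>
      by (simp add: n_def) (metis ennreal_less_top le_less_trans)
  qed
  obtain r where r: "\<And>y. y \<in> \<Omega> \<Longrightarrow> norm y \<le> r" using \<Omega>(2) by (auto simp: bounded_iff)
  define L where "L = \<lceil>r / \<delta>\<rceil> + 1"
  define I where "I = PiE (UNIV :: 'm set) (\<lambda>_. {- L..L})"
  have finI: "finite I" unfolding I_def by (intro finite_PiE) auto
  have kI: "k y \<in> I" if y: "y \<in> \<Omega>" for y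
  proof -
    have "\<lfloor>y $ i / \<delta>\<rfloor> \<in> {- L..L}" for i
    proof -
      have "\<bar>y $ i\<bar> \<le> r" using component_le_norm_cart[of y i] r[OF y] by linarith
      then have "\<bar>y $ i / \<delta>\<bar> \<le> r / \<delta>" using \<delta> by (simp add: abs_divide divide_right_mono)
      then have "\<bar>y $ i / \<delta>\<bar> \<le> of_int \<lceil>r / \<delta>\<rceil>" by linarith
      then show ?thesis unfolding L_def atLeastAtMost_iff by linarith
    qed
    then show ?thesis by (auto simp: I_def k_def)
  qed
  define P where "P \<kappa> = \<Omega> \<inter> R \<kappa>" for \<kappa>
  have Pb: "P \<kappa> \<in> sets borel" for \<kappa> unfolding P_def using Rb \<Omega>(1) by auto
  have P_sub: "P \<kappa> \<subseteq> \<Omega>" for \<kappa> by (auto simp: P_def)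
  have split: "(\<Sum>\<kappa>\<in>I. indicator (P \<kappa>) x * F \<kappa>) = indicator \<Omega> x * F (k x)"
    for x and F :: "('m \<Rightarrow> int) \<Rightarrow> 'b :: semiring_1"
  proof -
    have "(\<Sum>\<kappa>\<in>I. indicator (P \<kappa>) x * F \<kappa>) = (\<Sum>\<kappa>\<in>I. if \<kappa> = k x then indicator \<Omega> x * F (k x) else 0)"
      by (intro sum.cong refl) (auto simp: P_def R_iff indicator_def)
    then show ?thesis using finI kI[of x] by (auto simp: indicator_def)
  qed
  have est: "(LINT x|lebesgue. indicator \<Omega> x * \<bar>G x\<bar>) \<le> \<epsilon> * t + (\<Sum>\<kappa>\<in>I. \<bar>LINT x|lebesgue. indicator (P \<kappa>)
    x * G x\<bar>)"
    if G: "integrable lebesgue G" and t: "t \<ge> 0" and tr: "\<And>h. (LINT x|lebesgue. \<bar>G (x + h) - G x\<bar>) \<le>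
      norm h * t" for G t
  proof -
    obtain g where g: "integrable lborel g" "AE x in lebesgue. G x = g x"
      "\<And>A h. A \<in> sets borel \<Longrightarrow> (\<integral>\<^sup>+ x. indicator A x * ennreal \<bar>g (x + h) - g x\<bar> \<partial>lborel) =
        ennreal (LINT x|lebesgue. indicator A x * \<bar>G (x + h) - G x\<bar>)"
      by (rule borel_version[OF G]) (rule that)
    have gm[measurable]: "g \<in> borel_measurable borel" using borel_measurable_integrable[OF g(1)] by simp
    define c where "c \<kappa> = (LINT y|lborel. indicator (R \<kappa>) y * g y) / measure lborel (R \<kappa>)" for \<kappa>
    let ?v = "(\<chi> i. \<delta>) :: real ^ 'm"
    \<comment> \<open>Two points of one cube differ by a vector of this cube of side
      \<open>2 * \<delta>\<close>; its volume is the factor \<open>(2 * \<delta>) ^ n\<close>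
      below.\<close>
    let ?B = "cbox (- ?v) (- ?v + (\<chi> i. 2 * \<delta>))"
    have "(\<integral>\<^sup>+ x. indicator \<Omega> x * ennreal \<bar>g x - (LINT y|lborel. indicator (R (k x)) y * g y) / measure
      lborel (R (k x))\<bar> \<partial>lborel)
        \<le> ennreal (1 / \<delta> ^ n) * (ennreal (real n * \<delta> * t) * emeasure lborel ?B)"
    proof (rule cell_estimate[OF g(1)])
      show "{p. fst p \<in> \<Omega> \<and> snd p \<in> R (k (fst p))} \<in> sets borel"
      proof -
        have "{p \<in> space borel. real_of_int \<lfloor>snd p $ i / \<delta>\<rfloor> = real_of_int \<lfloor>fst p $ i / \<delta>\<rfloor>} \<in> sets (borel
          :: ((real ^ 'm) \<times> (real ^ 'm)) measure)" for i
        proof -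
          have [measurable]: "(\<lambda>p :: (real ^ 'm) \<times> (real ^ 'm). snd p $ i / \<delta>) \<in> borel_measurable borel"
            "(\<lambda>p :: (real ^ 'm) \<times> (real ^ 'm). fst p $ i / \<delta>) \<in> borel_measurable borel"
            using \<delta> by (intro borel_measurable_continuous_onI continuous_intros; simp)+
          show ?thesis by (intro borel_measurable_eq) measurable
        qed
        then have "(\<Inter>i. {p :: (real ^ 'm) \<times> (real ^ 'm). real_of_int \<lfloor>snd p $ i / \<delta>\<rfloor> = real_of_int \<lfloor>fst
          p $ i / \<delta>\<rfloor>}) \<in> sets borel"
          by (intro sets.finite_INT) auto
        moreover have "open (\<Omega> \<times> (UNIV :: (real ^ 'm) set))" using \<Omega>(1) by (intro open_Times) auto
        moreover have "{p. fst p \<in> \<Omega> \<and> snd p \<in> R (k (fst p))} =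
            (\<Omega> \<times> UNIV) \<inter> (\<Inter>i. {p :: (real ^ 'm) \<times> (real ^ 'm). real_of_int \<lfloor>snd p $ i / \<delta>\<rfloor> = real_of_int
              \<lfloor>fst p $ i / \<delta>\<rfloor>})"
          by (auto simp: R_def k_def)
        ultimately show ?thesis by auto
      qed
      show "R (k x) \<in> sets borel" "emeasure lborel (R (k x)) < \<infinity>" "ennreal (\<delta> ^ n) \<le> emeasure lborel (R
        (k x))" for x
        by (rule Rb Rm)+
      show "\<delta> ^ n > 0" using \<delta> by simp
      show "?B \<in> sets borel" by simp
      show "y - x \<in> ?B" if "x \<in> \<Omega>" "y \<in> R (k x)" for x y
      proof -
        have "x \<in> R (k x)" by (simp add: R_iff)
        then have "\<bar>y $ i - x $ i\<bar> \<le> \<delta>" for i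
          using that(2) by (auto simp: R_def floor_divide_eq_iff[OF \<delta>] abs_le_iff dest!: spec[of _ i])
        then show ?thesis by (auto simp: mem_box_cart abs_le_iff) (smt (verit, best))+
      qed
      fix h assume h: "h \<in> ?B"
      have "norm h \<le> (\<Sum>i\<in>UNIV. \<bar>h $ i\<bar>)" by (rule norm_le_l1_cart)
      also have "\<dots> \<le> (\<Sum>i\<in>(UNIV :: 'm set). \<delta>)"
        using h by (intro sum_mono) (auto simp: mem_box_cart abs_le_iff minus_le_iff dest: spec)
      finally have nh: "norm h \<le> real n * \<delta>" by (simp add: n_def)
      have "(\<integral>\<^sup>+ x. indicator {x \<in> \<Omega>. x + h \<in> R (k x)} x * ennreal \<bar>g (x + h) - g x\<bar> \<partial>lborel) \<le>
          (\<integral>\<^sup>+ x. indicator UNIV x * ennreal \<bar>g (x + h) - g x\<bar> \<partial>lborel)"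
        by (intro nn_integral_mono mult_right_mono) (auto simp: indicator_def)
      also have "\<dots> = ennreal (LINT x|lebesgue. \<bar>G (x + h) - G x\<bar>)" using g(3)[of UNIV h] by simp
      also have "\<dots> \<le> ennreal (real n * \<delta> * t)"
        using tr[of h] mult_right_mono[OF nh t] by (intro ennreal_leI) linarith
      finally show "(\<integral>\<^sup>+ x. indicator {x. x \<in> \<Omega> \<and> x + h \<in> R (k x)} x * ennreal \<bar>g (x + h) - g x\<bar> \<partial>lborel)
        \<le> ennreal (real n * \<delta> * t)" by simp
    qed
    also have "emeasure lborel ?B = ennreal ((2 * \<delta>) ^ n)" using measure_cube(2)[of "2 * \<delta>" "- ?v"] \<delta>
      by (simp add: n_def)
    also have "ennreal (1 / \<delta> ^ n) * (ennreal (real n * \<delta> * t) * ennreal ((2 * \<delta>) ^ n)) = ennreal (\<epsilon> * t / 2)"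
    proof -
      have "1 / \<delta> ^ n * (real n * \<delta> * t * (2 * \<delta>) ^ n) = (2 ^ n * real n * \<delta>) * t" using \<delta>
        by (simp add: power_mult_distrib)
      also have "2 ^ n * real n * \<delta> = \<epsilon> / 2" using n by (simp add: \<delta>_def)
      finally have "1 / \<delta> ^ n * (real n * \<delta> * t * (2 * \<delta>) ^ n) = \<epsilon> * t / 2" by simp
      moreover have "0 \<le> 1 / \<delta> ^ n" "0 \<le> real n * \<delta> * t" "0 \<le> (2 * \<delta>) ^ n" using \<delta> t by auto
      ultimately show ?thesis by (metis ennreal_mult mult_nonneg_nonneg)
    qed
    finally have dev: "(\<integral>\<^sup>+ x. indicator \<Omega> x * ennreal \<bar>g x - c (k x)\<bar> \<partial>lborel) \<le> ennreal (\<epsilon> * t / 2)"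
      by (simp add: c_def)
    have conv: "(LINT x|lborel. indicator A x * F (g x)) = (LINT x|lebesgue. indicator A x * F (G x))"
      if A: "A \<in> sets borel" and F: "F \<in> borel_measurable borel" for A and F :: "real \<Rightarrow> real"
    proof -
      have m: "(\<lambda>x. indicator A x * F (g x)) \<in> borel_measurable lborel" using A F by measurable
      have mG: "G \<in> borel_measurable lebesgue" using G by auto
      have "(LINT x|lborel. indicator A x * F (g x)) = (LINT x|lebesgue. indicator A x * F (g x))"
        by (rule integral_completion[OF m, symmetric])
      also have "\<dots> = (LINT x|lebesgue. indicator A x * F (G x))"
      proof (rule integral_cong_AE)
        show "(\<lambda>x. indicator A x * F (g x)) \<in> borel_measurable lebesgue" by (rule measurable_completion[OF m])
        show "(\<lambda>x. indicator A x * F (G x)) \<in> borel_measurable lebesgue"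
          using A by (intro borel_measurable_times borel_measurable_indicator measurable_compose[OF mG
            F]) auto
        show "AE x in lebesgue. indicator A x * F (g x) = indicator A x * F (G x)" using g(2)
          by eventually_elim simp
      qed
      finally show ?thesis .
    qed
    have iA: "integrable lborel (\<lambda>x. indicator A x * g x)" if "A \<in> sets borel" for A
      using integrable_mult_indicator[OF _ g(1), of A] that by simp
    have iP: "integrable lborel (\<lambda>x. indicator (P \<kappa>) x * b)" for \<kappa> and b :: real
    proof (rule integrable_mult_left, rule integrable_real_indicator)
      show "P \<kappa> \<in> sets lborel" using Pb by simp
      have "emeasure lborel (P \<kappa>) \<le> emeasure lborel (R \<kappa>)" using Rb
        by (intro emeasure_mono) (auto simp: P_def)
      then show "emeasure lborel (P \<kappa>) < \<infinity>" using Rm(2) le_less_trans by blast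
    qed
    define a where "a \<kappa> = (LINT x|lborel. indicator (P \<kappa>) x * \<bar>g x - c \<kappa>\<bar>)" for \<kappa>
    have iPg: "integrable lborel (\<lambda>x. indicator (P \<kappa>) x * (g x - c \<kappa>))" for \<kappa>
      using Bochner_Integration.integrable_diff[OF iA[OF Pb] iP] by (simp add: right_diff_distrib)
    have absP: "\<bar>indicator (P \<kappa>) x * y\<bar> = indicator (P \<kappa>) x * \<bar>y\<bar>" for \<kappa> x and y :: real
      by (simp add: abs_mult)
    have iPa: "integrable lborel (\<lambda>x. indicator (P \<kappa>) x * \<bar>g x - c \<kappa>\<bar>)" for \<kappa>
      using integrable_abs[OF iPg] by (simp add: absP)
    have suma: "(\<Sum>\<kappa>\<in>I. a \<kappa>) \<le> \<epsilon> * t / 2"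
    proof -
      have "ennreal (\<Sum>\<kappa>\<in>I. a \<kappa>) = (\<Sum>\<kappa>\<in>I. ennreal (a \<kappa>))"
        by (rule sum_ennreal[symmetric]) (simp add: a_def)
      also have "\<dots> = (\<Sum>\<kappa>\<in>I. (\<integral>\<^sup>+ x. indicator (P \<kappa>) x * ennreal \<bar>g x - c \<kappa>\<bar> \<partial>lborel))"
      proof (rule sum.cong[OF refl])
        fix \<kappa>
        have "ennreal (a \<kappa>) = (\<integral>\<^sup>+ x. ennreal (indicator (P \<kappa>) x * \<bar>g x - c \<kappa>\<bar>) \<partial>lborel)"
          unfolding a_def using iPa by (intro nn_integral_eq_integral[symmetric]) auto
        also have "\<dots> = (\<integral>\<^sup>+ x. indicator (P \<kappa>) x * ennreal \<bar>g x - c \<kappa>\<bar> \<partial>lborel)"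
          by (intro nn_integral_cong) (auto simp: indicator_def)
        finally show "ennreal (a \<kappa>) = (\<integral>\<^sup>+ x. indicator (P \<kappa>) x * ennreal \<bar>g x - c \<kappa>\<bar> \<partial>lborel)" .
      qed
      also have "\<dots> = (\<integral>\<^sup>+ x. (\<Sum>\<kappa>\<in>I. indicator (P \<kappa>) x * ennreal \<bar>g x - c \<kappa>\<bar>) \<partial>lborel)"
      proof (rule nn_integral_sum[symmetric])
        fix \<kappa>
        have [measurable]: "P \<kappa> \<in> sets borel" by (rule Pb)
        show "(\<lambda>x. indicator (P \<kappa>) x * ennreal \<bar>g x - c \<kappa>\<bar>) \<in> borel_measurable lborel" by measurable
      qed
      also have "\<dots> = (\<integral>\<^sup>+ x. indicator \<Omega> x * ennreal \<bar>g x - c (k x)\<bar> \<partial>lborel)"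
        by (intro nn_integral_cong split)
      also note dev
      finally show ?thesis using \<epsilon> t by (simp add: ennreal_le_iff)
    qed
    \<comment> \<open>The constant \<open>c \<kappa>\<close>, integrated over
      \<open>P \<kappa>\<close>, differs from the integral of \<open>g\<close> there by at most
      \<open>a \<kappa>\<close>; with the deviation of \<open>g\<close> itself this makes
      \<open>2 * a \<kappa>\<close>.\<close>
    have piece: "(LINT x|lborel. indicator (P \<kappa>) x * \<bar>g x\<bar>) \<le> 2 * a \<kappa> + \<bar>LINT x|lborel. indicator (P \<kappa>)
      x * g x\<bar>" for \<kappa>
    proof -
      have "(LINT x|lborel. indicator (P \<kappa>) x * \<bar>g x\<bar>) \<le>
          (LINT x|lborel. indicator (P \<kappa>) x * \<bar>g x - c \<kappa>\<bar> + indicator (P \<kappa>) x * \<bar>c \<kappa>\<bar>)"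
      proof (rule integral_mono)
        show "integrable lborel (\<lambda>x. indicator (P \<kappa>) x * \<bar>g x\<bar>)"
          using integrable_abs[OF iA[OF Pb]] by (simp add: absP)
        show "integrable lborel (\<lambda>x. indicator (P \<kappa>) x * \<bar>g x - c \<kappa>\<bar> + indicator (P \<kappa>) x * \<bar>c \<kappa>\<bar>)"
          by (intro Bochner_Integration.integrable_add iPa iP)
      qed (auto simp: indicator_def)
      also have "\<dots> = a \<kappa> + (LINT x|lborel. indicator (P \<kappa>) x * \<bar>c \<kappa>\<bar>)"
        unfolding a_def by (rule Bochner_Integration.integral_add[OF iPa iP])
      also have "(LINT x|lborel. indicator (P \<kappa>) x * \<bar>c \<kappa>\<bar>) = \<bar>LINT x|lborel. indicator (P \<kappa>) x * c \<kappa>\<bar>"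
        by (simp add: abs_mult)
      also have "(LINT x|lborel. indicator (P \<kappa>) x * c \<kappa>) =
          (LINT x|lborel. indicator (P \<kappa>) x * g x) - (LINT x|lborel. indicator (P \<kappa>) x * (g x - c \<kappa>))"
        by (subst Bochner_Integration.integral_diff[OF iA[OF Pb] iPg, symmetric]) (simp add: algebra_simps)
      also have "\<bar>\<dots>\<bar> \<le> \<bar>LINT x|lborel. indicator (P \<kappa>) x * g x\<bar> + a \<kappa>"
        using integral_abs_bound[of lborel "\<lambda>x. indicator (P \<kappa>) x * (g x - c \<kappa>)"] unfolding absP a_def
          by linarith
      finally show ?thesis by simp
    qed
    have "(LINT x|lborel. indicator \<Omega> x * \<bar>g x\<bar>) = (LINT x|lborel. (\<Sum>\<kappa>\<in>I. indicator (P \<kappa>) x * \<bar>g x\<bar>))"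
      by (intro Bochner_Integration.integral_cong refl split[symmetric])
    also have "\<dots> = (\<Sum>\<kappa>\<in>I. LINT x|lborel. indicator (P \<kappa>) x * \<bar>g x\<bar>)"
      using integrable_abs[OF iA[OF Pb]] by (intro Bochner_Integration.integral_sum) (simp add: absP)
    also have "\<dots> \<le> (\<Sum>\<kappa>\<in>I. 2 * a \<kappa> + \<bar>LINT x|lborel. indicator (P \<kappa>) x * g x\<bar>)" by (intro sum_mono piece)
    also have "\<dots> \<le> \<epsilon> * t + (\<Sum>\<kappa>\<in>I. \<bar>LINT x|lborel. indicator (P \<kappa>) x * g x\<bar>)"
      using suma by (simp add: sum.distrib sum_distrib_left[symmetric])
    finally show ?thesis
      using conv[of \<Omega> abs] conv[OF Pb, of "\<lambda>x. x"] \<Omega>(1) by simp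
  qed
  obtain e where e: "bij_betw e {..<card I} I" using ex_bij_betw_nat_finite[OF finI]
    by (auto simp: atLeast0LessThan)
  show ?thesis
  proof (intro exI[of _ "card I"] exI[of _ "\<lambda>j. P (e j)"] conjI allI impI)
    fix G :: "real ^ 'm \<Rightarrow> real" and t assume *: "integrable lebesgue G" "0 \<le> (t :: real)" "\<forall>h. (LINT
      x|lebesgue. \<bar>G (x + h) - G x\<bar>) \<le> norm h * t"
    show "(LINT x|lebesgue. indicator \<Omega> x * \<bar>G x\<bar>) \<le> \<epsilon> * t + (\<Sum>j<card I. \<bar>LINT x|lebesgue. indicator (P
      (e j)) x * G x\<bar>)"
      using est[OF *(1,2) *(3)[rule_format]] sum.reindex_bij_betw[OF e, of "\<lambda>\<kappa>. \<bar>LINT x|lebesgue.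
        indicator (P \<kappa>) x * G x\<bar>"] by simp
  qed (rule Pb P_sub)+
qed

text \<open>The extension lives on the whole space, so translations meet no boundary; the choice
  \<open>\<epsilon> / c\<close> in \<open>partition_estimate\<close> absorbs the extension
  constant.\<close>

lemma extension_L1_estimate:
  fixes \<Omega> :: "(real ^ 'm) set"
  assumes \<Omega>: "open \<Omega>" "bounded \<Omega>" and ext: "BV_extension_set \<Omega>" and \<epsilon>: "\<epsilon> > 0"
  shows "\<exists>(N :: nat) P. (\<forall>j. P j \<in> sets borel) \<and>
    (\<forall>u\<in>BV \<Omega>. L1_norm \<Omega> u \<le> \<epsilon> * BV_norm \<Omega> u + (\<Sum>j<N. \<bar>LINT x|lebesgue_on \<Omega>. u x * indicator (P j) x\<bar>))"
proof -
  obtain c where c: "c > 0" "\<And>u. u \<in> BV \<Omega> \<Longrightarrow> \<exists>w\<in>BV UNIV. (AE x in lebesgue_on \<Omega>. w x = u x) \<and>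
    total_variation UNIV w \<le> c * BV_norm \<Omega> u"
    using ext unfolding BV_extension_set_def by blast
  have \<epsilon>c: "\<epsilon> / c > 0" using c(1) \<epsilon> by simp
  obtain N :: nat and P where P': "\<forall>j. P j \<in> sets borel \<and> P j \<subseteq> \<Omega>"
    "\<forall>G t. integrable lebesgue G \<longrightarrow> t \<ge> 0 \<longrightarrow> (\<forall>h. (LINT x|lebesgue. \<bar>G (x + h) - G x\<bar>) \<le> norm h * t) \<longrightarrow>
      (LINT x|lebesgue. indicator \<Omega> x * \<bar>G x\<bar>) \<le> \<epsilon> / c * t + (\<Sum>j<N. \<bar>LINT x|lebesgue. indicator (P j) x
        * G x\<bar>)"
    using partition_estimate[OF \<Omega> \<epsilon>c] by (elim exE conjE)
  have P: "P j \<in> sets borel" "P j \<subseteq> \<Omega>" for j using P'(1) by auto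
  show ?thesis
  proof (intro exI[of _ N] exI[of _ P] conjI allI ballI)
    show "P j \<in> sets borel" for j by (rule P)
    fix u assume u: "u \<in> BV \<Omega>"
    obtain w where w: "w \<in> BV UNIV" "AE x in lebesgue_on \<Omega>. w x = u x" "total_variation UNIV w \<le> c *
      BV_norm \<Omega> u"
      using c(2)[OF u] by blast
    have iw: "integrable lebesgue w" using BV_integrable[OF w(1)] by (simp add: lebesgue_on_UNIV_eq)
    have T: "total_variation UNIV w \<ge> 0" by (rule total_variation_nonneg[OF open_UNIV w(1)])
    have tr: "(LINT x|lebesgue. \<bar>w (x + h) - w x\<bar>) \<le> norm h * total_variation UNIV w" for h
    proof -
      have "(LINT x|lebesgue. indicator UNIV x * \<bar>w (x + h) - w x\<bar>) \<le> norm h * total_variation UNIV w"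
      proof (rule translation_estimate[OF iw T, where \<Omega> = UNIV])
        show "(LINT x|lebesgue. w x * divergence v x) \<le> total_variation UNIV w"
          if "test_field UNIV v" "\<And>x. norm (v x) \<le> 1" for v
          using total_variation_upper[OF open_UNIV w(1) that] by (simp add: lebesgue_on_UNIV_eq)
      qed auto
      then show ?thesis by simp
    qed
    have wm: "w \<in> borel_measurable lebesgue" using iw by auto
    have wOm: "w \<in> borel_measurable (lebesgue_on \<Omega>)" by (rule measurable_restrict_space1[OF wm])
    have uOm: "u \<in> borel_measurable (lebesgue_on \<Omega>)" using BV_integrable[OF u] by auto
    have e1: "L1_norm \<Omega> u = (LINT x|lebesgue_on \<Omega>. \<bar>w x\<bar>)"
      unfolding L1_norm_def using w(2) wOm uOm by (intro integral_cong_AE) (auto elim: eventually_mono)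
    have e2: "(LINT x|lebesgue_on \<Omega>. \<bar>w x\<bar>) \<le> \<epsilon> / c * total_variation UNIV w + (\<Sum>j<N. \<bar>LINT x|lebesgue.
      indicator (P j) x * w x\<bar>)"
      unfolding integral_lebesgue_on[OF \<Omega>(1)] using P'(2) iw T tr by simp
    have e3: "(LINT x|lebesgue. indicator (P j) x * w x) = (LINT x|lebesgue_on \<Omega>. u x * indicator (P j)
      x)" for j
    proof -
      have "(LINT x|lebesgue. indicator (P j) x * w x) = (LINT x|lebesgue_on \<Omega>. w x * indicator (P j) x)"
        unfolding integral_lebesgue_on[OF \<Omega>(1)] using P(2)[of j]
        by (intro Bochner_Integration.integral_cong refl) (auto simp: indicator_def)
      also have "\<dots> = (LINT x|lebesgue_on \<Omega>. u x * indicator (P j) x)"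
      proof (rule integral_cong_AE)
        have "indicator (P j) \<in> borel_measurable (lebesgue_on \<Omega>)"
          using P(1) by (intro measurable_restrict_space1 borel_measurable_indicator) auto
        then show "(\<lambda>x. w x * indicator (P j) x) \<in> borel_measurable (lebesgue_on \<Omega>)"
          "(\<lambda>x. u x * indicator (P j) x) \<in> borel_measurable (lebesgue_on \<Omega>)"
          by (intro borel_measurable_times wOm uOm; assumption)+
        show "AE x in lebesgue_on \<Omega>. w x * indicator (P j) x = u x * indicator (P j) x" using w(2)
          by eventually_elim simp
      qed
      finally show ?thesis .
    qed
    have e4: "\<epsilon> / c * total_variation UNIV w \<le> \<epsilon> * BV_norm \<Omega> u"
      using mult_left_mono[OF w(3), of "\<epsilon> / c"] \<epsilon>c c(1) by simp
    show "L1_norm \<Omega> u \<le> \<epsilon> * BV_norm \<Omega> u + (\<Sum>j<N. \<bar>LINT x|lebesgue_on \<Omega>. u x * indicator (P j) x\<bar>)"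
      using e1 e2 e4 unfolding e3 by linarith
  qed
qed

text \<open>Bolzano-Weierstrass for each \<open>j\<close>, with the subsequences nested and
  diagonalised.\<close>

lemma bounded_family_convergent_subsequence:
  fixes a :: "nat \<Rightarrow> nat \<Rightarrow> real"
  assumes "\<And>j n. \<bar>a j n\<bar> \<le> M"
  obtains r :: "nat \<Rightarrow> nat" where "strict_mono r" "\<And>j. convergent (\<lambda>n. a j (r n))"
proof -
  interpret subseqs "\<lambda>j s. convergent (\<lambda>n. a j (s n))"
  proof
    fix j and s :: "nat \<Rightarrow> nat"
    have "bounded (range (\<lambda>n. a j (s n)))" using assms by (auto simp: bounded_iff)
    then obtain l r where "strict_mono (r :: nat \<Rightarrow> nat)" "((\<lambda>n. a j (s n)) \<circ> r) \<longlonglongrightarrow> l"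
      using bounded_imp_convergent_subsequence by blast
    then show "\<exists>r'. strict_mono r' \<and> convergent (\<lambda>n. a j ((s \<circ> r') n))"
      by (auto simp: convergent_def o_def)
  qed
  show ?thesis
  proof (rule that[OF subseq_diagseq])
    fix j
    have "convergent (\<lambda>n. a j ((diagseq \<circ> (+) (Suc j)) n))"
    proof (rule diagseq_holds)
      fix k s r assume "strict_mono (r :: nat \<Rightarrow> nat)" "convergent (\<lambda>n. a k (s n))"
      then show "convergent (\<lambda>n. a k ((s \<circ> r) n))"
        using convergent_subseq_convergent[of "\<lambda>n. a k (s n)" r] by (simp add: o_def)
    qed
    then have "convergent (\<lambda>n. a j (diagseq (n + Suc j)))" by (simp add: o_def add.commute)
    then show "convergent (\<lambda>n. a j (diagseq n))" by (rule convergent_ignore_initial_segment[THEN iffD1])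
  qed
qed

lemma L1_norm_add_le:
  assumes "integrable (lebesgue_on \<Omega>) u" "integrable (lebesgue_on \<Omega>) w"
  shows "L1_norm \<Omega> (\<lambda>x. u x + w x) \<le> L1_norm \<Omega> u + L1_norm \<Omega> w"
proof -
  have "L1_norm \<Omega> (\<lambda>x. u x + w x) \<le> (LINT x|lebesgue_on \<Omega>. \<bar>u x\<bar> + \<bar>w x\<bar>)"
    unfolding L1_norm_def using assms by (intro integral_mono) auto
  then show ?thesis using assms by (simp add: L1_norm_def)
qed

lemma L1_norm_cmult: "L1_norm \<Omega> (\<lambda>x. a * u x) = \<bar>a\<bar> * L1_norm \<Omega> u"
  by (simp add: L1_norm_def abs_mult)

lemma L1_norm_minus_commute: "L1_norm \<Omega> (\<lambda>x. u x - w x) = L1_norm \<Omega> (\<lambda>x. w x - u x)"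
  by (simp add: L1_norm_def abs_minus_commute)

lemma L1_norm_diff_le:
  assumes "integrable (lebesgue_on \<Omega>) u" "integrable (lebesgue_on \<Omega>) w"
  shows "L1_norm \<Omega> (\<lambda>x. u x - w x) \<le> L1_norm \<Omega> u + L1_norm \<Omega> w"
  using L1_norm_add_le[OF assms(1), of "\<lambda>x. - 1 * w x"] assms(2) by (simp add: L1_norm_def)

lemma L1_norm_triangle:
  assumes "integrable (lebesgue_on \<Omega>) u" "integrable (lebesgue_on \<Omega>) v" "integrable (lebesgue_on \<Omega>) w"
  shows "L1_norm \<Omega> (\<lambda>x. u x - w x) \<le> L1_norm \<Omega> (\<lambda>x. u x - v x) + L1_norm \<Omega> (\<lambda>x. v x - w x)"
  using L1_norm_add_le[of \<Omega> "\<lambda>x. u x - v x" "\<lambda>x. v x - w x"] assms by simp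

text \<open>An almost everywhere convergent subsequence supplies the limit, and Fatou's lemma turns
  the Cauchy condition into L1 convergence of the full sequence.\<close>

lemma L1_complete:
  assumes s: "\<And>n. integrable (lebesgue_on \<Omega>) (s n)"
    and C: "\<And>e. e > 0 \<Longrightarrow> \<exists>N. \<forall>i\<ge>N. \<forall>j\<ge>N. L1_norm \<Omega> (\<lambda>x. s i x - s j x) < e"
  obtains u where "integrable (lebesgue_on \<Omega>) u" "(\<lambda>n. L1_norm \<Omega> (\<lambda>x. s n x - u x)) \<longlonglongrightarrow> 0"
proof -
  let ?M = "lebesgue_on \<Omega>"
  have sm[measurable]: "s n \<in> borel_measurable ?M" for n using s[of n] by auto
  obtain r where r: "strict_mono (r :: nat \<Rightarrow> nat)" "AE x in ?M. Cauchy (\<lambda>i. s (r i) x)"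
  proof (rule cauchy_L1_AE_cauchy_subseq[of ?M s, OF s])
    show "\<exists>N. \<forall>i\<ge>N. \<forall>j\<ge>N. (LINT x|?M. norm (s i x - s j x)) < e" if "e > 0" for e
      using C[OF that] by (simp add: L1_norm_def)
  qed (rule that)
  define u where "u x = lim (\<lambda>i. s (r i) x)" for x
  have um[measurable]: "u \<in> borel_measurable ?M" unfolding u_def[abs_def] by measurable
  have ae: "AE x in ?M. (\<lambda>i. s (r i) x) \<longlonglongrightarrow> u x"
    using r(2) by eventually_elim (simp add: u_def Cauchy_convergent_iff convergent_LIMSEQ_iff)
  have key: "(\<integral>\<^sup>+ x. ennreal \<bar>s n x - u x\<bar> \<partial>?M) \<le> ennreal e"
    if N: "\<forall>i\<ge>N. \<forall>j\<ge>N. L1_norm \<Omega> (\<lambda>x. s i x - s j x) < e" and n: "n \<ge> N" for n N e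
  proof -
    have "(\<integral>\<^sup>+ x. ennreal \<bar>s n x - u x\<bar> \<partial>?M) = (\<integral>\<^sup>+ x. liminf (\<lambda>k. ennreal \<bar>s n x - s (r k) x\<bar>) \<partial>?M)"
    proof (rule nn_integral_cong_AE)
      show "AE x in ?M. ennreal \<bar>s n x - u x\<bar> = liminf (\<lambda>k. ennreal \<bar>s n x - s (r k) x\<bar>)"
        using ae
      proof eventually_elim
        case (elim x)
        then have "(\<lambda>k. ennreal \<bar>s n x - s (r k) x\<bar>) \<longlonglongrightarrow> ennreal \<bar>s n x - u x\<bar>"
          by (intro tendsto_ennrealI tendsto_rabs tendsto_diff tendsto_const)
        then show ?case by (rule lim_imp_Liminf[symmetric, rotated]) simp
      qed
    qed
    also have "\<dots> \<le> liminf (\<lambda>k. \<integral>\<^sup>+ x. ennreal \<bar>s n x - s (r k) x\<bar> \<partial>?M)"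
      by (rule nn_integral_liminf) measurable
    also have "\<dots> \<le> ennreal e"
    proof (rule Liminf_le)
      show "\<forall>\<^sub>F k in sequentially. (\<integral>\<^sup>+ x. ennreal \<bar>s n x - s (r k) x\<bar> \<partial>?M) \<le> ennreal e"
        unfolding eventually_sequentially
      proof (intro exI[of _ N] allI impI)
        fix k assume "k \<ge> N"
        then have "r k \<ge> N" using seq_suble[OF r(1), of k] by linarith
        then have "L1_norm \<Omega> (\<lambda>x. s n x - s (r k) x) \<le> e" using N n by (simp add: less_imp_le)
        moreover have "(\<integral>\<^sup>+ x. ennreal \<bar>s n x - s (r k) x\<bar> \<partial>?M) = ennreal (L1_norm \<Omega> (\<lambda>x. s n x - s (r k) x))"
          unfolding L1_norm_def using s by (intro nn_integral_eq_integral) auto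
        ultimately show "(\<integral>\<^sup>+ x. ennreal \<bar>s n x - s (r k) x\<bar> \<partial>?M) \<le> ennreal e" by (simp add: ennreal_leI)
      qed
    qed simp
    finally show ?thesis .
  qed
  have idiff: "integrable ?M (\<lambda>x. s n x - u x)"
    if "\<forall>i\<ge>N. \<forall>j\<ge>N. L1_norm \<Omega> (\<lambda>x. s i x - s j x) < e" "n \<ge> N" for n N e
  proof (rule integrableI_bounded)
    show "(\<integral>\<^sup>+ x. ennreal (norm (s n x - u x)) \<partial>?M) < \<infinity>"
      using key[OF that] by (simp add: le_less_trans)
  qed measurable
  obtain N1 where N1: "\<forall>i\<ge>N1. \<forall>j\<ge>N1. L1_norm \<Omega> (\<lambda>x. s i x - s j x) < 1" using C[of 1] by auto
  have iu: "integrable ?M u"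
    using Bochner_Integration.integrable_diff[OF s[of N1] idiff[OF N1 order_refl]] by simp
  show ?thesis
  proof (rule that[OF iu], rule LIMSEQ_I)
    fix e :: real assume e: "e > 0"
    then obtain N where N: "\<forall>i\<ge>N. \<forall>j\<ge>N. L1_norm \<Omega> (\<lambda>x. s i x - s j x) < e / 2" using C[of "e / 2"] by auto
    have "norm (L1_norm \<Omega> (\<lambda>x. s n x - u x) - 0) < e" if n: "n \<ge> N" for n
    proof -
      have "ennreal (L1_norm \<Omega> (\<lambda>x. s n x - u x)) = (\<integral>\<^sup>+ x. ennreal \<bar>s n x - u x\<bar> \<partial>?M)"
        unfolding L1_norm_def using idiff[OF N n] by (intro nn_integral_eq_integral[symmetric]) auto
      also note key[OF N n]
      finally show ?thesis using e L1_norm_nonneg[of \<Omega> "\<lambda>x. s n x - u x"] by (simp add: ennreal_le_iff)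
    qed
    then show "\<exists>no. \<forall>n\<ge>no. norm (L1_norm \<Omega> (\<lambda>x. s n x - u x) - 0) < e" by blast
  qed
qed

lemma integral_bounded_L1:
  assumes "integrable (lebesgue_on \<Omega>) u" "g \<in> borel_measurable (lebesgue_on \<Omega>)" "\<And>x. x \<in> \<Omega> \<Longrightarrow> \<bar>g x\<bar> \<le> B"
  shows "\<bar>LINT x|lebesgue_on \<Omega>. u x * g x\<bar> \<le> B * L1_norm \<Omega> u"
  unfolding L1_norm_def by (rule integrable_mult_bounded(2)[OF assms(1,2)]) (use assms(3) in \<open>simp add:
    space_restrict_space\<close>)

lemma tendsto_integral_L1:
  assumes f: "\<And>n. integrable (lebesgue_on \<Omega>) (f n)" and u: "integrable (lebesgue_on \<Omega>) u"
    and lim: "(\<lambda>n. L1_norm \<Omega> (\<lambda>x. f n x - u x)) \<longlonglongrightarrow> 0"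
    and g: "g \<in> borel_measurable (lebesgue_on \<Omega>)" "\<And>x. x \<in> \<Omega> \<Longrightarrow> \<bar>g x\<bar> \<le> B"
  shows "(\<lambda>n. LINT x|lebesgue_on \<Omega>. f n x * g x) \<longlonglongrightarrow> (LINT x|lebesgue_on \<Omega>. u x * g x)"
proof (rule LIM_zero_cancel, rule Lim_null_comparison)
  have gs: "\<And>x. x \<in> space (lebesgue_on \<Omega>) \<Longrightarrow> \<bar>g x\<bar> \<le> B" using g(2) by (simp add: space_restrict_space)
  have "\<bar>(LINT x|lebesgue_on \<Omega>. f n x * g x) - (LINT x|lebesgue_on \<Omega>. u x * g x)\<bar> \<le> B * L1_norm \<Omega> (\<lambda>x. f
    n x - u x)" for n
  proof -
    have "(LINT x|lebesgue_on \<Omega>. f n x * g x) - (LINT x|lebesgue_on \<Omega>. u x * g x) = (LINT x|lebesgue_on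
      \<Omega>. (f n x - u x) * g x)"
      unfolding left_diff_distrib
      by (rule Bochner_Integration.integral_diff[OF integrable_mult_bounded(1)[OF f g(1) gs]
        integrable_mult_bounded(1)[OF u g(1) gs], symmetric])
    then show ?thesis
      using integral_bounded_L1[OF Bochner_Integration.integrable_diff[OF f[of n] u] g] by simp
  qed
  then show "\<forall>\<^sub>F n in sequentially. norm ((LINT x|lebesgue_on \<Omega>. f n x * g x) - (LINT x|lebesgue_on \<Omega>. u
    x * g x))
      \<le> B * L1_norm \<Omega> (\<lambda>x. f n x - u x)" by simp
  show "(\<lambda>n. B * L1_norm \<Omega> (\<lambda>x. f n x - u x)) \<longlonglongrightarrow> 0" using tendsto_mult_right_zero[OF lim] .
qed

text \<open>Along a subsequence all integrals over the pieces from
  \<open>extension_L1_estimate\<close> converge, for every accuracy \<open>1 / (k + 1)\<close> at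
  once. Applied to differences, that estimate makes the subsequence Cauchy in L1.\<close>

lemma rellich:
  fixes \<Omega> :: "(real ^ 'm) set"
  assumes \<Omega>: "open \<Omega>" "bounded \<Omega>" and ext: "BV_extension_set \<Omega>"
    and f: "\<And>n. f n \<in> BV \<Omega>" "\<And>n. BV_norm \<Omega> (f n) \<le> M"
  obtains r u where "strict_mono (r :: nat \<Rightarrow> nat)" "integrable (lebesgue_on \<Omega>) u"
    "(\<lambda>n. L1_norm \<Omega> (\<lambda>x. f (r n) x - u x)) \<longlonglongrightarrow> 0"
proof -
  have "\<forall>k. \<exists>(N :: nat) P. (\<forall>j. P j \<in> sets borel) \<and> (\<forall>u\<in>BV \<Omega>. L1_norm \<Omega> u \<le> inverse (real (Suc k)) *
    BV_norm \<Omega> u +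
      (\<Sum>j<N. \<bar>LINT x|lebesgue_on \<Omega>. u x * indicator (P j) x\<bar>))"
    by (intro allI extension_L1_estimate[OF \<Omega> ext]) simp
  from choice[OF this] obtain N :: "nat \<Rightarrow> nat" where "\<forall>k. \<exists>P. (\<forall>j. P j \<in> sets borel) \<and>
      (\<forall>u\<in>BV \<Omega>. L1_norm \<Omega> u \<le> inverse (real (Suc k)) * BV_norm \<Omega> u +
      (\<Sum>j<N k. \<bar>LINT x|lebesgue_on \<Omega>. u x * indicator (P j) x\<bar>))" ..
  from choice[OF this] obtain P where P: "\<And>k j. P k j \<in> sets borel"
    "\<And>k u. u \<in> BV \<Omega> \<Longrightarrow> L1_norm \<Omega> u \<le> inverse (real (Suc k)) * BV_norm \<Omega> u +
      (\<Sum>j<N k. \<bar>LINT x|lebesgue_on \<Omega>. u x * indicator (P k j) x\<bar>)" by auto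
  have Pm: "indicator (P k j) \<in> borel_measurable (lebesgue_on \<Omega>)" for k j
    using P(1) by (intro measurable_restrict_space1 borel_measurable_indicator) auto
  have P1: "\<bar>indicator (P k j) x :: real\<bar> \<le> 1" for k j x by (simp add: indicator_def)
  define b where "b k j u = (LINT x|lebesgue_on \<Omega>. u x * indicator (P k j) x)"
    for k j and u :: "real ^ 'm \<Rightarrow> real"
  have L1M: "L1_norm \<Omega> (f n) \<le> M" for n
    using f(2)[of n] total_variation_nonneg[OF \<Omega>(1) f(1)]
      by (simp add: BV_norm_def add_increasing2) (metis add_increasing2 le_add_same_cancel1 order_trans)
  have bM: "\<bar>b k j (f n)\<bar> \<le> M" for k j n
    using integral_bounded_L1[OF BV_integrable[OF f(1)] Pm P1, of n k j] L1M[of n] by (simp add: b_def)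
  \<comment> \<open>The double family indexed by \<open>(k, j)\<close> is enumerated through
    \<open>prod_decode\<close>, so that one diagonal sequence serves all accuracies.\<close>
  obtain r where r: "strict_mono r" "\<And>i. convergent (\<lambda>n. (\<lambda>i n. b (fst (prod_decode i)) (snd
    (prod_decode i)) (f n)) i (r n))"
    by (rule bounded_family_convergent_subsequence[of "\<lambda>i n. b (fst (prod_decode i)) (snd (prod_decode
      i)) (f n)" M])
       (rule bM, rule that)
  have conv: "convergent (\<lambda>n. b k j (f (r n)))" for k j using r(2)[of "prod_encode (k, j)"] by simp
  define s where "s n = f (r n)" for n
  have sBV: "s n \<in> BV \<Omega>" for n by (simp add: s_def f)
  have cau: "\<exists>K. \<forall>i\<ge>K. \<forall>j\<ge>K. L1_norm \<Omega> (\<lambda>x. s i x - s j x) < e" if e: "e > 0" for e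
  proof -
    have M0: "M \<ge> 0" using L1M[of 0] L1_norm_nonneg[of \<Omega> "f 0"] by linarith
    \<comment> \<open>Differences have \<open>BV_norm\<close> at most \<open>2 * M\<close>; the
      added 1 keeps the denominator positive when \<open>M = 0\<close>.\<close>
    obtain k where k: "inverse (real (Suc k)) < e / (2 * (2 * M + 1))"
      using reals_Archimedean[of "e / (2 * (2 * M + 1))"] e M0 by auto
    have "\<exists>K. \<forall>m\<ge>K. \<forall>n\<ge>K. (\<Sum>j<N k. \<bar>b k j (s m) - b k j (s n)\<bar>) < e / 2"
    proof -
      have "\<forall>j. \<exists>K. \<forall>m\<ge>K. \<forall>n\<ge>K. \<bar>b k j (s m) - b k j (s n)\<bar> < e / (2 * real (Suc (N k)))"
      proof
        fix j
        have "Cauchy (\<lambda>n. b k j (s n))" using conv[of k j] by (simp add: s_def Cauchy_convergent_iff)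
        moreover have "e / (2 * real (Suc (N k))) > 0" using e by simp
        ultimately show "\<exists>K. \<forall>m\<ge>K. \<forall>n\<ge>K. \<bar>b k j (s m) - b k j (s n)\<bar> < e / (2 * real (Suc (N k)))"
          unfolding Cauchy_def dist_real_def by blast
      qed
      then obtain K where K: "\<And>j m n. m \<ge> K j \<Longrightarrow> n \<ge> K j \<Longrightarrow> \<bar>b k j (s m) - b k j (s n)\<bar> < e / (2 * real
        (Suc (N k)))" by metis
      have "(\<Sum>j<N k. \<bar>b k j (s m) - b k j (s n)\<bar>) < e / 2" if "m \<ge> (\<Sum>j<N k. K j)" "n \<ge> (\<Sum>j<N k. K j)" for m n
      proof -
        have "(\<Sum>j<N k. \<bar>b k j (s m) - b k j (s n)\<bar>) \<le> (\<Sum>j<N k. e / (2 * real (Suc (N k))))"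
        proof (rule sum_mono)
          fix j assume "j \<in> {..<N k}"
          then have "K j \<le> (\<Sum>j<N k. K j)" by (intro member_le_sum) auto
          then have "K j \<le> m" "K j \<le> n" using that by auto
          then show "\<bar>b k j (s m) - b k j (s n)\<bar> \<le> e / (2 * real (Suc (N k)))" by (rule less_imp_le[OF K])
        qed
        also have "\<dots> = real (N k) * (e / (2 * real (Suc (N k))))" by simp
        also have "\<dots> < real (Suc (N k)) * (e / (2 * real (Suc (N k))))" using e
          by (intro mult_strict_right_mono) auto
        also have "\<dots> = e / 2" by (simp del: of_nat_Suc)
        finally show ?thesis .
      qed
      then show ?thesis by blast
    qed
    then obtain K where K: "\<And>m n. m \<ge> K \<Longrightarrow> n \<ge> K \<Longrightarrow> (\<Sum>j<N k. \<bar>b k j (s m) - b k j (s n)\<bar>) < e / 2" by blast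
    have "L1_norm \<Omega> (\<lambda>x. s m x - s n x) < e" if mn: "m \<ge> K" "n \<ge> K" for m n
    proof -
      have D: "(\<lambda>x. s m x - s n x) \<in> BV \<Omega>" by (rule BV_diff[OF \<Omega>(1) sBV sBV])
      have "BV_norm \<Omega> (\<lambda>x. s m x - s n x) \<le> BV_norm \<Omega> (s m) + BV_norm \<Omega> (s n)"
        using total_variation_diff[OF \<Omega>(1) sBV[of m] sBV[of n]]
          L1_norm_diff_le[OF BV_integrable[OF sBV[of m]] BV_integrable[OF sBV[of n]]]
            by (simp add: BV_norm_def)
      also have "\<dots> \<le> 2 * M" using f(2) by (simp add: s_def) (metis add_mono mult_2)
      finally have BVd: "BV_norm \<Omega> (\<lambda>x. s m x - s n x) \<le> 2 * M" .
      have bd: "b k j (\<lambda>x. s m x - s n x) = b k j (s m) - b k j (s n)" for j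
        unfolding b_def left_diff_distrib
        by (rule Bochner_Integration.integral_diff[OF integrable_mult_bounded(1)[OF BV_integrable[OF
          sBV] Pm P1]
              integrable_mult_bounded(1)[OF BV_integrable[OF sBV] Pm P1]])
      have "inverse (real (Suc k)) * BV_norm \<Omega> (\<lambda>x. s m x - s n x) \<le> inverse (real (Suc k)) * (2 * M)"
        by (intro mult_left_mono BVd) simp
      also have "\<dots> \<le> inverse (real (Suc k)) * (2 * M + 1)" by (intro mult_left_mono) auto
      also have "\<dots> < e / 2" using k M0 by (simp add: field_simps)
      finally have "inverse (real (Suc k)) * BV_norm \<Omega> (\<lambda>x. s m x - s n x) < e / 2" .
      moreover have "(\<Sum>j<N k. \<bar>LINT x|lebesgue_on \<Omega>. (s m x - s n x) * indicator (P k j) x\<bar>) < e / 2"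
        using K[OF mn] bd unfolding b_def by simp
      ultimately show ?thesis using P(2)[OF D, of k] by linarith
    qed
    then show ?thesis by blast
  qed
  obtain u where u: "integrable (lebesgue_on \<Omega>) u" "(\<lambda>n. L1_norm \<Omega> (\<lambda>x. s n x - u x)) \<longlonglongrightarrow> 0"
    by (rule L1_complete[of \<Omega> s, OF BV_integrable[OF sBV] cau]) (assumption, rule that)
  show ?thesis using that[OF r(1) u(1)] u(2) by (simp add: s_def)
qed

section \<open>Poincare inequality on extension domains\<close>

lemma bounded_emeasure_finite:
  fixes \<Omega> :: "(real ^ 'm) set"
  shows "bounded \<Omega> \<Longrightarrow> open \<Omega> \<Longrightarrow> emeasure lebesgue \<Omega> < \<infinity>"
  using emeasure_bounded_finite[of \<Omega>] by simp

lemma integrable_const_bounded: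
  fixes \<Omega> :: "(real ^ 'm) set"
  assumes "open \<Omega>" "bounded \<Omega>" shows "integrable (lebesgue_on \<Omega>) (\<lambda>x. c :: real)"
proof -
  have "finite_measure (lebesgue_on \<Omega>)"
    using bounded_emeasure_finite[OF assms(2,1)] assms(1)
    by (intro finite_measureI) (simp add: emeasure_restrict_space space_restrict_space)
  then show ?thesis by (rule finite_measure.integrable_const)
qed

lemma measure_lebesgue_on_space:
  fixes \<Omega> :: "(real ^ 'm) set"
  assumes "open \<Omega>" shows "measure (lebesgue_on \<Omega>) (space (lebesgue_on \<Omega>)) = measure lebesgue \<Omega>"
  using assms by (simp add: measure_restrict_space space_restrict_space)

lemma BV_shift:
  fixes u :: "real ^ 'm \<Rightarrow> real"
  assumes \<Omega>: "open \<Omega>" "bounded \<Omega>" and u: "u \<in> BV \<Omega>"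
  shows "(\<lambda>x. u x - c) \<in> BV \<Omega>" "total_variation \<Omega> (\<lambda>x. u x - c) = total_variation \<Omega> u"
proof -
  have i: "integrable (lebesgue_on \<Omega>) (\<lambda>x. u x - c)"
    by (intro Bochner_Integration.integrable_diff BV_integrable u integrable_const_bounded \<Omega>)
  have ae: "AE x in lebesgue_on \<Omega>. (u x - c) - u x = - c" by simp
  have "is_weak_partial \<Omega> i (\<lambda>x. u x - c) = is_weak_partial \<Omega> i u" for i
    by (rule is_weak_partial_shift[OF \<Omega>(1) BV_integrable[OF u] i ae])
  then show "(\<lambda>x. u x - c) \<in> BV \<Omega>" using u i by (simp add: BV_def L1_def)
  show "total_variation \<Omega> (\<lambda>x. u x - c) = total_variation \<Omega> u"
    by (rule total_variation_shift[OF \<Omega>(1) BV_integrable[OF u] i ae])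
qed

lemma integral_minus_mean:
  fixes u :: "real ^ 'm \<Rightarrow> real"
  assumes \<Omega>: "open \<Omega>" "bounded \<Omega>" "\<Omega> \<noteq> {}" and u: "integrable (lebesgue_on \<Omega>) u"
  shows "(LINT x|lebesgue_on \<Omega>. u x - mean \<Omega> u) = 0"
proof -
  note fin = bounded_emeasure_finite[OF \<Omega>(2,1)]
  have "(LINT x|lebesgue_on \<Omega>. u x - mean \<Omega> u) = (LINT x|lebesgue_on \<Omega>. u x) - mean \<Omega> u * measure lebesgue \<Omega>"
    using u integrable_const_bounded[OF \<Omega>(1,2)] measure_lebesgue_on_space[OF \<Omega>(1)] by simp
  then show ?thesis using measure_open_pos[OF \<Omega>(1,3) fin] fin by (simp add: mean_def)
qed

text \<open>Functions violating the inequality more and more are centred and normalised to L1 norm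
  1, so that their total variations tend to 0. A limit has vanishing gradient, is constant by
  connectedness, has mean 0 and is therefore 0, against the norm 1.\<close>

lemma extension_poincare:
  fixes \<Omega> :: "(real ^ 'm) set"
  assumes \<Omega>: "open \<Omega>" "bounded \<Omega>" "\<Omega> \<noteq> {}" "connected \<Omega>" and ext: "BV_extension_set \<Omega>"
  obtains C where "C > 0" "\<And>u. u \<in> BV \<Omega> \<Longrightarrow> L1_norm \<Omega> (\<lambda>x. u x - mean \<Omega> u) \<le> C * total_variation \<Omega> u"
proof (rule ccontr)
  assume no: "\<not> thesis"
  note obt = that
  have "\<exists>u. u \<in> BV \<Omega> \<and> L1_norm \<Omega> (\<lambda>x. u x - mean \<Omega> u) > C * total_variation \<Omega> u" if "C > 0" for C
    using no obt[of C] that by (meson linorder_not_le)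
  then have "\<exists>u. u \<in> BV \<Omega> \<and> L1_norm \<Omega> (\<lambda>x. u x - mean \<Omega> u) > real (Suc n) * total_variation \<Omega> u" for n
    by simp
  then obtain u where u: "\<And>n. u n \<in> BV \<Omega>"
    "\<And>n. L1_norm \<Omega> (\<lambda>x. u n x - mean \<Omega> (u n)) > real (Suc n) * total_variation \<Omega> (u n)" by metis
  define s where "s n = L1_norm \<Omega> (\<lambda>x. u n x - mean \<Omega> (u n))" for n
  have T0: "total_variation \<Omega> (u n) \<ge> 0" for n by (rule total_variation_nonneg[OF \<Omega>(1) u(1)])
  have s: "s n > 0" for n
    using u(2)[of n] mult_nonneg_nonneg[of "real (Suc n)", OF _ T0[of n]] unfolding s_def by linarith
  define f where "f n x = inverse (s n) * (u n x - mean \<Omega> (u n))" for n x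
  have f: "f n \<in> BV \<Omega>" for n unfolding f_def by (intro BV_cmult BV_shift(1)[OF \<Omega>(1,2)] u)
  note fi = BV_integrable[OF f]
  have f1: "L1_norm \<Omega> (f n) = 1" for n
    unfolding f_def L1_norm_cmult using s[of n] by (simp add: s_def[symmetric])
  have fT: "total_variation \<Omega> (f n) \<le> inverse (real (Suc n))" for n
  proof -
    have "total_variation \<Omega> (f n) \<le> \<bar>inverse (s n)\<bar> * total_variation \<Omega> (u n)"
      unfolding f_def using total_variation_cmult[OF \<Omega>(1) BV_shift(1)[OF \<Omega>(1,2) u(1)]] BV_shift(2)[OF
        \<Omega>(1,2) u(1)] by metis
    also have "\<dots> \<le> inverse (real (Suc n))"
      using u(2)[of n] s[of n] unfolding s_def[symmetric] by (simp add: field_simps)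
    finally show ?thesis .
  qed
  have fBV: "BV_norm \<Omega> (f n) \<le> 2" for n
  proof -
    have "inverse (real (Suc n)) \<le> 1" by (simp add: field_simps)
    then show ?thesis using f1[of n] fT[of n] by (simp add: BV_norm_def)
  qed
  obtain r w where r: "strict_mono (r :: nat \<Rightarrow> nat)" and w: "integrable (lebesgue_on \<Omega>) w"
    and lim: "(\<lambda>n. L1_norm \<Omega> (\<lambda>x. f (r n) x - w x)) \<longlonglongrightarrow> 0"
    by (rule rellich[OF \<Omega>(1,2) ext f fBV]) (rule that)
  have one: "(\<lambda>x. 1) \<in> borel_measurable (lebesgue_on \<Omega>)" by simp
  have "(LINT x|lebesgue_on \<Omega>. f n x) = 0" for n
    unfolding f_def using integral_minus_mean[OF \<Omega>(1-3) BV_integrable[OF u(1)]] by simp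
  then have w0: "(LINT x|lebesgue_on \<Omega>. w x) = 0"
    using tendsto_integral_L1[OF fi w lim one, of 1] by (simp add: LIMSEQ_const_iff)
  have "(LINT x|lebesgue_on \<Omega>. w x * divergence v x) = 0" if v: "test_field \<Omega> v" for v
  proof -
    obtain B where B: "B > 0" "\<And>x. \<bar>divergence v x\<bar> \<le> B" by (rule divergence_bounded[OF v]) (rule that)
    obtain D where D: "D > 0" "\<And>x. x \<in> \<Omega> \<Longrightarrow> norm (v x) \<le> D"
      by (rule C0_bounded[OF test_field_C0[OF v]]) (rule that)
    have D': "norm (v x) \<le> D" for x using D test_field_outside[OF v, of x] by (cases "x \<in> \<Omega>") auto
    have l1: "(\<lambda>n. LINT x|lebesgue_on \<Omega>. f (r n) x * divergence v x) \<longlonglongrightarrow> (LINT x|lebesgue_on \<Omega>. w x *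
      divergence v x)"
      by (rule tendsto_integral_L1[OF fi w lim measurable_continuous_lebesgue_on[OF \<Omega>(1)
        divergence_continuous[OF v]] B(2)])
    have "(\<lambda>n. LINT x|lebesgue_on \<Omega>. f (r n) x * divergence v x) \<longlonglongrightarrow> 0"
    proof (rule Lim_null_comparison)
      have "\<bar>LINT x|lebesgue_on \<Omega>. f (r n) x * divergence v x\<bar> \<le> D * inverse (real (Suc n))" for n
      proof -
        have "\<bar>LINT x|lebesgue_on \<Omega>. f (r n) x * divergence v x\<bar> \<le> D * total_variation \<Omega> (f (r n))"
          by (rule integral_divergence_le[OF \<Omega>(1) f v D'])
        also have "\<dots> \<le> D * inverse (real (Suc n))"
        proof -
          have "inverse (real (Suc (r n))) \<le> inverse (real (Suc n))"
            using seq_suble[OF r, of n] by (intro le_imp_inverse_le) auto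
          with fT[of "r n"] have "total_variation \<Omega> (f (r n)) \<le> inverse (real (Suc n))" by (rule order_trans)
          then show ?thesis using D(1) by (intro mult_left_mono) auto
        qed
        finally show ?thesis .
      qed
      then show "\<forall>\<^sub>F n in sequentially. norm (LINT x|lebesgue_on \<Omega>. f (r n) x * divergence v x) \<le> D *
        inverse (real (Suc n))" by simp
      show "(\<lambda>n. D * inverse (real (Suc n))) \<longlonglongrightarrow> 0"
        by (rule tendsto_mult_right_zero[OF LIMSEQ_inverse_real_of_nat])
    qed
    then show ?thesis using LIMSEQ_unique[OF l1] by simp
  qed
  \<comment> \<open>Cutting \<open>w\<close> off outside \<open>\<Omega>\<close> transfers the
    condition to \<open>lebesgue\<close>, where \<open>constant_of_zero_gradient\<close> is
    stated.\<close>
  then have dv: "(LINT x|lebesgue. (indicator \<Omega> x * w x) * divergence v x) \<le> 0" if "test_field \<Omega> v" for v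
    using that unfolding integral_lebesgue_on[OF \<Omega>(1)] by (simp add: mult.assoc)
  obtain c where c: "AE x in lebesgue. x \<in> \<Omega> \<longrightarrow> indicator \<Omega> x * w x = c"
    by (rule constant_of_zero_gradient[OF \<Omega>(1,4) w[unfolded integral_lebesgue_on[OF \<Omega>(1)]] dv])
      (assumption, rule that)
  have "AE x in lebesgue_on \<Omega>. indicator \<Omega> x * w x = c" using c \<Omega>(1) by (subst AE_restrict_space_iff) auto
  then have wc: "AE x in lebesgue_on \<Omega>. w x = c"
    using AE_space by eventually_elim (simp add: space_restrict_space)
  have wm: "w \<in> borel_measurable (lebesgue_on \<Omega>)" using w by auto
  have "(LINT x|lebesgue_on \<Omega>. w x) = (LINT x|lebesgue_on \<Omega>. c)"
    by (rule integral_cong_AE[OF wm]) (use wc in auto)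
  then have "c * measure lebesgue \<Omega> = 0" using w0 measure_lebesgue_on_space[OF \<Omega>(1)] by auto
  then have "c = 0" using measure_open_pos[OF \<Omega>(1,3) bounded_emeasure_finite[OF \<Omega>(2,1)]] by simp
  then have "L1_norm \<Omega> w = (LINT x|lebesgue_on \<Omega>. 0)" unfolding L1_norm_def using wm wc
    by (intro integral_cong_AE) auto
  then have L0: "L1_norm \<Omega> w = 0" by simp
  have "1 \<le> L1_norm \<Omega> (\<lambda>x. f (r n) x - w x)" for n
    using L1_norm_add_le[OF Bochner_Integration.integrable_diff[OF fi w] w, of "r n"] f1[of "r n"] L0 by simp
  then have "1 \<le> (0 :: real)" by (intro LIMSEQ_le_const[OF lim]) auto
  then show False by simp
qed

section \<open>The Riesz representation theorem on bounded open sets\<close>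

text \<open>Continuous functions vanishing outside \<open>\<Omega>\<close>; for bounded open \<open>\<Omega>\<close> these are the elements of
  \<open>C\<^sub>0(\<Omega>)\<close>, extended by zero.\<close>

definition vanishing :: "'a::euclidean_space set \<Rightarrow> ('a \<Rightarrow> real) \<Rightarrow> bool" where
  "vanishing \<Omega> f \<longleftrightarrow> continuous_on UNIV f \<and> (\<forall>x. x \<notin> \<Omega> \<longrightarrow> f x = 0)"

definition nonneg_vanishing :: "'a::euclidean_space set \<Rightarrow> ('a \<Rightarrow> real) \<Rightarrow> bool" where
  "nonneg_vanishing \<Omega> f \<longleftrightarrow> vanishing \<Omega> f \<and> (\<forall>x. f x \<ge> 0)"

lemma vanishing_bounded:
  assumes "bounded \<Omega>" "vanishing \<Omega> f"
  obtains B where "B > 0" "\<And>x. \<bar>f x\<bar> \<le> B"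
proof -
  have "compact (closure \<Omega>)" using assms(1) by (simp add: compact_closure)
  moreover have "continuous_on (closure \<Omega>) f"
    using assms(2) continuous_on_subset[of UNIV f "closure \<Omega>"] by (simp add: vanishing_def)
  ultimately have "bounded (f ` closure \<Omega>)" by (intro compact_imp_bounded compact_continuous_image)
  then obtain B where B: "B > 0" "\<forall>y\<in>f ` closure \<Omega>. norm y \<le> B" unfolding bounded_pos by blast
  have "\<bar>f x\<bar> \<le> B" for x
  proof (cases "x \<in> \<Omega>")
    case True
    then have "x \<in> closure \<Omega>" using closure_subset by blast
    then show ?thesis using B(2) by simp
  next
    case False
    then show ?thesis using assms(2) B(1) by (simp add: vanishing_def)
  qed
  then show ?thesis using B(1) that by blast
qed

lemma vanishing_add: "vanishing \<Omega> f \<Longrightarrow> vanishing \<Omega> g \<Longrightarrow> vanishing \<Omega> (\<lambda>x. f x + g x)"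
  by (auto simp: vanishing_def intro: continuous_on_add)

lemma vanishing_diff: "vanishing \<Omega> f \<Longrightarrow> vanishing \<Omega> g \<Longrightarrow> vanishing \<Omega> (\<lambda>x. f x - g x)"
  by (auto simp: vanishing_def intro: continuous_on_diff)

text \<open>The axioms concern the cone of nonnegative functions only, because \<open>L\<close> will
  be the positive part of a signed functional, and the supremum that gives it is taken on this
  cone.\<close>

locale positive_functional =
  fixes \<Omega> :: "'a::euclidean_space set" and L :: "('a \<Rightarrow> real) \<Rightarrow> real" and C :: real
  assumes \<Omega>: "open \<Omega>" "bounded \<Omega>"
    and L_nonneg: "\<And>f. nonneg_vanishing \<Omega> f \<Longrightarrow> L f \<ge> 0"
    and L_add: "\<And>f g. nonneg_vanishing \<Omega> f \<Longrightarrow> nonneg_vanishing \<Omega> g \<Longrightarrow> L (\<lambda>x. f x + g x) = L f + L g"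
    and L_le: "\<And>f. nonneg_vanishing \<Omega> f \<Longrightarrow> (\<And>x. f x \<le> 1) \<Longrightarrow> L f \<le> C"
begin

abbreviation "Hp \<equiv> nonneg_vanishing \<Omega>"

lemma Hp_I: "continuous_on UNIV f \<Longrightarrow> (\<And>x. x \<notin> \<Omega> \<Longrightarrow> f x = 0) \<Longrightarrow> (\<And>x. f x \<ge> 0) \<Longrightarrow> Hp f"
  by (simp add: nonneg_vanishing_def vanishing_def)

lemma Hp_D: assumes "Hp f" shows "continuous_on UNIV f" "x \<notin> \<Omega> \<Longrightarrow> f x = 0" "f x \<ge> 0"
  using assms by (auto simp: nonneg_vanishing_def vanishing_def)

lemma Hp_zero: "Hp (\<lambda>x. 0)"
  by (rule Hp_I) auto

lemma Hp_add: "Hp f \<Longrightarrow> Hp g \<Longrightarrow> Hp (\<lambda>x. f x + g x)"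
  by (auto simp: nonneg_vanishing_def intro: vanishing_add)

lemma L_zero: "L (\<lambda>x. 0) = 0"
  using L_add[OF Hp_zero Hp_zero] by simp

lemma C_nonneg: "C \<ge> 0"
  using L_le[OF Hp_zero] L_zero by simp

lemma L_mono: assumes "Hp f" "Hp g" "\<And>x. f x \<le> g x" shows "L f \<le> L g"
proof -
  have "Hp (\<lambda>x. g x - f x)" using Hp_D[OF assms(1)] Hp_D[OF assms(2)] assms(3)
    by (intro Hp_I continuous_on_diff) auto
  from L_add[OF assms(1) this] L_nonneg[OF this] show ?thesis by simp
qed

lemma Hp_sum: "(\<And>j. j \<in> J \<Longrightarrow> Hp (f j)) \<Longrightarrow> Hp (\<lambda>x. \<Sum>j\<in>J. f j x)"
  by (induction J rule: infinite_finite_induct) (auto intro: Hp_zero Hp_add)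

lemma L_sum: "(\<And>j. j \<in> J \<Longrightarrow> Hp (f j)) \<Longrightarrow> L (\<lambda>x. \<Sum>j\<in>J. f j x) = (\<Sum>j\<in>J. L (f j))"
proof (induction J rule: infinite_finite_induct)
  case (insert j J)
  then have "L (\<lambda>x. f j x + (\<Sum>j\<in>J. f j x)) = L (f j) + L (\<lambda>x. \<Sum>j\<in>J. f j x)"
    by (intro L_add Hp_sum) auto
  with insert show ?case by simp
qed (auto simp: L_zero)

lemma L_scale: assumes "Hp f" shows "L (\<lambda>x. real n * f x) = real n * L f" "Hp (\<lambda>x. real n * f x)"
proof -
  show "L (\<lambda>x. real n * f x) = real n * L f" using L_sum[of "{..<n}" "\<lambda>_. f"] assms by simp
  show "Hp (\<lambda>x. real n * f x)" using Hp_sum[of "{..<n}" "\<lambda>_. f"] assms by simp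
qed

text \<open>The function \<open>min (g x) (1 / n)\<close>, multiplied by \<open>n\<close>, is at
  most 1, whence its value under \<open>L\<close> is at most \<open>C / n\<close>; the factor is a
  natural number so that homogeneity follows from additivity. The remaining part of \<open>g\<close>
  is zero off the set where \<open>g\<close> is at least \<open>1 / n\<close>, which is compact in
  \<open>\<Omega>\<close>.\<close>

lemma cut:
  assumes g: "Hp g" and n: "n > (0 :: nat)"
  shows "Hp (\<lambda>x. max 0 (g x - 1 / n))" "L g \<le> L (\<lambda>x. max 0 (g x - 1 / n)) + C / n"
proof -
  show c: "Hp (\<lambda>x. max 0 (g x - 1 / n))"
    using Hp_D[OF g] by (intro Hp_I continuous_intros) auto
  have m: "Hp (\<lambda>x. min (g x) (1 / n))"
    using Hp_D[OF g] by (intro Hp_I continuous_intros) (auto simp: min_def)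
  have "g = (\<lambda>x. max 0 (g x - 1 / n) + min (g x) (1 / n))" by (auto simp: fun_eq_iff max_def min_def)
  then have "L g = L (\<lambda>x. max 0 (g x - 1 / n)) + L (\<lambda>x. min (g x) (1 / n))" using L_add[OF c m] by simp
  moreover have "real n * L (\<lambda>x. min (g x) (1 / n)) \<le> C"
    unfolding L_scale(1)[OF m, symmetric] using n
      by (intro L_le L_scale(2)[OF m]) (simp add: min_def field_simps)
  ultimately show "L g \<le> L (\<lambda>x. max 0 (g x - 1 / n)) + C / n" using n by (simp add: field_simps)
qed

section \<open>The Riesz-Markov content on open sets and its outer measure\<close>

definition below :: "'a set \<Rightarrow> ('a \<Rightarrow> real) set" where
  "below U = {g. Hp g \<and> (\<forall>x. g x \<le> indicator U x)}"

definition content_open :: "'a set \<Rightarrow> ennreal" where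
  "content_open U = (SUP g\<in>below U. ennreal (L g))"

definition outer :: "'a set \<Rightarrow> ennreal" where
  "outer A = (INF U\<in>{U. open U \<and> A \<subseteq> U}. content_open U)"

lemma content_upper: "g \<in> below U \<Longrightarrow> ennreal (L g) \<le> content_open U"
  unfolding content_open_def by (rule SUP_upper)

lemma content_least: "(\<And>g. g \<in> below U \<Longrightarrow> ennreal (L g) \<le> c) \<Longrightarrow> content_open U \<le> c"
  unfolding content_open_def by (rule SUP_least)

lemma content_mono:
  assumes "U \<subseteq> V" shows "content_open U \<le> content_open V"
proof (rule content_least, rule content_upper)
  fix g assume g: "g \<in> below U"
  have "indicator U x \<le> (indicator V x :: real)" for x using assms by (auto simp: indicator_def)
  then have "g x \<le> indicator V x" for x using g order_trans unfolding below_def by blast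
  then show "g \<in> below V" using g by (simp add: below_def)
qed

lemma content_le: "content_open U \<le> ennreal C"
proof (rule content_least, rule ennreal_leI)
  fix g assume "g \<in> below U"
  then have "Hp g" "g x \<le> indicator U x" for x by (auto simp: below_def)
  moreover have "indicator U x \<le> (1 :: real)" for x :: 'a by (simp add: indicator_def)
  ultimately show "L g \<le> C" by (intro L_le) (auto intro: order_trans)
qed

lemma outer_open: "open U \<Longrightarrow> outer U = content_open U"
  unfolding outer_def by (intro antisym INF_lower INF_greatest content_mono) auto

lemma outer_le: "open U \<Longrightarrow> A \<subseteq> U \<Longrightarrow> outer A \<le> content_open U"
  unfolding outer_def by (intro INF_lower) auto

lemma outer_mono: "A \<subseteq> B \<Longrightarrow> outer A \<le> outer B"
  unfolding outer_def by (intro INF_superset_mono) auto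

lemma ennreal_le_of_archimedean:
  fixes x y :: ennreal
  assumes "\<And>n. n > (0 :: nat) \<Longrightarrow> x \<le> y + ennreal (C / real n)"
  shows "x \<le> y"
proof (rule ennreal_le_epsilon)
  fix e :: real assume e: "e > 0"
  obtain n :: nat where n: "n > 0" "C / n \<le> e"
  proof -
    obtain n :: nat where "real n \<ge> C / e" using real_arch_simple by blast
    then have "C / real (Suc n) \<le> e" using e C_nonneg by (simp add: field_simps)
    then show ?thesis using that[of "Suc n"] by simp
  qed
  show "x \<le> y + ennreal e" by (rule order_trans[OF assms[OF n(1)]]) (intro add_left_mono ennreal_leI n(2))
qed

text \<open>After cutting off at height \<open>1 / n\<close>, a function below a union of open sets has compact support
  in it, and is split by a finite partition of unity built from distance functions.\<close>

lemma content_countable_subadditive: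
  fixes U :: "nat \<Rightarrow> 'a set"
  assumes U: "\<And>i. open (U i)"
  shows "content_open (\<Union>i. U i) \<le> (\<Sum>i. content_open (U i))"
proof (rule content_least, rule ennreal_le_of_archimedean)
  fix g and n :: nat assume g: "g \<in> below (\<Union>i. U i)" and n: "n > 0"
  have Hg: "Hp g" and gU: "g x \<le> indicator (\<Union>i. U i) x" for x using g by (auto simp: below_def)
  note gD = Hp_D[OF Hg]
  define ge where "ge x = max 0 (g x - 1 / n)" for x
  have Hge: "Hp ge" unfolding ge_def by (rule cut(1)[OF Hg n])
  define S where "S = {x. 1 / n \<le> g x}"
  have n1: "1 / real n > 0" using n by simp
  have S\<Omega>: "S \<subseteq> \<Omega>" using gD(2) n1 by (force simp: S_def)
  have "closed S" unfolding S_def by (intro closed_Collect_le continuous_on_const gD(1))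
  then have cS: "compact S" using \<Omega>(2) S\<Omega> bounded_subset compact_eq_bounded_closed by blast
  have "S \<subseteq> (\<Union>i\<in>UNIV. U i)"
  proof
    fix x assume "x \<in> S"
    then have "1 / real n \<le> g x" by (simp add: S_def)
    then have "indicator (\<Union>i. U i) x > (0 :: real)" using gU[of x] n1 by linarith
    then show "x \<in> (\<Union>i\<in>UNIV. U i)" by (simp add: indicator_def split: if_splits)
  qed
  then obtain F where F: "finite F" "S \<subseteq> (\<Union>i\<in>F. U i)" using compactE_image[OF cS, of UNIV U] U by auto
  define W where "W i = U i \<inter> \<Omega>" for i
  have oW: "open (W i)" for i using U \<Omega>(1) by (auto simp: W_def)
  have cW: "closed (- W i)" for i using oW by (simp add: open_closed)
  \<comment> \<open>The distance \<open>infdist\<close> to an empty set would be 0 everywhere;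
    boundedness of \<open>\<Omega>\<close> excludes this.\<close>
  have neW: "- W i \<noteq> {}" for i using \<Omega>(2) not_bounded_UNIV
    by (metis W_def Compl_empty_eq bounded_Int double_complement inf_commute)
  define \<rho> where "\<rho> i x = infdist x (- W i)" for i x
  have \<rho>0: "\<rho> i x \<ge> 0" for i x by (simp add: \<rho>_def infdist_nonneg)
  have \<rho>p: "\<rho> i x > 0 \<longleftrightarrow> x \<in> W i" for i x
    unfolding \<rho>_def using infdist_pos_not_in_closed[OF cW neW, of x i] infdist_zero[of x "- W i"] by fastforce
  have c\<rho>: "continuous_on A (\<rho> i)" for A i unfolding \<rho>_def by (intro continuous_on_infdist continuous_on_id)
  define R where "R x = (\<Sum>i\<in>F. \<rho> i x)" for x
  have R0: "R x \<ge> 0" for x unfolding R_def by (intro sum_nonneg \<rho>0)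
  have Rp: "R x > 0" if "x \<in> S" for x
  proof -
    obtain i where i: "i \<in> F" "x \<in> U i" using F(2) \<open>x \<in> S\<close> by blast
    then have "\<rho> i x > 0" using \<rho>p S\<Omega> \<open>x \<in> S\<close> by (auto simp: W_def)
    then show ?thesis unfolding R_def using i F(1) \<rho>0 by (intro sum_pos2[of F i]) auto
  qed
  have cR: "continuous_on A R" for A unfolding R_def by (intro continuous_on_sum c\<rho>)
  define f where "f i x = ge x * (\<rho> i x / R x)" for i x
  have geS: "ge x = 0" if "x \<notin> S" for x using that by (simp add: ge_def S_def)
  have \<rho>R: "0 \<le> \<rho> i x / R x" "\<rho> i x / R x \<le> 1" if "i \<in> F" for i x
  proof -
    have "\<rho> i x \<le> R x" unfolding R_def using that F(1) \<rho>0 by (intro member_le_sum) auto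
    then show "0 \<le> \<rho> i x / R x" "\<rho> i x / R x \<le> 1" using \<rho>0[of i x] R0[of x] by (auto simp: divide_le_eq_1)
  qed
  have Hf: "Hp (f i)" if i: "i \<in> F" for i
  proof (rule Hp_I)
    \<comment> \<open>The quotient is continuous where \<open>R\<close> is positive, and off
      \<open>S\<close> the factor \<open>ge\<close> annihilates it; these two open sets cover the
      space.\<close>
    have "continuous_on {x. R x > 0} (f i)" unfolding f_def
      by (intro continuous_on_mult continuous_on_divide c\<rho> cR continuous_on_subset[OF Hp_D(1)[OF Hge]
        subset_UNIV]) auto
    moreover have "continuous_on (- S) (f i)"
      using geS by (subst continuous_on_cong[of _ "- S" _ "\<lambda>_. 0"]) (auto simp: f_def)
    moreover have "open {x. R x > 0}" by (intro open_Collect_less continuous_on_const cR)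
    ultimately have "continuous_on ({x. R x > 0} \<union> - S) (f i)"
      using \<open>closed S\<close> by (intro continuous_on_open_Un) (auto simp: open_Compl)
    moreover have "{x. R x > 0} \<union> - S = UNIV" using Rp by auto
    ultimately show "continuous_on UNIV (f i)" by simp
    show "f i x = 0" if "x \<notin> \<Omega>" for x using Hp_D(2)[OF Hge that] by (simp add: f_def)
    show "f i x \<ge> 0" for x unfolding f_def using Hp_D(3)[OF Hge, of x] \<rho>R[OF i]
      by (intro mult_nonneg_nonneg) auto
  qed
  have fb: "f i \<in> below (U i)" if i: "i \<in> F" for i
    unfolding below_def
  proof (intro CollectI conjI allI Hf[OF i])
    fix x
    have "indicator (\<Union>i. U i) x \<le> (1 :: real)" by (simp add: indicator_def)
    then have "g x \<le> 1" using gU[of x] by linarith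
    then have "ge x \<le> 1" using n1 unfolding ge_def by (intro max.boundedI) linarith+
    then have "f i x \<le> 1" unfolding f_def using \<rho>R[OF i, of x] Hp_D(3)[OF Hge, of x]
      by (intro mult_le_one) auto
    moreover have "f i x = 0" if "x \<notin> U i"
      using \<rho>p[of i x] \<rho>0[of i x] that by (simp add: f_def W_def)
    ultimately show "f i x \<le> indicator (U i) x" by (auto simp: indicator_def)
  qed
  have "(\<Sum>i\<in>F. f i x) = ge x" for x
  proof (cases "x \<in> S")
    case True
    have "(\<Sum>i\<in>F. f i x) = ge x * (R x / R x)" unfolding f_def R_def
      by (simp add: sum_distrib_left[symmetric] sum_divide_distrib[symmetric])
    then show ?thesis using Rp[OF True] by simp
  qed (simp add: f_def geS)
  then have "(\<lambda>x. \<Sum>i\<in>F. f i x) = ge" by (rule ext)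
  then have "L ge = (\<Sum>i\<in>F. L (f i))" using L_sum[of F f, OF Hf] by simp
  then have "ennreal (L ge) = (\<Sum>i\<in>F. ennreal (L (f i)))" using L_nonneg[OF Hf] by (simp add: sum_ennreal)
  also have "\<dots> \<le> (\<Sum>i\<in>F. content_open (U i))" by (intro sum_mono content_upper fb)
  also have "\<dots> \<le> (\<Sum>i. content_open (U i))" using F(1) by (intro sum_le_suminf) auto
  finally have ge: "ennreal (L ge) \<le> (\<Sum>i. content_open (U i))" .
  have "ennreal (L g) \<le> ennreal (L ge + C / n)" using cut(2)[OF Hg n]
    by (intro ennreal_leI) (simp add: ge_def[abs_def])
  also have "\<dots> = ennreal (L ge) + ennreal (C / n)" using L_nonneg[OF Hge] C_nonneg
    by (intro ennreal_plus) auto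
  also have "\<dots> \<le> (\<Sum>i. content_open (U i)) + ennreal (C / n)" by (intro add_right_mono ge)
  finally show "ennreal (L g) \<le> (\<Sum>i. content_open (U i)) + ennreal (C / n)" .
qed

lemma outer_fin: "outer A \<le> ennreal C"
  using outer_le[of UNIV A] content_le[of UNIV] order_trans by auto

text \<open>Each \<open>A i\<close> is enclosed in an open set at the cost
  \<open>e / 2 ^ Suc i\<close>; these costs sum to \<open>e\<close>.\<close>

lemma outer_countable_subadditive: "outer (\<Union>i. A i) \<le> (\<Sum>i. outer (A i))" for A :: "nat \<Rightarrow> 'a set"
proof (rule ennreal_le_epsilon)
  fix e :: real assume e: "e > 0"
  have pos: "ennreal (e * (1 / 2) ^ Suc i) > 0" for i using e by simp
  have "\<exists>U. open U \<and> A i \<subseteq> U \<and> content_open U \<le> outer (A i) + ennreal (e * (1 / 2) ^ Suc i)" for i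
  proof -
    have "outer (A i) \<noteq> top" using outer_fin[of "A i"] by (metis ennreal_neq_top top.extremum_unique)
    then have "outer (A i) + 0 < outer (A i) + ennreal (e * (1 / 2) ^ Suc i)"
      unfolding ennreal_add_left_cancel_less using pos[of i] by simp
    then have "outer (A i) < outer (A i) + ennreal (e * (1 / 2) ^ Suc i)" by simp
    then obtain U where "U \<in> {U. open U \<and> A i \<subseteq> U}" "content_open U < outer (A i) + ennreal (e * (1 / 2)
      ^ Suc i)"
      unfolding outer_def[of "A i"] INF_less_iff by blast
    then show ?thesis by (auto intro: less_imp_le)
  qed
  then obtain U where U: "\<And>i. open (U i)" "\<And>i. A i \<subseteq> U i" "\<And>i. content_open (U i) \<le> outer (A i) +
    ennreal (e * (1 / 2) ^ Suc i)"
    by metis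
  have "outer (\<Union>i. A i) \<le> content_open (\<Union>i. U i)" using U(1,2) by (intro outer_le) auto
  also have "\<dots> \<le> (\<Sum>i. content_open (U i))" by (rule content_countable_subadditive[OF U(1)])
  also have "\<dots> \<le> (\<Sum>i. outer (A i) + ennreal (e * (1 / 2) ^ Suc i))" by (intro suminf_le U(3)) auto
  also have "\<dots> = (\<Sum>i. outer (A i)) + (\<Sum>i. ennreal (e * (1 / 2) ^ Suc i))"
    by (intro suminf_add[symmetric]) auto
  also have "(\<Sum>i. ennreal (e * (1 / 2) ^ Suc i)) = ennreal e"
  proof -
    have "(\<lambda>i. e * (1 / 2) ^ Suc i) sums (e * 1)" by (intro sums_mult power_half_series)
    then show ?thesis using e by (intro suminf_ennreal_eq) auto
  qed
  finally show "outer (\<Union>i. A i) \<le> (\<Sum>i. outer (A i)) + ennreal e" .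
qed

lemma outer_empty: "outer {} = 0"
proof -
  have "content_open {} \<le> 0"
  proof (rule content_least)
    fix g assume g: "g \<in> below {}"
    then have "g x = 0" for x using Hp_D(3)[of g x] by (auto simp: below_def intro: antisym)
    then have "g = (\<lambda>x. 0)" by auto
    then show "ennreal (L g) \<le> 0" using L_zero by simp
  qed
  then show ?thesis using outer_open[of "{}"] by simp
qed

lemma outer_subadditive: "outer (A \<union> B) \<le> outer A + outer B"
proof -
  have "outer (\<Union>i. binaryset A B i) \<le> (\<Sum>i. outer (binaryset A B i))" by (rule outer_countable_subadditive)
  also have "\<dots> = outer A + outer B" by (rule suminf_binaryset_eq[of outer A B, OF outer_empty])
  finally show ?thesis by (simp add: UN_binaryset_eq)
qed

lemma outer_measure: "outer_measure_space (Pow UNIV) outer"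
  unfolding outer_measure_space_def
proof (intro conjI)
  show "positive (Pow UNIV) outer" by (simp add: positive_def outer_empty)
  show "increasing (Pow UNIV) outer" by (simp add: increasing_def outer_mono)
  show "countably_subadditive (Pow UNIV) outer"
    by (simp add: countably_subadditive_def outer_countable_subadditive)
qed

text \<open>A function below \<open>A \<inter> U\<close>, once cut at height \<open>1 / n\<close>,
  is zero off a closed set \<open>S\<close> inside \<open>A\<close>. Any function below
  \<open>U - S\<close> may then be added without exceeding the indicator of \<open>U\<close>, and
  \<open>U - S\<close> is an open set containing \<open>U - A\<close>.\<close>

lemma open_split:
  assumes A: "open A" and U: "open U"
  shows "content_open (A \<inter> U) + outer (U - A) \<le> content_open U"
proof -
  have ne: "below X \<noteq> {}" for X using Hp_zero by (force simp: below_def)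
  have 1: "ennreal (L g) + outer (U - A) \<le> content_open U" if g: "g \<in> below (A \<inter> U)" for g
  proof (rule ennreal_le_of_archimedean)
    fix n :: nat assume n: "n > 0"
    have Hg: "Hp g" and gU: "g x \<le> indicator (A \<inter> U) x" for x using g by (auto simp: below_def)
    define ge where "ge x = max 0 (g x - 1 / n)" for x
    have Hge: "Hp ge" unfolding ge_def by (rule cut(1)[OF Hg n])
    define S where "S = {x. 1 / n \<le> g x}"
    have n1: "1 / real n > 0" using n by simp
    have "closed S" unfolding S_def by (intro closed_Collect_le continuous_on_const Hp_D(1)[OF Hg])
    then have oS: "open (U - S)" using U by (simp add: open_Diff)
    have SA: "x \<in> A \<inter> U" if "x \<in> S" for x
    proof -
      have "1 / real n \<le> g x" using that by (simp add: S_def)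
      then have "indicator (A \<inter> U) x > (0 :: real)" using gU[of x] n1 by linarith
      then show ?thesis by (simp add: indicator_def split: if_splits)
    qed
    have "ennreal (L ge) + content_open (U - S) = (SUP h\<in>below (U - S). ennreal (L ge) + ennreal (L h))"
      unfolding content_open_def by (rule ennreal_SUP_add_right[OF ne])
    also have "\<dots> \<le> content_open U"
    proof (rule SUP_least)
      fix h assume h: "h \<in> below (U - S)"
      then have Hh: "Hp h" and hU: "h x \<le> indicator (U - S) x" for x by (auto simp: below_def)
      have "(\<lambda>x. ge x + h x) \<in> below U" unfolding below_def
      proof (intro CollectI conjI allI Hp_add Hge Hh)
        fix x
        show "ge x + h x \<le> indicator U x"
        proof (cases "x \<in> S")
          case True
          then have "x \<in> U" "h x \<le> 0" "g x \<le> 1" using SA[of x] hU[of x] gU[of x]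
            by (auto simp: indicator_def split: if_splits)
          moreover from this have "ge x \<le> 1" using n1 unfolding ge_def by (intro max.boundedI) linarith+
          ultimately show ?thesis by (simp add: indicator_def)
        next
          case False
          then have "ge x = 0" by (simp add: ge_def S_def)
          moreover have "indicator (U - S) x \<le> (indicator U x :: real)" by (simp add: indicator_def)
          ultimately show ?thesis using hU[of x] by linarith
        qed
      qed
      then have "ennreal (L (\<lambda>x. ge x + h x)) \<le> content_open U" by (rule content_upper)
      then show "ennreal (L ge) + ennreal (L h) \<le> content_open U"
        using L_add[OF Hge Hh] L_nonneg[OF Hge] L_nonneg[OF Hh] by (simp add: ennreal_plus)
    qed
    finally have 2: "ennreal (L ge) + content_open (U - S) \<le> content_open U" .
    have "outer (U - A) \<le> content_open (U - S)" using SA by (intro outer_le oS) auto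
    moreover have "ennreal (L g) \<le> ennreal (L ge) + ennreal (C / n)"
    proof -
      have "ennreal (L g) \<le> ennreal (L ge + C / n)" using cut(2)[OF Hg n]
        by (intro ennreal_leI) (simp add: ge_def[abs_def])
      then show ?thesis using L_nonneg[OF Hge] C_nonneg by (simp add: ennreal_plus)
    qed
    ultimately have "ennreal (L g) + outer (U - A) \<le> (ennreal (L ge) + ennreal (C / n)) + content_open
      (U - S)"
      by (rule add_mono[rotated])
    also have "\<dots> = (ennreal (L ge) + content_open (U - S)) + ennreal (C / n)" by (simp add: ac_simps)
    also have "\<dots> \<le> content_open U + ennreal (C / n)" by (rule add_right_mono[OF 2])
    finally show "ennreal (L g) + outer (U - A) \<le> content_open U + ennreal (C / n)" .
  qed
  have "content_open (A \<inter> U) + outer (U - A) = (SUP g\<in>below (A \<inter> U). ennreal (L g) + outer (U - A))"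
    unfolding content_open_def[of "A \<inter> U"] by (rule ennreal_SUP_add_left[OF ne, symmetric])
  also have "\<dots> \<le> content_open U" by (rule SUP_least) (rule 1)
  finally show ?thesis .
qed

text \<open>Caratheodory measurability against an arbitrary \<open>X\<close> follows from
  \<open>open_split\<close>, because \<open>outer\<close> is an infimum over open supersets.\<close>

lemma open_in_lambda:
  assumes A: "open A" shows "A \<in> lambda_system UNIV (Pow UNIV) outer"
  unfolding lambda_system_def
proof (intro CollectI conjI ballI)
  fix X :: "'a set"
  show "outer (A \<inter> X) + outer ((UNIV - A) \<inter> X) = outer X"
  proof (rule antisym)
    have "outer X = outer ((A \<inter> X) \<union> ((UNIV - A) \<inter> X))" by (rule arg_cong[where f = outer]) auto
    also have "\<dots> \<le> outer (A \<inter> X) + outer ((UNIV - A) \<inter> X)" by (rule outer_subadditive)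
    finally show "outer X \<le> outer (A \<inter> X) + outer ((UNIV - A) \<inter> X)" .
    show "outer (A \<inter> X) + outer ((UNIV - A) \<inter> X) \<le> outer X"
      unfolding outer_def[of X]
    proof (rule INF_greatest)
      fix U assume "U \<in> {U. open U \<and> X \<subseteq> U}"
      then have U: "open U" "X \<subseteq> U" by auto
      have "outer (A \<inter> X) + outer ((UNIV - A) \<inter> X) \<le> content_open (A \<inter> U) + outer (U - A)"
        using U A by (intro add_mono outer_le outer_mono) auto
      also have "\<dots> \<le> content_open U" by (rule open_split[OF A U(1)])
      finally show "outer (A \<inter> X) + outer ((UNIV - A) \<inter> X) \<le> content_open U" .
    qed
  qed
qed simp

definition representing :: "'a measure" where
  "representing = measure_of UNIV (sets borel) outer"

lemma sets_representing: "sets representing = sets borel"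
  unfolding representing_def using sets.sigma_sets_eq[of "borel :: 'a measure"]
    by (simp add: sets_measure_of_conv)

text \<open>The Caratheodory sets form a sigma-algebra on which \<open>outer\<close> is a measure;
  it contains the open sets, hence all Borel sets.\<close>

lemma emeasure_representing: "A \<in> sets borel \<Longrightarrow> emeasure representing A = outer A"
proof -
  assume A: "A \<in> sets borel"
  let ?L = "lambda_system UNIV (Pow UNIV) outer"
  have ms: "measure_space UNIV ?L outer"
    using sigma_algebra.caratheodory_lemma[OF sigma_algebra_Pow outer_measure] .
  then interpret sigma_algebra UNIV ?L by (simp add: measure_space_def)
  have "sigma_sets UNIV {S :: 'a set. open S} \<subseteq> ?L"
    by (intro sigma_sets_subset subsetI, elim CollectE) (rule open_in_lambda)
  then have sub: "sets borel \<subseteq> ?L" by (simp add: borel_def)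
  have sa: "sigma_algebra UNIV (sets (borel :: 'a measure))"
    using sets.sigma_algebra_axioms[of "borel :: 'a measure"] by simp
  have "positive (sets borel) outer" by (simp add: positive_def outer_empty)
  moreover have "countably_additive (sets borel) outer"
    using ms sub unfolding measure_space_def countably_additive_def by (meson order_trans subsetD)
  ultimately show ?thesis unfolding representing_def by (rule emeasure_measure_of_sigma[OF sa _ _ A])
qed

lemma space_representing: "space representing = UNIV"
  using sets_eq_imp_space_eq[OF sets_representing] by simp

lemma finite_representing: "finite_measure representing"
proof
  have "emeasure representing UNIV \<le> ennreal C" using emeasure_representing[of UNIV] outer_fin by simp
  then show "emeasure representing (space representing) \<noteq> \<infinity>"
    by (metis ennreal_less_top infinity_ennreal_def leD space_representing)
qed

lemma measure_representing_open:
  assumes "open U" shows "ennreal (measure representing U) = content_open U" "measure representing U \<le> C"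
proof -
  interpret finite_measure representing by (rule finite_representing)
  show e: "ennreal (measure representing U) = content_open U"
    using emeasure_representing[of U] outer_open[OF assms] assms emeasure_eq_measure by simp
  then show "measure representing U \<le> C" using content_le[of U] C_nonneg by (metis ennreal_le_iff)
qed

text \<open>The summands are the unit slices of \<open>y\<close>, each counting the part of
  \<open>y\<close> between two consecutive integers.\<close>

lemma clamp_sum: "y \<ge> 0 \<Longrightarrow> (\<Sum>j<J. max 0 (min 1 (y - real j))) = min y (real J)"
  by (induction J) (auto simp: min_def max_def)

text \<open>Both \<open>L\<close> and the integral of the \<open>j\<close>-th slice of \<open>n f\<close> lie between the measures of
  \<open>{n f > j + 1}\<close> and \<open>{n f > j}\<close>, so the total discrepancy telescopes.\<close>

lemma integral_representing:
  assumes f: "Hp f"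
  shows "(LINT x|representing. f x) = L f" "integrable representing f"
proof -
  interpret finite_measure representing by (rule finite_representing)
  note fD = Hp_D[OF f]
  have meas: "h \<in> borel_measurable representing" if "Hp h" for h
    using borel_measurable_continuous_onI[OF Hp_D(1)[OF that]] measurable_cong_sets[OF sets_representing
      refl] by blast
  have int: "integrable representing h" if "Hp h" for h
  proof -
    have "vanishing \<Omega> h" using that by (simp add: nonneg_vanishing_def)
    then obtain B where "B > 0" "\<And>x. \<bar>h x\<bar> \<le> B" by (rule vanishing_bounded[OF \<Omega>(2)]) (rule that)
    then show ?thesis by (intro integrable_const_bound[of _ B] meas \<open>Hp h\<close>) auto
  qed
  show "integrable representing f" by (rule int[OF f])
  have fv: "vanishing \<Omega> f" using f by (simp add: nonneg_vanishing_def)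
  obtain B where B: "B > 0" "\<And>x. \<bar>f x\<bar> \<le> B" by (rule vanishing_bounded[OF \<Omega>(2) fv]) (rule that)
  have est: "real n * \<bar>(LINT x|representing. f x) - L f\<bar> \<le> C" for n :: nat
  proof -
    \<comment> \<open>Enough slices to exhaust the range of \<open>n f\<close>, as \<open>f\<close>
      is bounded by \<open>B\<close>.\<close>
    obtain J :: nat where J: "real J \<ge> real n * B" using real_arch_simple by blast
    define g where "g j x = max 0 (min 1 (real n * f x - real j))" for j x
    define U where "U j = {x. real n * f x > real j}" for j
    have oU: "open (U j)" for j unfolding U_def by (intro open_Collect_less continuous_intros fD(1))
    have bU: "U j \<in> sets representing" for j using oU sets_representing by simp
    have Hg: "Hp (g j)" for j
      unfolding g_def using fD(2) by (intro Hp_I continuous_intros fD(1)) auto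
    have gU: "indicator (U (Suc j)) x \<le> g j x" "g j x \<le> indicator (U j) x" for j x
      by (auto simp: g_def U_def indicator_def)
    have sum_g: "(\<Sum>j<J. g j x) = real n * f x" for x
    proof -
      have "real n * f x \<le> real n * B" using B(2)[of x] by (intro mult_left_mono) auto
      then show ?thesis unfolding g_def using clamp_sum[of "real n * f x" J] fD(3)[of x] J by simp
    qed
    have L1: "L (g j) \<le> measure representing (U j)" for j
    proof -
      have "ennreal (L (g j)) \<le> content_open (U j)" using Hg gU(2)
        by (intro content_upper) (auto simp: below_def)
      then show ?thesis using measure_representing_open(1)[OF oU[of j]]
        by (metis ennreal_le_iff measure_nonneg)
    qed
    have L2: "measure representing (U (Suc j)) \<le> L (g j)" for j
    proof -
      have "content_open (U (Suc j)) \<le> ennreal (L (g j))"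
      proof (rule content_least, rule ennreal_leI)
        fix h assume h: "h \<in> below (U (Suc j))"
        then have "h x \<le> g j x" for x using gU(1)[of j x] order_trans by (auto simp: below_def)
        then show "L h \<le> L (g j)" using h Hg by (intro L_mono) (auto simp: below_def)
      qed
      then show ?thesis using measure_representing_open(1)[OF oU[of "Suc j"]] L_nonneg[OF Hg]
        by (metis ennreal_le_iff)
    qed
    have I1: "(LINT x|representing. g j x) \<le> measure representing (U j)" for j
    proof -
      have "(LINT x|representing. g j x) \<le> (LINT x|representing. indicator (U j) x)"
        using bU gU(2) by (intro integral_mono int Hg integrable_real_indicator) (auto simp:
          emeasure_eq_measure)
      then show ?thesis using space_representing by simp
    qed
    have I2: "measure representing (U (Suc j)) \<le> (LINT x|representing. g j x)" for j
    proof -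
      have "(LINT x|representing. indicator (U (Suc j)) x) \<le> (LINT x|representing. g j x)"
        using bU gU(1) by (intro integral_mono int Hg integrable_real_indicator) (auto simp:
          emeasure_eq_measure)
      then show ?thesis using space_representing by simp
    qed
    have eq1: "real n * (LINT x|representing. f x) = (\<Sum>j<J. LINT x|representing. g j x)"
    proof -
      have "real n * (LINT x|representing. f x) = (LINT x|representing. (\<Sum>j<J. g j x))" unfolding sum_g
        by simp
      also have "\<dots> = (\<Sum>j<J. LINT x|representing. g j x)" by (intro Bochner_Integration.integral_sum int Hg)
      finally show ?thesis .
    qed
    have eq2: "real n * L f = (\<Sum>j<J. L (g j))"
    proof -
      have "real n * L f = L (\<lambda>x. \<Sum>j<J. g j x)" unfolding sum_g by (rule L_scale(1)[OF f, symmetric])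
      then show ?thesis using L_sum[of "{..<J}" g, OF Hg] by simp
    qed
    have "real n * \<bar>(LINT x|representing. f x) - L f\<bar> = \<bar>real n * (LINT x|representing. f x) - real n * L f\<bar>"
      unfolding right_diff_distrib[symmetric] by (simp add: abs_mult)
    also have "\<dots> = \<bar>\<Sum>j<J. (LINT x|representing. g j x) - L (g j)\<bar>" unfolding eq1 eq2 sum_subtractf ..
    also have "\<dots> \<le> (\<Sum>j<J. measure representing (U j) - measure representing (U (Suc j)))"
    proof (rule order_trans[OF sum_abs sum_mono])
      show "\<bar>(LINT x|representing. g j x) - L (g j)\<bar> \<le> measure representing (U j) - measure representing
        (U (Suc j))" for j
        using L1[of j] L2[of j] I1[of j] I2[of j] by linarith
    qed
    also have "\<dots> = measure representing (U 0) - measure representing (U J)" by (rule sum_lessThan_telescope')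
    also have "\<dots> \<le> C" using measure_representing_open(2)[OF oU[of 0]] measure_nonneg[of representing "U
      J"] by linarith
    finally show ?thesis .
  qed
  \<comment> \<open>The bound \<open>C\<close> in \<open>est\<close> does not depend on
    \<open>n\<close>, so letting \<open>n\<close> grow forces equality.\<close>
  show "(LINT x|representing. f x) = L f"
  proof (rule ccontr)
    assume "(LINT x|representing. f x) \<noteq> L f"
    then have p: "\<bar>(LINT x|representing. f x) - L f\<bar> > 0" by simp
    obtain n :: nat where "C < real n * \<bar>(LINT x|representing. f x) - L f\<bar>"
      using reals_Archimedean3[OF p] by blast
    then show False using est[of n] by simp
  qed
qed

end

text \<open>\<open>L\<close> is the positive part of \<open>T\<close>, the supremum of
  \<open>T g\<close> over \<open>0 \<le> g \<le> f\<close>, and \<open>L - T\<close> is the negative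
  part; each is a \<open>positive_functional\<close> and so has a representing measure.\<close>

lemma riesz_signed:
  fixes \<Omega> :: "'a::euclidean_space set" and T :: "('a \<Rightarrow> real) \<Rightarrow> real"
  assumes \<Omega>: "open \<Omega>" "bounded \<Omega>"
    and add: "\<And>f g. vanishing \<Omega> f \<Longrightarrow> vanishing \<Omega> g \<Longrightarrow> T (\<lambda>x. f x + g x) = T f + T g"
    and bound: "\<And>f s. vanishing \<Omega> f \<Longrightarrow> (\<And>x. \<bar>f x\<bar> \<le> s) \<Longrightarrow> \<bar>T f\<bar> \<le> C * s"
  obtains \<mu>\<^sub>1 \<mu>\<^sub>2 where "finite_measure \<mu>\<^sub>1" "finite_measure \<mu>\<^sub>2" "sets \<mu>\<^sub>1 = sets borel" "sets \<mu>\<^sub>2 =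
    sets borel"
    "\<And>f. vanishing \<Omega> f \<Longrightarrow> T f = (LINT x|\<mu>\<^sub>1. f x) - (LINT x|\<mu>\<^sub>2. f x)"
proof -
  let ?Hp = "nonneg_vanishing \<Omega>"
  have HpV: "vanishing \<Omega> f" if "?Hp f" for f using that by (simp add: nonneg_vanishing_def)
  have Hp0: "?Hp (\<lambda>x. 0)" by (simp add: nonneg_vanishing_def vanishing_def)
  have T0: "T (\<lambda>x. 0) = 0" using add[OF HpV[OF Hp0] HpV[OF Hp0]] by simp
  define D where "D f = {g. ?Hp g \<and> (\<forall>x. g x \<le> f x)}" for f
  define L where "L f = (SUP g\<in>D f. T g)" for f
  have bdd: "bdd_above (T ` D f)" if "?Hp f" for f
  proof -
    obtain B where B: "B > 0" "\<And>x. \<bar>f x\<bar> \<le> B" by (rule vanishing_bounded[OF \<Omega>(2) HpV[OF \<open>?Hp f\<close>]]) (rule that)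
    have "T g \<le> C * B" if "g \<in> D f" for g
    proof -
      have gH: "?Hp g" and gf: "\<And>x. g x \<le> f x" using that by (auto simp: D_def)
      have gB: "\<bar>g x\<bar> \<le> B" for x
        using gH gf[of x] B(2)[of x] by (simp add: nonneg_vanishing_def)
      have "\<bar>T g\<bar> \<le> C * B" by (rule bound[OF HpV[OF gH] gB])
      then show ?thesis by linarith
    qed
    then show ?thesis by (intro bdd_aboveI2) auto
  qed
  have upper: "T g \<le> L f" if "?Hp f" "g \<in> D f" for f g
    unfolding L_def by (rule cSUP_upper[OF that(2) bdd[OF that(1)]])
  have least: "L f \<le> c" if "?Hp f" "\<And>g. g \<in> D f \<Longrightarrow> T g \<le> c" for f c
    unfolding L_def using that Hp0 by (intro cSUP_least) (auto simp: D_def nonneg_vanishing_def)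
  have zD: "(\<lambda>x. 0) \<in> D f" if "?Hp f" for f using that Hp0 by (auto simp: D_def nonneg_vanishing_def)
  have sD: "f \<in> D f" if "?Hp f" for f using that by (auto simp: D_def)
  have Hp_add: "?Hp (\<lambda>x. f x + g x)" if "?Hp f" "?Hp g" for f g
    using that by (auto simp: nonneg_vanishing_def intro: vanishing_add)
  have L_add: "L (\<lambda>x. f x + g x) = L f + L g" if f: "?Hp f" and g: "?Hp g" for f g
  proof (rule antisym)
    show "L (\<lambda>x. f x + g x) \<le> L f + L g"
    proof (rule least[OF Hp_add[OF f g]])
      fix h assume h: "h \<in> D (\<lambda>x. f x + g x)"
      have hH: "?Hp h" and hfg: "h x \<le> f x + g x" for x using h by (auto simp: D_def)
      \<comment> \<open>Riesz decomposition: a function below \<open>f + g\<close> splits into its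
        minimum with \<open>f\<close> and a remainder below \<open>g\<close>.\<close>
      have h1: "?Hp (\<lambda>x. min (h x) (f x))"
        using hH f by (auto simp: nonneg_vanishing_def vanishing_def intro: continuous_on_min)
      have h2: "?Hp (\<lambda>x. h x - min (h x) (f x))"
        using hH h1 by (auto simp: nonneg_vanishing_def intro: vanishing_diff)
      have "(\<lambda>x. min (h x) (f x)) \<in> D f" using h1 by (auto simp: D_def)
      moreover have "(\<lambda>x. h x - min (h x) (f x)) \<in> D g"
      proof -
        have "h x - min (h x) (f x) \<le> g x" for x using hfg[of x] g
          by (auto simp: min_def nonneg_vanishing_def)
        then show ?thesis using h2 by (simp add: D_def)
      qed
      ultimately have "T (\<lambda>x. min (h x) (f x)) + T (\<lambda>x. h x - min (h x) (f x)) \<le> L f + L g"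
        by (intro add_mono upper f g)
      then show "T h \<le> L f + L g" using add[OF HpV[OF h1] HpV[OF h2]] by simp
    qed
    have 1: "T h + T k \<le> L (\<lambda>x. f x + g x)" if h: "h \<in> D f" and k: "k \<in> D g" for h k
    proof -
      have hk: "?Hp h" "?Hp k" using h k by (auto simp: D_def)
      have "(\<lambda>x. h x + k x) \<in> D (\<lambda>x. f x + g x)" using h k Hp_add[OF hk] by (auto simp: D_def intro: add_mono)
      from upper[OF Hp_add[OF f g] this] show ?thesis using add[OF HpV[OF hk(1)] HpV[OF hk(2)]] by simp
    qed
    have 2: "L f \<le> L (\<lambda>x. f x + g x) - T k" if k: "k \<in> D g" for k
      by (rule least[OF f]) (use 1[OF _ k] in \<open>simp add: le_diff_eq\<close>)
    have "L g \<le> L (\<lambda>x. f x + g x) - L f"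
    proof (rule least[OF g])
      show "T k \<le> L (\<lambda>x. f x + g x) - L f" if "k \<in> D g" for k using 2[OF that] by simp
    qed
    then show "L f + L g \<le> L (\<lambda>x. f x + g x)" by simp
  qed
  have L_le: "L f \<le> C" if f: "?Hp f" "\<And>x. f x \<le> 1" for f
  proof (rule least[OF f(1)])
    fix g assume "g \<in> D f"
    then have g: "?Hp g" "\<And>x. g x \<le> f x" by (auto simp: D_def)
    have "\<bar>g x\<bar> \<le> 1" for x using g(1) order_trans[OF g(2) f(2), of x] by (simp add: nonneg_vanishing_def)
    then show "T g \<le> C" using bound[OF HpV[OF g(1)], of 1] by simp
  qed
  interpret p: positive_functional \<Omega> L C
  proof (unfold_locales, fact, fact)
    show "L f \<ge> 0" if "?Hp f" for f using upper[OF that zD[OF that]] T0 by simp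
  qed (fact L_add, fact L_le)
  interpret q: positive_functional \<Omega> "\<lambda>f. L f - T f" "2 * C"
  proof (unfold_locales, fact, fact)
    show "L f - T f \<ge> 0" if "?Hp f" for f using upper[OF that sD[OF that]] by simp
    show "L (\<lambda>x. f x + g x) - T (\<lambda>x. f x + g x) = (L f - T f) + (L g - T g)" if "?Hp f" "?Hp g" for f g
      using L_add[OF that] add[OF HpV[OF that(1)] HpV[OF that(2)]] by simp
    show "L f - T f \<le> 2 * C" if f: "?Hp f" "\<And>x. f x \<le> 1" for f
    proof -
      have "\<bar>f x\<bar> \<le> 1" for x using f by (simp add: nonneg_vanishing_def)
      then have "\<bar>T f\<bar> \<le> C" using bound[OF HpV[OF f(1)], of 1] by simp
      then show ?thesis using L_le[OF f] by linarith
    qed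
  qed
  show ?thesis
  proof (rule that[OF p.finite_representing q.finite_representing p.sets_representing q.sets_representing])
    fix f assume f: "vanishing \<Omega> f"
    have fp: "?Hp (\<lambda>x. max 0 (f x))" and fn: "?Hp (\<lambda>x. max 0 (- f x))"
      using f by (auto simp: nonneg_vanishing_def vanishing_def intro!: continuous_intros)
    have eq: "f x + max 0 (- f x) = max 0 (f x)" "max 0 (f x) - max 0 (- f x) = f x" for x
      by (auto simp: max_def)
    have "T (\<lambda>x. max 0 (f x)) = T f + T (\<lambda>x. max 0 (- f x))" using add[OF f HpV[OF fn]] by (simp add: eq)
    moreover have "(LINT x|p.representing. f x) = (LINT x|p.representing. max 0 (f x)) - (LINT
      x|p.representing. max 0 (- f x))"
      using Bochner_Integration.integral_diff[OF p.integral_representing(2)[OF fp]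
        p.integral_representing(2)[OF fn]] by (simp add: eq)
    moreover have "(LINT x|q.representing. f x) = (LINT x|q.representing. max 0 (f x)) - (LINT
      x|q.representing. max 0 (- f x))"
      using Bochner_Integration.integral_diff[OF q.integral_representing(2)[OF fp]
        q.integral_representing(2)[OF fn]] by (simp add: eq)
    ultimately show "T f = (LINT x|p.representing. f x) - (LINT x|q.representing. f x)"
      using p.integral_representing(1)[OF fp] p.integral_representing(1)[OF fn]
        q.integral_representing(1)[OF fp] q.integral_representing(1)[OF fn] by simp
  qed
qed

section \<open>Closedness of the unit ball of \<open>BV\<close> in \<open>L\<^sub>1\<close>\<close>

text \<open>Uniform limits keep both continuity and the decay at infinity.\<close>

lemma C0_I_approx:
  assumes a: "\<And>e. e > 0 \<Longrightarrow> \<exists>\<phi>. test_field \<Omega> \<phi> \<and> (\<forall>x\<in>\<Omega>. norm (\<phi> x - v x) < e)"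
  shows "v \<in> C0 \<Omega>"
  unfolding C0_def
proof (intro CollectI conjI allI impI)
  have "\<forall>n. \<exists>\<phi>. test_field \<Omega> \<phi> \<and> (\<forall>x\<in>\<Omega>. norm (\<phi> x - v x) < inverse (real (Suc n)))" using a by simp
  then obtain \<phi> where \<phi>: "\<And>n. test_field \<Omega> (\<phi> n)" "\<And>n x. x \<in> \<Omega> \<Longrightarrow> norm (\<phi> n x - v x) < inverse (real (Suc
    n))" by metis
  have "uniform_limit \<Omega> \<phi> v sequentially"
    unfolding uniform_limit_sequentially_iff
  proof (intro allI impI)
    fix e :: real assume "e > 0"
    then obtain N where N: "inverse (real (Suc N)) < e" using reals_Archimedean by blast
    have "dist (\<phi> n x) (v x) < e" if "x \<in> \<Omega>" "n \<ge> N" for x n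
    proof -
      have "inverse (real (Suc n)) \<le> inverse (real (Suc N))" using that(2) by (intro le_imp_inverse_le) auto
      then show ?thesis using \<phi>(2)[OF that(1), of n] N unfolding dist_norm by linarith
    qed
    then show "\<exists>N. \<forall>n\<ge>N. \<forall>x\<in>\<Omega>. dist (\<phi> n x) (v x) < e" by blast
  qed
  then show "continuous_on \<Omega> v"
    by (rule uniform_limit_theorem[rotated]) (simp_all add: C0_continuous[OF test_field_C0[OF \<phi>(1)]])
  fix e :: real assume "e > 0"
  then obtain \<psi> where \<psi>: "test_field \<Omega> \<psi>" "\<And>x. x \<in> \<Omega> \<Longrightarrow> norm (\<psi> x - v x) < e / 2" using a[of "e / 2"] by auto
  have "\<exists>K. compact K \<and> K \<subseteq> \<Omega> \<and> (\<forall>x\<in>\<Omega> - K. norm (\<psi> x) < e / 2)"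
    using test_field_C0[OF \<psi>(1)] half_gt_zero[OF \<open>e > 0\<close>] unfolding C0_def by blast
  then obtain K where K: "compact K" "K \<subseteq> \<Omega>" "\<And>x. x \<in> \<Omega> - K \<Longrightarrow> norm (\<psi> x) < e / 2" by auto
  have "norm (v x) < e" if "x \<in> \<Omega> - K" for x
    using K(3)[OF that] \<psi>(2)[of x] norm_triangle_sub[of "v x" "\<psi> x"] that by (simp add: norm_minus_commute)
  then show "\<exists>K. compact K \<and> K \<subseteq> \<Omega> \<and> (\<forall>x\<in>\<Omega> - K. norm (v x) < e)" using K by blast
qed

lemma test_field_diff: "test_field \<Omega> v \<Longrightarrow> test_field \<Omega> w \<Longrightarrow> test_field \<Omega> (\<lambda>x. v x - w x)"
  using test_field_add[of \<Omega> v "\<lambda>x. - 1 *\<^sub>R w x"] test_field_scaleR[of \<Omega> w "- 1"] by simp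

lemma C0_diff:
  assumes "open \<Omega>" "v \<in> C0 \<Omega>" "w \<in> C0 \<Omega>" shows "(\<lambda>x. v x - w x) \<in> C0 \<Omega>"
proof (rule C0_I_approx)
  fix e :: real assume "e > 0"
  then have e2: "e / 2 > 0" by simp
  obtain \<phi> where \<phi>: "test_field \<Omega> \<phi>" "\<And>x. x \<in> \<Omega> \<Longrightarrow> norm (\<phi> x - v x) < e / 2"
    by (rule test_field_dense_C0[OF assms(1,2) e2]) (rule that)
  obtain \<psi> where \<psi>: "test_field \<Omega> \<psi>" "\<And>x. x \<in> \<Omega> \<Longrightarrow> norm (\<psi> x - w x) < e / 2"
    by (rule test_field_dense_C0[OF assms(1,3) e2]) (rule that)
  have "norm ((\<phi> x - \<psi> x) - (v x - w x)) < e" if "x \<in> \<Omega>" for x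
  proof -
    have eq: "(\<phi> x - \<psi> x) - (v x - w x) = (\<phi> x - v x) - (\<psi> x - w x)" by simp
    then show ?thesis using \<phi>(2)[OF that] \<psi>(2)[OF that] norm_triangle_ineq4[of "\<phi> x - v x" "\<psi> x - w x"]
      unfolding eq by linarith
  qed
  then show "\<exists>\<phi>. test_field \<Omega> \<phi> \<and> (\<forall>x\<in>\<Omega>. norm (\<phi> x - (v x - w x)) < e)"
    using test_field_diff[OF \<phi>(1) \<psi>(1)] by blast
qed

lemma pairing_diff_field:
  assumes "open \<Omega>" "u \<in> BV \<Omega>" "v \<in> C0 \<Omega>" "w \<in> C0 \<Omega>"
  shows "pairing \<Omega> (\<lambda>x. v x - w x) u = pairing \<Omega> v u - pairing \<Omega> w u"
proof -
  let ?M = "restrict_space borel \<Omega>"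
  have "signed_integral ?M (weak_partial \<Omega> i u) (\<lambda>x. v x $ i - w x $ i) =
      signed_integral ?M (weak_partial \<Omega> i u) (\<lambda>x. v x $ i) - signed_integral ?M (weak_partial \<Omega> i u)
        (\<lambda>x. w x $ i)" for i
  proof -
    have c: "(\<lambda>x. z x $ i) \<in> borel_measurable ?M" if "z \<in> C0 \<Omega>" for z
      by (intro measurable_restrict_borel continuous_on_component C0_continuous that)
    have b: "\<exists>B. \<forall>x\<in>space ?M. \<bar>z x $ i\<bar> \<le> B" if "z \<in> C0 \<Omega>" for z
    proof -
      obtain B where "B > 0" "\<And>x. x \<in> \<Omega> \<Longrightarrow> norm (z x) \<le> B" by (rule C0_bounded[OF \<open>z \<in> C0 \<Omega>\<close>]) (rule that)
      then have "\<forall>x\<in>space ?M. \<bar>z x $ i\<bar> \<le> B"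
        using order_trans[OF component_le_norm_cart] by (auto simp: space_restrict_space)
      then show ?thesis ..
    qed
    obtain B where B: "\<And>x. x \<in> space ?M \<Longrightarrow> \<bar>v x $ i\<bar> \<le> B" using b[OF assms(3)] by blast
    obtain D where D: "\<And>x. x \<in> space ?M \<Longrightarrow> \<bar>w x $ i\<bar> \<le> D" using b[OF assms(4)] by blast
    show ?thesis by (rule signed_integral_diff[OF signed_measure_weak_partial[OF assms(2)] c[OF
      assms(3)] B c[OF assms(4)] D])
  qed
  then show ?thesis by (simp add: pairing_def sum_subtractf)
qed

lemma vanishing_axis_C0:
  fixes \<Omega> :: "(real ^ 'm) set"
  assumes \<Omega>: "bounded \<Omega>" and g: "vanishing \<Omega> g"
  shows "(\<lambda>x. g x *\<^sub>R axis i (1 :: real)) \<in> C0 \<Omega>"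
  unfolding C0_def
proof (intro CollectI conjI allI impI)
  have c: "continuous_on UNIV g" using g by (simp add: vanishing_def)
  show "continuous_on \<Omega> (\<lambda>x. g x *\<^sub>R axis i (1 :: real))"
    by (rule continuous_on_scaleR[OF continuous_on_subset[OF c subset_UNIV] continuous_on_const])
  fix e :: real assume e: "e > 0"
  define K where "K = {x. e \<le> \<bar>g x\<bar>}"
  have "closed K" unfolding K_def by (intro closed_Collect_le continuous_on_const continuous_on_rabs c)
  moreover have K: "K \<subseteq> \<Omega>" using g e by (force simp: K_def vanishing_def)
  ultimately have "compact K" using \<Omega> bounded_subset compact_eq_bounded_closed by blast
  moreover have "\<forall>x\<in>\<Omega> - K. norm (g x *\<^sub>R axis i (1 :: real)) < e" by (simp add: K_def)
  ultimately show "\<exists>K. compact K \<and> K \<subseteq> \<Omega> \<and> (\<forall>x\<in>\<Omega> - K. norm (g x *\<^sub>R axis i (1 :: real)) < e)" using K by blast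
qed

lemma pairing_axis:
  "pairing \<Omega> (\<lambda>x. g x *\<^sub>R axis i 1) u = signed_integral (restrict_space borel \<Omega>) (weak_partial \<Omega> i u) g"
proof -
  have "pairing \<Omega> (\<lambda>x. g x *\<^sub>R axis i 1) u =
      (\<Sum>j\<in>UNIV. if j = i then signed_integral (restrict_space borel \<Omega>) (weak_partial \<Omega> i u) g else 0)"
    unfolding pairing_def by (intro sum.cong refl) (auto simp: axis_def signed_integral_def)
  then show ?thesis by simp
qed

text \<open>The derivative measures of \<open>u\<close> arise as weak limits of those of
  \<open>f n\<close>. L1 convergence settles the limit on test fields, the common bound
  \<open>M\<close> extends it by density to all \<open>vanishing\<close> functions, and
  \<open>riesz_signed\<close> turns the limit functional into a signed measure.\<close>

lemma BV_closed:
  fixes \<Omega> :: "(real ^ 'm) set"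
  assumes \<Omega>: "open \<Omega>" "bounded \<Omega>" and f: "\<And>n. f n \<in> BV \<Omega>" "\<And>n. total_variation \<Omega> (f n) \<le> M"
    and u: "integrable (lebesgue_on \<Omega>) u" and lim: "(\<lambda>n. L1_norm \<Omega> (\<lambda>x. f n x - u x)) \<longlonglongrightarrow> 0"
  shows "u \<in> BV \<Omega>"
proof -
  let ?Mb = "restrict_space borel \<Omega>"
  have M0: "M \<ge> 0" using total_variation_nonneg[OF \<Omega>(1) f(1)] f(2) order_trans by blast
  have "\<exists>\<nu>. is_weak_partial \<Omega> i u \<nu>" for i
  proof -
    define a where "a g n = signed_integral ?Mb (weak_partial \<Omega> i (f n)) g" for g n
    have test_lim: "(\<lambda>n. pairing \<Omega> \<phi> (f n)) \<longlonglongrightarrow> - (LINT x|lebesgue_on \<Omega>. u x * divergence \<phi> x)"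
      if \<phi>: "test_field \<Omega> \<phi>" for \<phi>
    proof -
      obtain B where B: "B > 0" "\<And>x. \<bar>divergence \<phi> x\<bar> \<le> B" by (rule divergence_bounded[OF \<phi>]) (rule that)
      show ?thesis unfolding pairing_test[OF \<Omega>(1) f(1) \<phi>]
        by (intro tendsto_minus tendsto_integral_L1[OF BV_integrable[OF f(1)] u lim
              measurable_continuous_lebesgue_on[OF \<Omega>(1) divergence_continuous[OF \<phi>]] B(2)])
    qed
    have apair: "a g n = pairing \<Omega> (\<lambda>x. g x *\<^sub>R axis i 1) (f n)" for g n by (simp add: a_def pairing_axis)
    have conv: "convergent (a g)" if g: "vanishing \<Omega> g" for g
    proof -
      let ?v = "\<lambda>x. g x *\<^sub>R axis i 1 :: real ^ 'm"
      note v = vanishing_axis_C0[OF \<Omega>(2) g, of i]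
      have "Cauchy (a g)"
      proof (rule CauchyI)
        fix e :: real assume e: "e > 0"
        \<comment> \<open>With this \<open>d\<close>, replacing \<open>g\<close> by a test field
          costs at most \<open>e / 4\<close>, less than a third of \<open>e\<close>;
          \<open>M + 1\<close> keeps the denominator positive.\<close>
        define d where "d = e / (4 * (M + 1))"
        have d: "d > 0" using e M0 by (simp add: d_def)
        obtain \<phi> where \<phi>: "test_field \<Omega> \<phi>" "\<And>x. x \<in> \<Omega> \<Longrightarrow> norm (\<phi> x - ?v x) < d"
          by (rule test_field_dense_C0[OF \<Omega>(1) v d]) (rule that)
        have near: "\<bar>pairing \<Omega> \<phi> (f n) - a g n\<bar> < e / 3" for n
        proof -
          have "\<bar>pairing \<Omega> (\<lambda>x. \<phi> x - ?v x) (f n)\<bar> \<le> d * total_variation \<Omega> (f n)"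
            using \<phi>(2) d by (intro abs_pairing_le[OF \<Omega>(1) f(1) C0_diff[OF \<Omega>(1) test_field_C0[OF \<phi>(1)]
              v]]) (auto intro: less_imp_le)
          also have "\<dots> \<le> d * (M + 1)" using f(2)[of n] d by (intro mult_left_mono) auto
          also have "\<dots> = e / 4" using M0 by (simp add: d_def field_simps)
          also have "\<dots> < e / 3" using e by simp
          finally show ?thesis using pairing_diff_field[OF \<Omega>(1) f(1) test_field_C0[OF \<phi>(1)] v]
            by (simp add: apair)
        qed
        have "Cauchy (\<lambda>n. pairing \<Omega> \<phi> (f n))" using test_lim[OF \<phi>(1)] by (rule LIMSEQ_imp_Cauchy)
        then obtain N where N: "\<And>m n. m \<ge> N \<Longrightarrow> n \<ge> N \<Longrightarrow> \<bar>pairing \<Omega> \<phi> (f m) - pairing \<Omega> \<phi> (f n)\<bar> < e / 3"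
          using CauchyD[of _ "e / 3"] e by (metis divide_pos_pos real_norm_def zero_less_numeral)
        have "norm (a g m - a g n) < e" if "m \<ge> N" "n \<ge> N" for m n
          using N[OF that] near[of m] near[of n] unfolding real_norm_def by linarith
        then show "\<exists>N. \<forall>m\<ge>N. \<forall>n\<ge>N. norm (a g m - a g n) < e" by blast
      qed
      then show ?thesis by (simp add: Cauchy_convergent_iff)
    qed
    define T where "T g = lim (a g)" for g
    have Tlim: "a g \<longlonglongrightarrow> T g" if "vanishing \<Omega> g" for g
      using conv[OF that] by (simp add: T_def convergent_LIMSEQ_iff)
    have meas: "g \<in> borel_measurable ?Mb" if "vanishing \<Omega> g" for g
      using that continuous_on_subset[of UNIV g \<Omega>]
        by (intro measurable_restrict_borel) (simp add: vanishing_def)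
    have T_add: "T (\<lambda>x. g x + h x) = T g + T h" if g: "vanishing \<Omega> g" and h: "vanishing \<Omega> h" for g h
    proof -
      obtain B where B: "B > 0" "\<And>x. \<bar>g x\<bar> \<le> B" by (rule vanishing_bounded[OF \<Omega>(2) g]) (rule that)
      obtain D where D: "D > 0" "\<And>x. \<bar>h x\<bar> \<le> D" by (rule vanishing_bounded[OF \<Omega>(2) h]) (rule that)
      have "a (\<lambda>x. g x + h x) n = a g n + a h n" for n
        unfolding a_def by (rule signed_integral_add[OF signed_measure_weak_partial[OF f(1)] meas[OF g]
          B(2) meas[OF h] D(2)])
      then have "(\<lambda>n. a g n + a h n) \<longlonglongrightarrow> T (\<lambda>x. g x + h x)" using Tlim[OF vanishing_add[OF g h]] by presburger
      then show ?thesis using LIMSEQ_unique tendsto_add[OF Tlim[OF g] Tlim[OF h]] by blast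
    qed
    have T_bound: "\<bar>T g\<bar> \<le> M * s" if g: "vanishing \<Omega> g" and s: "\<And>x. \<bar>g x\<bar> \<le> s" for g s
    proof -
      have s0: "s \<ge> 0" using s[of undefined] by linarith
      have "\<bar>a g n\<bar> \<le> M * s" for n
      proof -
        have "\<bar>a g n\<bar> \<le> s * total_variation \<Omega> (f n)"
          unfolding apair by (rule abs_pairing_le[OF \<Omega>(1) f(1) vanishing_axis_C0[OF \<Omega>(2) g] _ s0]) (simp
            add: s)
        also have "\<dots> \<le> s * M" by (rule mult_left_mono[OF f(2) s0])
        finally show ?thesis by (simp add: mult.commute)
      qed
      then show ?thesis by (intro LIMSEQ_le_const2[OF tendsto_rabs[OF Tlim[OF g]]]) auto
    qed
    obtain \<mu>\<^sub>1 \<mu>\<^sub>2 where \<mu>: "finite_measure \<mu>\<^sub>1" "finite_measure \<mu>\<^sub>2" "sets \<mu>\<^sub>1 = sets borel" "sets \<mu>\<^sub>2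
      = sets borel"
      "\<And>g. vanishing \<Omega> g \<Longrightarrow> T g = (LINT x|\<mu>\<^sub>1. g x) - (LINT x|\<mu>\<^sub>2. g x)"
      by (rule riesz_signed[of \<Omega> T M, OF \<Omega> T_add T_bound]) (assumption+, rule that)
    \<comment> \<open>The representing measures live on the whole space; functions that vanish off
      \<open>\<Omega>\<close> keep their integrals when the measures are restricted to
      \<open>\<Omega>\<close>.\<close>
    have fr: "finite_measure (restrict_space \<mu> \<Omega>)" "sets (restrict_space \<mu> \<Omega>) = sets ?Mb"
      "g \<in> borel_measurable \<mu> \<Longrightarrow> (\<And>x. x \<notin> \<Omega> \<Longrightarrow> g x = 0) \<Longrightarrow> (LINT x|restrict_space \<mu> \<Omega>. g x) = (LINT x|\<mu>. g x)"
      if "finite_measure \<mu>" "sets \<mu> = sets borel" for \<mu> and g :: "real ^ 'm \<Rightarrow> real"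
    proof -
      have \<Omega>m: "\<Omega> \<in> sets \<mu>" using \<Omega>(1) that(2) by auto
      have \<Omega>s: "\<Omega> \<inter> space \<mu> \<in> sets \<mu>" using \<Omega>(1) that(2) by auto
      show "finite_measure (restrict_space \<mu> \<Omega>)" by (rule finite_measure_restrict_space[OF that(1) \<Omega>m])
      show "sets (restrict_space \<mu> \<Omega>) = sets ?Mb" by (rule sets_restrict_space_cong[OF that(2)])
      show "(LINT x|restrict_space \<mu> \<Omega>. g x) = (LINT x|\<mu>. g x)" if "\<And>x. x \<notin> \<Omega> \<Longrightarrow> g x = 0"
      proof -
        have "(\<lambda>x. indicator \<Omega> x *\<^sub>R g x) = g" using that by (auto simp: indicator_def fun_eq_iff)
        then show ?thesis using integral_restrict_space[OF \<Omega>s, of g] by simp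
      qed
    qed
    define \<nu> where "\<nu> A = measure (restrict_space \<mu>\<^sub>1 \<Omega>) A - measure (restrict_space \<mu>\<^sub>2 \<Omega>) A" for A
    note fm = fr(1)[OF \<mu>(1,3)] fr(1)[OF \<mu>(2,4)] fr(2)[OF \<mu>(1,3)] fr(2)[OF \<mu>(2,4)]
    have "is_weak_partial \<Omega> i u \<nu>"
      unfolding is_weak_partial_def
    proof (intro conjI allI impI)
      show "signed_measure ?Mb \<nu>" by (rule signed_measure_diff[OF fm]) (simp add: \<nu>_def)
      fix \<phi> assume \<phi>: "test_function \<Omega> \<phi>"
      obtain B where "B > 0" and B: "\<And>x. \<bar>\<phi> x\<bar> \<le> B" "\<And>i x. \<bar>partial i \<phi> x\<bar> \<le> B"
        by (rule test_function_bounded[OF \<phi>]) (rule that)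
      have \<phi>0: "\<phi> x = 0" if "x \<notin> \<Omega>" for x by (rule test_functionE[OF \<phi>]) (use that in blast)
      have v: "vanishing \<Omega> \<phi>" using test_function_continuous[OF \<phi>] \<phi>0 by (simp add: vanishing_def)
      have bm: "\<phi> \<in> borel_measurable borel"
        by (rule borel_measurable_continuous_onI[OF test_function_continuous[OF \<phi>]])
      have "signed_integral ?Mb \<nu> \<phi> = (LINT x|restrict_space \<mu>\<^sub>1 \<Omega>. \<phi> x) - (LINT x|restrict_space \<mu>\<^sub>2 \<Omega>. \<phi> x)"
        by (rule signed_integral_diff_measure[OF fm _ measurable_test_function[OF \<phi>] B(1)]) (simp add: \<nu>_def)
      also have "\<dots> = T \<phi>"
        using fr(3)[OF \<mu>(1,3) _ \<phi>0] fr(3)[OF \<mu>(2,4) _ \<phi>0] \<mu>(3,4) bm \<mu>(5)[OF v]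
          by (simp cong: measurable_cong_sets)
      also have "\<dots> = - (LINT x|lebesgue_on \<Omega>. u x * partial i \<phi> x)"
        using LIMSEQ_unique[OF Tlim[OF v]] test_lim[OF test_field_axis[OF \<phi>], of i]
        unfolding apair[abs_def] divergence_axis by blast
      finally show "(LINT x|lebesgue_on \<Omega>. u x * partial i \<phi> x) = - signed_integral ?Mb \<nu> \<phi>" by simp
    qed
    then show ?thesis by (rule exI[of _ \<nu>])
  qed
  then show ?thesis using u by (simp add: BV_def L1_def)
qed

section \<open>A finite minimax principle\<close>

text \<open>The points \<open>(f u, g u)\<close> form a convex set in the plane that misses the open
  positive quadrant; the normal of a separating line, scaled to coordinate sum 1, gives the
  weight.\<close>

lemma two_function_minimax:
  fixes f g :: "'u \<Rightarrow> real"
  assumes K: "\<And>u w t. u \<in> K \<Longrightarrow> w \<in> K \<Longrightarrow> 0 \<le> t \<Longrightarrow> t \<le> 1 \<Longrightarrow>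
      \<exists>z\<in>K. f z = t * f u + (1 - t) * f w \<and> g z = t * g u + (1 - t) * g w"
    and no: "\<And>u. u \<in> K \<Longrightarrow> f u \<le> 0 \<or> g u \<le> 0"
  shows "\<exists>l. 0 \<le> l \<and> l \<le> 1 \<and> (\<forall>u\<in>K. l * f u + (1 - l) * g u \<le> 0)"
proof (cases "K = {}")
  case True
  then show ?thesis by (intro exI[of _ 0]) simp
next
  case False
  define A where "A = (\<lambda>u. (f u, g u)) ` K"
  define B where "B = {0 :: real<..} \<times> {0 :: real<..}"
  have "convex A"
  proof (rule convexI)
    fix x y and s t :: real assume *: "x \<in> A" "y \<in> A" "0 \<le> s" "0 \<le> t" "s + t = 1"
    then obtain u w where uw: "u \<in> K" "w \<in> K" "x = (f u, g u)" "y = (f w, g w)" by (auto simp: A_def)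
    have t: "t = 1 - s" "s \<le> 1" using * by auto
    obtain z where "z \<in> K" "f z = s * f u + (1 - s) * f w" "g z = s * g u + (1 - s) * g w"
      using K[OF uw(1,2) *(3) t(2)] by blast
    then show "s *\<^sub>R x + t *\<^sub>R y \<in> A" by (auto simp: A_def uw t intro!: image_eqI[of _ _ z])
  qed
  moreover have "convex B" unfolding B_def by (intro convex_Times) auto
  moreover have "A \<inter> B = {}" using no by (force simp: A_def B_def)
  moreover have "A \<noteq> {}" "B \<noteq> {}" using False by (auto simp: A_def B_def intro: gt_ex)
  ultimately obtain a b where a: "a \<noteq> 0" "\<And>x. x \<in> A \<Longrightarrow> inner a x \<le> b" "\<And>x. x \<in> B \<Longrightarrow> inner a x \<ge> b"
    using separating_hyperplane_sets[of A B] by blast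
  obtain p q where pq: "a = (p, q)" by (cases a)
  have le: "b \<le> p * s + q * t" if "s > 0" "t > 0" for s t
    using a(3)[of "(s, t)"] that by (simp add: B_def pq)
  \<comment> \<open>With a negative coordinate the linear functional would be unbounded below on the
    quadrant.\<close>
  have p: "p \<ge> 0"
  proof (rule ccontr)
    assume neg: "\<not> p \<ge> 0"
    define s where "s = (\<bar>b\<bar> + \<bar>q\<bar> + 1) / (- p)"
    have "s > 0" unfolding s_def using neg by (intro divide_pos_pos) linarith+
    moreover have "p * s = - (\<bar>b\<bar> + \<bar>q\<bar> + 1)" using neg by (simp add: s_def)
    ultimately show False using le[of s 1] by simp
  qed
  have q: "q \<ge> 0"
  proof (rule ccontr)
    assume neg: "\<not> q \<ge> 0"
    define s where "s = (\<bar>b\<bar> + \<bar>p\<bar> + 1) / (- q)"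
    have "s > 0" unfolding s_def using neg by (intro divide_pos_pos) linarith+
    moreover have "q * s = - (\<bar>b\<bar> + \<bar>p\<bar> + 1)" using neg by (simp add: s_def)
    ultimately show False using le[of 1 s] by simp
  qed
  have pq0: "p + q > 0" using a(1) p q by (auto simp: pq zero_prod_def)
  \<comment> \<open>The quadrant has points arbitrarily close to the origin, where the functional is
    close to 0.\<close>
  have b: "b \<le> 0"
  proof (rule ccontr)
    assume neg: "\<not> b \<le> 0"
    define s where "s = b / 2 / (p + q)"
    have "s > 0" unfolding s_def using neg pq0 by (intro divide_pos_pos) auto
    moreover have "(p + q) * s = b / 2" unfolding s_def using pq0
      by (metis less_irrefl nonzero_mult_div_cancel_left times_divide_eq_right)
    ultimately show False using le[of s s] neg by (simp add: distrib_right)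
  qed
  have "p / (p + q) * f u + (1 - p / (p + q)) * g u \<le> 0" if "u \<in> K" for u
  proof -
    have "p * f u + q * g u \<le> 0" using a(2)[of "(f u, g u)"] that b by (simp add: A_def pq)
    then have "(p * f u + q * g u) / (p + q) \<le> 0" using pq0 by (simp add: divide_le_0_iff)
    moreover have "1 - p / (p + q) = q / (p + q)" using pq0 by (simp add: field_simps)
    ultimately show ?thesis by (simp add: add_divide_distrib)
  qed
  then show ?thesis using p q pq0 by (intro exI[of _ "p / (p + q)"]) auto
qed

text \<open>Induction on \<open>J\<close>: a new member \<open>v\<close> settles the points with
  \<open>\<Phi> v u \<le> 0\<close>, the remaining ones are handled by some \<open>w\<close> from
  the induction hypothesis, and \<open>two_function_minimax\<close> mixes the two. Convexity is
  expressed through values of \<open>\<Phi>\<close>, so \<open>V\<close> and \<open>K\<close> carry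
  no vector space structure.\<close>

lemma finite_minimax:
  fixes \<Phi> :: "'v \<Rightarrow> 'u \<Rightarrow> real"
  assumes "finite J" "J \<subseteq> V" "V \<noteq> {}"
    and V: "\<And>v w l. v \<in> V \<Longrightarrow> w \<in> V \<Longrightarrow> 0 \<le> l \<Longrightarrow> l \<le> 1 \<Longrightarrow>
      \<exists>z\<in>V. \<forall>u\<in>K. \<Phi> z u = l * \<Phi> v u + (1 - l) * \<Phi> w u"
    and K: "\<And>u w t. u \<in> K \<Longrightarrow> w \<in> K \<Longrightarrow> 0 \<le> t \<Longrightarrow> t \<le> 1 \<Longrightarrow>
      \<exists>z\<in>K. \<forall>v\<in>V. \<Phi> v z = t * \<Phi> v u + (1 - t) * \<Phi> v w"
    and J: "\<And>u. u \<in> K \<Longrightarrow> \<exists>v\<in>J. \<Phi> v u \<le> 0"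
  shows "\<exists>v\<in>V. \<forall>u\<in>K. \<Phi> v u \<le> 0"
  using assms
proof (induction J arbitrary: K rule: finite_induct)
  case empty
  then show ?case by blast
next
  case (insert v J)
  have v: "v \<in> V" using insert.prems(1) by simp
  \<comment> \<open>The points where \<open>v\<close> fails inherit convexity, since positivity of
    \<open>\<Phi> v\<close> passes to interpolating points. The induction hypothesis is applied to
    this smaller set, hence the generalisation over \<open>K\<close>.\<close>
  define K' where "K' = {u \<in> K. \<Phi> v u > 0}"
  have "\<exists>w\<in>V. \<forall>u\<in>K'. \<Phi> w u \<le> 0"
  proof (rule insert.IH)
    show "J \<subseteq> V" "V \<noteq> {}" using insert.prems(1,2) by auto
    show "\<exists>z\<in>V. \<forall>u\<in>K'. \<Phi> z u = l * \<Phi> v u + (1 - l) * \<Phi> w u"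
      if "v \<in> V" "w \<in> V" "0 \<le> l" "l \<le> 1" for v w l
      using insert.prems(3)[OF that] by (auto simp: K'_def)
    show "\<exists>w\<in>J. \<Phi> w u \<le> 0" if "u \<in> K'" for u using insert.prems(5)[of u] that by (auto simp: K'_def)
    show "\<exists>z\<in>K'. \<forall>v\<in>V. \<Phi> v z = t * \<Phi> v u + (1 - t) * \<Phi> v w"
      if u: "u \<in> K'" and w: "w \<in> K'" and t: "0 \<le> t" "t \<le> 1" for u w t
    proof -
      have uw: "u \<in> K" "w \<in> K" "\<Phi> v u > 0" "\<Phi> v w > 0" using u w by (auto simp: K'_def)
      obtain z where z: "z \<in> K" "\<forall>v\<in>V. \<Phi> v z = t * \<Phi> v u + (1 - t) * \<Phi> v w"
        using insert.prems(4)[OF uw(1,2) t] by blast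
      have "t * \<Phi> v u + (1 - t) * \<Phi> v w > 0"
      proof (cases "t = 0")
        case False
        then have "t * \<Phi> v u > 0" using t uw by simp
        moreover have "(1 - t) * \<Phi> v w \<ge> 0" using t uw by simp
        ultimately show ?thesis by simp
      qed (use uw in simp)
      then show ?thesis using z v by (auto simp: K'_def)
    qed
  qed
  then obtain w where w: "w \<in> V" "\<And>u. u \<in> K' \<Longrightarrow> \<Phi> w u \<le> 0" by blast
  have "\<exists>l. 0 \<le> l \<and> l \<le> 1 \<and> (\<forall>u\<in>K. l * \<Phi> v u + (1 - l) * \<Phi> w u \<le> 0)"
  proof (rule two_function_minimax)
    show "\<exists>z\<in>K. \<Phi> v z = t * \<Phi> v u + (1 - t) * \<Phi> v u' \<and> \<Phi> w z = t * \<Phi> w u + (1 - t) * \<Phi> w u'"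
      if "u \<in> K" "u' \<in> K" "0 \<le> t" "t \<le> 1" for u u' t
      using insert.prems(4)[OF that] v w(1) by blast
    show "\<Phi> v u \<le> 0 \<or> \<Phi> w u \<le> 0" if "u \<in> K" for u using w(2)[of u] that by (force simp: K'_def)
  qed
  then obtain l where l: "0 \<le> l" "l \<le> 1" "\<And>u. u \<in> K \<Longrightarrow> l * \<Phi> v u + (1 - l) * \<Phi> w u \<le> 0" by blast
  from insert.prems(3)[OF v w(1) l(1,2)] show ?case using l(3) by force
qed

section \<open>Approximation of forms by divergences of test fields\<close>

text \<open>Each integral against a divergence is L1-continuous, and a supremum of continuous
  functionals is lower semicontinuous.\<close>

lemma total_variation_L1_limit:
  fixes \<Omega> :: "(real ^ 'm) set"
  assumes \<Omega>: "open \<Omega>" and f: "\<And>n. f n \<in> BV \<Omega>" "\<And>n. total_variation \<Omega> (f n) \<le> M"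
    and u: "integrable (lebesgue_on \<Omega>) u" and lim: "(\<lambda>n. L1_norm \<Omega> (\<lambda>x. f n x - u x)) \<longlonglongrightarrow> 0"
  shows "total_variation \<Omega> u \<le> M"
proof (rule total_variation_least)
  fix v assume v: "test_field \<Omega> v" "\<And>x. norm (v x) \<le> 1"
  obtain B where B: "B > 0" "\<And>x. \<bar>divergence v x\<bar> \<le> B" by (rule divergence_bounded[OF v(1)]) (rule that)
  have "(\<lambda>n. LINT x|lebesgue_on \<Omega>. f n x * divergence v x) \<longlonglongrightarrow> (LINT x|lebesgue_on \<Omega>. u x * divergence v x)"
    by (rule tendsto_integral_L1[OF BV_integrable[OF f(1)] u lim
          measurable_continuous_lebesgue_on[OF \<Omega> divergence_continuous[OF v(1)]] B(2)])
  moreover have "(LINT x|lebesgue_on \<Omega>. f n x * divergence v x) \<le> M" for n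
    by (rule order_trans[OF total_variation_upper[OF \<Omega> f(1) v] f(2)])
  ultimately show "(LINT x|lebesgue_on \<Omega>. u x * divergence v x) \<le> M"
    by (intro LIMSEQ_le_const2) auto
qed

lemma total_variation_almost_attained:
  assumes \<Omega>: "open \<Omega>" and e: "e > 0"
  obtains v where "test_field \<Omega> v" "\<And>x. norm (v x) \<le> 1"
    "(LINT x|lebesgue_on \<Omega>. u x * divergence v x) > total_variation \<Omega> u - e"
proof (rule ccontr)
  assume no: "\<not> thesis"
  have "total_variation \<Omega> u \<le> total_variation \<Omega> u - e"
  proof (rule total_variation_least)
    fix v assume "test_field \<Omega> v" "\<And>x. norm (v x) \<le> 1"
    then show "(LINT x|lebesgue_on \<Omega>. u x * divergence v x) \<le> total_variation \<Omega> u - e"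
      using no that[of v] by (meson not_le)
  qed
  then show False using e by simp
qed

lemma integral_diff_divergence_le:
  assumes \<Omega>: "open \<Omega>" and u: "integrable (lebesgue_on \<Omega>) u" and w: "integrable (lebesgue_on \<Omega>) w"
    and v: "test_field \<Omega> v" "\<And>x. \<bar>divergence v x\<bar> \<le> B"
  shows "\<bar>(LINT x|lebesgue_on \<Omega>. u x * divergence v x) - (LINT x|lebesgue_on \<Omega>. w x * divergence v x)\<bar>
    \<le> B * L1_norm \<Omega> (\<lambda>x. u x - w x)"
proof -
  have "(LINT x|lebesgue_on \<Omega>. u x * divergence v x) - (LINT x|lebesgue_on \<Omega>. w x * divergence v x) =
      (LINT x|lebesgue_on \<Omega>. (u x - w x) * divergence v x)"
    using integral_times_divergence(1)[OF \<Omega> u v(1)] integral_times_divergence(1)[OF \<Omega> w v(1)]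
    by (simp add: left_diff_distrib)
  then show ?thesis
    using integral_bounded_L1[OF Bochner_Integration.integrable_diff[OF u w]
        measurable_continuous_lebesgue_on[OF \<Omega> divergence_continuous[OF v(1)]] v(2)] by simp
qed

text \<open>Two compactness arguments prepare \<open>finite_minimax\<close>. The first bounds the
  divergences of the near-optimal fields by a common \<open>R\<close>; with this bound a field that
  is good at one function is nearly as good at L1-close ones, which lets the second select finitely
  many fields.\<close>

lemma form_approximation:
  fixes \<Omega> :: "(real ^ 'm) set" and f :: "(real ^ 'm \<Rightarrow> real) \<Rightarrow> real"
  assumes \<Omega>: "open \<Omega>" "bounded \<Omega>" "\<Omega> \<noteq> {}" "connected \<Omega>" and ext: "BV_extension_set \<Omega>"
    and add: "\<And>u w. u \<in> BV \<Omega> \<Longrightarrow> w \<in> BV \<Omega> \<Longrightarrow> f (\<lambda>x. u x + w x) = f u + f w"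
    and cmult: "\<And>u a. u \<in> BV \<Omega> \<Longrightarrow> f (\<lambda>x. a * u x) = a * f u"
    and shift: "\<And>u c. u \<in> BV \<Omega> \<Longrightarrow> f (\<lambda>x. u x - c) = f u"
    and cont: "\<And>e. e > 0 \<Longrightarrow> \<exists>\<theta>>0. \<forall>u\<in>BV \<Omega>. \<bar>f u\<bar> \<le> \<theta> * L1_norm \<Omega> u + e * total_variation \<Omega> u"
    and M: "M > 0" "\<And>u. u \<in> BV \<Omega> \<Longrightarrow> \<bar>f u\<bar> \<le> M * total_variation \<Omega> u"
    and \<delta>: "\<delta> > 0"
  obtains v where "test_field \<Omega> v" "\<And>x. norm (v x) \<le> M"
    "\<And>u. u \<in> BV \<Omega> \<Longrightarrow> \<bar>f u - (LINT x|lebesgue_on \<Omega>. u x * divergence v x)\<bar> \<le> \<delta> * total_variation \<Omega> u"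
proof -
  note result = that
  let ?I = "\<lambda>v u. LINT x|lebesgue_on \<Omega>. u x * divergence v x"
  obtain C where C: "C > 0" "\<And>u. u \<in> BV \<Omega> \<Longrightarrow> L1_norm \<Omega> (\<lambda>x. u x - mean \<Omega> u) \<le> C * total_variation \<Omega> u"
    by (rule extension_poincare[OF \<Omega> ext]) (rule that)
  \<comment> \<open>By \<open>extension_poincare\<close> a function of total variation at most 1
    lies in \<open>K\<close> after its mean has been subtracted.\<close>
  define K where "K = {u \<in> BV \<Omega>. L1_norm \<Omega> u \<le> C \<and> total_variation \<Omega> u \<le> 1}"
  have KBV: "u \<in> BV \<Omega>" and Kint: "integrable (lebesgue_on \<Omega>) u" and KTV: "total_variation \<Omega> u \<le> 1"
    and Knorm: "BV_norm \<Omega> u \<le> C + 1" if "u \<in> K" for u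
    using that BV_integrable by (auto simp: K_def BV_norm_def)
  define V where "V = {v. test_field \<Omega> v \<and> (\<forall>x. norm (v x) \<le> M)}"
  have diff: "f u - f w = f (\<lambda>x. u x - w x)" if "u \<in> BV \<Omega>" "w \<in> BV \<Omega>" for u w
    using add[OF that(1) BV_cmult[OF that(2), of "- 1"]] cmult[OF that(2), of "- 1"] by simp
  \<comment> \<open>Differences of members of \<open>K\<close> have total variation up to 2, so
    \<open>\<delta> / 16\<close> becomes \<open>\<delta> / 8\<close> in
    \<open>f_near\<close>.\<close>
  obtain \<theta> where \<theta>: "\<theta> > 0" "\<And>u. u \<in> BV \<Omega> \<Longrightarrow> \<bar>f u\<bar> \<le> \<theta> * L1_norm \<Omega> u + \<delta> / 16 * total_variation \<Omega> u"
    using cont[of "\<delta> / 16"] \<delta> by auto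
  have f_near: "\<bar>f u - f w\<bar> \<le> \<theta> * L1_norm \<Omega> (\<lambda>x. u x - w x) + \<delta> / 8"
    if u: "u \<in> BV \<Omega>" "total_variation \<Omega> u \<le> 1" and w: "w \<in> BV \<Omega>" "total_variation \<Omega> w \<le> 1" for u w
  proof -
    have "total_variation \<Omega> (\<lambda>x. u x - w x) \<le> 2" using total_variation_diff[OF \<Omega>(1) u(1) w(1)] u(2) w(2)
      by linarith
    then have "\<delta> / 16 * total_variation \<Omega> (\<lambda>x. u x - w x) \<le> \<delta> / 16 * 2" using \<delta> by (intro mult_left_mono) auto
    then show ?thesis using \<theta>(2)[OF BV_diff[OF \<Omega>(1) u(1) w(1)]] diff[OF u(1) w(1)] by simp
  qed
  have "\<exists>R. \<forall>u\<in>K. \<exists>v\<in>V. (\<forall>x. \<bar>divergence v x\<bar> \<le> R) \<and> f u - ?I v u \<le> \<delta> / 2"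
  proof (rule ccontr)
    assume "\<not> ?thesis"
    then have "\<forall>n. \<exists>u\<in>K. \<forall>v\<in>V. (\<forall>x. \<bar>divergence v x\<bar> \<le> real n) \<longrightarrow> \<delta> / 2 < f u - ?I v u"
      by (meson not_le)
    then obtain U where U: "\<And>n. U n \<in> K"
      "\<And>n v. v \<in> V \<Longrightarrow> (\<And>x. \<bar>divergence v x\<bar> \<le> real n) \<Longrightarrow> \<delta> / 2 < f (U n) - ?I v (U n)" by metis
    obtain r u where r: "strict_mono (r :: nat \<Rightarrow> nat)" and u: "integrable (lebesgue_on \<Omega>) u"
      and lim: "(\<lambda>n. L1_norm \<Omega> (\<lambda>x. U (r n) x - u x)) \<longlonglongrightarrow> 0"
      by (rule rellich[OF \<Omega>(1,2) ext KBV[OF U(1)] Knorm[OF U(1)]]) (rule that)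
    \<comment> \<open>The bound of \<open>f\<close> by \<open>M\<close> is available for members of
      \<open>BV\<close>, so the limit has to be shown to be one.\<close>
    have uBV: "u \<in> BV \<Omega>" by (rule BV_closed[OF \<Omega>(1,2) KBV[OF U(1)] KTV[OF U(1)] u lim])
    have uTV: "total_variation \<Omega> u \<le> 1" by (rule total_variation_L1_limit[OF \<Omega>(1) KBV[OF U(1)] KTV[OF
      U(1)] u lim])
    \<comment> \<open>After scaling by \<open>M\<close>, the integral of \<open>u\<close> against
      the divergence falls short of \<open>M * total_variation \<Omega> u\<close>, hence of
      \<open>f u\<close>, by at most \<open>\<delta> / 8\<close>.\<close>
    have "\<delta> / (8 * M) > 0" using \<delta> M by simp
    then obtain \<phi> where \<phi>: "test_field \<Omega> \<phi>" "\<And>x. norm (\<phi> x) \<le> 1" "?I \<phi> u > total_variation \<Omega> u - \<delta> / (8 * M)"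
      by (rule total_variation_almost_attained[OF \<Omega>(1), of _ u]) (rule that)
    define v where "v x = M *\<^sub>R \<phi> x" for x
    have vt: "test_field \<Omega> v" unfolding v_def[abs_def] by (rule test_field_scaleR[OF \<phi>(1)])
    have vV: "v \<in> V" using vt \<phi>(2) M by (auto simp: V_def v_def mult_le_cancel_left1)
    have "?I v u = M * ?I \<phi> u"
      unfolding v_def[abs_def] divergence_scaleR[OF \<phi>(1)] by (simp add: mult.left_commute)
    moreover have "M * ?I \<phi> u \<ge> M * (total_variation \<Omega> u - \<delta> / (8 * M))" using \<phi>(3) M
      by (intro mult_left_mono) auto
    moreover have "M * (total_variation \<Omega> u - \<delta> / (8 * M)) = M * total_variation \<Omega> u - \<delta> / 8"
      using M by (simp add: right_diff_distrib)
    ultimately have good: "f u - ?I v u \<le> \<delta> / 8" using M(2)[OF uBV] by linarith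
    obtain B where B: "B > 0" "\<And>x. \<bar>divergence v x\<bar> \<le> B" by (rule divergence_bounded[OF vt]) (rule that)
    have "(\<lambda>n. (\<theta> + B) * L1_norm \<Omega> (\<lambda>x. U (r n) x - u x)) \<longlonglongrightarrow> (\<theta> + B) * 0" by (intro tendsto_intros lim)
    then have "\<forall>\<^sub>F n in sequentially. (\<theta> + B) * L1_norm \<Omega> (\<lambda>x. U (r n) x - u x) < \<delta> / 8"
      by (rule order_tendstoD(2)) (use \<delta> in simp)
    then have "\<forall>\<^sub>F n in sequentially. (\<theta> + B) * L1_norm \<Omega> (\<lambda>x. U (r n) x - u x) < \<delta> / 8 \<and> n \<ge> nat \<lceil>B\<rceil>"
      using eventually_ge_at_top by (rule eventually_conj)
    then obtain n where n: "(\<theta> + B) * L1_norm \<Omega> (\<lambda>x. U (r n) x - u x) < \<delta> / 8" "n \<ge> nat \<lceil>B\<rceil>"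
      using eventually_happens'[OF sequentially_bot] by blast
    \<comment> \<open>This places \<open>v\<close> among the fields that \<open>U (r n)\<close> is
      supposed to defeat.\<close>
    have "B \<le> real (r n)" using n(2) strict_mono_imp_increasing[OF r, of n] by linarith
    then have "\<delta> / 2 < f (U (r n)) - ?I v (U (r n))" using B(2) order_trans by (intro U(2)[OF vV]) blast
    moreover have "\<bar>f (U (r n)) - f u\<bar> \<le> \<theta> * L1_norm \<Omega> (\<lambda>x. U (r n) x - u x) + \<delta> / 8"
      by (rule f_near[OF KBV[OF U(1)] KTV[OF U(1)] uBV uTV])
    moreover have "\<bar>?I v (U (r n)) - ?I v u\<bar> \<le> B * L1_norm \<Omega> (\<lambda>x. U (r n) x - u x)"
      by (rule integral_diff_divergence_le[OF \<Omega>(1) Kint[OF U(1)] u vt B(2)])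
    ultimately show False using n(1) good \<delta> unfolding distrib_right by linarith
  qed
  then obtain R where R: "\<forall>u\<in>K. \<exists>v\<in>V. (\<forall>x. \<bar>divergence v x\<bar> \<le> R) \<and> f u - ?I v u \<le> \<delta> / 2" by blast
  then have "\<forall>u. \<exists>v. u \<in> K \<longrightarrow> v \<in> V \<and> (\<forall>x. \<bar>divergence v x\<bar> \<le> R) \<and> f u - ?I v u \<le> \<delta> / 2" by blast
  then obtain v where v: "\<And>u. u \<in> K \<Longrightarrow> v u \<in> V" "\<And>u x. u \<in> K \<Longrightarrow> \<bar>divergence (v u) x\<bar> \<le> R"
      "\<And>u. u \<in> K \<Longrightarrow> f u - ?I (v u) u \<le> \<delta> / 2" by metis
  have "\<exists>J. finite J \<and> J \<subseteq> V \<and> (\<forall>u\<in>K. \<exists>w\<in>J. f u - ?I w u \<le> \<delta>)"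
  proof (rule ccontr)
    assume "\<not> ?thesis"
    then have "\<forall>J. \<exists>u. finite J \<and> J \<subseteq> V \<longrightarrow> u \<in> K \<and> (\<forall>w\<in>J. \<delta> < f u - ?I w u)" by (meson not_le)
    then obtain G where G: "\<And>J. finite J \<Longrightarrow> J \<subseteq> V \<Longrightarrow> G J \<in> K"
        "\<And>J w. finite J \<Longrightarrow> J \<subseteq> V \<Longrightarrow> w \<in> J \<Longrightarrow> \<delta> < f (G J) - ?I w (G J)" by metis
    \<comment> \<open>A greedy choice: each new function defeats the fields attached to all earlier
      ones. Two L1-close members of the resulting sequence contradict this.\<close>
    define J where "J = rec_nat {} (\<lambda>_ J. insert (v (G J)) J)"
    define U where "U n = G (J n)" for n
    have J: "finite (J n) \<and> J n \<subseteq> V" for n by (induction n) (auto simp: J_def intro!: v(1) G(1))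
    have U: "U n \<in> K" for n unfolding U_def using J by (intro G(1)) auto
    have JU: "v (U m) \<in> J n" if "m < n" for m n
      using that by (induction n) (auto simp: J_def U_def less_Suc_eq)
    have bad: "\<delta> < f (U n) - ?I (v (U m)) (U n)" if "m < n" for m n
      unfolding U_def[of n] using J JU[OF that] by (intro G(2)) auto
    obtain r u where r: "strict_mono (r :: nat \<Rightarrow> nat)" and u: "integrable (lebesgue_on \<Omega>) u"
      and lim: "(\<lambda>n. L1_norm \<Omega> (\<lambda>x. U (r n) x - u x)) \<longlonglongrightarrow> 0"
      by (rule rellich[OF \<Omega>(1,2) ext KBV[OF U] Knorm[OF U]]) (rule that)
    have R0: "R \<ge> 0" using v(2)[OF U[of 0], of undefined] by linarith
    have "(\<lambda>n. (\<theta> + R) * L1_norm \<Omega> (\<lambda>x. U (r n) x - u x)) \<longlonglongrightarrow> (\<theta> + R) * 0" by (intro tendsto_intros lim)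
    then have "\<forall>\<^sub>F n in sequentially. (\<theta> + R) * L1_norm \<Omega> (\<lambda>x. U (r n) x - u x) < \<delta> / 16"
      by (rule order_tendstoD(2)) (use \<delta> in simp)
    then obtain m where m: "\<And>n. n \<ge> m \<Longrightarrow> (\<theta> + R) * L1_norm \<Omega> (\<lambda>x. U (r n) x - u x) < \<delta> / 16"
      unfolding eventually_sequentially by blast
    define d where "d = L1_norm \<Omega> (\<lambda>x. U (r (Suc m)) x - U (r m) x)"
    have "d \<le> L1_norm \<Omega> (\<lambda>x. U (r (Suc m)) x - u x) + L1_norm \<Omega> (\<lambda>x. U (r m) x - u x)"
      unfolding d_def using L1_norm_triangle[OF Kint[OF U] u Kint[OF U]] L1_norm_minus_commute[of \<Omega> u]
        by metis
    then have "(\<theta> + R) * d \<le> (\<theta> + R) * (L1_norm \<Omega> (\<lambda>x. U (r (Suc m)) x - u x) + L1_norm \<Omega> (\<lambda>x. U (r m) x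
      - u x))"
      using \<theta>(1) R0 by (intro mult_left_mono) auto
    then have d: "(\<theta> + R) * d < \<delta> / 8" using m[of m] m[of "Suc m"] by (simp add: distrib_left)
    have "\<delta> < f (U (r (Suc m))) - ?I (v (U (r m))) (U (r (Suc m)))" using r
      by (intro bad) (simp add: strict_mono_Suc_iff)
    moreover have "\<bar>f (U (r (Suc m))) - f (U (r m))\<bar> \<le> \<theta> * d + \<delta> / 8"
      unfolding d_def by (rule f_near[OF KBV[OF U] KTV[OF U] KBV[OF U] KTV[OF U]])
    moreover have "\<bar>?I (v (U (r m))) (U (r (Suc m))) - ?I (v (U (r m))) (U (r m))\<bar> \<le> R * d"
      unfolding d_def using v(1)[OF U] by (intro integral_diff_divergence_le[OF \<Omega>(1) Kint[OF U] Kint[OF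
        U]] v(2) U) (simp add: V_def)
    moreover have "f (U (r m)) - ?I (v (U (r m))) (U (r m)) \<le> \<delta> / 2" by (rule v(3)[OF U])
    ultimately show False using d \<delta> unfolding distrib_right by linarith
  qed
  then obtain J where J: "finite J" "J \<subseteq> V" "\<forall>u\<in>K. \<exists>w\<in>J. f u - ?I w u \<le> \<delta>" by blast
  have "\<exists>v\<in>V. \<forall>u\<in>K. f u - ?I v u - \<delta> \<le> 0"
  proof (rule finite_minimax[OF J(1,2), where \<Phi> = "\<lambda>v u. f u - ?I v u - \<delta>"])
    have "(\<lambda>x. 0) \<in> V" using M test_field_zero[of \<Omega>] by (simp add: V_def)
    then show "V \<noteq> {}" by blast
    show "\<exists>w\<in>J. f u - ?I w u - \<delta> \<le> 0" if "u \<in> K" for u using J(3) that by auto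
    fix l :: real assume l: "0 \<le> l" "l \<le> 1"
    show "\<exists>z\<in>V. \<forall>u\<in>K. f u - ?I z u - \<delta> = l * (f u - ?I v u - \<delta>) + (1 - l) * (f u - ?I w u - \<delta>)"
      if v: "v \<in> V" and w: "w \<in> V" for v w
    proof (intro bexI ballI)
      let ?z = "\<lambda>x. l *\<^sub>R v x + (1 - l) *\<^sub>R w x"
      have t: "test_field \<Omega> v" "test_field \<Omega> w" using v w by (auto simp: V_def)
      have "norm (?z x) \<le> M" for x
      proof -
        have "norm (?z x) \<le> l * norm (v x) + (1 - l) * norm (w x)"
          using l norm_triangle_ineq[of "l *\<^sub>R v x" "(1 - l) *\<^sub>R w x"] by simp
        also have "\<dots> \<le> l * M + (1 - l) * M" using v w l by (intro add_mono mult_left_mono) (auto simp: V_def)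
        finally show ?thesis by (simp add: algebra_simps)
      qed
      then show "?z \<in> V" using test_field_add[OF test_field_scaleR[OF t(1)] test_field_scaleR[OF t(2)]]
        by (simp add: V_def)
      fix u assume "u \<in> K"
      note i = integral_times_divergence(1)[OF \<Omega>(1) Kint[OF this]]
      have "?I ?z u = (LINT x|lebesgue_on \<Omega>. l * (u x * divergence v x) + (1 - l) * (u x * divergence w x))"
        unfolding divergence_add[OF test_field_scaleR[OF t(1)] test_field_scaleR[OF t(2)]]
          divergence_scaleR[OF t(1)] divergence_scaleR[OF t(2)] by (simp add: algebra_simps)
      also have "\<dots> = l * ?I v u + (1 - l) * ?I w u" using i[OF t(1)] i[OF t(2)] by simp
      finally have I: "?I ?z u = l * ?I v u + (1 - l) * ?I w u" .
      show "f u - ?I ?z u - \<delta> = l * (f u - ?I v u - \<delta>) + (1 - l) * (f u - ?I w u - \<delta>)"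
        unfolding I by (simp add: algebra_simps)
    qed
    show "\<exists>z\<in>K. \<forall>v\<in>V. f z - ?I v z - \<delta> = l * (f u - ?I v u - \<delta>) + (1 - l) * (f w - ?I v w - \<delta>)"
      if u: "u \<in> K" and w: "w \<in> K" for u w
    proof (intro bexI ballI)
      let ?z = "\<lambda>x. l * u x + (1 - l) * w x"
      note b = BV_cmult[OF KBV[OF u], of l] BV_cmult[OF KBV[OF w], of "1 - l"]
      have cvx: "a * l + b * (1 - l) \<le> c" if "a \<le> c" "b \<le> c" for a b c :: real
      proof -
        have "a * l + b * (1 - l) \<le> c * l + c * (1 - l)" using that l by (intro add_mono mult_right_mono) auto
        then show ?thesis by (simp add: algebra_simps)
      qed
      have "L1_norm \<Omega> ?z \<le> L1_norm \<Omega> u * l + L1_norm \<Omega> w * (1 - l)"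
        using L1_norm_add_le[OF BV_integrable[OF b(1)] BV_integrable[OF b(2)]] l
        unfolding L1_norm_cmult abs_of_nonneg[OF l(1)]
          by (simp only: abs_of_nonneg diff_ge_0_iff_ge mult.commute)
      moreover have "total_variation \<Omega> ?z \<le> total_variation \<Omega> u * l + total_variation \<Omega> w * (1 - l)"
        using total_variation_add[OF \<Omega>(1) b] total_variation_cmult[OF \<Omega>(1) KBV[OF u], of l]
          total_variation_cmult[OF \<Omega>(1) KBV[OF w], of "1 - l"] l by (simp add: mult.commute)
      moreover have "L1_norm \<Omega> u * l + L1_norm \<Omega> w * (1 - l) \<le> C" using u w by (intro cvx) (auto simp: K_def)
      moreover have "total_variation \<Omega> u * l + total_variation \<Omega> w * (1 - l) \<le> 1" using u w
        by (intro cvx) (auto simp: K_def)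
      ultimately show "?z \<in> K" using BV_add[OF \<Omega>(1) b] by (simp add: K_def)
      fix v assume "v \<in> V"
      then have t: "test_field \<Omega> v" by (simp add: V_def)
      note i = integral_times_divergence(1)[OF \<Omega>(1) Kint[OF u] t] integral_times_divergence(1)[OF \<Omega>(1)
        Kint[OF w] t]
      have "?I v ?z = (LINT x|lebesgue_on \<Omega>. l * (u x * divergence v x) + (1 - l) * (w x * divergence v x))"
        by (simp add: algebra_simps)
      also have "\<dots> = l * ?I v u + (1 - l) * ?I v w" using i by simp
      finally have I: "?I v ?z = l * ?I v u + (1 - l) * ?I v w" .
      have F: "f ?z = l * f u + (1 - l) * f w" using add[OF b] cmult[OF KBV[OF u]] cmult[OF KBV[OF w]] by simp
      show "f ?z - ?I v ?z - \<delta> = l * (f u - ?I v u - \<delta>) + (1 - l) * (f w - ?I v w - \<delta>)"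
        unfolding I F by (simp add: algebra_simps)
    qed
  qed
  then obtain w where w: "w \<in> V" "\<And>u. u \<in> K \<Longrightarrow> f u - ?I w u \<le> \<delta>" by force
  have wt: "test_field \<Omega> w" "\<And>x. norm (w x) \<le> M" using w(1) by (auto simp: V_def)
  show ?thesis
  proof (rule result[OF wt])
    fix u assume u: "u \<in> BV \<Omega>"
    define T where "T = total_variation \<Omega> u"
    have T0: "T \<ge> 0" unfolding T_def by (rule total_variation_nonneg[OF \<Omega>(1) u])
    show "\<bar>f u - ?I w u\<bar> \<le> \<delta> * total_variation \<Omega> u"
    proof (cases "T = 0")
      case True
      then show ?thesis using M(2)[OF u] integral_divergence_le[OF \<Omega>(1) u wt] by (simp add: T_def)
    next
      case False
      then have T: "T > 0" using T0 by simp
      define c where "c = mean \<Omega> u"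
      note s = BV_shift[OF \<Omega>(1,2) u, of c]
      have Is: "?I w (\<lambda>x. u x - c) = ?I w u"
        by (rule integral_divergence_shift[OF \<Omega>(1) BV_integrable[OF u] BV_integrable[OF s(1)] _ wt(1),
          of "- c"]) simp
      \<comment> \<open>Both \<open>a = 1 / T\<close> and \<open>a = - 1 / T\<close> will be
        inserted, which turns the one-sided minimax bound into a two-sided one.\<close>
      have le: "a * (f u - ?I w u) \<le> \<delta>" if a: "\<bar>a\<bar> * T = 1" for a
      proof -
        have "(\<lambda>x. a * (u x - c)) \<in> K"
        proof -
          have "\<bar>a\<bar> * L1_norm \<Omega> (\<lambda>x. u x - c) \<le> \<bar>a\<bar> * (C * T)"
            unfolding c_def T_def by (intro mult_left_mono C(2) u) simp
          also have "\<dots> = C" using a by (simp add: mult.left_commute)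
          finally have "L1_norm \<Omega> (\<lambda>x. a * (u x - c)) \<le> C" by (simp add: L1_norm_cmult)
          moreover have "total_variation \<Omega> (\<lambda>x. a * (u x - c)) \<le> 1"
            using total_variation_cmult[OF \<Omega>(1) s(1), of a] a by (simp add: s(2) T_def)
          ultimately show ?thesis using BV_cmult[OF s(1)] by (simp add: K_def)
        qed
        from w(2)[OF this] have "f (\<lambda>x. a * (u x - c)) - ?I w (\<lambda>x. a * (u x - c)) \<le> \<delta>" .
        moreover have "?I w (\<lambda>x. a * (u x - c)) = a * ?I w u" using Is by (simp add: mult.assoc)
        ultimately show ?thesis using cmult[OF s(1)] shift[OF u] by (simp add: right_diff_distrib)
      qed
      have "(f u - ?I w u) / T \<le> \<delta>" "- ((f u - ?I w u) / T) \<le> \<delta>"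
        using le[of "1 / T"] le[of "- 1 / T"] T by simp_all
      then have "\<bar>(f u - ?I w u) / T\<bar> \<le> \<delta>" by (simp only: abs_le_iff)
      then have "\<bar>f u - ?I w u\<bar> / T \<le> \<delta>" using T by simp
      then show ?thesis using T unfolding T_def[symmetric] by (simp only: pos_divide_le_eq)
    qed
  qed
qed

section \<open>The range of the divergence operator\<close>

text \<open>Replacing \<open>v\<close> by a test field within distance \<open>e\<close> costs
  \<open>e * total_variation \<Omega> u\<close>; what remains is an integral against a bounded
  divergence, and its bound is the \<open>\<theta>\<close> belonging to \<open>e\<close>.\<close>

lemma div_op_in_dual:
  fixes \<Omega> :: "(real ^ 'm) set"
  assumes \<Omega>: "open \<Omega>" and v: "v \<in> C0 \<Omega>"
  shows "div_op \<Omega> v \<in> BV_cst_dual \<Omega>"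
  unfolding BV_cst_dual_def linear_form_def
proof (intro CollectI conjI ballI allI impI)
  show "div_op \<Omega> v \<in> extensional (BV_cst \<Omega>)" by (simp add: div_op_def)
  show "div_op \<Omega> v (cst_class \<Omega> (\<lambda>x. u x + w x)) = div_op \<Omega> v (cst_class \<Omega> u) + div_op \<Omega> v (cst_class \<Omega> w)"
    if "u \<in> BV \<Omega>" "w \<in> BV \<Omega>" for u w
    using that by (simp add: div_op_cst_class[OF \<Omega>] BV_add[OF \<Omega>] pairing_add[OF \<Omega> v])
  show "div_op \<Omega> v (cst_class \<Omega> (\<lambda>x. a * u x)) = a * div_op \<Omega> v (cst_class \<Omega> u)" if "u \<in> BV \<Omega>" for u a
    using that by (simp add: div_op_cst_class[OF \<Omega>] BV_cmult pairing_cmult[OF \<Omega> v])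
  fix e :: real assume e: "e > 0"
  obtain \<phi> where \<phi>: "test_field \<Omega> \<phi>" "\<And>x. x \<in> \<Omega> \<Longrightarrow> norm (\<phi> x - v x) < e"
    by (rule test_field_dense_C0[OF \<Omega> v e]) (rule that)
  obtain B where B: "B > 0" "\<And>x. \<bar>divergence \<phi> x\<bar> \<le> B" by (rule divergence_bounded[OF \<phi>(1)]) (rule that)
  have "\<bar>div_op \<Omega> v (cst_class \<Omega> u)\<bar> \<le> B * L1_norm \<Omega> (\<lambda>x. u x - mean \<Omega> u) + e * total_variation \<Omega> u"
    if u: "u \<in> BV \<Omega>" for u
  proof -
    note i = BV_integrable[OF u]
    have "\<bar>pairing \<Omega> (\<lambda>x. \<phi> x - v x) u\<bar> \<le> e * total_variation \<Omega> u"
      using e by (intro abs_pairing_le[OF \<Omega> u C0_diff[OF \<Omega> test_field_C0[OF \<phi>(1)] v]] less_imp_le[OF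
        \<phi>(2)]) auto
    then have 1: "\<bar>pairing \<Omega> \<phi> u - pairing \<Omega> v u\<bar> \<le> e * total_variation \<Omega> u"
      by (simp add: pairing_diff_field[OF \<Omega> u test_field_C0[OF \<phi>(1)] v])
    have "pairing \<Omega> \<phi> u = - (LINT x|lebesgue_on \<Omega>. (u x - mean \<Omega> u) * divergence \<phi> x)"
      unfolding pairing_test[OF \<Omega> u \<phi>(1)]
      using integral_divergence_shift[OF \<Omega> i integrable_minus_mean[OF \<Omega> i] _ \<phi>(1), of "- mean \<Omega> u"] by simp
    moreover have "\<bar>LINT x|lebesgue_on \<Omega>. (u x - mean \<Omega> u) * divergence \<phi> x\<bar> \<le> B * L1_norm \<Omega> (\<lambda>x. u x -
      mean \<Omega> u)"
      by (rule integral_bounded_L1[OF integrable_minus_mean[OF \<Omega> i]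
            measurable_continuous_lebesgue_on[OF \<Omega> divergence_continuous[OF \<phi>(1)]] B(2)])
    ultimately show ?thesis using 1 unfolding div_op_cst_class[OF \<Omega> u] by linarith
  qed
  then show "\<exists>\<theta>>0. \<forall>u\<in>BV \<Omega>. \<bar>div_op \<Omega> v (cst_class \<Omega> u)\<bar>
      \<le> \<theta> * L1_norm \<Omega> (\<lambda>x. u x - mean \<Omega> u) + e * total_variation \<Omega> u"
    using B(1) by blast
qed

lemma L1_norm_minus_mean_le:
  fixes \<Omega> :: "(real ^ 'm) set"
  assumes \<Omega>: "open \<Omega>" "bounded \<Omega>" "\<Omega> \<noteq> {}" and u: "integrable (lebesgue_on \<Omega>) u"
  shows "L1_norm \<Omega> (\<lambda>x. u x - mean \<Omega> u) \<le> 2 * L1_norm \<Omega> u"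
proof -
  note fin = bounded_emeasure_finite[OF \<Omega>(2,1)]
  note pos = measure_open_pos[OF \<Omega>(1,3) fin]
  have "L1_norm \<Omega> (\<lambda>x. mean \<Omega> u) = \<bar>mean \<Omega> u\<bar> * measure lebesgue \<Omega>"
    using measure_lebesgue_on_space[OF \<Omega>(1)] by (simp add: L1_norm_def)
  also have "\<dots> = \<bar>LINT x|lebesgue_on \<Omega>. u x\<bar>" unfolding mean_def if_P[OF fin] abs_divide
    using less_imp_neq[OF pos] by (simp del: measure_completion)
  also have "\<dots> \<le> L1_norm \<Omega> u" unfolding L1_norm_def by (rule integral_abs_bound)
  finally show ?thesis using L1_norm_diff_le[OF u integrable_const_bounded[OF \<Omega>(1,2), of "mean \<Omega> u"]]
    by linarith
qed

lemma dual_in_range: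
  fixes \<Omega> :: "(real ^ 'm) set"
  assumes \<Omega>: "open \<Omega>" "bounded \<Omega>" "\<Omega> \<noteq> {}" "connected \<Omega>" and ext: "BV_extension_set \<Omega>"
    and F: "F \<in> BV_cst_dual \<Omega>"
  shows "F \<in> div_op \<Omega> ` C0 \<Omega>"
proof -
  let ?I = "\<lambda>v u. LINT x|lebesgue_on \<Omega>. u x * divergence v x"
  define f where "f u = F (cst_class \<Omega> u)" for u
  have lin: "F \<in> extensional (BV_cst \<Omega>)"
    "\<And>u w. u \<in> BV \<Omega> \<Longrightarrow> w \<in> BV \<Omega> \<Longrightarrow> f (\<lambda>x. u x + w x) = f u + f w"
    "\<And>u a. u \<in> BV \<Omega> \<Longrightarrow> f (\<lambda>x. a * u x) = a * f u"
    using F by (auto simp: BV_cst_dual_def linear_form_def f_def)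
  have dual: "\<exists>\<theta>>0. \<forall>u\<in>BV \<Omega>. \<bar>f u\<bar> \<le> \<theta> * L1_norm \<Omega> (\<lambda>x. u x - mean \<Omega> u) + e * total_variation \<Omega> u"
    if "e > 0" for e
    using F that by (simp add: BV_cst_dual_def f_def)
  have shift: "f (\<lambda>x. u x - c) = f u" for u c
    unfolding f_def by (intro arg_cong[where f = F] cst_class_eqI[where c = "- c"]) simp
  have cont: "\<exists>\<theta>>0. \<forall>u\<in>BV \<Omega>. \<bar>f u\<bar> \<le> \<theta> * L1_norm \<Omega> u + e * total_variation \<Omega> u" if e: "e > 0" for e
  proof -
    obtain \<theta> where \<theta>: "\<theta> > 0" "\<forall>u\<in>BV \<Omega>. \<bar>f u\<bar> \<le> \<theta> * L1_norm \<Omega> (\<lambda>x. u x - mean \<Omega> u) + e * total_variation \<Omega> u"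
      using dual[OF e] by blast
    have "\<bar>f u\<bar> \<le> (2 * \<theta>) * L1_norm \<Omega> u + e * total_variation \<Omega> u" if u: "u \<in> BV \<Omega>" for u
      using \<theta>(2)[rule_format, OF u]
        mult_left_mono[OF L1_norm_minus_mean_le[OF \<Omega>(1-3) BV_integrable[OF u]] less_imp_le[OF \<theta>(1)]]
          by linarith
    moreover have "2 * \<theta> > 0" using \<theta>(1) by simp
    ultimately show ?thesis by blast
  qed
  obtain C where C: "C > 0" "\<And>u. u \<in> BV \<Omega> \<Longrightarrow> L1_norm \<Omega> (\<lambda>x. u x - mean \<Omega> u) \<le> C * total_variation \<Omega> u"
    by (rule extension_poincare[OF \<Omega> ext]) (rule that)
  obtain \<theta> where \<theta>: "\<theta> > 0" "\<forall>u\<in>BV \<Omega>. \<bar>f u\<bar> \<le> \<theta> * L1_norm \<Omega> (\<lambda>x. u x - mean \<Omega> u) + 1 * total_variation \<Omega> u"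
    using dual[of 1] by auto
  \<comment> \<open>From the dual condition with \<open>e = 1\<close>, after the L1 term has been
    absorbed by the Poincare inequality.\<close>
  define M where "M = \<theta> * C + 1"
  have M: "M > 0" using \<theta> C by (simp add: M_def add_pos_pos)
  have fM: "\<bar>f u\<bar> \<le> M * total_variation \<Omega> u" if u: "u \<in> BV \<Omega>" for u
    using \<theta>(2)[rule_format, OF u] mult_left_mono[OF C(2)[OF u] less_imp_le[OF \<theta>(1)]]
      by (simp add: M_def distrib_right)
  define m where "m k = M * (1 / 2) ^ k" for k :: nat
  have m: "m k > 0" "m (Suc k) = m k / 2" for k using M by (simp_all add: m_def)
  have m_lim: "m \<longlonglongrightarrow> 0"
    unfolding m_def[abs_def] by (rule tendsto_mult_right_zero[OF LIMSEQ_power_zero]) simp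
  \<comment> \<open>The invariant of the iteration: relative to the total variation, what
    \<open>W\<close> leaves of \<open>f\<close> has size at most \<open>m k\<close>, so that the
    next correction can be chosen with norm at most \<open>m k\<close>.\<close>
  define P where "P k W \<longleftrightarrow> test_field \<Omega> W \<and> (\<forall>u\<in>BV \<Omega>. \<bar>f u - ?I W u\<bar> \<le> m k * total_variation \<Omega> u)" for k W
  have "\<exists>W. \<forall>k. P k (W k) \<and> (\<forall>x. norm (W (Suc k) x - W k x) \<le> m k)"
  proof (rule dependent_nat_choice)
    have "P 0 (\<lambda>x. 0)"
      using fM test_field_zero[of \<Omega>] divergence_scaleR[OF test_field_zero, of 0] by (simp add: P_def m_def)
    then show "\<exists>W. P 0 W" by (rule exI[of _ "\<lambda>x. 0"])
    fix W k assume "P k W"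
    then have W: "test_field \<Omega> W" "\<And>u. u \<in> BV \<Omega> \<Longrightarrow> \<bar>f u - ?I W u\<bar> \<le> m k * total_variation \<Omega> u"
      by (auto simp: P_def)
    note int = integral_times_divergence(1)[OF \<Omega>(1) BV_integrable W(1)]
    obtain B where B: "B > 0" "\<And>x. \<bar>divergence W x\<bar> \<le> B" by (rule divergence_bounded[OF W(1)]) (rule that)
    obtain v where v: "test_field \<Omega> v" "\<And>x. norm (v x) \<le> m k"
      "\<And>u. u \<in> BV \<Omega> \<Longrightarrow> \<bar>(f u - ?I W u) - ?I v u\<bar> \<le> m (Suc k) * total_variation \<Omega> u"
    \<comment> \<open>The remainder is again a form of the required kind: subtracting an integral
      against a divergence bounded by \<open>B\<close> adds \<open>B\<close> to
      \<open>\<theta>\<close> in the continuity condition.\<close>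
    proof (rule form_approximation[OF \<Omega> ext, of "\<lambda>u. f u - ?I W u" "m k" "m (Suc k)"])
      show "f (\<lambda>x. u x + w x) - ?I W (\<lambda>x. u x + w x) = (f u - ?I W u) + (f w - ?I W w)"
        if "u \<in> BV \<Omega>" "w \<in> BV \<Omega>" for u w
        using int[OF that(1)] int[OF that(2)] lin(2)[OF that] by (simp add: distrib_right)
      show "f (\<lambda>x. a * u x) - ?I W (\<lambda>x. a * u x) = a * (f u - ?I W u)" if "u \<in> BV \<Omega>" for u a
        using lin(3)[OF that] by (simp add: mult.assoc right_diff_distrib)
      show "f (\<lambda>x. u x - c) - ?I W (\<lambda>x. u x - c) = f u - ?I W u" if u: "u \<in> BV \<Omega>" for u c
        using integral_divergence_shift[OF \<Omega>(1) BV_integrable[OF u] BV_integrable[OF BV_shift(1)[OF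
          \<Omega>(1,2) u]] _ W(1), of c "- c"]
        by (simp add: shift)
      show "\<exists>\<theta>>0. \<forall>u\<in>BV \<Omega>. \<bar>f u - ?I W u\<bar> \<le> \<theta> * L1_norm \<Omega> u + e * total_variation \<Omega> u" if e: "e > 0" for e
      proof -
        obtain \<theta> where \<theta>: "\<theta> > 0" "\<forall>u\<in>BV \<Omega>. \<bar>f u\<bar> \<le> \<theta> * L1_norm \<Omega> u + e * total_variation \<Omega> u"
          using cont[OF e] by blast
        have "\<bar>f u - ?I W u\<bar> \<le> (\<theta> + B) * L1_norm \<Omega> u + e * total_variation \<Omega> u" if u: "u \<in> BV \<Omega>" for u
          using \<theta>(2)[rule_format, OF u] integral_bounded_L1[OF BV_integrable[OF u]
              measurable_continuous_lebesgue_on[OF \<Omega>(1) divergence_continuous[OF W(1)]] B(2)]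
          unfolding distrib_right by linarith
        moreover have "\<theta> + B > 0" using \<theta>(1) B(1) by simp
        ultimately show ?thesis by blast
      qed
    qed (use W m in auto)
    have "P (Suc k) (\<lambda>x. W x + v x)"
      unfolding P_def
    proof (intro conjI ballI test_field_add W v)
      fix u assume u: "u \<in> BV \<Omega>"
      have "?I (\<lambda>x. W x + v x) u = ?I W u + ?I v u"
        using int[OF u] integral_times_divergence(1)[OF \<Omega>(1) BV_integrable[OF u] v(1)]
        by (simp add: divergence_add[OF W(1) v(1)] distrib_left)
      then show "\<bar>f u - ?I (\<lambda>x. W x + v x) u\<bar> \<le> m (Suc k) * total_variation \<Omega> u" using v(3)[OF u]
        by (simp add: algebra_simps)
    qed
    then show "\<exists>W'. P (Suc k) W' \<and> (\<forall>x. norm (W' x - W x) \<le> m k)" using v(2)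
      by (intro exI[of _ "\<lambda>x. W x + v x"]) simp
  qed
  then obtain W where W: "\<And>k. test_field \<Omega> (W k)" "\<And>k x. norm (W (Suc k) x - W k x) \<le> m k"
    "\<And>k u. u \<in> BV \<Omega> \<Longrightarrow> \<bar>f u - ?I (W k) u\<bar> \<le> m k * total_variation \<Omega> u"
    by (auto simp: P_def)
  \<comment> \<open>As \<open>m\<close> halves at each step, the step lengths from \<open>k\<close>
    up to \<open>k + j\<close> telescope as a geometric sum, with total at most
    \<open>2 * m k\<close>.\<close>
  have step: "norm (W (k + j) x - W k x) \<le> 2 * m k - 2 * m (k + j)" for k j x
  proof (induction j)
    case (Suc j)
    have "norm (W (Suc (k + j)) x - W k x) \<le> norm (W (Suc (k + j)) x - W (k + j) x) + norm (W (k + j) x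
      - W k x)"
      using norm_triangle_ineq[of "W (Suc (k + j)) x - W (k + j) x" "W (k + j) x - W k x"] by simp
    then show ?case using Suc W(2)[of "k + j" x] m(2)[of "k + j"] unfolding add_Suc_right by linarith
  qed simp
  have step': "norm (W n x - W k x) \<le> 2 * m k" if "k \<le> n" for n k x
    using step[of k "n - k" x] m(1)[of n] that by simp
  have m_ev: "\<exists>k. 2 * m k < e" if "e > 0" for e
  proof -
    have "\<forall>\<^sub>F k in sequentially. m k < e / 2" using m_lim by (rule order_tendstoD(2)) (use that in simp)
    then obtain k where "m k < e / 2" using eventually_happens'[OF sequentially_bot] by blast
    then show ?thesis by (intro exI[of _ k]) linarith
  qed
  have "\<exists>w. (\<lambda>n. W n x) \<longlonglongrightarrow> w" for x
  proof -
    have "Cauchy (\<lambda>n. W n x)"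
    proof (rule metric_CauchyI)
      fix e :: real assume "e > 0"
      then obtain k where k: "2 * m k < e / 2" using m_ev[of "e / 2"] by auto
      have "dist (W i x) (W j x) < e" if "i \<ge> k" "j \<ge> k" for i j
        using dist_triangle3[of "W i x" "W j x" "W k x"] step'[OF that(1), of x] step'[OF that(2), of x] k
        unfolding dist_norm norm_minus_commute[of "W k x"] by linarith
      then show "\<exists>k. \<forall>i\<ge>k. \<forall>j\<ge>k. dist (W i x) (W j x) < e" by blast
    qed
    then show ?thesis by (simp add: Cauchy_convergent_iff convergent_def)
  qed
  then obtain w where w: "\<And>x. (\<lambda>n. W n x) \<longlonglongrightarrow> w x" by metis
  have near: "norm (W k x - w x) \<le> 2 * m k" for k x
  proof -
    have "(\<lambda>n. norm (W n x - W k x)) \<longlonglongrightarrow> norm (w x - W k x)" by (intro tendsto_intros w)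
    then show ?thesis
      using step' by (subst norm_minus_commute) (rule LIMSEQ_le_const2, auto)
  qed
  have w0: "w \<in> C0 \<Omega>"
  proof (rule C0_I_approx)
    fix e :: real assume "e > 0"
    then obtain k where "2 * m k < e" using m_ev by blast
    then have "\<forall>x\<in>\<Omega>. norm (W k x - w x) < e" using near le_less_trans by blast
    then show "\<exists>\<phi>. test_field \<Omega> \<phi> \<and> (\<forall>x\<in>\<Omega>. norm (\<phi> x - w x) < e)" using W(1) by blast
  qed
  obtain D where D: "D > 0" "\<And>x. x \<in> \<Omega> \<Longrightarrow> norm (w x) \<le> D" by (rule C0_bounded[OF w0]) (rule that)
  \<comment> \<open>The \<open>pairing\<close> with a test field is minus the integral against its
    divergence, which accounts for the sign and matches the one in \<open>div_op\<close>.\<close>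
  have rep: "f u = - pairing \<Omega> w u" if u: "u \<in> BV \<Omega>" for u
  proof -
    have "(\<lambda>n. pairing \<Omega> (W n) u) \<longlonglongrightarrow> pairing \<Omega> w u"
      by (rule pairing_tendsto[OF u C0_continuous[OF w0] D(2) C0_continuous[OF test_field_C0[OF W(1)]] near])
        (auto intro: tendsto_mult_right_zero m_lim)
    then have 1: "(\<lambda>n. ?I (W n) u) \<longlonglongrightarrow> - pairing \<Omega> w u"
      unfolding pairing_test[OF \<Omega>(1) u W(1)] using tendsto_minus by fastforce
    have "(\<lambda>n. ?I (W n) u - f u) \<longlonglongrightarrow> 0"
    proof (rule Lim_null_comparison)
      show "\<forall>\<^sub>F n in sequentially. norm (?I (W n) u - f u) \<le> m n * total_variation \<Omega> u"
        using W(3)[OF u] by (intro always_eventually) (simp add: abs_minus_commute)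
      show "(\<lambda>n. m n * total_variation \<Omega> u) \<longlonglongrightarrow> 0" by (rule tendsto_mult_left_zero[OF m_lim])
    qed
    then have "(\<lambda>n. ?I (W n) u) \<longlonglongrightarrow> f u" by (rule LIM_zero_cancel)
    then show ?thesis using 1 LIMSEQ_unique by blast
  qed
  have "F = div_op \<Omega> w"
  proof (rule extensionalityI[OF lin(1)])
    show "div_op \<Omega> w \<in> extensional (BV_cst \<Omega>)" by (simp add: div_op_def)
    show "F X = div_op \<Omega> w X" if "X \<in> BV_cst \<Omega>" for X
      using that rep by (auto simp: BV_cst_def div_op_cst_class[OF \<Omega>(1)] f_def)
  qed
  then show ?thesis using w0 by blast
qed

theorem theoremE:
  fixes \<Omega> :: "(real ^ 'm) set"
  assumes "CARD('m) \<ge> 2"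
    and "open \<Omega>"
    and "\<Omega> \<noteq> {}"
  shows "(div_op \<Omega> ` C0 \<Omega> = BV_cst_dual \<Omega> \<longrightarrow> poincare_1_1 \<Omega>) \<and>
    (bounded \<Omega> \<and> connected \<Omega> \<and> BV_extension_set \<Omega> \<longrightarrow> div_op \<Omega> ` C0 \<Omega> = BV_cst_dual \<Omega>)"
proof (intro conjI impI)
  assume "div_op \<Omega> ` C0 \<Omega> = BV_cst_dual \<Omega>"
  then show "poincare_1_1 \<Omega>" by (intro poincare_of_surjective[OF assms(2,3)]) simp
next
  assume "bounded \<Omega> \<and> connected \<Omega> \<and> BV_extension_set \<Omega>"
  then show "div_op \<Omega> ` C0 \<Omega> = BV_cst_dual \<Omega>"
    using div_op_in_dual[OF assms(2)] dual_in_range[OF assms(2) _ assms(3)] by blast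
qed

end
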